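(* Let $k$ be an algebraically closed field and let $\mathcal{Q}$ be a (finite and acyclic) quiver. If $\mathcal{Q}$ is not a Dynkin quiver, then \[\dim\mathbb{D}^b(\operatorname{mod}k\mathcal{Q})=1 .\]
   Context: A quiver $\mathcal{Q}$ is a directed graph; it is finite if it has finitely many vertices and arrows, and acyclic if it has no path of length $\geq1$ whose source and target coincide. $k\mathcal{Q}$ is the path algebra of $\mathcal{Q}$ over $k$, $\operatorname{mod}k\mathcal{Q}$ is its category of finitely presented (equivalently, since $k\mathcal{Q}$ is finite dimensional, finitely generated) modules, and $\mathbb{D}^b$ denotes the bounded derived category. A Dynkin quiver is a quiver whose underlying undirected graph is one of the Dynkin diagrams $A_n$, $D_n$, $E_6$, $E_7$, $E_8$. Dimension of a triangulated category $\mathcal{T}$: for a subcategory $\mathcal{X}$, $\langle\mathcal{X}\rangle$ is the smallest full subcategory of $\mathcal{T}$ containing $\mathcal{X}$ and closed under finite coproducts, direct factors and all shifts. $\mathcal{X}_1\ast\mathcal{X}_2$ is the full subcategory of objects $X$ for which there is a distinguished triangle $X_1\to X\to X_2\to X_1[1]$ with $X_i\in\mathcal{X}_i$, and $\mathcal{X}_1\diamond\mathcal{X}_2:=\langle\mathcal{X}_1\ast\mathcal{X}_2\rangle$. Set $\langle\mathcal{X}\rangle_0=0$ and $\langle\mathcal{X}\rangle_n=\langle\mathcal{X}\rangle_{n-1}\diamond\langle\mathcal{X}\rangle$ for $n\geq1$. Then $\dim\mathcal{T}$ is the minimal integer $d\geq0$ such that $\mathcal{T}=\langle M\rangle_{d+1}$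 for some object $M\in\mathcal{T}$, and $\infty$ if no such $M$ exists.
   Formalization: "Not a Dynkin quiver" is read as: some connected component is not of type A, D or E; as literally worded the claim fails for disjoint unions of Dynkin quivers (two vertices, no arrows: dimension 0) and for the empty quiver. *)

theory Defs
  imports
    "HOL-Algebra.AbelCoset"
    "HOL-Algebra.Module"
    "HOL-Computational_Algebra.Polynomial"
    "HOL-Library.Extended_Nat"
    "HOL-Library.FuncSet"
    "Graph_Theory.Digraph_Component"
begin

section \<open>Quivers and Dynkin diagrams\<close>

text \<open>
  A finite quiver is a graph satisfying \<^locale>\<open>fin_digraph\<close>: finitely many vertices and
  arrows, loops and parallel arrows allowed.
\<close>

definition acyclic_quiver :: "('v, 'a) pre_digraph \<Rightarrow> bool" where
  "acyclic_quiver Q \<longleftrightarrow> \<not> (\<exists>u p. pre_digraph.awalk Q u p u \<and> p \<noteq> [])"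

text \<open>
  Dynkin diagrams with vertex set \<open>{..<n}\<close>. \<open>branched_edges n b\<close> is the chain
  \<open>0 - 1 - \<dots> - (n - 2)\<close> with the vertex \<open>n - 1\<close> attached to \<open>b\<close>; the arms at \<open>b\<close> have \<open>b\<close>, \<open>n - 2 - b\<close> and \<open>1\<close> vertices.
\<close>

definition chain_edges :: "nat \<Rightarrow> nat set set" where
  "chain_edges n = {{i, Suc i} | i. Suc i < n}"

definition branched_edges :: "nat \<Rightarrow> nat \<Rightarrow> nat set set" where
  "branched_edges n b = insert {b, n - 1} (chain_edges (n - 1))"

inductive dynkin_diagram :: "nat \<Rightarrow> nat set set \<Rightarrow> bool" where
  A: "n \<ge> 1 \<Longrightarrow> dynkin_diagram n (chain_edges n)"
| D: "n \<ge> 4 \<Longrightarrow> dynkin_diagram n (branched_edges n (n - 3))"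
| E: "n \<in> {6, 7, 8} \<Longrightarrow> dynkin_diagram n (branched_edges n 2)"

text \<open>
  The arrows have to correspond bijectively to the edges, so parallel arrows are not identified
  when passing to the underlying undirected graph.
\<close>

definition underlying_graph_iso :: "('v, 'a) pre_digraph \<Rightarrow> nat \<Rightarrow> nat set set \<Rightarrow> bool" where
  "underlying_graph_iso Q n E \<longleftrightarrow>
     (\<exists>\<phi>. bij_betw \<phi> (verts Q) {..<n} \<and> bij_betw (\<lambda>e. {\<phi> (tail Q e), \<phi> (head Q e)}) (arcs Q) E)"

definition connected_dynkin_quiver :: "('v, 'a) pre_digraph \<Rightarrow> bool" where
  "connected_dynkin_quiver Q \<longleftrightarrow> (\<exists>n E. dynkin_diagram n E \<and> underlying_graph_iso Q n E)"

text \<open>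
  For a connected quiver, being Dynkin means that the underlying graph is a Dynkin diagram
  (lemma \<open>dynkin_quiver_connected\<close> below). An arbitrary quiver is called Dynkin if each of its
  connected components is; without this convention a disjoint union of Dynkin quivers, whose
  derived category has dimension 0, would count as non-Dynkin.
\<close>

definition dynkin_quiver :: "('v, 'a) pre_digraph \<Rightarrow> bool" where
  "dynkin_quiver Q \<longleftrightarrow>
     (\<forall>S \<in> pre_digraph.sccs_verts (with_proj (mk_symmetric Q)). connected_dynkin_quiver (Q \<restriction> S))"

lemma dynkin_quiver_connected:
  assumes "wf_digraph Q" "connected Q"
  shows "dynkin_quiver Q \<longleftrightarrow> connected_dynkin_quiver Q"
proof -
  interpret wf_digraph Q by fact
  interpret S: pair_wf_digraph "mk_symmetric Q" ..
  have ne: "verts Q \<noteq> {}"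
    and r: "\<And>u v. u \<in> verts Q \<Longrightarrow> v \<in> verts Q \<Longrightarrow> u \<rightarrow>\<^sup>*\<^bsub>mk_symmetric Q\<^esub> v"
    using assms(2) by (auto simp: connected_def strongly_connected_def)
  have in_verts: "u \<in> verts Q" "v \<in> verts Q" if "u \<rightarrow>\<^sup>*\<^bsub>mk_symmetric Q\<^esub> v" for u v
    using S.reachable_in_verts[OF that] by auto
  have eq: "S.sccs_verts = {verts Q}"
  proof (intro equalityI subsetI)
    fix S assume S: "S \<in> S.sccs_verts"
    have sub: "S \<subseteq> verts Q" using S in_verts unfolding S.sccs_verts_def by blast
    moreover have "verts Q \<subseteq> S" using S r sub unfolding S.sccs_verts_def by blast
    ultimately show "S \<in> {verts Q}" by auto
  next
    fix S assume "S \<in> {verts Q}"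
    then have "S = verts Q" by simp
    then show "S \<in> S.sccs_verts" using ne r in_verts unfolding S.sccs_verts_def by blast
  qed
  have "Q \<restriction> verts Q = Q"
    by (rule pre_digraph.equality) (auto simp: induce_subgraph_def)
  with eq show ?thesis by (simp add: dynkin_quiver_def)
qed


section \<open>Path algebras\<close>

text \<open>
  A path is a pair of its start vertex and its list of arrows; \<open>(v, [])\<close> is the trivial path
  at \<open>v\<close>.
\<close>

definition paths :: "('v, 'a) pre_digraph \<Rightarrow> ('v \<times> 'a list) set" where
  "paths Q = {(u, p). \<exists>v. pre_digraph.awalk Q u p v}"

text \<open>
  Elements are finitely supported functions on paths, and \<open>p \<cdot> q\<close> is "first \<open>p\<close>, then \<open>q\<close>": the
  coefficient of \<open>f \<cdot> g\<close> at a path is the sum over all its factorisations.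
\<close>

definition path_algebra :: "('v, 'a) pre_digraph \<Rightarrow> ('v \<times> 'a list \<Rightarrow> 'k::field) ring" where
  "path_algebra Q = \<lparr>
     carrier = {f. finite {p. f p \<noteq> 0} \<and> {p. f p \<noteq> 0} \<subseteq> paths Q},
     monoid.mult = (\<lambda>f g (u, p). \<Sum>i\<le>length p.
       f (u, take i p) * g (last (pre_digraph.awalk_verts Q u (take i p)), drop i p)),
     one = (\<lambda>(u, p). if u \<in> verts Q \<and> p = [] then 1 else 0),
     zero = (\<lambda>_. 0),
     add = (\<lambda>f g p. f p + g p)\<rparr>"

lemma awlast_append_conv: "last (pre_digraph.awalk_verts Q u (p @ q)) = last (pre_digraph.awalk_verts Q (last (pre_digraph.awalk_verts Q u p)) q)"
  by (auto simp: pre_digraph.awalk_verts_conv)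

lemma sum_take_drop_reindex:
  fixes F :: "nat \<Rightarrow> nat \<Rightarrow> 'b::comm_monoid_add"
  shows "(\<Sum>i\<le>n. \<Sum>j\<le>i. F j (i-j)) = (\<Sum>j\<le>n. \<Sum>l\<le>n-j. F j l)"
proof -
  have "(\<Sum>i\<le>n. \<Sum>j\<le>i. F j (i-j)) = (\<Sum>(i,j)\<in>Sigma {..n} (\<lambda>i. {..i}). F j (i-j))"
    by (simp add: sum.Sigma)
  also have "\<dots> = (\<Sum>(j,l)\<in>Sigma {..n} (\<lambda>j. {..n-j}). F j l)"
    by (rule sum.reindex_bij_witness[where i="\<lambda>(j,l). (j+l,j)" and j="\<lambda>(i,j). (j,i-j)"]) auto
  finally show ?thesis by (simp add: sum.Sigma)
qed

lemma path_algebra_assoc: 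
  "((f \<otimes>\<^bsub>path_algebra Q\<^esub> g) \<otimes>\<^bsub>path_algebra Q\<^esub> h) = (f \<otimes>\<^bsub>path_algebra Q\<^esub> (g \<otimes>\<^bsub>path_algebra Q\<^esub> h))"
proof (rule ext, clarify)
  fix u p
  let ?v = "\<lambda>p. last (pre_digraph.awalk_verts Q u p)"
  define F where "F j l = f (u, take j p) * g (?v (take j p), take l (drop j p)) * h (?v (take (j+l) p), drop (j+l) p)" for j l
  have "((f \<otimes>\<^bsub>path_algebra Q\<^esub> g) \<otimes>\<^bsub>path_algebra Q\<^esub> h) (u,p) = (\<Sum>i\<le>length p. \<Sum>j\<le>i. F j (i-j))"
    by (auto simp: path_algebra_def F_def sum_distrib_right min_def drop_take intro!: sum.cong)
  moreover have "(f \<otimes>\<^bsub>path_algebra Q\<^esub> (g \<otimes>\<^bsub>path_algebra Q\<^esub> h)) (u,p) = (\<Sum>j\<le>length p. \<Sum>l\<le>length p-j. F j l)"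
    by (auto simp: path_algebra_def F_def sum_distrib_left take_add awlast_append_conv add.commute mult.assoc intro!: sum.cong)
  ultimately show "((f \<otimes>\<^bsub>path_algebra Q\<^esub> g) \<otimes>\<^bsub>path_algebra Q\<^esub> h) (u,p) = (f \<otimes>\<^bsub>path_algebra Q\<^esub> (g \<otimes>\<^bsub>path_algebra Q\<^esub> h)) (u,p)"
    by (simp add: sum_take_drop_reindex)
qed

lemma path_algebra_mult_closed:
  assumes "wf_digraph Q" "f \<in> carrier (path_algebra Q)" "g \<in> carrier (path_algebra Q)"
  shows "f \<otimes>\<^bsub>path_algebra Q\<^esub> g \<in> carrier (path_algebra Q)"
proof -
  interpret wf_digraph Q by fact
  let ?h = "f \<otimes>\<^bsub>path_algebra Q\<^esub> g"
  let ?S = "(\<lambda>((u,p),(v,q)). (u,p@q)) ` ({p. f p \<noteq> 0} \<times> {p. g p \<noteq> 0})"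
  have *: "\<exists>i\<le>length p. f (u, take i p) \<noteq> 0 \<and> g (awlast u (take i p), drop i p) \<noteq> 0" if "?h (u,p) \<noteq> 0" for u p
  proof (rule ccontr)
    assume "\<not> ?thesis"
    then have "?h (u,p) = 0" by (auto simp: path_algebra_def intro!: sum.neutral)
    with that show False by simp
  qed
  have "{p. ?h p \<noteq> 0} \<subseteq> ?S"
  proof clarify
    fix u p assume "?h (u,p) \<noteq> 0"
    from *[OF this] obtain i where "f (u, take i p) \<noteq> 0" "g (awlast u (take i p), drop i p) \<noteq> 0" by auto
    then show "(u,p) \<in> ?S"
      by (intro image_eqI[where x="((u, take i p), (awlast u (take i p), drop i p))"]) auto
  qed
  moreover have "finite ?S" using assms by (auto simp: path_algebra_def)
  ultimately have "finite {p. ?h p \<noteq> 0}" by (rule finite_subset)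
  moreover have "{p. ?h p \<noteq> 0} \<subseteq> paths Q"
  proof clarify
    fix u p assume "?h (u,p) \<noteq> 0"
    from *[OF this] obtain i where i: "f (u, take i p) \<noteq> 0" "g (awlast u (take i p), drop i p) \<noteq> 0" by auto
    have "(u, take i p) \<in> paths Q" "(awlast u (take i p), drop i p) \<in> paths Q"
      using i assms by (auto simp: path_algebra_def)
    then obtain v w where "awalk u (take i p) v" "awalk (awlast u (take i p)) (drop i p) w"
      by (auto simp: paths_def)
    then have "awalk u (take i p @ drop i p) w" by (intro awalk_appendI) auto
    then show "(u,p) \<in> paths Q" by (auto simp: paths_def)
  qed
  ultimately show ?thesis by (simp add: path_algebra_def)
qed

lemma path_algebra_one_closed: "fin_digraph Q \<Longrightarrow> \<one>\<^bsub>path_algebra Q\<^esub> \<in> carrier (path_algebra Q :: ('v \<times> 'a list \<Rightarrow> 'k::field) ring)"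
proof -
  assume "fin_digraph Q" then interpret fin_digraph Q .
  have "{p. (\<one>\<^bsub>path_algebra Q\<^esub> :: ('v \<times> 'a list \<Rightarrow> 'k::field)) p \<noteq> 0} = (\<lambda>v. (v,[])) ` verts Q"
    by (auto simp: path_algebra_def split: if_splits)
  moreover have "\<dots> \<subseteq> paths Q" by (auto simp: paths_def awalk_Nil_iff)
  ultimately show ?thesis by (simp add: path_algebra_def)
qed

lemma path_algebra_ring:
  assumes "fin_digraph Q"
  shows "ring (path_algebra Q :: ('v \<times> 'a list \<Rightarrow> 'k::field) ring)" (is "ring ?R")
proof -
  interpret fin_digraph Q by fact
  have sub1: "carrier ?R \<subseteq> {f. \<forall>u p. f (u,p) \<noteq> 0 \<longrightarrow> u \<in> verts Q \<and> awlast u p \<in> verts Q}"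
    by (fastforce simp: path_algebra_def paths_def awalk_def intro: awlast_in_verts)
  have "finite {p. f p + g p \<noteq> 0}" if "finite {p. f p \<noteq> (0::'k)}" "finite {p. g p \<noteq> 0}" for f g :: "'v \<times> 'a list \<Rightarrow> 'k"
    by (rule finite_subset[OF _ finite_UnI[OF that]]) auto
  then have ag: "abelian_group ?R"
    apply (intro abelian_groupI)
    apply (auto simp: path_algebra_def fun_eq_iff algebra_simps)
      apply (metis (mono_tags, lifting) add_cancel_right_left mem_Collect_eq subsetD)
    subgoal for f by (intro exI[of _ "\<lambda>p. - f p"]) (auto simp: fun_eq_iff)
    done
  have l: "\<one>\<^bsub>?R\<^esub> \<otimes>\<^bsub>?R\<^esub> f = f" if f: "f \<in> carrier ?R" for f
  proof (rule ext, clarify)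
    fix u p
    have "(\<one>\<^bsub>?R\<^esub> \<otimes>\<^bsub>?R\<^esub> f) (u,p) = (\<Sum>i\<le>length p. if i = 0 then (if u \<in> verts Q then f (u,p) else 0) else 0)"
      unfolding path_algebra_def monoid.simps prod.case by (rule sum.cong) auto
    then show "(\<one>\<^bsub>?R\<^esub> \<otimes>\<^bsub>?R\<^esub> f) (u,p) = f (u,p)" using sub1 f by auto
  qed
  have r: "f \<otimes>\<^bsub>?R\<^esub> \<one>\<^bsub>?R\<^esub> = f" if f: "f \<in> carrier ?R" for f
  proof (rule ext, clarify)
    fix u p
    have "(f \<otimes>\<^bsub>?R\<^esub> \<one>\<^bsub>?R\<^esub>) (u,p) = (\<Sum>i\<le>length p. if i = length p then (if awlast u p \<in> verts Q then f (u,p) else 0) else 0)"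
      unfolding path_algebra_def monoid.simps prod.case by (rule sum.cong) auto
    then show "(f \<otimes>\<^bsub>?R\<^esub> \<one>\<^bsub>?R\<^esub>) (u,p) = f (u,p)" using sub1 f by auto
  qed
  have "monoid ?R"
    by (rule monoidI) (auto intro: path_algebra_mult_closed path_algebra_one_closed assms wf_digraph_axioms simp: path_algebra_assoc l r)
  then show ?thesis
    by (intro ringI ag) (auto simp: path_algebra_def fun_eq_iff algebra_simps sum.distrib)
qed


section \<open>Finitely generated modules\<close>

text \<open>\<^locale>\<open>module\<close> of the library requires a commutative base ring.\<close>

locale left_module = R?: ring R + M?: abelian_group M for R (structure) and M (structure) +
  assumes smult_closed:
      "\<lbrakk>a \<in> carrier R; x \<in> carrier M\<rbrakk> \<Longrightarrow> a \<odot>\<^bsub>M\<^esub> x \<in> carrier M"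
    and smult_l_distr:
      "\<lbrakk>a \<in> carrier R; b \<in> carrier R; x \<in> carrier M\<rbrakk> \<Longrightarrow>
        (a \<oplus> b) \<odot>\<^bsub>M\<^esub> x = a \<odot>\<^bsub>M\<^esub> x \<oplus>\<^bsub>M\<^esub> b \<odot>\<^bsub>M\<^esub> x"
    and smult_r_distr:
      "\<lbrakk>a \<in> carrier R; x \<in> carrier M; y \<in> carrier M\<rbrakk> \<Longrightarrow>
        a \<odot>\<^bsub>M\<^esub> (x \<oplus>\<^bsub>M\<^esub> y) = a \<odot>\<^bsub>M\<^esub> x \<oplus>\<^bsub>M\<^esub> a \<odot>\<^bsub>M\<^esub> y"
    and smult_assoc1:
      "\<lbrakk>a \<in> carrier R; b \<in> carrier R; x \<in> carrier M\<rbrakk> \<Longrightarrow>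
        (a \<otimes> b) \<odot>\<^bsub>M\<^esub> x = a \<odot>\<^bsub>M\<^esub> (b \<odot>\<^bsub>M\<^esub> x)"
    and smult_one: "x \<in> carrier M \<Longrightarrow> \<one> \<odot>\<^bsub>M\<^esub> x = x"

definition finitely_generated :: "('r, 'm) ring_scheme \<Rightarrow> ('r, 'u) module \<Rightarrow> bool" where
  "finitely_generated R M \<longleftrightarrow>
     (\<exists>S. finite S \<and> S \<subseteq> carrier M \<and>
        carrier M = {finsum M (\<lambda>s. r s \<odot>\<^bsub>M\<^esub> s) S | r. r \<in> S \<rightarrow> carrier R})"

text \<open>Homomorphisms are extensional, so that equal maps are equal as HOL functions.\<close>

definition mod_hom :: "('r, 'm) ring_scheme \<Rightarrow> ('r, 'u) module \<Rightarrow> ('r, 'u) module \<Rightarrow> ('u \<Rightarrow> 'u) set"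
  where "mod_hom R M N = {f \<in> carrier M \<rightarrow>\<^sub>E carrier N.
     (\<forall>x\<in>carrier M. \<forall>y\<in>carrier M. f (x \<oplus>\<^bsub>M\<^esub> y) = f x \<oplus>\<^bsub>N\<^esub> f y) \<and>
     (\<forall>a\<in>carrier R. \<forall>x\<in>carrier M. f (a \<odot>\<^bsub>M\<^esub> x) = a \<odot>\<^bsub>N\<^esub> f x)}"

text \<open>
  The universe from which the elements of modules are taken: nested tuples of ring elements.
  It contains \<open>R\<close>, it is closed under pairing (so direct sums exist on the nose), and every finitely
  generated \<open>R\<close>-module, being a quotient of some \<open>R\<^sup>n\<close>, is isomorphic to one whose carrier
  is a set of representatives in \<open>R\<^sup>n\<close>.
\<close>

datatype 'r tuple = Elem 'r | Tup (tfst: "'r tuple") (tsnd: "'r tuple")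

definition direct_sum ::
  "('r, 'r tuple) module \<Rightarrow> ('r, 'r tuple) module \<Rightarrow> ('r, 'r tuple) module" where
  "direct_sum M N = \<lparr>
     carrier = {Tup x y | x y. x \<in> carrier M \<and> y \<in> carrier N},
     monoid.mult = undefined,
     one = undefined,
     zero = Tup \<zero>\<^bsub>M\<^esub> \<zero>\<^bsub>N\<^esub>,
     add = (\<lambda>p q. Tup (tfst p \<oplus>\<^bsub>M\<^esub> tfst q) (tsnd p \<oplus>\<^bsub>N\<^esub> tsnd q)),
     module.smult = (\<lambda>a p. Tup (a \<odot>\<^bsub>M\<^esub> tfst p) (a \<odot>\<^bsub>N\<^esub> tsnd p))\<rparr>"


section \<open>Bounded complexes\<close>

record 'r cpx =
  deg :: "int \<Rightarrow> ('r, 'r tuple) module"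
  diff :: "int \<Rightarrow> 'r tuple \<Rightarrow> 'r tuple"

type_synonym 'r cpx_map = "int \<Rightarrow> 'r tuple \<Rightarrow> 'r tuple"

definition bounded_cpx :: "('r, 'm) ring_scheme \<Rightarrow> 'r cpx \<Rightarrow> bool" where
  "bounded_cpx R X \<longleftrightarrow>
     (\<forall>i. left_module R (deg X i) \<and> finitely_generated R (deg X i)) \<and>
     (\<forall>i. diff X i \<in> mod_hom R (deg X i) (deg X (i + 1))) \<and>
     (\<forall>i. \<forall>x\<in>carrier (deg X i). diff X (i + 1) (diff X i x) = \<zero>\<^bsub>deg X (i + 1 + 1)\<^esub>) \<and>
     (\<exists>n. \<forall>i. \<bar>i\<bar> > n \<longrightarrow> carrier (deg X i) = {\<zero>\<^bsub>deg X i\<^esub>})"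

definition chain_map :: "('r, 'm) ring_scheme \<Rightarrow> 'r cpx \<Rightarrow> 'r cpx \<Rightarrow> 'r cpx_map set" where
  "chain_map R X Y = {f.
     (\<forall>i. f i \<in> mod_hom R (deg X i) (deg Y i)) \<and>
     (\<forall>i. \<forall>x\<in>carrier (deg X i). f (i + 1) (diff X i x) = diff Y i (f i x))}"

definition cocycles :: "'r cpx \<Rightarrow> int \<Rightarrow> 'r tuple set" where
  "cocycles X i = {x \<in> carrier (deg X i). diff X i x = \<zero>\<^bsub>deg X (i + 1)\<^esub>}"

definition coboundaries :: "'r cpx \<Rightarrow> int \<Rightarrow> 'r tuple set" where
  "coboundaries X i = diff X (i - 1) ` carrier (deg X (i - 1))"

definition cohomology :: "'r cpx \<Rightarrow> int \<Rightarrow> 'r tuple set set" where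
  "cohomology X i = {coboundaries X i +>\<^bsub>deg X i\<^esub> x | x. x \<in> cocycles X i}"

definition cohomology_map :: "'r cpx \<Rightarrow> 'r cpx_map \<Rightarrow> int \<Rightarrow> 'r tuple set \<Rightarrow> 'r tuple set" where
  "cohomology_map Y f i c = (\<Union>x\<in>c. coboundaries Y i +>\<^bsub>deg Y i\<^esub> f i x)"

definition quasi_iso :: "('r, 'm) ring_scheme \<Rightarrow> 'r cpx \<Rightarrow> 'r cpx \<Rightarrow> 'r cpx_map set" where
  "quasi_iso R X Y = {f \<in> chain_map R X Y.
     \<forall>i. bij_betw (cohomology_map Y f i) (cohomology X i) (cohomology Y i)}"

text \<open>\<open>X[n]\<^sup>i = X\<^sup>i\<^sup>+\<^sup>n\<close> with differential \<open>(-1)\<^sup>n d\<close>.\<close>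

definition shift_cpx :: "int \<Rightarrow> 'r cpx \<Rightarrow> 'r cpx" where
  "shift_cpx n X = \<lparr>
     deg = (\<lambda>i. deg X (i + n)),
     diff = (\<lambda>i. \<lambda>x\<in>carrier (deg X (i + n)).
       if even n then diff X (i + n) x else \<ominus>\<^bsub>deg X (i + n + 1)\<^esub> diff X (i + n) x)\<rparr>"

definition shift_map :: "int \<Rightarrow> 'r cpx_map \<Rightarrow> 'r cpx_map" where
  "shift_map n f = (\<lambda>i. f (i + n))"

text \<open>The mapping cone \<open>X[1] \<oplus> Y\<close> with differential \<open>(x, y) \<mapsto> (- d x, f x + d y)\<close>.\<close>

definition cone :: "'r cpx \<Rightarrow> 'r cpx \<Rightarrow> 'r cpx_map \<Rightarrow> 'r cpx" where
  "cone X Y f = \<lparr>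
     deg = (\<lambda>i. direct_sum (deg X (i + 1)) (deg Y i)),
     diff = (\<lambda>i. \<lambda>p\<in>carrier (direct_sum (deg X (i + 1)) (deg Y i)).
       Tup (\<ominus>\<^bsub>deg X (i + 1 + 1)\<^esub> diff X (i + 1) (tfst p))
           (f (i + 1) (tfst p) \<oplus>\<^bsub>deg Y (i + 1)\<^esub> diff Y i (tsnd p)))\<rparr>"

definition cone_incl :: "'r cpx \<Rightarrow> 'r cpx \<Rightarrow> 'r cpx_map" where
  "cone_incl X Y = (\<lambda>i. \<lambda>y\<in>carrier (deg Y i). Tup \<zero>\<^bsub>deg X (i + 1)\<^esub> y)"

definition cone_proj :: "'r cpx \<Rightarrow> 'r cpx \<Rightarrow> 'r cpx_map" where
  "cone_proj X Y = (\<lambda>i. \<lambda>p\<in>carrier (direct_sum (deg X (i + 1)) (deg Y i)). tfst p)"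


section \<open>Categories and localisation\<close>

record ('o, 'm) category =
  Ob :: "'o set"
  Hom :: "'o \<Rightarrow> 'o \<Rightarrow> 'm set"
  Idt :: "'o \<Rightarrow> 'm"
  Comp :: "'o \<Rightarrow> 'o \<Rightarrow> 'o \<Rightarrow> 'm \<Rightarrow> 'm \<Rightarrow> 'm"
    \<comment> \<open>\<open>Comp C X Y Z g f\<close> is \<open>g \<circ> f\<close> for \<open>f : X \<rightarrow> Y\<close> and \<open>g : Y \<rightarrow> Z\<close>\<close>

definition cat_iso :: "('o, 'm, 'z) category_scheme \<Rightarrow> 'o \<Rightarrow> 'o \<Rightarrow> 'm \<Rightarrow> bool" where
  "cat_iso C X Y f \<longleftrightarrow> f \<in> Hom C X Y \<and>
     (\<exists>g\<in>Hom C Y X. Comp C X Y X g f = Idt C X \<and> Comp C Y X Y f g = Idt C Y)"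

definition initial_object :: "('o, 'm, 'z) category_scheme \<Rightarrow> 'o \<Rightarrow> bool" where
  "initial_object C Z \<longleftrightarrow> Z \<in> Ob C \<and> (\<forall>X\<in>Ob C. \<exists>!f. f \<in> Hom C Z X)"

definition zero_object :: "('o, 'm, 'z) category_scheme \<Rightarrow> 'o \<Rightarrow> bool" where
  "zero_object C Z \<longleftrightarrow> initial_object C Z \<and> (\<forall>X\<in>Ob C. \<exists>!f. f \<in> Hom C X Z)"

definition is_coproduct :: "('o, 'm, 'z) category_scheme \<Rightarrow> 'o \<Rightarrow> 'o \<Rightarrow> 'o \<Rightarrow> bool" where
  "is_coproduct C X Y Z \<longleftrightarrow> X \<in> Ob C \<and> Y \<in> Ob C \<and> Z \<in> Ob C \<and>
     (\<exists>i\<in>Hom C X Z. \<exists>j\<in>Hom C Y Z. \<forall>W\<in>Ob C. \<forall>f\<in>Hom C X W. \<forall>g\<in>Hom C Y W.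
        \<exists>!h. h \<in> Hom C Z W \<and> Comp C X Z W h i = f \<and> Comp C Y Z W h j = g)"

text \<open>
  The localisation of a category at a class \<open>W\<close> of morphisms: morphisms are zigzags of morphisms
  and formal inverses of elements of \<open>W\<close>, modulo the congruence making them inverses. A step
  records its target object; \<open>Bwd X s\<close> is the formal inverse of \<open>s : X \<rightarrow> Y\<close>.
\<close>

datatype ('o, 'm) step = Fwd 'o 'm | Bwd 'o 'm

inductive zigzag ::
  "('o, 'm, 'z) category_scheme \<Rightarrow> ('o \<Rightarrow> 'o \<Rightarrow> 'm set) \<Rightarrow> 'o \<Rightarrow> 'o \<Rightarrow> ('o, 'm) step list \<Rightarrow> bool"
  for C W where
  nil: "X \<in> Ob C \<Longrightarrow> zigzag C W X X []"
| fwd: "\<lbrakk>X \<in> Ob C; f \<in> Hom C X Y; zigzag C W Y Z p\<rbrakk> \<Longrightarrow> zigzag C W X Z (Fwd Y f # p)"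
| bwd: "\<lbrakk>X \<in> Ob C; s \<in> Hom C Y X; s \<in> W Y X; zigzag C W Y Z p\<rbrakk> \<Longrightarrow> zigzag C W X Z (Bwd Y s # p)"

inductive zigzag_eq ::
  "('o, 'm, 'z) category_scheme \<Rightarrow> ('o \<Rightarrow> 'o \<Rightarrow> 'm set) \<Rightarrow> 'o \<Rightarrow> 'o \<Rightarrow>
    ('o, 'm) step list \<Rightarrow> ('o, 'm) step list \<Rightarrow> bool"
  for C W where
  refl: "zigzag C W X Y p \<Longrightarrow> zigzag_eq C W X Y p p"
| sym: "zigzag_eq C W X Y p q \<Longrightarrow> zigzag_eq C W X Y q p"
| trans: "\<lbrakk>zigzag_eq C W X Y p q; zigzag_eq C W X Y q r\<rbrakk> \<Longrightarrow> zigzag_eq C W X Y p r"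
| append: "\<lbrakk>zigzag_eq C W X Y p p'; zigzag_eq C W Y Z q q'\<rbrakk> \<Longrightarrow> zigzag_eq C W X Z (p @ q) (p' @ q')"
| idt: "X \<in> Ob C \<Longrightarrow> zigzag_eq C W X X [Fwd X (Idt C X)] []"
| comp: "\<lbrakk>X \<in> Ob C; Y \<in> Ob C; Z \<in> Ob C; f \<in> Hom C X Y; g \<in> Hom C Y Z\<rbrakk> \<Longrightarrow>
    zigzag_eq C W X Z [Fwd Y f, Fwd Z g] [Fwd Z (Comp C X Y Z g f)]"
| inv_l: "\<lbrakk>X \<in> Ob C; Y \<in> Ob C; s \<in> Hom C X Y; s \<in> W X Y\<rbrakk> \<Longrightarrow>
    zigzag_eq C W X X [Fwd Y s, Bwd X s] []"
| inv_r: "\<lbrakk>X \<in> Ob C; Y \<in> Ob C; s \<in> Hom C X Y; s \<in> W X Y\<rbrakk> \<Longrightarrow>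
    zigzag_eq C W Y Y [Bwd X s, Fwd Y s] []"

definition zigzag_class ::
  "('o, 'm, 'z) category_scheme \<Rightarrow> ('o \<Rightarrow> 'o \<Rightarrow> 'm set) \<Rightarrow> 'o \<Rightarrow> 'o \<Rightarrow>
    ('o, 'm) step list \<Rightarrow> ('o, 'm) step list set" where
  "zigzag_class C W X Y p = {q. zigzag_eq C W X Y p q}"

definition localisation ::
  "('o, 'm, 'z) category_scheme \<Rightarrow> ('o \<Rightarrow> 'o \<Rightarrow> 'm set) \<Rightarrow>
    ('o, ('o, 'm) step list set) category" where
  "localisation C W = \<lparr>
     Ob = Ob C,
     Hom = (\<lambda>X Y. {zigzag_class C W X Y p | p. zigzag C W X Y p}),
     Idt = (\<lambda>X. zigzag_class C W X X []),
     Comp = (\<lambda>X Y Z g f. \<Union>p\<in>f. \<Union>q\<in>g. zigzag_class C W X Z (p @ q))\<rparr>"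


section \<open>The bounded derived category\<close>

text \<open>The data of a triangulated category.\<close>

record ('o, 'm) tri_category = "('o, 'm) category" +
  Shift_ob :: "int \<Rightarrow> 'o \<Rightarrow> 'o"
  Shift_hom :: "int \<Rightarrow> 'o \<Rightarrow> 'o \<Rightarrow> 'm \<Rightarrow> 'm"
  Triangles :: "('o \<times> 'o \<times> 'o \<times> 'm \<times> 'm \<times> 'm) set"
    \<comment> \<open>\<open>(X, Y, Z, f, g, h)\<close> stands for \<open>X \<rightarrow> Y \<rightarrow> Z \<rightarrow> X[1]\<close>\<close>

definition cpx_category :: "('r, 'm) ring_scheme \<Rightarrow> ('r cpx, 'r cpx_map) category" where
  "cpx_category R = \<lparr>
     Ob = {X. bounded_cpx R X},
     Hom = chain_map R,
     Idt = (\<lambda>X i. \<lambda>x\<in>carrier (deg X i). x),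
     Comp = (\<lambda>X Y Z g f i. compose (carrier (deg X i)) (g i) (f i))\<rparr>"

type_synonym 'r derived_hom = "('r cpx, 'r cpx_map) step list set"

definition derived_hom ::
  "('r, 'm) ring_scheme \<Rightarrow> 'r cpx \<Rightarrow> 'r cpx \<Rightarrow> 'r cpx_map \<Rightarrow> 'r derived_hom" where
  "derived_hom R X Y f = zigzag_class (cpx_category R) (quasi_iso R) X Y [Fwd Y f]"

definition derived_shift ::
  "('r, 'm) ring_scheme \<Rightarrow> int \<Rightarrow> 'r cpx \<Rightarrow> 'r cpx \<Rightarrow> 'r derived_hom \<Rightarrow> 'r derived_hom" where
  "derived_shift R n X Y \<alpha> = (\<Union>p\<in>\<alpha>. zigzag_class (cpx_category R) (quasi_iso R)
     (shift_cpx n X) (shift_cpx n Y) (map (map_step (shift_cpx n) (shift_map n)) p))"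

definition distinguished_triangles ::
  "('r, 'm) ring_scheme \<Rightarrow>
    ('r cpx \<times> 'r cpx \<times> 'r cpx \<times> 'r derived_hom \<times> 'r derived_hom \<times> 'r derived_hom) set" where
  "distinguished_triangles R = {(X, Y, Z, u, v, w).
     let D = localisation (cpx_category R) (quasi_iso R) in
     X \<in> Ob D \<and> Y \<in> Ob D \<and> Z \<in> Ob D \<and>
     u \<in> Hom D X Y \<and> v \<in> Hom D Y Z \<and> w \<in> Hom D Z (shift_cpx 1 X) \<and>
     (\<exists>X' \<in> Ob D. \<exists>Y' \<in> Ob D. \<exists>f \<in> chain_map R X' Y'. \<exists>a b c.
        cat_iso D X X' a \<and> cat_iso D Y Y' b \<and> cat_iso D Z (cone X' Y' f) c \<and>
        Comp D X Y Y' b u = Comp D X X' Y' (derived_hom R X' Y' f) a \<and>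
        Comp D Y Z (cone X' Y' f) c v =
          Comp D Y Y' (cone X' Y' f) (derived_hom R Y' (cone X' Y' f) (cone_incl X' Y')) b \<and>
        Comp D Z (shift_cpx 1 X) (shift_cpx 1 X') (derived_shift R 1 X X' a) w =
          Comp D Z (cone X' Y' f) (shift_cpx 1 X')
            (derived_hom R (cone X' Y' f) (shift_cpx 1 X') (cone_proj X' Y')) c)}"

text \<open>\<open>\<D>\<^sup>b(mod R)\<close>, for \<open>mod R\<close> the finitely generated left \<open>R\<close>-modules.\<close>

definition bounded_derived_category ::
  "('r, 'm) ring_scheme \<Rightarrow> ('r cpx, 'r derived_hom) tri_category" where
  "bounded_derived_category R =
     category.extend (localisation (cpx_category R) (quasi_iso R))
       \<lparr>Shift_ob = shift_cpx, Shift_hom = derived_shift R, Triangles = distinguished_triangles R\<rparr>"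


section \<open>Dimension of a triangulated category\<close>

text \<open>
  Full subcategories are identified with their sets of objects. Finite coproducts are generated by
  the empty one and the binary ones.
\<close>

inductive_set add_closure :: "('o, 'm, 'z) tri_category_scheme \<Rightarrow> 'o set \<Rightarrow> 'o set"
  for T \<X> where
  base: "X \<in> \<X> \<Longrightarrow> X \<in> add_closure T \<X>"
| empty_coproduct: "initial_object T Z \<Longrightarrow> Z \<in> add_closure T \<X>"
| coproduct: "\<lbrakk>X \<in> add_closure T \<X>; Y \<in> add_closure T \<X>; is_coproduct T X Y Z\<rbrakk> \<Longrightarrow> Z \<in> add_closure T \<X>"
| direct_factor: "\<lbrakk>Z \<in> add_closure T \<X>; is_coproduct T X Y Z\<rbrakk> \<Longrightarrow> X \<in> add_closure T \<X>"
| shift: "X \<in> add_closure T \<X> \<Longrightarrow> Shift_ob T n X \<in> add_closure T \<X>"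

definition extensions :: "('o, 'm, 'z) tri_category_scheme \<Rightarrow> 'o set \<Rightarrow> 'o set \<Rightarrow> 'o set" where
  "extensions T \<X>\<^sub>1 \<X>\<^sub>2 =
     {X \<in> Ob T. \<exists>X\<^sub>1\<in>\<X>\<^sub>1. \<exists>X\<^sub>2\<in>\<X>\<^sub>2. \<exists>f g h. (X\<^sub>1, X, X\<^sub>2, f, g, h) \<in> Triangles T}"

definition diamond :: "('o, 'm, 'z) tri_category_scheme \<Rightarrow> 'o set \<Rightarrow> 'o set \<Rightarrow> 'o set" where
  "diamond T \<X>\<^sub>1 \<X>\<^sub>2 = add_closure T (extensions T \<X>\<^sub>1 \<X>\<^sub>2)"

primrec generated :: "('o, 'm, 'z) tri_category_scheme \<Rightarrow> 'o set \<Rightarrow> nat \<Rightarrow> 'o set" where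
  "generated T \<X> 0 = {Z. zero_object T Z}"
| "generated T \<X> (Suc n) = diamond T (generated T \<X> n) (add_closure T \<X>)"

definition tri_dim :: "('o, 'm, 'z) tri_category_scheme \<Rightarrow> enat" where
  "tri_dim T = Inf {enat d | d. \<exists>M\<in>Ob T. generated T {M} (d + 1) = Ob T}"

end

theory Submission
 imports Defs "HOL-Library.Function_Algebras"
begin

text \<open>
 For \<open>dim <= 1\<close>, every bounded complex \<open>X\<close> receives a map from a finite sum of shifted
 indecomposable projectives that is surjective on cohomology. Its cone has as cohomology submodules
 of projectives, which are projective because the path algebra is hereditary; hence the cone is again
 a sum of shifted projectives, and \<open>X\<close> is an extension of two objects of the additive closure of the
 direct sum of all indecomposable projectives.

 For \<open>dim ~= 0\<close>, a non-Dynkin quiver has a dimension vector \<open>d ~= 0\<close> with \<open>q(d) <= 0\<close> for the Tits form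
 \<open>q\<close>. If the shifts of a single \<open>M\<close> generated everything up to sums and factors, then the identity of
 every representation of dimension \<open>m * d\<close> would factor through finitely many copies of the cohomology
 of \<open>M\<close>. For a representation with endomorphism algebra of minimal dimension this bounds the number
 of indecomposable summand types independently of \<open>m\<close>, whereas deformations along \<open>Ext\<close>, which is at
 least as large as the endomorphism algebra because \<open>q(m * d) <= 0\<close>, force unboundedly many.
\<close>

text \<open>The derived category is given by zigzags modulo a congruence, so neither an additive
  structure nor a calculus of fractions is at hand. Coproducts come from applying sum functors to
  zigzags, and the only invariant of a complex used is its cohomology, as a functor to modules. This
  suffices because level one is built by sums, factors, shifts and isomorphisms alone. The lower
  bound is a dimension count in one ring of operators on sequences. If \<open>x\<close> has smallest
  endomorphism algebra \<open>E\<close>, a non-split extension between two of its summands would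
  have a smaller one. So \<open>Ext(x, x)\<close> lives on the summands that occur once, and the
  cohomology of \<open>M\<close> bounds its dimension. The two-term complex computing
  \<open>Hom\<close> and \<open>Ext\<close> gives \<open>dim E - dim Ext = q(m * d) <= 0\<close>,
  which bounds \<open>E\<close> and then the number of summands. Every summand embeds in a fixed
  space covering the cohomology of \<open>M\<close>, so the total dimension is bounded, which is
  false for large \<open>m\<close>. The vector \<open>d\<close> comes from growing a Dynkin diagram
  vertex by vertex; forbidden positions are excluded by the null roots of the Euclidean
  diagrams.\<close>

abbreviation (input) add_index ("_ \<oplus>[_] _" [65, 0, 66] 65) where "x \<oplus>[G] y \<equiv> x \<oplus>\<^bsub>G\<^esub> y"
abbreviation (input) mult_index ("_ \<otimes>[_] _" [70, 0, 71] 70) where "x \<otimes>[G] y \<equiv> x \<otimes>\<^bsub>G\<^esub> y"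
abbreviation (input) smult_index ("_ \<odot>[_] _" [70, 0, 71] 70) where "a \<odot>[G] x \<equiv> a \<odot>\<^bsub>G\<^esub> x"
abbreviation (input) minus_index ("_ \<ominus>[_] _" [65, 0, 66] 65) where "x \<ominus>[G] y \<equiv> x \<ominus>\<^bsub>G\<^esub> y"
abbreviation (input) uminus_index ("\<ominus>[_] _" [0, 81] 80) where "\<ominus>[G] x \<equiv> \<ominus>\<^bsub>G\<^esub> x"
abbreviation (input) zero_index ("\<zero>[_]") where "\<zero>[G] \<equiv> \<zero>\<^bsub>G\<^esub>"
abbreviation (input) one_index ("\<one>[_]") where "\<one>[G] \<equiv> \<one>\<^bsub>G\<^esub>"

abbreviation (input) elts :: "'r cpx => int => 'r tuple set" where "elts X i \<equiv> carrier (deg X i)"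

section \<open>Dimensions of subspaces\<close>

context vector_space
begin

text \<open>The ambient spaces below are infinite dimensional, and \<open>dim\<close> is the
  \<open>card\<close> of a basis, which is 0 when the basis is infinite. Finiteness is therefore
  carried along as a predicate on subsets.\<close>

definition fin_dim :: "'b set => bool" where
 "fin_dim S \<longleftrightarrow> (\<exists>W. finite W \<and> S \<subseteq> local.span W)"

lemma fin_dim_subset: "S \<subseteq> T ==> local.fin_dim T ==> local.fin_dim S"
 unfolding fin_dim_def by blast

lemma fin_dim_basis:
 assumes "local.fin_dim S"
 obtains B where "finite B" "B \<subseteq> S" "local.independent B" "S \<subseteq> local.span B" "card B = local.dim S"
proof -
 obtain B where B: "B \<subseteq> S" "local.independent B" "S \<subseteq> local.span B" "card B = local.dim S"
  using basis_exists by blast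
 obtain W where W: "finite W" "S \<subseteq> local.span W" using assms unfolding fin_dim_def by blast
 have "finite B" using independent_span_bound[OF W(1) B(2)] B(1) W(2) by blast
 then show thesis using B that by blast
qed

lemma independent_card_le_dim':
 assumes "local.fin_dim S" "local.independent B" "B \<subseteq> S"
 shows "finite B \<and> card B \<le> local.dim S"
proof -
 obtain C where C: "finite C" "C \<subseteq> S" "local.independent C" "S \<subseteq> local.span C" "card C = local.dim S"
  using fin_dim_basis[OF assms(1)] .
 have "B \<subseteq> local.span C" using assms(3) C(4) by blast
 then show ?thesis using independent_span_bound[OF C(1) assms(2)] C(5) by simp
qed

lemma dim_mono':
 assumes "local.fin_dim T" "S \<subseteq> T"
 shows "local.dim S \<le> local.dim T"
proof -
 obtain B where "finite B" "B \<subseteq> S" "local.independent B" "S \<subseteq> local.span B" "card B = local.dim S"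
  using fin_dim_basis[OF fin_dim_subset[OF assms(2,1)]] .
 then show ?thesis using independent_card_le_dim'[OF assms(1), of B] assms(2) by auto
qed

lemma dim_strict_mono':
 assumes "local.fin_dim T" "local.subspace S" "S \<subseteq> T" "x : T" "x \<notin> S"
 shows "local.dim S < local.dim T"
proof -
 obtain B where B: "finite B" "B \<subseteq> S" "local.independent B" "S \<subseteq> local.span B" "card B = local.dim S"
  using fin_dim_basis[OF fin_dim_subset[OF assms(3,1)]] .
 have x: "x \<notin> local.span B" using span_minimal[OF B(2) assms(2)] assms(5) by blast
 then have "local.independent (insert x B)" using B(3) independent_insertI by blast
 moreover have "x \<notin> B" using x span_base by blast
 ultimately show ?thesis
  using independent_card_le_dim'[OF assms(1), of "insert x B"] B assms(3,4) by (auto simp: subset_iff)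
qed

text \<open>Independence is stated for an indexed family because the families used later, such as
  powers of an element, are not known to be injective. Two equal members would satisfy the relation
  with coefficients 1 and -1.\<close>

lemma family_card_le_dim:
 assumes fd: "local.fin_dim S" and fin: "finite I" and v: "!!i. i : I ==> v i : S"
  and ind: "!!c i. (\<Sum>i\<in>I. c i *s v i) = 0 ==> i : I ==> c i = 0"
 shows "card I \<le> local.dim S"
proof -
 have inj: "inj_on v I"
 proof (rule inj_onI, rule ccontr)
  fix i j assume ij: "i : I" "j : I" "v i = v j" "i ~= j"
  let ?c = "%l. if l = i then 1 else if l = j then -1 else 0"
  have "(\<Sum>l\<in>I. ?c l *s v l) = (\<Sum>l\<in>{i,j}. ?c l *s v l)"
   by (rule sum.mono_neutral_right) (use ij fin in auto)
  also have "\<dots> = 0" using ij by simp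
  finally show False using ind[of ?c i] ij by simp
 qed
 have "local.independent (v ` I)"
 proof (rule independent_if_scalars_zero)
  show "finite (v ` I)" using fin by simp
  fix f x assume "(\<Sum>x\<in>v ` I. f x *s x) = 0" "x : v ` I"
  moreover have "(\<Sum>x\<in>v ` I. f x *s x) = (\<Sum>i\<in>I. f (v i) *s v i)"
   by (simp add: sum.reindex[OF inj])
  ultimately show "f x = 0" using ind[of "f \<circ> v"] by auto
 qed
 then have "card (v ` I) \<le> local.dim S" using independent_card_le_dim'[OF fd, of "v ` I"] v by auto
 then show ?thesis by (simp add: card_image[OF inj])
qed

lemma dim_zero_set: "local.fin_dim {0} \<and> local.dim {0} = 0"
proof -
 have "local.dim {0} \<le> card ({} :: 'b set)" by (rule dim_le_card) auto
 moreover have "local.fin_dim {0}"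
  unfolding fin_dim_def by (rule exI[of _ "{0}"]) (auto simp: span_base)
 ultimately show ?thesis by simp
qed

lemma dependent_family:
 assumes fd: "local.fin_dim S" and fin: "finite I" and v: "!!i. i : I ==> v i : S" and "local.dim S < card I"
 obtains c i where "(\<Sum>i\<in>I. c i *s v i) = 0" "i : I" "c i ~= 0"
proof (rule ccontr)
 assume "\<not> thesis"
 then have "card I \<le> local.dim S" using that by (intro family_card_le_dim[OF fd fin v]) auto
 then show False using assms(4) by simp
qed

end

context vector_space_pair
begin

text \<open>Finiteness is assumed for kernel and image only and concluded for \<open>S\<close>; in
  this form it drives the induction in \<open>families_dim\<close>. The basis of \<open>S\<close>
  consists of a basis of the kernel and of lifts \<open>g y\<close> of a basis of the image.\<close>

lemma rank_nullity:
 assumes lin: "Vector_Spaces.linear s1 s2 f" and S: "vs1.subspace S"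
  and ker: "vs1.fin_dim {x : S. f x = 0}" and im: "vs2.fin_dim (f ` S)"
 shows "vs1.fin_dim S \<and> vs1.dim S = vs1.dim {x : S. f x = 0} + vs2.dim (f ` S)"
proof -
 interpret Vector_Spaces.linear s1 s2 f by (rule lin)
 let ?K = "{x : S. f x = 0}"
 obtain B where B: "finite B" "B \<subseteq> ?K" "vs1.independent B" "?K \<subseteq> vs1.span B" "card B = vs1.dim ?K"
  using vs1.fin_dim_basis[OF ker] .
 obtain C where C: "finite C" "C \<subseteq> f ` S" "vs2.independent C" "f ` S \<subseteq> vs2.span C"
  "card C = vs2.dim (f ` S)"
  using vs2.fin_dim_basis[OF im] .
 have "\<forall>y\<in>C. \<exists>x. x : S \<and> f x = y" using C(2) by blast
 from bchoice[OF this] obtain g where g: "!!y. y : C ==> g y : S \<and> f (g y) = y" by blast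
 have injg: "inj_on g C" by (rule inj_on_inverseI[of _ f]) (use g in blast)
 have disj: "B \<inter> g ` C = {}"
 proof -
  have "y = 0" if "y : C" "g y : B" for y using g[OF that(1)] that(2) B(2) by auto
  then show ?thesis using C(3) vs2.dependent_zero by blast
 qed
 have sp: "S \<subseteq> vs1.span (B \<union> g ` C)"
 proof
  fix x assume x: "x : S"
  then have "f x : vs2.span C" using C(4) by blast
  then obtain r where r: "f x = (\<Sum>y\<in>C. r y *b y)" using vs2.span_finite[OF C(1)] by auto
  let ?y = "\<Sum>y\<in>C. r y *a g y"
  have yS: "?y : S" by (intro vs1.subspace_sum vs1.subspace_scale S) (use g in auto)
  have "f ?y = (\<Sum>y\<in>C. r y *b f (g y))" by (simp add: sum scale)
  also have "\<dots> = f x" using r g by simp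
  finally have "x - ?y : ?K" using x yS vs1.subspace_diff[OF S] by (simp add: diff)
  then have "x - ?y : vs1.span (B \<union> g ` C)"
   using B(4) vs1.span_mono[of B "B \<union> g ` C"] by blast
  moreover have "?y : vs1.span (B \<union> g ` C)"
   by (intro vs1.span_sum vs1.span_scale vs1.span_base) auto
  ultimately show "x : vs1.span (B \<union> g ` C)" using vs1.span_add by fastforce
 qed
 have "vs1.independent (B \<union> g ` C)"
 proof (rule vs1.independent_if_scalars_zero)
  show fin: "finite (B \<union> g ` C)" using B C by simp
  fix r x assume r: "(\<Sum>x\<in>B \<union> g ` C. r x *a x) = 0" and x: "x : B \<union> g ` C"
  have eq: "(\<Sum>x\<in>B. r x *a x) + (\<Sum>y\<in>C. r (g y) *a g y) = 0"
   using r B(1) C(1) disj by (simp add: sum.union_disjoint sum.reindex[OF injg])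
  have "f (\<Sum>x\<in>B. r x *a x) = (\<Sum>x\<in>B. r x *b f x)" by (simp add: sum scale)
  also have "\<dots> = 0"
 proof (intro sum.neutral ballI)
  fix x assume "x : B"
  then have "f x = 0" using B(2) by blast
  then show "r x *b f x = 0" by simp
 qed
  finally have z: "f (\<Sum>x\<in>B. r x *a x) = 0" .
  have "0 = f ((\<Sum>x\<in>B. r x *a x) + (\<Sum>y\<in>C. r (g y) *a g y))" unfolding eq by (simp add: zero)
  also have "\<dots> = f (\<Sum>y\<in>C. r (g y) *a g y)" by (simp only: add z add_0)
  also have "\<dots> = (\<Sum>y\<in>C. r (g y) *b f (g y))" by (simp add: sum scale)
  also have "\<dots> = (\<Sum>y\<in>C. r (g y) *b y)" using g by simp
  finally have rC: "!!y. y : C ==> r (g y) = 0"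
   using C(1,3) vs2.independentD[of C C "%y. r (g y)"] by auto
  then have "(\<Sum>x\<in>B. r x *a x) = 0" using eq by simp
  then have "!!x. x : B ==> r x = 0" using B(1,3) vs1.independentD[of B B r] by auto
  then show "r x = 0" using x rC by auto
 qed
 then have "card (B \<union> g ` C) = vs1.dim S"
  using sp B(2) g by (intro vs1.basis_card_eq_dim) auto
 moreover have "card (B \<union> g ` C) = card B + card C"
  using B(1) C(1) disj by (simp add: card_Un_disjoint card_image[OF injg])
 moreover have "vs1.fin_dim S" unfolding vs1.fin_dim_def
  by (rule exI[of _ "B \<union> g ` C"]) (simp add: sp B(1) C(1))
 ultimately show ?thesis using B(5) C(5) by simp
qed

lemma fin_dim_image:
 assumes lin: "Vector_Spaces.linear s1 s2 f" and "vs1.fin_dim S"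
 shows "vs2.fin_dim (f ` S)"
proof -
 interpret Vector_Spaces.linear s1 s2 f by (rule lin)
 obtain W where W: "finite W" "S \<subseteq> vs1.span W" using assms(2) unfolding vs1.fin_dim_def by blast
 have "f ` S \<subseteq> vs2.span (f ` W)" using W(2) span_image[of W] by blast
 then show ?thesis unfolding vs2.fin_dim_def using W(1) by blast
qed

lemma rank_nullity':
 assumes lin: "Vector_Spaces.linear s1 s2 f" and S: "vs1.subspace S" and fd: "vs1.fin_dim S"
 shows "vs1.dim S = vs1.dim {x : S. f x = 0} + vs2.dim (f ` S)"
 by (rule conjunct2[OF rank_nullity[OF lin S vs1.fin_dim_subset[OF _ fd] fin_dim_image[OF lin fd]]]) auto

lemma dim_le_of_inj:
 assumes lin: "Vector_Spaces.linear s1 s2 f" and S: "vs1.subspace S"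
  and inj: "!!x. x : S ==> f x = 0 ==> x = 0" and im: "f ` S \<subseteq> T" and T: "vs2.fin_dim T"
 shows "vs1.fin_dim S \<and> vs1.dim S \<le> vs2.dim T"
proof -
 have K: "{x : S. f x = 0} \<subseteq> {0}" using inj by blast
 have z: "vs1.fin_dim {0}" using vs1.dim_zero_set by blast
 have d: "vs1.dim {x : S. f x = 0} = 0" using vs1.dim_mono'[OF z K] vs1.dim_zero_set by simp
 show ?thesis
  using rank_nullity[OF lin S vs1.fin_dim_subset[OF K z] vs2.fin_dim_subset[OF im T]]
   vs2.dim_mono'[OF T im] d by simp
qed

end

section \<open>Direct sums of subspaces as families\<close>

definition scale_fun :: "('k => 'b => 'b) => 'k => ('i => 'b) => ('i => 'b)" where
 "scale_fun s c x = (%i. s c (x i))"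

text \<open>The product of the subspaces \<open>S a\<close> inside the space of all functions; the
  value 0 outside \<open>A\<close> makes a member determined by its values on
  \<open>A\<close>.\<close>

definition families :: "'i set => ('i => 'b::zero set) => ('i => 'b) set" where
 "families A S = {x. (\<forall>a\<in>A. x a : S a) \<and> (\<forall>a. a \<notin> A --> x a = 0)}"

context vector_space
begin

lemma vector_space_fun: "vector_space (scale_fun scale)"
 by unfold_locales (auto simp: scale_fun_def fun_eq_iff scale_right_distrib scale_left_distrib)

text \<open>Evaluation at the new index \<open>a\<close> has the families over the old indices as
  kernel and \<open>S a\<close> as image.\<close>

lemma families_dim:
 assumes "finite A" "!!a. a : A ==> local.subspace (S a)" "!!a. a : A ==> local.fin_dim (S a)"
 shows "module.subspace (scale_fun scale) (families A S) \<and> 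
  vector_space.fin_dim (scale_fun scale) (families A S) \<and>
  vector_space.dim (scale_fun scale) (families A S) = (\<Sum>a\<in>A. local.dim (S a))"
 using assms
proof (induction A)
 case empty
 interpret F: vector_space "scale_fun scale" by (rule vector_space_fun)
 have e: "families {} S = {0}" by (auto simp: families_def)
 show ?case unfolding e using F.dim_zero_set F.subspace_single_0 by simp
next
 case (insert a A)
 interpret F: vector_space "scale_fun scale" by (rule vector_space_fun)
 interpret P: vector_space_pair "scale_fun scale" scale by unfold_locales
 have IH: "F.subspace (families A S) \<and> F.fin_dim (families A S) \<and>
  F.dim (families A S) = (\<Sum>a\<in>A. local.dim (S a))"
  by (rule insert.IH) (use insert.prems in blast)+
 have S0: "0 : S b" and Sadd: "x : S b ==> y : S b ==> x + y : S b"
  and Sscale: "x : S b ==> c *s x : S b" if "b : insert a A" for b x y c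
  using insert.prems(1)[OF that] by (auto simp: subspace_0 subspace_add subspace_scale)
 have sub: "F.subspace (families (insert a A) S)"
  unfolding F.subspace_def
  by (simp add: families_def scale_fun_def S0 Sadd Sscale)
 have lin: "Vector_Spaces.linear (scale_fun scale) scale (%x. x a)"
  by unfold_locales (auto simp: scale_fun_def)
 have ker: "{x : families (insert a A) S. x a = 0} = families A S"
  using insert.hyps(2) S0[of a] unfolding families_def by auto
 have im: "(%x. x a) ` families (insert a A) S = S a"
 proof (intro equalityI subsetI)
  fix y assume y: "y : S a"
  with S0 have "(%i. if i = a then y else 0) : families (insert a A) S"
   by (auto simp: families_def)
  then show "y : (%x. x a) ` families (insert a A) S"
   by (intro image_eqI[of _ _ "%i. if i = a then y else 0"]) auto
 qed (auto simp: families_def)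
 have "F.fin_dim (families (insert a A) S) \<and>
  F.dim (families (insert a A) S) = F.dim (families A S) + local.dim (S a)"
  by (rule P.rank_nullity[OF lin sub, unfolded ker im]) (use IH insert.prems(2)[of a] in auto)
 then show ?case using sub IH insert.hyps by simp
qed

end

section \<open>Idempotents in finite-dimensional algebras\<close>

lemma (in vector_space) dim_sum_le:
 assumes "local.fin_dim S" "local.fin_dim T" "!!x. x : W ==> \<exists>a\<in>S. \<exists>b\<in>T. x = a + b"
 shows "local.dim W \<le> local.dim S + local.dim T"
proof -
 obtain B where B: "finite B" "B \<subseteq> S" "local.independent B" "S \<subseteq> local.span B" "card B = local.dim S"
  using fin_dim_basis[OF assms(1)] .
 obtain C where C: "finite C" "C \<subseteq> T" "local.independent C" "T \<subseteq> local.span C" "card C = local.dim T"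
  using fin_dim_basis[OF assms(2)] .
 have BC: "local.span B \<subseteq> local.span (B \<union> C)" "local.span C \<subseteq> local.span (B \<union> C)"
  by (rule span_mono; simp)+
 have "W \<subseteq> local.span (B \<union> C)"
 proof
  fix x assume "x : W"
  then obtain a b where ab: "a : S" "b : T" "x = a + b" using assms(3) by blast
  have "a : local.span (B \<union> C)" "b : local.span (B \<union> C)"
   using ab(1) B(4) BC(1) ab(2) C(4) BC(2) by auto
  then show "x : local.span (B \<union> C)" unfolding ab(3) by (rule span_add)
 qed
 then have "local.dim W \<le> card (B \<union> C)" using B(1) C(1) by (intro dim_le_card) auto
 also have "\<dots> \<le> local.dim S + local.dim T" using card_Un_le[of B C] B(5) C(5) by simp
 finally show ?thesis .
qed

locale k_algebra = vector_space scale
 for scale :: "'k::field => 'r::ring_1 => 'r" (infixr "*s" 75) +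
 assumes scale_mult_left: "(c *s x) * y = c *s (x * y)"
  and scale_mult_right: "x * (c *s y) = c *s (x * y)"
begin

text \<open>The Peirce component of two idempotents. For operators it consists of the maps from the
  image of \<open>q\<close> to the image of \<open>p\<close>, extended by zero on the kernel of
  \<open>q\<close>.\<close>

definition corner :: "'r => 'r => 'r set" where
 "corner p q = {r. p * r * q = r}"

lemma corner_subspace: "local.subspace (corner p q)"
 unfolding subspace_def corner_def
 by (simp add: distrib_left distrib_right scale_mult_left scale_mult_right)

text \<open>No unit is demanded: the endomorphism algebras below have an idempotent of the ambient
  ring as unit and need not contain 1.\<close>

definition subalgebra :: "'r set => bool" where
 "subalgebra E \<longleftrightarrow> local.subspace E \<and> (\<forall>x\<in>E. \<forall>y\<in>E. x * y : E)"

lemma subalgebraD: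
 assumes "subalgebra E"
 shows "0 : E" "x : E ==> y : E ==> x + y : E" "x : E ==> y : E ==> x - y : E"
  "x : E ==> y : E ==> x * y : E" "x : E ==> c *s x : E"
  "(!!i. i : I ==> f i : E) ==> sum f I : E"
proof -
 have E: "local.subspace E" and m: "!!x y. x : E ==> y : E ==> x * y : E"
  using assms unfolding subalgebra_def by auto
 show "0 : E" "x : E ==> y : E ==> x + y : E" "x : E ==> y : E ==> x - y : E"
  "x : E ==> y : E ==> x * y : E" "x : E ==> c *s x : E"
  "(!!i. i : I ==> f i : E) ==> sum f I : E"
  by (fact subspace_0[OF E] subspace_add[OF E] subspace_diff[OF E] m subspace_scale[OF E] subspace_sum[OF E])+
qed

lemma mult_power_mem:
 assumes "subalgebra E" "p : E" "z : E"
 shows "p * z ^ k : E"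
proof (induction k)
 case (Suc k)
 have "p * z ^ Suc k = (p * z ^ k) * z" by (simp only: power_Suc2 mult.assoc)
 then show ?case using Suc subalgebraD(4)[OF assms(1)] assms(3) by simp
qed (use assms in simp)

text \<open>Fitting's lemma. More powers of \<open>z\<close> than the dimension of \<open>E\<close>
  satisfy a linear relation; solving it for the lowest power gives
  \<open>z ^ n = z ^ Suc n * h\<close> with \<open>h\<close> a polynomial in \<open>z\<close>.
  Iterating this yields the stated equation, which makes \<open>z ^ n * h ^ n\<close>
  idempotent.\<close>

lemma fitting_idempotent:
 assumes E: "subalgebra E" and fd: "local.fin_dim E" and p: "p : E" "p * p = p"
  and z: "z : E" "p * z = z" "z * p = z"
 obtains n h where "0 < n" "h : E" "p * h = h" "z * h = h * z" "z ^ n = z ^ n * (z ^ n * h ^ n)"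
proof -
 let ?I = "{1..Suc (local.dim E)}"
 have pz: "p * z ^ i = z ^ i" "z ^ i * p = z ^ i" if i0: "0 < i" for i
 proof -
  obtain j where j: "i = Suc j" using i0 gr0_implies_Suc by blast
  show "p * z ^ i = z ^ i" unfolding j power_Suc mult.assoc[symmetric] z(2) ..
  show "z ^ i * p = z ^ i" unfolding j power_Suc2 mult.assoc z(3) ..
 qed
 have zE: "z ^ i : E" if "0 < i" for i using mult_power_mem[OF E p(1) z(1), of i] pz(1)[OF that] by simp
 obtain c i where ci: "(\<Sum>i\<in>?I. c i *s z ^ i) = 0" "i : ?I" "c i ~= 0"
  by (rule dependent_family[OF fd, of ?I "%i. z ^ i"]) (use zE in auto)
 define n where "n = (LEAST i. i : ?I \<and> c i ~= 0)"
 have n: "n : ?I" "c n ~= 0" using LeastI[of "%i. i : ?I \<and> c i ~= 0", OF conjI[OF ci(2,3)]]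
  unfolding n_def by auto
 have low: "c j = 0" if "j : ?I" "j < n" for j
  using not_less_Least[of j "%i. i : ?I \<and> c i ~= 0"] that unfolding n_def by auto
 let ?K = "{i : ?I. n < i}"
 \<comment> \<open>For \<open>i = n + 1\<close> the exponent is 0, and \<open>z ^ 0\<close> is the
   ambient 1, which need not lie in \<open>E\<close>; the factor \<open>p\<close> replaces it by the
   unit of the corner. The exponents in \<open>?I\<close> start at 1 for the same reason.\<close>
 define h where "h = (\<Sum>i\<in>?K. (- c i / c n) *s (p * z ^ (i - n - 1)))"
 have hE: "h : E" unfolding h_def
  by (intro subalgebraD(5,6)[OF E] mult_power_mem[OF E p(1) z(1)])
 have ph: "p * h = h" unfolding h_def by (simp add: sum_distrib_left scale_mult_right mult.assoc[symmetric] p(2))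
 have pc: "z * (p * z ^ k) = (p * z ^ k) * z" for k
 proof -
  have "z * (p * z ^ k) = z ^ Suc k" by (simp only: mult.assoc[symmetric] z(3) power_Suc)
  also have "\<dots> = p * z ^ Suc k" using pz(1)[of "Suc k"] by (simp only: zero_less_Suc)
  finally show ?thesis by (simp only: power_Suc2 mult.assoc)
 qed
 have comm: "z * h = h * z" unfolding h_def
  by (simp add: sum_distrib_left sum_distrib_right scale_mult_right scale_mult_left pc)
 have "(\<Sum>i\<in>?I. c i *s z ^ i) = c n *s z ^ n + (\<Sum>i\<in>?I - {n}. c i *s z ^ i)"
  using n(1) by (intro sum.remove) auto
 also have "(\<Sum>i\<in>?I - {n}. c i *s z ^ i) = (\<Sum>i\<in>?K. c i *s z ^ i)"
 proof (intro sum.mono_neutral_right ballI)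
  fix i assume i: "i : ?I - {n} - ?K"
  then have "i : ?I" "i < n" by auto
  then show "c i *s z ^ i = 0" using low by simp
 qed auto
 finally have rel: "c n *s z ^ n + (\<Sum>i\<in>?K. c i *s z ^ i) = 0" using ci(1) by simp
 have "z ^ Suc n * h = (\<Sum>i\<in>?K. (- c i / c n) *s z ^ i)"
  unfolding h_def sum_distrib_left scale_mult_right
 proof (rule sum.cong)
  fix i assume i: "i : ?K"
  have "z ^ Suc n * (p * z ^ (i - n - 1)) = z ^ Suc n * z ^ (i - n - 1)"
   by (simp only: mult.assoc[symmetric] pz(2)[OF zero_less_Suc])
  also have "\<dots> = z ^ i" using i by (simp add: power_add[symmetric] del: power_Suc)
  finally show "(- c i / c n) *s (z ^ Suc n * (p * z ^ (i - n - 1))) = (- c i / c n) *s z ^ i" by simp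
 qed simp
 also have "\<dots> = (- 1 / c n) *s (\<Sum>i\<in>?K. c i *s z ^ i)" by (simp add: scale_sum_right)
 also have "(\<Sum>i\<in>?K. c i *s z ^ i) = - (c n *s z ^ n)" using rel by (simp add: eq_neg_iff_add_eq_0 add.commute)
 also have "(- 1 / c n) *s (- (c n *s z ^ n)) = z ^ n" using n(2) by simp
 finally have step: "z ^ n = z ^ Suc n * h" by simp
 have pw: "z ^ n = z ^ (n + j) * h ^ j" for j
 proof (induction j)
  case (Suc j)
  have "z ^ (n + j) = z ^ j * z ^ n" by (simp add: power_add add.commute)
  also have "\<dots> = z ^ j * (z ^ Suc n * h)" using step by (rule arg_cong)
  also have "\<dots> = z ^ (n + Suc j) * h" by (simp add: power_add[symmetric] mult.assoc[symmetric] add.commute del: power_Suc)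
  finally have "z ^ n = z ^ (n + Suc j) * h * h ^ j" using Suc by simp
  then show ?case by (simp only: mult.assoc power_Suc)
 qed simp
 have "z ^ n = z ^ n * (z ^ n * h ^ n)" using pw[of n] by (simp add: power_add mult.assoc)
 then show thesis using that[of n h] n(1) hE ph comm by auto
qed

definition primitive :: "'r set => 'r => bool" where
 "primitive E p \<longleftrightarrow> p : E \<and> p * p = p \<and> p ~= 0 \<and>
   (\<forall>e\<in>E. e * e = e --> p * e = e --> e * p = e --> e = 0 \<or> e = p)"

definition left_invertible :: "'r set => 'r => 'r => bool" where
 "left_invertible E p z \<longleftrightarrow> (\<exists>h\<in>E. p * h = h \<and> h * p = h \<and> h * z = p)"

text \<open>The Fitting idempotent of \<open>z\<close> lies below the primitive \<open>p\<close>, so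
  it is 0 or \<open>p\<close>: in the first case \<open>z\<close> is nilpotent, in the second
  invertible.\<close>

lemma primitive_dichotomy:
 assumes E: "subalgebra E" and fd: "local.fin_dim E" and prim: "primitive E p"
  and z: "z : E" "p * z = z" "z * p = z"
 shows "(\<exists>n>0. z ^ n = 0) \<or> left_invertible E p z"
proof -
 have p: "p : E" "p * p = p" using prim by (auto simp: primitive_def)
 obtain n h where n: "0 < n" and h: "h : E" "p * h = h" "z * h = h * z"
  and zn: "z ^ n = z ^ n * (z ^ n * h ^ n)"
  using fitting_idempotent[OF E fd p z] .
 define e where "e = z ^ n * h ^ n"
 obtain m where m: "n = Suc m" using n gr0_implies_Suc by blast
 have pzn: "p * z ^ n = z ^ n" unfolding m power_Suc by (simp add: mult.assoc[symmetric] z(2))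
 have znp: "z ^ n * p = z ^ n" unfolding m power_Suc2 by (simp add: mult.assoc z(3))
 have hz: "h ^ i * z ^ j = z ^ j * h ^ i" for i j
 proof (rule power_commuting_commutes)
  show "h * z ^ j = z ^ j * h" by (rule power_commuting_commutes[symmetric]) (rule h(3))
 qed
 have e1: "z ^ n * h ^ n = z ^ n * (p * h ^ n)" by (simp add: mult.assoc[symmetric] znp)
 have znE: "z ^ n : E" using mult_power_mem[OF E p(1) z(1), of n] pzn by simp
 have eE: "e : E" unfolding e_def e1 by (intro subalgebraD(4)[OF E] znE mult_power_mem[OF E p(1) h(1)])
 have "e * e = z ^ n * (h ^ n * z ^ n) * h ^ n" unfolding e_def by (simp only: mult.assoc)
 also have "\<dots> = z ^ n * (z ^ n * h ^ n) * h ^ n" by (simp only: hz)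
 also have "\<dots> = e" using zn unfolding e_def by simp
 finally have ee: "e * e = e" .
 have pe: "p * e = e" unfolding e_def by (simp add: mult.assoc[symmetric] pzn)
 have "e * p = h ^ n * z ^ n * p" unfolding e_def hz ..
 also have "\<dots> = e" unfolding e_def by (simp only: mult.assoc znp) (rule hz)
 finally have ep: "e * p = e" .
 have "e = 0 \<or> e = p" using prim eE ee pe ep unfolding primitive_def by blast
 then show ?thesis
 proof
  assume "e = 0"
  then have "z ^ n = 0" using zn unfolding e_def by simp
  then show ?thesis using n by blast
 next
  assume e: "e = p"
  \<comment> \<open>The inverse is \<open>h ^ n * z ^ (n - 1)\<close>. The factors \<open>p\<close>
    keep it in \<open>E\<close> when \<open>n = 1\<close> and the power of \<open>z\<close> is the
    ambient 1, and give it \<open>p\<close> as unit on both sides.\<close>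
  define g where "g = (p * h ^ n) * (p * z ^ m) * p"
  have "g : E" unfolding g_def by (intro subalgebraD(4)[OF E] mult_power_mem[OF E p(1)] h(1) z(1) p(1))
  moreover have "p * g = g" "g * p = g"
   unfolding g_def by (simp_all add: mult.assoc[symmetric] p(2)) (simp add: mult.assoc p(2))
  moreover have "g * z = p"
  proof -
   have "g * z = p * h ^ n * (p * (z ^ m * (p * z)))" unfolding g_def by (simp only: mult.assoc)
   also have "\<dots> = p * h ^ n * (p * z ^ n)" unfolding z(2) m power_Suc2 ..
   also have "\<dots> = p * (h ^ n * z ^ n)" unfolding pzn mult.assoc ..
   also have "\<dots> = p" using e p(2) unfolding e_def hz by simp
   finally show ?thesis .
  qed
  ultimately show ?thesis unfolding left_invertible_def by blast
 qed
qed

text \<open>The corner at a primitive idempotent is a local ring. After division by the sum the two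
  elements add up to \<open>p\<close>; if both were nilpotent, the geometric series \<open>s\<close>
  in \<open>y1\<close> would invert \<open>y2 = p - y1\<close>.\<close>

lemma primitive_add:
 assumes E: "subalgebra E" and fd: "local.fin_dim E" and prim: "primitive E p"
  and z1: "z1 : E" "p * z1 = z1" "z1 * p = z1" and z2: "z2 : E" "p * z2 = z2" "z2 * p = z2"
  and inv: "left_invertible E p (z1 + z2)"
 shows "left_invertible E p z1 \<or> left_invertible E p z2"
proof -
 obtain h where h: "h : E" "p * h = h" "h * p = h" "h * (z1 + z2) = p"
  using inv unfolding left_invertible_def by blast
 have p: "p : E" "p * p = p" "p ~= 0" using prim by (auto simp: primitive_def)
 define y1 y2 where "y1 = h * z1" and "y2 = h * z2"
 have y: "y1 : E" "p * y1 = y1" "y1 * p = y1" "y2 : E" "p * y2 = y2" "y2 * p = y2"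
  unfolding y1_def y2_def using h z1 z2 subalgebraD(4)[OF E]
  by (simp_all add: mult.assoc[symmetric]) (simp_all add: mult.assoc)
 have sum: "y1 + y2 = p" using h(4) unfolding y1_def y2_def by (simp add: distrib_left)
 have lift: "left_invertible E p z" if l: "left_invertible E p (h * z)" for z
 proof -
  obtain g where g: "g : E" "p * g = g" "g * p = g" "g * (h * z) = p"
   using l unfolding left_invertible_def by blast
  have "g * h : E" "p * (g * h) = g * h" "g * h * p = g * h" "g * h * z = p"
   using g h subalgebraD(4)[OF E] by (simp_all add: mult.assoc[symmetric]) (simp_all add: mult.assoc)
  then show ?thesis unfolding left_invertible_def by blast
 qed
 show ?thesis
 proof (rule ccontr)
  assume "\<not> ?thesis"
  then have ni: "\<not> left_invertible E p y1" "\<not> left_invertible E p y2"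
   using lift unfolding y1_def y2_def by blast+
  obtain n where n: "0 < n" "y1 ^ n = 0"
   using primitive_dichotomy[OF E fd prim y(1,2,3)] ni(1) by blast
  obtain m where m: "0 < m" "y2 ^ m = 0"
   using primitive_dichotomy[OF E fd prim y(4,5,6)] ni(2) by blast
  define s where "s = (\<Sum>i<n. p * y1 ^ i)"
  have y2: "y2 = p - y1" using sum by (simp add: eq_diff_eq add.commute)
  have "y2 * s = (\<Sum>i<n. p * y1 ^ i - p * y1 ^ Suc i)"
   unfolding s_def sum_distrib_left
  proof (rule sum.cong)
   fix i
   have "y2 * (p * y1 ^ i) = y2 * y1 ^ i" by (simp only: mult.assoc[symmetric] y(6))
   also have "\<dots> = p * y1 ^ i - y1 ^ Suc i" unfolding y2 by (simp add: left_diff_distrib)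
   also have "y1 ^ Suc i = p * y1 ^ Suc i" unfolding power_Suc by (simp only: mult.assoc[symmetric] y(2))
   finally show "y2 * (p * y1 ^ i) = p * y1 ^ i - p * y1 ^ Suc i" .
  qed simp
  also have "\<dots> = p * y1 ^ 0 - p * y1 ^ n" by (rule sum_lessThan_telescope')
  finally have ys: "y2 * s = p" using n(2) by simp
  have "y2 ^ Suc j * s ^ Suc j = p" for j
  proof (induction j)
   case (Suc j)
   have "y2 ^ Suc (Suc j) * s ^ Suc (Suc j) = y2 ^ Suc j * (y2 * s) * s ^ Suc j"
    by (simp only: power_Suc2[of y2 "Suc j"] power_Suc[of s "Suc j"] mult.assoc)
   also have "\<dots> = y2 ^ j * (y2 * p) * s ^ Suc j" unfolding ys by (simp only: power_Suc2 mult.assoc)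
   also have "\<dots> = y2 ^ Suc j * s ^ Suc j" unfolding y(6) by (simp only: power_Suc2)
   finally show ?case using Suc by simp
  qed (simp add: ys)
  then have "y2 ^ Suc (m - 1) * s ^ Suc (m - 1) = p" .
  moreover have "Suc (m - 1) = m" using m(1) by simp
  ultimately show False using m(2) p(3) by simp
 qed
qed

lemma primitive_sum:
 assumes E: "subalgebra E" and fd: "local.fin_dim E" and prim: "primitive E p" and fin: "finite I"
  and z: "!!i. i : I ==> z i : E" "!!i. i : I ==> p * z i = z i" "!!i. i : I ==> z i * p = z i"
  and inv: "left_invertible E p (sum z I)"
 shows "\<exists>i\<in>I. left_invertible E p (z i)"
 using fin z inv
proof (induction I)
 case empty
 have "p ~= 0" using prim by (auto simp: primitive_def)
 then show ?case using empty by (auto simp: left_invertible_def)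
next
 case (insert i I)
 have "sum z I : E" by (rule subalgebraD(6)[OF E]) (use insert.prems in auto)
 moreover have "p * sum z I = sum z I" "sum z I * p = sum z I"
  using insert.prems by (simp_all add: sum_distrib_left sum_distrib_right)
 ultimately have "left_invertible E p (z i) \<or> left_invertible E p (sum z I)"
  using insert.prems insert.hyps by (intro primitive_add[OF E fd prim]) auto
 then show ?case using insert.IH insert.prems by auto
qed

end

section \<open>Representations with minimal endomorphism algebra\<close>

text \<open>The space at a vertex is the image of the idempotent \<open>e v\<close>, and a
  representation is a family of operators, the one of \<open>a\<close> mapping the space at
  \<open>t a\<close> to the space at \<open>s a\<close>. This direction belongs to left modules over
  an algebra whose product reads paths from left to right. All representations of one dimension
  vector lie in one ambient ring, so that they can be added and their endomorphisms
  compared.\<close>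

locale operator_reps = k_algebra scale
 for scale :: "'k::field => 'r::ring_1 => 'r" (infixr "*s" 75) +
 fixes V :: "'v set" and A :: "'a set" and s t :: "'a => 'v" and e :: "'v => 'r"
 assumes finite_V: "finite V" and finite_A: "finite A"
  and s_in: "a : A ==> s a : V" and t_in: "a : A ==> t a : V"
  and e_orth: "v : V ==> w : V ==> e v * e w = (if v = w then e v else 0)"
  and fin_dim_total: "local.fin_dim (corner (sum e V) (sum e V))"
begin

definition total :: 'r where "total = sum e V"

definition reps :: "('a => 'r) set" where
 "reps = families A (%a. corner (e (s a)) (e (t a)))"

text \<open>The block-diagonal operators, that is, the product of the endomorphism rings of the
  vertex spaces.\<close>

definition local_ops :: "'r set" where
 "local_ops = {f : corner total total. \<forall>v\<in>V. f * e v = e v * f}"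

definition end_alg :: "('a => 'r) => 'r set" where
 "end_alg x = {f : local_ops. \<forall>a\<in>A. f * x a = x a * f}"

text \<open>The differential of the two-term complex from \<open>local_ops\<close> to
  \<open>reps\<close>; its kernel is the endomorphism algebra of \<open>x\<close> and its cokernel
  is \<open>Ext(x, x)\<close>.\<close>

definition bd :: "('a => 'r) => 'r => 'a => 'r" where
 "bd x f = (%a. if a : A then f * x a - x a * f else 0)"

lemma total_e: "v : V ==> total * e v = e v" "v : V ==> e v * total = e v"
proof -
 assume v: "v : V"
 have "total * e v = (\<Sum>w\<in>V. if w = v then e v else 0)"
  unfolding total_def sum_distrib_right by (rule sum.cong) (use v e_orth in auto)
 then show "total * e v = e v" using v finite_V by simp
 have "e v * total = (\<Sum>w\<in>V. if v = w then e v else 0)"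
  unfolding total_def sum_distrib_left by (rule sum.cong) (use v e_orth in auto)
 then show "e v * total = e v" using v finite_V by simp
qed

lemma total_idem: "total * total = total"
proof -
 have "total * total = (\<Sum>v\<in>V. total * e v)" by (subst (2) total_def) (simp add: sum_distrib_left)
 also have "\<dots> = total" unfolding total_def[symmetric] by (simp add: total_e(1)) (simp add: total_def)
 finally show ?thesis .
qed

lemma cornerD: "r : corner p q ==> p * p = p ==> p * r = r" "r : corner p q ==> q * q = q ==> r * q = r"
proof -
 assume r: "r : corner p q"
 have eq: "p * r * q = r" using r by (simp add: corner_def)
 show "p * r = r" if "p * p = p" using eq that by (metis mult.assoc)
 show "r * q = r" if "q * q = q" using eq that by (metis mult.assoc)
qed

lemma cornerI: "p * r = r ==> r * q = r ==> r : corner p q" by (simp add: corner_def)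

lemma local_opsD: "f : local_ops ==> total * f = f" "f : local_ops ==> f * total = f"
 using cornerD[OF _ total_idem] by (auto simp: local_ops_def)

lemma local_ops_subalgebra: "subalgebra local_ops"
 unfolding subalgebra_def subspace_def
proof (intro conjI ballI allI)
 show "0 : local_ops" by (simp add: local_ops_def corner_def)
 fix x y assume x: "x : local_ops" and y: "y : local_ops"
 show "x + y : local_ops" using x y by (auto simp: local_ops_def corner_def algebra_simps)
 have "x * y * e v = e v * (x * y)" if "v : V" for v
  using x y that by (simp add: local_ops_def mult.assoc) (simp add: mult.assoc[symmetric])
 moreover have "total * (x * y) = x * y" by (simp only: mult.assoc[symmetric] local_opsD(1)[OF x])
 moreover have "x * y * total = x * y" by (simp only: mult.assoc local_opsD(2)[OF y])
 ultimately show "x * y : local_ops" by (simp add: local_ops_def cornerI)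
next
 fix c x assume "x : local_ops"
 then show "c *s x : local_ops" by (auto simp: local_ops_def corner_def scale_mult_left scale_mult_right)
qed

lemma end_alg_subalgebra: "subalgebra (end_alg x)"
 unfolding subalgebra_def subspace_def
proof (intro conjI ballI allI)
 note L = subalgebraD[OF local_ops_subalgebra]
 show "0 : end_alg x" using L(1) by (simp add: end_alg_def)
 fix f g assume f: "f : end_alg x" and g: "g : end_alg x"
 show "f + g : end_alg x" using f g L(2) by (simp add: end_alg_def distrib_left distrib_right)
 have "f * g * x a = x a * (f * g)" if "a : A" for a
  using f g that by (simp add: end_alg_def mult.assoc) (simp add: mult.assoc[symmetric])
 then show "f * g : end_alg x" using f g L(4) by (simp add: end_alg_def)
next
 fix c f assume "f : end_alg x"
 then show "c *s f : end_alg x" using subalgebraD(5)[OF local_ops_subalgebra]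
  by (simp add: end_alg_def scale_mult_left scale_mult_right)
qed

lemma rep_corner:
 assumes "x : reps" "a : A"
 shows "e (s a) * x a = x a" "x a * e (t a) = x a"
proof -
 have c: "x a : corner (e (s a)) (e (t a))" using assms by (simp add: reps_def families_def)
 show "e (s a) * x a = x a" by (rule cornerD(1)[OF c]) (simp add: e_orth s_in assms)
 show "x a * e (t a) = x a" by (rule cornerD(2)[OF c]) (simp add: e_orth t_in assms)
qed

lemma rep_total_mult:
 assumes "x : reps" "a : A"
 shows "total * x a = x a" "x a * total = x a"
proof -
 have "total * x a = (total * e (s a)) * x a" by (simp only: mult.assoc rep_corner(1)[OF assms])
 then show "total * x a = x a" by (simp only: total_e s_in[OF assms(2)] rep_corner(1)[OF assms])
 have "x a * total = x a * (e (t a) * total)" by (simp only: mult.assoc[symmetric] rep_corner(2)[OF assms])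
 then show "x a * total = x a" by (simp only: total_e t_in[OF assms(2)] rep_corner(2)[OF assms])
qed

lemma total_in_end_alg: "x : reps ==> total : end_alg x"
proof -
 assume x: "x : reps"
 have "total * x a = x a * total" if "a : A" for a
  using rep_total_mult[OF x that] by simp
 then show ?thesis
  using total_idem total_e by (auto simp: end_alg_def local_ops_def corner_def)
qed

lemma fin_dim_corner_total: "local.fin_dim (corner total total)"
 using fin_dim_total by (simp add: total_def)

lemma fin_dim_local_ops: "local.fin_dim local_ops"
 by (rule fin_dim_subset[OF _ fin_dim_corner_total]) (auto simp: local_ops_def)

lemma fin_dim_end_alg: "local.fin_dim (end_alg x)"
 by (rule fin_dim_subset[OF _ fin_dim_local_ops]) (auto simp: end_alg_def)

lemma corner_mono:
 assumes "p * P = p" "P * p = p" "q * Q = q" "Q * q = q" "p * p = p" "q * q = q"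
 shows "corner p q \<subseteq> corner P Q"
proof
 fix r assume r: "r : corner p q"
 have a: "p * r = r" "r * q = r" using cornerD r assms by auto
 have "P * r = r" using a(1) assms(2) by (metis mult.assoc)
 moreover have "r * Q = r" using a(2) assms(3) by (metis mult.assoc)
 ultimately show "r : corner P Q" by (rule cornerI)
qed

lemma rep_total: "x : reps ==> a : A ==> x a : corner total total"
 using rep_total_mult by (intro cornerI) auto

lemma rep_comm:
 assumes "c : reps" "u : local_ops" "w : local_ops" "a : A"
 shows "u * c a * w : corner (e (s a)) (e (t a))"
proof -
 note c = rep_corner[OF assms(1,4)]
 have u: "u * e (s a) = e (s a) * u" and w: "w * e (t a) = e (t a) * w"
  using assms s_in t_in by (auto simp: local_ops_def)
 have "e (s a) * (u * c a * w) = u * (e (s a) * c a) * w" by (simp only: mult.assoc[symmetric] u)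
 moreover have "u * c a * w * e (t a) = u * (c a * e (t a)) * w" by (simp only: mult.assoc w)
 ultimately show ?thesis unfolding c by (intro cornerI)
qed

text \<open>
 The representation \<open>x + c\<close> is the extension with class \<open>c\<close> of the two summands of \<open>x\<close> given by
 \<open>p\<close> and \<open>total - p\<close>. Filtering its endomorphisms by block shape embeds their graded pieces into
 those of \<open>x\<close>, properly so if the extension does not split.
\<close>

lemma off_diagonal_split:
 assumes x: "x : reps" and min: "!!y. y : reps ==> local.dim (end_alg x) \<le> local.dim (end_alg y)"
  and p: "p : end_alg x" "p * p = p" and c: "c : reps"
  and off: "!!a. a : A ==> p * c a * (total - p) = c a"
 shows "\<exists>f\<in>local_ops. bd x f = c"
proof (rule ccontr)
 assume no: "\<not> ?thesis"
 interpret VP: vector_space_pair scale scale by unfold_locales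
 define q where "q = total - p"
 define y where "y = x + c"
 \<comment> \<open>The filtration by block shape: \<open>p1\<close> reads off the block
   \<open>q f p\<close>, \<open>p2\<close> the diagonal of what \<open>p1\<close> kills, and the
   block \<open>p f q\<close> remains. By rank and nullity the dimension of an endomorphism algebra
   is the sum of the dimensions of these three pieces.\<close>
 define p1 where "p1 f = q * f * p" for f
 define p2 where "p2 f = p * f * p + q * f * q" for f
 note E = subalgebraD[OF end_alg_subalgebra]
 have tE: "total : end_alg x" using total_in_end_alg[OF x] .
 have pL: "p : local_ops" using p by (simp add: end_alg_def)
 have tp: "total * p = p" "p * total = p" using local_opsD[OF pL] by auto
 have qE: "q : end_alg x" unfolding q_def by (rule E(3)[OF tE p(1)])
 have pq: "p * q = 0" "q * p = 0" "q * q = q" "p + q = total"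
  unfolding q_def using p(2) tp total_idem by (simp_all add: algebra_simps)
 have ycar: "y : reps" unfolding y_def using x c corner_subspace
  by (auto simp: reps_def families_def intro: subspace_add)
 have xc: "p * x a = x a * p" "q * x a = x a * q" if "a : A" for a
  using p(1) qE that by (auto simp: end_alg_def)
 have cc: "c a * p = 0" "q * c a = 0" "p * c a = c a" "c a * q = c a" if "a : A" for a
 proof -
  have o: "p * c a * q = c a" using off[OF that] unfolding q_def .
  show "c a * p = 0" by (subst o[symmetric]) (simp add: mult.assoc pq)
  show "q * c a = 0" by (subst o[symmetric]) (simp add: mult.assoc[symmetric] pq)
  have "p * (p * c a * q) = p * c a * q" by (simp add: mult.assoc[symmetric] p(2))
  then show "p * c a = c a" unfolding o .
  have "(p * c a * q) * q = p * c a * q" by (simp add: mult.assoc pq)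
  then show "c a * q = c a" unfolding o .
 qed
 have lin1: "Vector_Spaces.linear scale scale p1"
  by unfold_locales (auto simp: p1_def algebra_simps scale_mult_left scale_mult_right)
 have lin2: "Vector_Spaces.linear scale scale p2"
  by unfold_locales (auto simp: p2_def algebra_simps scale_mult_left scale_mult_right scale_right_distrib)
 have dimE: "local.dim (end_alg z) = local.dim (p1 ` end_alg z) +
   (local.dim (p2 ` {f : end_alg z. p1 f = 0}) + local.dim {f : end_alg z. p1 f = 0 \<and> p2 f = 0})" for z
 proof -
  have S: "local.subspace (end_alg z)" using end_alg_subalgebra by (simp add: subalgebra_def)
  have S1: "local.subspace {f : end_alg z. p1 f = 0}"
   using S unfolding subspace_def p1_def
   by (auto simp: algebra_simps scale_mult_left scale_mult_right)
  have "{f : {f : end_alg z. p1 f = 0}. p2 f = 0} = {f : end_alg z. p1 f = 0 \<and> p2 f = 0}" by auto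
  then show ?thesis
   using VP.rank_nullity'[OF lin1 S fin_dim_end_alg]
    VP.rank_nullity'[OF lin2 S1 fin_dim_subset[OF _ fin_dim_end_alg[of z]]] by simp
 qed
 have fx: "f * x a = x a * f + c a * f - f * c a" if "f : end_alg y" "a : A" for f a
 proof -
  have "f * (x a + c a) = (x a + c a) * f" using that by (simp add: end_alg_def y_def)
  then have "f * x a + f * c a = x a * f + c a * f" by (simp only: distrib_left distrib_right)
  then show ?thesis by (simp add: eq_diff_eq)
 qed
 have pfq: "u * f * w : local_ops" if "f : end_alg y" "u : {p,q}" "w : {p,q}" for f u w
  using that p(1) qE subalgebraD(4)[OF local_ops_subalgebra] by (auto simp: end_alg_def)
 \<comment> \<open>The block \<open>u f w\<close> of the equation saying that \<open>f\<close>
   commutes with \<open>y = x + c\<close>. As \<open>c\<close> has only the block from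
   \<open>q\<close> to \<open>p\<close>, the correction terms vanish in the block
   \<open>q f p\<close>, on the diagonal once that block is 0, and in the block \<open>p f q\<close>
   once the diagonal is 0.\<close>
 have block: "u * f * w * x a = x a * (u * f * w) + (u * c a * f * w - u * f * (c a * w))"
  if f: "f : end_alg y" "u : {p,q}" "w : {p,q}" "a : A" for f u w a
 proof -
  have ux: "u * x a = x a * u" and wx: "w * x a = x a * w" using f xc by auto
  have "u * f * w * x a = u * (f * x a) * w" by (simp only: mult.assoc wx)
  also have "\<dots> = u * x a * f * w + (u * c a * f * w - u * f * (c a * w))"
   unfolding fx[OF f(1,4)] by (simp add: algebra_simps)
  finally show ?thesis unfolding ux by (simp only: mult.assoc)
 qed
 have m1: "p1 f : end_alg x" if f: "f : end_alg y" for f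
 proof -
  have "p1 f * x a = x a * p1 f" if "a : A" for a
   using block[OF f, of q p a] that cc by (simp add: p1_def)
  then show ?thesis using pfq[OF f, of q p] by (simp add: end_alg_def p1_def)
 qed
 have c1: "p1 ` end_alg y \<subseteq> p1 ` end_alg x"
 proof clarify
  fix f assume f: "f : end_alg y"
  have "p1 (p1 f) = (q * q) * f * (p * p)" unfolding p1_def by (simp only: mult.assoc)
  then have "p1 (p1 f) = p1 f" unfolding pq p(2) p1_def .
  then show "p1 f : p1 ` end_alg x" using m1[OF f] by (metis image_eqI)
 qed
 have m2: "p2 f : end_alg x" "p1 (p2 f) = 0" "p2 (p2 f) = p2 f"
  if f: "f : end_alg y" and f1: "p1 f = 0" for f
 proof -
  have z: "q * (f * p) = 0" using f1 by (simp add: p1_def mult.assoc)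
  have "p * f * p * x a = x a * (p * f * p)" if "a : A" for a
  proof -
   have "p * c a * f * p = c a * (q * (f * p))" by (simp only: mult.assoc[symmetric] cc(3,4)[OF that])
   then show ?thesis using block[OF f, of p p a] that cc z by simp
  qed
  moreover have "q * f * q * x a = x a * (q * f * q)" if "a : A" for a
  proof -
   have "q * f * (c a * q) = q * (f * p) * c a" by (simp only: mult.assoc cc(3,4)[OF that])
   then show ?thesis using block[OF f, of q q a] that cc z by simp
  qed
  ultimately show "p2 f : end_alg x"
   using pfq[OF f, of p p] pfq[OF f, of q q] subalgebraD(2)[OF local_ops_subalgebra]
   by (simp add: end_alg_def p2_def distrib_left distrib_right)
  have "p1 (p2 f) = (q * p) * f * (p * p) + (q * q) * f * (q * p)"
   unfolding p1_def p2_def by (simp only: distrib_left distrib_right mult.assoc)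
  then show "p1 (p2 f) = 0" by (simp add: pq)
  have "p2 (p2 f) = (p * p) * f * (p * p) + (p * q) * f * (q * p) + ((q * p) * f * (p * q) + (q * q) * f * (q * q))"
   unfolding p2_def by (simp only: distrib_left distrib_right mult.assoc)
  then show "p2 (p2 f) = p2 f" by (simp add: pq p(2) p2_def)
 qed
 have c2: "p2 ` {f : end_alg y. p1 f = 0} \<subseteq> p2 ` {f : end_alg x. p1 f = 0}"
 proof clarify
  fix f assume f: "f : end_alg y" "p1 f = 0"
  show "p2 f : p2 ` {f : end_alg x. p1 f = 0}"
   by (rule image_eqI[of _ _ "p2 f"]) (use m2[OF f] in auto)
 qed
 have split_f: "f = p * f * p + p * f * q + (q * f * p + q * f * q)" if "f : local_ops" for f
 proof -
  have "f = (p + q) * f * (p + q)" unfolding pq using local_opsD[OF that] by simp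
  then show ?thesis by (simp add: algebra_simps)
 qed
 have diag: "p * f * p = p * (p2 f) * p" "q * f * q = q * (p2 f) * q" for f
 proof -
  have "p * (p2 f) * p = (p * p) * f * (p * p) + (p * q) * f * (q * p)"
   "q * (p2 f) * q = (q * p) * f * (p * q) + (q * q) * f * (q * q)"
   unfolding p2_def by (simp_all only: distrib_left distrib_right mult.assoc)
  then show "p * f * p = p * (p2 f) * p" "q * f * q = q * (p2 f) * q" by (simp_all add: pq p(2))
 qed
 have pin: "p : p2 ` {f : end_alg x. p1 f = 0}"
  by (rule image_eqI[of _ _ p]) (use p pq in \<open>auto simp: p1_def p2_def\<close>)
 \<comment> \<open>Here the inclusion of graded pieces becomes strict. If \<open>p\<close> were the
   diagonal of an endomorphism \<open>f\<close> of \<open>y\<close>, then comparing the blocks from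
   \<open>q\<close> to \<open>p\<close> would give \<open>bd x (- b) = c\<close> for
   \<open>b = p * f * q\<close>, a splitting of the extension.\<close>
 have pnot: "p \<notin> p2 ` {f : end_alg y. p1 f = 0}"
 proof
  assume "p : p2 ` {f : end_alg y. p1 f = 0}"
  then obtain f where f: "f : end_alg y" "p1 f = 0" "p2 f = p" by auto
  have d: "p * f * p = p" "q * f * q = 0" using diag[of f] unfolding f(3) by (simp_all add: p(2) pq)
  define b where "b = p * f * q"
  have bd: "bd x (- b) = c"
  proof
   fix a
   show "bd x (- b) a = c a"
   proof (cases "a : A")
    case True
    have e1: "p * c a * f * q = c a * (q * f * q)" by (simp only: mult.assoc[symmetric] cc(3,4)[OF True])
    have e2: "p * f * (c a * q) = p * f * p * c a" by (simp only: mult.assoc cc(3,4)[OF True])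
    have "b * x a = x a * b + (0 - c a)"
     using block[OF f(1), of p q a] True unfolding b_def e1 e2 d by (simp add: cc)
    then show ?thesis using True by (simp add: bd_def)
   next
    case False
    then show ?thesis using c by (simp add: bd_def reps_def families_def)
   qed
  qed
  have "b : local_ops" unfolding b_def using pfq[OF f(1), of p q] by simp
  then have "- b : local_ops" using subalgebraD(1,3)[OF local_ops_subalgebra] by (metis diff_0)
  then show False using no bd by blast
 qed
 have c3: "{f : end_alg y. p1 f = 0 \<and> p2 f = 0} \<subseteq> {f : end_alg x. p1 f = 0 \<and> p2 f = 0}"
 proof
  fix f assume "f : {f : end_alg y. p1 f = 0 \<and> p2 f = 0}"
  then have f: "f : end_alg y" "p1 f = 0" "p2 f = 0" by auto
  have d: "p * f * p = 0" "q * f * q = 0" "q * f * p = 0"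
   using diag[of f] f(2) unfolding f(3) by (simp_all add: p1_def)
  have fL: "f : local_ops" using f(1) by (simp add: end_alg_def)
  have fb: "f = p * f * q" using split_f[OF fL] d by simp
  have "f * x a = x a * f" if "a : A" for a
  proof -
   have e1: "p * c a * f * q = c a * (q * f * q)" by (simp only: mult.assoc[symmetric] cc(3,4)[OF that])
   have e2: "p * f * (c a * q) = p * f * p * c a" by (simp only: mult.assoc cc(3,4)[OF that])
   have "p * f * q * x a = x a * (p * f * q)"
    using block[OF f(1), of p q a] that unfolding e1 e2 d by simp
   then show ?thesis using fb by simp
  qed
  then show "f : {f : end_alg x. p1 f = 0 \<and> p2 f = 0}" using fL f by (simp add: end_alg_def)
 qed
 have fd1: "local.fin_dim {f : end_alg x. p1 f = 0}"
  by (rule fin_dim_subset[OF _ fin_dim_end_alg[of x]]) auto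
 have fdx: "local.fin_dim (p1 ` end_alg x)" "local.fin_dim (p2 ` {f : end_alg x. p1 f = 0})"
  "local.fin_dim {f : end_alg x. p1 f = 0 \<and> p2 f = 0}"
   apply (rule VP.fin_dim_image[OF lin1 fin_dim_end_alg])
   apply (rule VP.fin_dim_image[OF lin2 fd1])
  apply (rule fin_dim_subset[OF _ fd1], auto)
  done
 have sub2: "local.subspace (p2 ` {f : end_alg y. p1 f = 0})"
 proof -
  interpret L2: Vector_Spaces.linear scale scale p2 by (rule lin2)
  have "local.subspace {f : end_alg y. p1 f = 0}"
   using end_alg_subalgebra[of y] unfolding subalgebra_def subspace_def p1_def
   by (auto simp: algebra_simps scale_mult_left scale_mult_right)
  then show ?thesis by (rule L2.subspace_image)
 qed
 have "local.dim (end_alg y) < local.dim (end_alg x)"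
  unfolding dimE[of x] dimE[of y]
  using dim_mono'[OF fdx(1) c1] dim_mono'[OF fdx(3) c3] dim_strict_mono'[OF fdx(2) sub2 c2 pin pnot]
  by linarith
 then show False using min[OF ycar] by simp
qed

text \<open>Models a factorisation of the identity through modules indexed by classes; the classes
  will be cohomological degrees. The operators \<open>f l\<close> and \<open>g l\<close> are only
  linear lifts to the image of \<open>\<tau>\<close>. What survives of linearity over the path
  algebra is that \<open>g l * f l'\<close> is an endomorphism of \<open>x\<close> when both pass
  through the same class.\<close>

definition factors_through :: "'r => 'i set => ('a => 'r) => bool" where
 "factors_through \<tau> K x \<longleftrightarrow> (\<exists>(I :: nat set) cl f g. finite I \<and>
   (\<forall>l\<in>I. cl l : K \<and> \<tau> * f l = f l \<and> g l * \<tau> = g l) \<and> (\<Sum>l\<in>I. g l * f l) = total \<and>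
   (\<forall>l\<in>I. \<forall>l'\<in>I. cl l = cl l' --> g l * f l' : end_alg x))"

definition orthogonal_decomposition :: "'r set => 'r set => bool" where
 "orthogonal_decomposition E P \<longleftrightarrow> finite P \<and> P \<subseteq> E \<and> 0 \<notin> P \<and>
   (\<forall>p\<in>P. \<forall>q\<in>P. p * q = (if p = q then p else 0)) \<and> sum id P = total"

text \<open>Multiplying a linear relation by \<open>q\<close> from the right leaves only the term of
  \<open>q\<close>.\<close>

lemma orthogonal_card_le:
 assumes "orthogonal_decomposition E P" "local.fin_dim E"
 shows "card P \<le> local.dim E"
proof (rule family_card_le_dim[OF assms(2)])
 show "finite P" "!!p. p : P ==> id p : E"
  using assms(1) by (auto simp: orthogonal_decomposition_def)
 fix c q assume 0: "(\<Sum>p\<in>P. c p *s id p) = 0" and q: "q : P"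
 have "(\<Sum>p\<in>P. c p *s id p) * q = (\<Sum>p\<in>P. if p = q then c q *s q else 0)"
  unfolding sum_distrib_right
  by (rule sum.cong) (use assms(1) q in \<open>auto simp: scale_mult_left orthogonal_decomposition_def\<close>)
 then have "c q *s q = 0" using 0 q assms(1) by (simp add: orthogonal_decomposition_def)
 moreover have "q ~= 0" using q assms(1) by (auto simp: orthogonal_decomposition_def)
 ultimately show "c q = 0" by simp
qed

text \<open>A decomposition with the largest number of members consists of primitive idempotents: a
  nontrivial \<open>d\<close> below a member \<open>p\<close> would allow \<open>p\<close> to be
  replaced by \<open>d\<close> and \<open>p - d\<close>.\<close>

lemma primitive_decomposition:
 assumes E: "subalgebra E" and fd: "local.fin_dim E" and tot: "total : E"
 obtains P where "orthogonal_decomposition E P" "!!p. p : P ==> primitive E p"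
proof -
 have ex: "\<exists>P. orthogonal_decomposition E P"
 proof (cases "total = 0")
  case True then show ?thesis by (intro exI[of _ "{}"]) (simp add: orthogonal_decomposition_def)
 next
  case False then show ?thesis
   by (intro exI[of _ "{total}"]) (simp add: orthogonal_decomposition_def tot total_idem)
 qed
 then obtain P0 where P0: "orthogonal_decomposition E P0" by blast
 have bd: "\<forall>P. orthogonal_decomposition E P --> card P < Suc (local.dim E)"
  using orthogonal_card_le[OF _ fd] by (simp add: less_Suc_eq_le)
 obtain P where P: "orthogonal_decomposition E P"
  and mx: "!!P'. orthogonal_decomposition E P' ==> card P' \<le> card P"
  using ex_has_greatest_nat[OF P0 bd] by blast
 have Pf: "finite P" "P \<subseteq> E" "0 \<notin> P" "sum id P = total"
  and Po: "!!p q. p : P ==> q : P ==> p * q = (if p = q then p else 0)"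
  using P by (auto simp: orthogonal_decomposition_def)
 have "primitive E p" if p: "p : P" for p
  unfolding primitive_def
 proof (intro conjI ballI impI)
  show "p : E" "p * p = p" "p ~= 0" using p Pf Po by auto
  fix d assume d: "d : E" "d * d = d" "p * d = d" "d * p = d"
  show "d = 0 \<or> d = p"
  proof (rule ccontr)
   assume "\<not> ?thesis"
   then have nz: "d ~= 0" "p - d ~= 0" by auto
   define R where "R = P - {p}"
   have dR: "d * r = 0" "r * d = 0" "p * r = 0" "r * p = 0" if "r : R" for r
   proof -
    show pr: "p * r = 0" "r * p = 0" using Po that p by (auto simp: R_def)
    have "d * r = d * (p * r)" by (simp only: mult.assoc[symmetric] d(4))
    then show "d * r = 0" using pr by simp
    have "r * d = (r * p) * d" by (simp only: mult.assoc d(3))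
    then show "r * d = 0" using pr by simp
   qed
   have "d * (p - d) = 0" "(p - d) * d = 0" "(p - d) * (p - d) = p - d"
    using d Po[OF p p] by (simp_all add: algebra_simps)
   note dd = this
   have ne: "d ~= p - d" using dd(1) d(2) nz(1) by auto
   have nR: "d \<notin> R" "p - d \<notin> R"
    using dR[of d] d(2) nz(1) dR(1,3)[of "p - d"] dd(3) nz(2) by (auto simp: left_diff_distrib)
   let ?P = "insert d (insert (p - d) R)"
   have "orthogonal_decomposition E ?P" unfolding orthogonal_decomposition_def
   proof (intro conjI)
    show "finite ?P" using Pf by (simp add: R_def)
    show "?P \<subseteq> E" using Pf(2) d(1) subalgebraD(3)[OF E] p by (auto simp: R_def)
    show "0 \<notin> ?P" using nz Pf(3) by (auto simp: R_def)
    show "sum id ?P = total"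
     using Pf ne nR sum.remove[OF Pf(1) p, of id] by (simp add: R_def)
    have R: "x * y = (if x = y then x else 0)" if "x : R" "y : R" for x y
     using that Po by (simp add: R_def)
    show "\<forall>x\<in>?P. \<forall>y\<in>?P. x * y = (if x = y then x else 0)"
     using d(2) dd ne nR ne[symmetric] dR R
     by (auto simp: left_diff_distrib right_diff_distrib)
   qed
   then have "card ?P \<le> card P" by (rule mx)
   moreover have "card ?P = Suc (Suc (card R))" using Pf ne nR by (simp add: R_def)
   moreover have "card P = Suc (card R)" unfolding R_def by (rule card.remove[OF Pf(1) p])
   ultimately show False by simp
  qed
 qed
 then show thesis using that P by blast
qed

text \<open>
 For \<open>x\<close> with minimal endomorphism algebra, every derivation is inner up to its components at the
 summands in \<open>J\<close>, those that occur only once. If \<open>total\<close> factors through \<open>\<tau>\<close> in \<open>|K|\<close> classes, then \<open>J\<close> is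
 bounded independently of \<open>x\<close>.
\<close>

theorem dim_corner_total_le:
 assumes q: "(\<Sum>v\<in>V. local.dim (corner (e v) (e v))) \<le> (\<Sum>a\<in>A. local.dim (corner (e (s a)) (e (t a))))"
  and fac: "!!x. x : reps ==> factors_through \<tau> K x"
  and tau: "\<tau> * \<tau> = \<tau>" "local.fin_dim (corner \<tau> \<tau>)" and K: "finite K"
 defines "T \<equiv> local.dim (corner \<tau> \<tau>)"
 shows "local.dim (corner total total) \<le> (card A * ((card K * T)\<^sup>2 * T))\<^sup>2 * T"
proof -
 interpret VP: vector_space_pair scale scale by unfold_locales
 have "0 : reps" using corner_subspace by (simp add: reps_def families_def subspace_0)
 then obtain x where x: "x : reps"
  and min: "!!y. y : reps ==> local.dim (end_alg x) \<le> local.dim (end_alg y)"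
  using ex_has_least_nat[of "%x. x : reps" 0 "%x. local.dim (end_alg x)"] by blast
 let ?E = "end_alg x"
 note E = subalgebraD[OF end_alg_subalgebra[of x]] and sE = end_alg_subalgebra[of x] and fE = fin_dim_end_alg[of x]
 have tE: "total : ?E" by (rule total_in_end_alg[OF x])
 have EL: "f : local_ops" if "f : ?E" for f using that by (simp add: end_alg_def)
 have Et: "total * f = f" "f * total = f" if "f : ?E" for f
  using local_opsD[OF EL[OF that]] by auto
 obtain P where P: "orthogonal_decomposition ?E P" and prim: "!!p. p : P ==> primitive ?E p"
  using primitive_decomposition[OF sE fE tE] by blast
 have Pf: "finite P" and PE: "!!p. p : P ==> p : ?E" and Ps: "sum id P = total"
  and Po: "!!p q. p : P ==> q : P ==> p * q = (if p = q then p else 0)"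
  using P by (auto simp: orthogonal_decomposition_def)
 have pp: "p * p = p" if "p : P" for p using Po[OF that that] by simp
 obtain I cl f g where Ifg: "finite (I :: nat set) \<and>
   (\<forall>l\<in>I. cl l : K \<and> \<tau> * f l = f l \<and> g l * \<tau> = g l) \<and> (\<Sum>l\<in>I. g l * f l) = total \<and>
   (\<forall>l\<in>I. \<forall>l'\<in>I. cl l = cl l' --> g l * f l' : ?E)"
  using fac[OF x] unfolding factors_through_def by (elim exE) (rule that)
 have I: "finite I" and cl: "!!l. l : I ==> cl l : K"
  and fl: "!!l. l : I ==> \<tau> * f l = f l" and gl: "!!l. l : I ==> g l * \<tau> = g l"
  and gf: "(\<Sum>l\<in>I. g l * f l) = total"
  and cross: "!!l l'. l : I ==> l' : I ==> cl l = cl l' ==> g l * f l' : ?E"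
  using Ifg by simp_all
 \<comment> \<open>The products \<open>p * (g l * f l) * p\<close> add up to the unit
   \<open>p\<close> of a local ring, so one of them is invertible.\<close>
 have "\<exists>l h. l : I \<and> h : ?E \<and> p * h = h \<and> h * p = h \<and> h * (p * (g l * f l) * p) = p" if p: "p : P" for p
 proof -
  have sum: "(\<Sum>l\<in>I. p * (g l * f l) * p) = p"
   unfolding sum_distrib_right[symmetric] sum_distrib_left[symmetric] gf
   using Et[OF PE[OF p]] pp[OF p] by simp
  have "\<exists>l\<in>I. left_invertible ?E p (p * (g l * f l) * p)"
  proof (rule primitive_sum[OF sE fE prim[OF p] I])
   show "p * (g l * f l) * p : ?E" if "l : I" for l
    by (rule E(4)[OF E(4)[OF PE[OF p] cross[OF that that HOL.refl]] PE[OF p]])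
   show "p * (p * (g l * f l) * p) = p * (g l * f l) * p" for l
    by (simp add: mult.assoc[symmetric] pp[OF p])
   show "p * (g l * f l) * p * p = p * (g l * f l) * p" for l
    by (simp add: mult.assoc pp[OF p])
   show "left_invertible ?E p (\<Sum>l\<in>I. p * (g l * f l) * p)"
    unfolding sum left_invertible_def using PE[OF p] pp[OF p] by blast
  qed
  then show ?thesis unfolding left_invertible_def by blast
 qed
 then have "\<forall>p\<in>P. \<exists>lh. fst lh : I \<and> snd lh : ?E \<and> p * snd lh = snd lh \<and> snd lh * p = snd lh \<and>
   snd lh * (p * (g (fst lh) * f (fst lh)) * p) = p"
  by simp
 from bchoice[OF this] obtain LH where LH': "\<forall>p\<in>P. fst (LH p) : I \<and> snd (LH p) : ?E \<and>
   p * snd (LH p) = snd (LH p) \<and> snd (LH p) * p = snd (LH p) \<and>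
   snd (LH p) * (p * (g (fst (LH p)) * f (fst (LH p))) * p) = p" ..
 define L where "L p = fst (LH p)" for p
 define H where "H p = snd (LH p)" for p
 have LH: "L p : I \<and> H p : ?E \<and> p * H p = H p \<and> H p * p = H p \<and>
   H p * (p * (g (L p) * f (L p)) * p) = p" if "p : P" for p
  using LH' that unfolding L_def H_def by blast
 define F where "F p = f (L p) * p" for p
 define G where "G p = H p * g (L p)" for p
 define kl where "kl p = cl (L p)" for p
 have GF: "G p * F p = p" if p: "p : P" for p
 proof -
  have "H p * (p * (g (L p) * f (L p)) * p) = (H p * p) * (g (L p) * f (L p)) * p" by (simp only: mult.assoc)
  also have "\<dots> = G p * F p" using LH[OF p] unfolding F_def G_def by (simp add: mult.assoc)
  finally show ?thesis using LH[OF p] by simp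
 qed
 have pG: "p * G p = G p" and Fp: "F p * p = F p" and Gt: "G p * \<tau> = G p" and tF: "\<tau> * F p = F p" if p: "p : P" for p
  using LH[OF p] gl[of "L p"] fl[of "L p"] pp[OF p] unfolding F_def G_def
  by (simp_all add: mult.assoc) (simp_all add: mult.assoc[symmetric])
 have GFE: "G p * F q : ?E" if "p : P" "q : P" "kl p = kl q" for p q
 proof -
  have "G p * F q = H p * (g (L p) * f (L q)) * q" unfolding F_def G_def by (simp only: mult.assoc)
  then show ?thesis using LH that PE unfolding kl_def by (simp add: E(4) cross)
 qed
 have corn: "local.fin_dim (corner p q) \<and> local.dim (corner p q) \<le> T" if p: "p : P" and q': "q : P" for p q
  unfolding T_def
 proof (rule VP.dim_le_of_inj[OF _ corner_subspace])
  show "Vector_Spaces.linear scale scale (%r. F p * r * G q)"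
   by unfold_locales (auto simp: algebra_simps scale_mult_left scale_mult_right)
  show "(%r. F p * r * G q) ` corner p q \<subseteq> corner \<tau> \<tau>"
  proof clarify
   fix r
   show "F p * r * G q : corner \<tau> \<tau>"
    by (rule cornerI) (simp_all only: mult.assoc[symmetric] tF[OF p], simp only: mult.assoc Gt[OF q'])
  qed
  fix r assume r: "r : corner p q" and z: "F p * r * G q = 0"
  have "p * r * q = (G p * F p) * r * (G q * F q)" by (simp only: GF[OF p] GF[OF q'])
  also have "\<dots> = G p * (F p * r * G q) * F q" by (simp only: mult.assoc)
  finally have "p * r * q = 0" using z by simp
  then show "r = 0" using r by (simp add: corner_def)
 qed (rule tau)
 have bigcorner: "local.fin_dim (corner (sum id S) (sum id S)) \<and>
   local.dim (corner (sum id S) (sum id S)) \<le> (card S)\<^sup>2 * T" if S: "S \<subseteq> P" for S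
 proof -
  interpret VF: vector_space_pair scale "scale_fun scale"
   by (intro vector_space_pair.intro vector_space_axioms vector_space_fun)
  have fS: "finite S" using S Pf finite_subset by blast
  have cornS: "local.fin_dim (corner a b)" "local.dim (corner a b) \<le> T" if ab: "a : S" "b : S" for a b
   using corn[OF subsetD[OF S ab(1)] subsetD[OF S ab(2)]] by auto
  let ?\<phi> = "%r (pq :: 'r \<times> 'r). if pq : S \<times> S then fst pq * r * snd pq else 0"
  let ?T = "families (S \<times> S) (%pq. corner (fst pq) (snd pq))"
  have T: "VF.vs2.fin_dim ?T \<and> VF.vs2.dim ?T = (\<Sum>pq\<in>S \<times> S. local.dim (corner (fst pq) (snd pq)))"
   by (rule conjunct2[OF families_dim]) (use fS corner_subspace cornS in auto)
  have f1: "local.fin_dim (corner (sum id S) (sum id S)) \<and> local.dim (corner (sum id S) (sum id S)) \<le> VF.vs2.dim ?T"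
  proof (rule VF.dim_le_of_inj[OF _ corner_subspace])
   show "Vector_Spaces.linear scale (scale_fun scale) ?\<phi>"
    by unfold_locales (auto simp: fun_eq_iff scale_fun_def algebra_simps scale_mult_left scale_mult_right)
   show "?\<phi> ` corner (sum id S) (sum id S) \<subseteq> ?T"
   proof clarify
    fix r
    show "?\<phi> r : ?T" using S pp
     by (auto simp: families_def corner_def mult.assoc subset_iff) (simp add: mult.assoc[symmetric])
   qed
   fix r assume r: "r : corner (sum id S) (sum id S)" and z: "?\<phi> r = 0"
   have z': "p * r * p' = 0" if "p : S" "p' : S" for p p'
    using fun_cong[OF z, of "(p, p')"] that by simp
   have "r = sum id S * r * sum id S" using r by (simp add: corner_def)
   also have "\<dots> = (\<Sum>p'\<in>S. \<Sum>p\<in>S. p * r * p')" by (simp add: sum_distrib_left sum_distrib_right)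
   also have "\<dots> = 0" using z' by (simp add: sum.neutral)
   finally show "r = 0" .
  qed (use T in blast)
  have "VF.vs2.dim ?T = (\<Sum>pq\<in>S \<times> S. local.dim (corner (fst pq) (snd pq)))" using T by simp
  also have "\<dots> \<le> card (S \<times> S) * T"
   using sum_bounded_above[of "S \<times> S" "%pq. local.dim (corner (fst pq) (snd pq))" T] cornS by auto
  also have "\<dots> = (card S)\<^sup>2 * T" by (simp add: card_cartesian_product power2_eq_square)
  finally have "VF.vs2.dim ?T \<le> (card S)\<^sup>2 * T" .
  then show ?thesis using order_trans[OF conjunct2[OF f1]] f1 by simp
 qed
 \<comment> \<open>Between primitive idempotents the one-sided relation already means isomorphism of
   the summands; it serves below to carry derivations from \<open>p\<close> to \<open>q\<close> and
   back.\<close>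
 define iso where "iso p q \<longleftrightarrow> (\<exists>u\<in>?E. \<exists>w\<in>?E. q * u * p = u \<and> p * w * q = w \<and> w * u = p)" for p q
 define J where "J = {p : P. \<forall>q\<in>P. q ~= p --> \<not> iso p q}"
 have JP: "J \<subseteq> P" and Jf: "finite J" using Pf by (auto simp: J_def)
 \<comment> \<open>Multiplying a linear relation among the \<open>F p * G p\<close> of one class by
   \<open>G q\<close> and \<open>F q\<close> writes \<open>q\<close> as a sum of products
   \<open>(G q * F p) * (G p * F q)\<close> of endomorphisms. One of them is invertible, so
   \<open>q\<close> is isomorphic to some other \<open>p\<close>, against
   \<open>q : J\<close>.\<close>
 have Jk: "card {p : J. kl p = \<kappa>} \<le> T" for \<kappa>
  unfolding T_def
 proof (rule family_card_le_dim[OF tau(2), of _ "%p. F p * G p"])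
  let ?J = "{p : J. kl p = \<kappa>}"
  show "finite ?J" using Jf by simp
  show "F p * G p : corner \<tau> \<tau>" if "p : ?J" for p
   using that JP tF Gt by (intro cornerI) (auto simp: mult.assoc[symmetric], simp add: mult.assoc subset_iff)
  fix c q assume 0: "(\<Sum>p\<in>?J. c p *s (F p * G p)) = 0" and q: "q : ?J"
  show "c q = 0"
  proof (rule ccontr)
   assume cq: "c q ~= 0"
   have qP: "q : P" using q JP by blast
   define z where "z p = (- c p / c q) *s ((G q * F p) * (G p * F q))" for p
   have "0 = G q * (\<Sum>p\<in>?J. c p *s (F p * G p)) * F q" using 0 by simp
   also have "\<dots> = (\<Sum>p\<in>?J. c p *s ((G q * F p) * (G p * F q)))"
    by (simp add: sum_distrib_left sum_distrib_right scale_mult_left scale_mult_right mult.assoc)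
   also have "\<dots> = c q *s q + (\<Sum>p\<in>?J - {q}. c p *s ((G q * F p) * (G p * F q)))"
    using q Jf by (subst sum.remove[of _ q]) (auto simp: GF[OF qP] pp[OF qP])
   finally have "(\<Sum>p\<in>?J - {q}. c p *s ((G q * F p) * (G p * F q))) = - (c q *s q)"
    by (simp add: eq_neg_iff_add_eq_0 add.commute)
   moreover have "(\<Sum>p\<in>?J - {q}. z p) = (- 1 / c q) *s (\<Sum>p\<in>?J - {q}. c p *s ((G q * F p) * (G p * F q)))"
    unfolding z_def scale_sum_right by (intro sum.cong) auto
   ultimately have sumz: "sum z (?J - {q}) = q" using cq by simp
   have "\<exists>p\<in>?J - {q}. left_invertible ?E q (z p)"
   proof (rule primitive_sum[OF sE fE prim[OF qP]])
    show "finite (?J - {q})" using Jf by simp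
    show "left_invertible ?E q (sum z (?J - {q}))"
     unfolding sumz left_invertible_def using PE[OF qP] pp[OF qP] by blast
    fix p assume "p : ?J - {q}"
    then have p: "p : P" "kl p = kl q" using q JP by auto
    show "z p : ?E" unfolding z_def using p qP by (intro E(5) E(4) GFE) auto
    show "q * z p = z p" unfolding z_def scale_mult_right by (simp only: mult.assoc[symmetric] pG[OF qP])
    show "z p * q = z p" unfolding z_def scale_mult_left by (simp only: mult.assoc Fp[OF qP])
   qed
   then obtain p h where p: "p : J" "kl p = kl q" "p ~= q" and h: "h : ?E" "q * h = h" "h * z p = q"
    using q unfolding left_invertible_def by auto
   have pP: "p : P" using p JP by blast
   define u where "u = G p * F q"
   define w where "w = (- c p / c q) *s (h * (G q * F p))"
   have uE: "u : ?E" unfolding u_def by (rule GFE[OF pP qP p(2)])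
   have wE: "w : ?E" unfolding w_def by (rule E(5)[OF E(4)[OF h(1) GFE[OF qP pP p(2)[symmetric]]]])
   have "p * u * q = u" unfolding u_def
    by (simp only: mult.assoc Fp[OF qP]) (simp only: mult.assoc[symmetric] pG[OF pP])
   moreover have "q * w * p = w" unfolding w_def scale_mult_left scale_mult_right
    by (simp only: mult.assoc Fp[OF pP]) (simp only: mult.assoc[symmetric] h(2))
   moreover have "w * u = q"
    using h(3) unfolding u_def w_def z_def scale_mult_left scale_mult_right by (simp only: mult.assoc)
   ultimately have "iso q p" unfolding iso_def using uE wE by blast
   then show False using q p pP unfolding J_def by blast
  qed
 qed
 have "card J \<le> card (\<Union>\<kappa>\<in>K. {p : J. kl p = \<kappa>})"
  by (rule card_mono) (use K Jf JP LH cl in \<open>auto simp: kl_def\<close>)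
 also have "\<dots> \<le> (\<Sum>\<kappa>\<in>K. card {p : J. kl p = \<kappa>})" by (rule card_UN_le[OF K])
 also have "\<dots> \<le> card K * T" using sum_bounded_above[of K "%\<kappa>. card {p : J. kl p = \<kappa>}" T] Jk by simp
 finally have Jc: "card J \<le> card K * T" .
 have offd: "\<exists>h\<in>local_ops. bd x h = (%a. p * c a * q)"
  if c: "c : reps" and p: "p : P" and q': "q : P" and ne: "p ~= q" for c p q
 proof (rule off_diagonal_split[OF x min PE[OF p] pp[OF p]])
  show "(%a. p * c a * q) : reps"
   using rep_comm[OF c EL[OF PE[OF p]] EL[OF PE[OF q']]] c by (auto simp: reps_def families_def)
  fix a
  have "q * (total - p) = q" using Et[OF PE[OF q']] Po[OF q' p] ne by (simp add: right_diff_distrib)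
  then show "p * (p * c a * q) * (total - p) = p * c a * q"
   by (simp only: mult.assoc) (simp only: mult.assoc[symmetric] pp[OF p])
 qed
 \<comment> \<open>Outside \<open>J\<close> the summand of \<open>p\<close> occurs a second time, as
   \<open>q\<close>. The diagonal block at \<open>p\<close> is moved to the off-diagonal position by
   right multiplication with \<open>w\<close>, is inner there by \<open>offd\<close>, and returns by
   right multiplication with the endomorphism \<open>u\<close>.\<close>
 have diag: "\<exists>h\<in>local_ops. bd x h = (%a. p * c a * p)" if c: "c : reps" and p: "p : P" and pJ: "p \<notin> J" for c p
 proof -
  obtain q u w where q': "q : P" "q ~= p" and uw: "u : ?E" "w : ?E" "q * u * p = u" "p * w * q = w" "w * u = p"
   using p pJ unfolding J_def iso_def by blast
  have wq: "w * q = w" and uE: "u : local_ops" using uw(4) pp[OF q'(1)] EL[OF uw(1)] by (metis mult.assoc, simp)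
  have cw: "(%a. c a * w) : reps"
  proof -
   have "total * c a * w : corner (e (s a)) (e (t a))" if "a : A" for a
    by (rule rep_comm[OF c EL[OF tE] EL[OF uw(2)] that])
   then show ?thesis using c rep_total_mult(1)[OF c] by (auto simp: reps_def families_def)
  qed
  obtain h where h: "h : local_ops" "bd x h = (%a. p * (c a * w) * q)"
   using offd[OF cw p q'(1) q'(2)[symmetric]] by blast
  have "bd x (h * u) = (%a. p * c a * p)"
  proof
   fix a
   show "bd x (h * u) a = p * c a * p"
   proof (cases "a : A")
    case True
    have ux: "u * x a = x a * u" using uw(1) True by (simp add: end_alg_def)
    have "bd x (h * u) a = (h * x a - x a * h) * u"
     using True by (simp add: bd_def left_diff_distrib mult.assoc ux)
    also have "h * x a - x a * h = p * (c a * w) * q" using fun_cong[OF h(2), of a] True by (simp add: bd_def)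
    also have "\<dots> * u = p * c a * (w * q * u)" by (simp only: mult.assoc)
    finally show ?thesis unfolding wq uw(5) .
   next
    case False then show ?thesis using c by (simp add: bd_def reps_def families_def)
   qed
  qed
  then show ?thesis using subalgebraD(4)[OF local_ops_subalgebra h(1) uE] by blast
 qed
 define \<pi> where "\<pi> = sum id J"
 interpret VF: vector_space_pair scale "scale_fun scale"
  by (intro vector_space_pair.intro vector_space_axioms vector_space_fun)
 let ?S = "bd x ` local_ops" and ?T = "families A (%_. corner \<pi> \<pi>)"
 have linbd: "Vector_Spaces.linear scale (scale_fun scale) (bd x)"
  by unfold_locales (auto simp: bd_def fun_eq_iff scale_fun_def algebra_simps scale_mult_left scale_mult_right)
 have sL: "local.subspace local_ops" using local_ops_subalgebra by (simp add: subalgebra_def)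
 have pi: "\<pi> * \<pi> = \<pi>"
 proof -
  have "\<pi> * \<pi> = (\<Sum>p\<in>J. \<Sum>p'\<in>J. if p' = p then p else 0)"
   unfolding \<pi>_def sum_product by (intro sum.cong HOL.refl) (use Po subsetD[OF JP] in auto)
  then show ?thesis using Jf by (simp add: \<pi>_def)
 qed
 have T: "VF.vs2.fin_dim ?T \<and> VF.vs2.dim ?T \<le> card A * ((card K * T)\<^sup>2 * T)"
 proof -
  have b: "local.fin_dim (corner \<pi> \<pi>)" "local.dim (corner \<pi> \<pi>) \<le> (card J)\<^sup>2 * T"
   using bigcorner[OF JP] unfolding \<pi>_def by auto
  have "(card J)\<^sup>2 * T \<le> (card K * T)\<^sup>2 * T" using Jc by (simp add: power_mono)
  from order_trans[OF b(2) this] have "local.dim (corner \<pi> \<pi>) \<le> (card K * T)\<^sup>2 * T" .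
  moreover have "VF.vs2.fin_dim ?T \<and> VF.vs2.dim ?T = (\<Sum>a\<in>A. local.dim (corner \<pi> \<pi>))"
   by (rule conjunct2[OF families_dim[OF finite_A corner_subspace b(1)]])
  ultimately show ?thesis by simp
 qed
 \<comment> \<open>Expand \<open>c = total * c * total\<close> over \<open>P\<close>. Blocks outside
   \<open>J \<times> J\<close> are inner, by \<open>offd\<close> if the two idempotents differ and
   by \<open>diag\<close> otherwise; the rest is \<open>\<pi> * c * \<pi>\<close>.\<close>
 have dec: "\<exists>a\<in>?S. \<exists>b\<in>?T. c = a + b" if c: "c : reps" for c
 proof -
  let ?X = "P \<times> P - J \<times> J"
  have ex: "\<exists>h. h : local_ops \<and> bd x h = (%a. fst pq * c a * snd pq)" if pq: "pq : ?X" for pq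
   using offd[OF c, of "fst pq" "snd pq"] diag[OF c, of "fst pq"] pq
   by (cases "fst pq = snd pq") (auto simp: mem_Times_iff)
  from bchoice[OF ballI[OF ex]] obtain h
   where h': "\<forall>pq\<in>?X. h pq : local_ops \<and> bd x (h pq) = (%a. fst pq * c a * snd pq)" ..
  note h = bspec[OF h']
  let ?h = "sum h ?X" and ?b = "%a. \<pi> * c a * \<pi>"
  have hL: "?h : local_ops" by (rule subalgebraD(6)[OF local_ops_subalgebra conjunct1[OF h]])
  have "?b : ?T" using c by (auto simp: families_def reps_def corner_def mult.assoc pi) (simp add: mult.assoc[symmetric] pi)
  moreover have "c = bd x ?h + ?b"
  proof
   fix a
   show "c a = (bd x ?h + ?b) a"
   proof (cases "a : A")
    case True
    have "c a = total * c a * total" using rep_total_mult[OF c True] by simp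
    also have "\<dots> = (\<Sum>pq\<in>P \<times> P. fst pq * c a * snd pq)"
     unfolding Ps[symmetric] sum_distrib_right sum_distrib_left
     by (subst sum.swap) (simp add: sum.cartesian_product case_prod_unfold)
    also have "\<dots> = (\<Sum>pq\<in>?X. fst pq * c a * snd pq) + (\<Sum>pq\<in>J \<times> J. fst pq * c a * snd pq)"
     by (rule sum.subset_diff) (use JP Pf in auto)
    also have "(\<Sum>pq\<in>J \<times> J. fst pq * c a * snd pq) = \<pi> * c a * \<pi>"
     unfolding \<pi>_def sum_distrib_right sum_distrib_left
     by (subst sum.swap) (simp add: sum.cartesian_product case_prod_unfold)
    also have "(\<Sum>pq\<in>?X. fst pq * c a * snd pq) = (\<Sum>pq\<in>?X. h pq * x a - x a * h pq)"
    proof (rule sum.cong)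
     fix pq assume "pq : ?X"
     then have "bd x (h pq) a = fst pq * c a * snd pq" using fun_cong[OF conjunct2[OF h]] by blast
     then show "fst pq * c a * snd pq = h pq * x a - x a * h pq" using True by (simp add: bd_def)
    qed simp
    also have "\<dots> = bd x ?h a" using True by (simp add: bd_def sum_subtractf sum_distrib_left sum_distrib_right)
    finally show ?thesis by simp
   next
    case False then show ?thesis using c by (simp add: bd_def reps_def families_def)
   qed
  qed
  ultimately show ?thesis using hL by blast
 qed
 have fS: "VF.vs2.fin_dim ?S" by (rule VF.fin_dim_image[OF linbd fin_dim_local_ops])
 have d1: "VF.vs2.dim reps \<le> VF.vs2.dim ?S + VF.vs2.dim ?T"
  by (rule VF.vs2.dim_sum_le[OF fS _ dec]) (use T in blast)
 have fc: "local.fin_dim (corner (e v) (e w))" if "v : V" "w : V" for v w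
  by (rule fin_dim_subset[OF corner_mono fin_dim_corner_total]) (use that total_e e_orth in auto)
 have d2: "VF.vs2.dim reps = (\<Sum>a\<in>A. local.dim (corner (e (s a)) (e (t a))))"
  unfolding reps_def
  by (rule conjunct2[OF conjunct2[OF families_dim[OF finite_A corner_subspace fc[OF s_in t_in]]]])
 have "{f : local_ops. bd x f = 0} = ?E" by (auto simp: end_alg_def bd_def fun_eq_iff)
 then have d3: "local.dim local_ops = local.dim ?E + VF.vs2.dim ?S"
  using VF.rank_nullity'[OF linbd sL fin_dim_local_ops] by simp
 have d4: "local.dim local_ops \<le> (\<Sum>v\<in>V. local.dim (corner (e v) (e v)))"
 proof -
  let ?\<phi> = "%r v. if v : V then e v * r * e v else 0"
  let ?TV = "families V (%v. corner (e v) (e v))"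
  have TV: "VF.vs2.fin_dim ?TV \<and> VF.vs2.dim ?TV = (\<Sum>v\<in>V. local.dim (corner (e v) (e v)))"
   by (rule conjunct2[OF families_dim[OF finite_V corner_subspace fc]])
  have "local.fin_dim local_ops \<and> local.dim local_ops \<le> VF.vs2.dim ?TV"
  proof (rule VF.dim_le_of_inj[OF _ sL])
   show "Vector_Spaces.linear scale (scale_fun scale) ?\<phi>"
    by unfold_locales (auto simp: fun_eq_iff scale_fun_def algebra_simps scale_mult_left scale_mult_right)
   show "?\<phi> ` local_ops \<subseteq> ?TV"
    by (auto simp: families_def corner_def mult.assoc e_orth) (simp add: mult.assoc[symmetric] e_orth)
   fix r assume r: "r : local_ops" and z: "?\<phi> r = 0"
   have "e v * r = 0" if v: "v : V" for v
   proof -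
    have "e v * r = e v * e v * r" using v e_orth by simp
    also have "\<dots> = e v * (r * e v)" using r v by (simp add: local_ops_def mult.assoc)
    also have "\<dots> = 0" using fun_cong[OF z, of v] v by (simp add: mult.assoc)
    finally show ?thesis .
   qed
   then have "total * r = 0" unfolding total_def sum_distrib_right by (simp add: sum.neutral)
   then show "r = 0" using local_opsD(1)[OF r] by simp
  qed (use TV in blast)
  then show ?thesis using TV by simp
 qed
 \<comment> \<open>By \<open>q\<close> the space of representations is at least as large as
   \<open>local_ops\<close>, and \<open>bd x\<close> has kernel \<open>?E\<close> and image
   \<open>?S\<close>. So the dimension of \<open>?E\<close> is at most the codimension of
   \<open>?S\<close> among the representations, which \<open>?T\<close> bounds.\<close>
 have dE: "local.dim ?E \<le> card A * ((card K * T)\<^sup>2 * T)" using d1 d2 d3 d4 q T by linarith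
 have cP: "card P \<le> local.dim ?E" by (rule orthogonal_card_le[OF P fE])
 have "local.dim (corner total total) \<le> (card P)\<^sup>2 * T" using bigcorner[of P] Ps by simp
 also have "\<dots> \<le> (card A * ((card K * T)\<^sup>2 * T))\<^sup>2 * T"
  using cP dE by (intro mult_right_mono power_mono) auto
 finally show ?thesis .
qed

end

section \<open>Linear operators on the space of sequences\<close>

definition fscale :: "'k::times => ('i => 'k) => 'i => 'k" where
 "fscale c \<phi> = (%i. c * \<phi> i)"

lemma fscale_apply [simp]: "fscale c \<phi> i = c * \<phi> i"
 by (simp add: fscale_def)

definition fun_linear :: "((nat => 'k::field) => nat => 'k) => bool" where
 "fun_linear f \<longleftrightarrow> (\<forall>x y. f (x + y) = f x + f y) \<and> (\<forall>c x. f (fscale c x) = fscale c (f x))"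

text \<open>One fixed ring that contains the representations of every finite dimension vector; the
  vertex spaces are coordinate subspaces cut out by \<open>proj\<close>.\<close>

typedef (overloaded) 'k endo = "{f :: (nat => 'k::field) => nat => 'k. fun_linear f}"
 morphisms app Endo
 by (rule exI[of _ "%x. x"]) (simp add: fun_linear_def)

lemma endo_eqI: "(!!\<phi> i. app x \<phi> i = app y \<phi> i) ==> x = y"
 by (simp add: app_inject[symmetric] fun_eq_iff)

lemma app_linear: "app x (\<phi> + \<psi>) = app x \<phi> + app x \<psi>" "app x (fscale c \<phi>) = fscale c (app x \<phi>)"
 using app[of x] by (simp_all add: fun_linear_def)

lemma app_zero: "app x 0 = 0"
 using app_linear(1)[of x 0 0] by simp

lemma app_sum: "app x (sum f S) = (\<Sum>s\<in>S. app x (f s))"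
proof (induction S rule: infinite_finite_induct)
 case (insert s S)
 then show ?case by (simp only: sum.insert[OF insert.hyps] app_linear)
qed (simp_all only: sum.infinite sum.empty app_zero not_False_eq_True)

lemma app_Endo: "fun_linear f ==> app (Endo f) = f"
 by (simp add: Endo_inverse)

instantiation endo :: (field) ring_1
begin

definition zero_endo :: "'a endo" where "0 = Endo (%_. 0)"
definition one_endo :: "'a endo" where "1 = Endo (%x. x)"
definition plus_endo :: "'a endo => 'a endo => 'a endo" where "x + y = Endo (%\<phi>. app x \<phi> + app y \<phi>)"
definition uminus_endo :: "'a endo => 'a endo" where "- x = Endo (%\<phi>. - app x \<phi>)"
definition minus_endo :: "'a endo => 'a endo => 'a endo" where "x - y = Endo (%\<phi>. app x \<phi> - app y \<phi>)"
definition times_endo :: "'a endo => 'a endo => 'a endo" where "x * y = Endo (%\<phi>. app x (app y \<phi>))"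

lemma app_simps [simp]:
 "app 0 \<phi> = 0" "app 1 \<phi> = \<phi>" "app (x + y) \<phi> = app x \<phi> + app y \<phi>" "app (- x) \<phi> = - app x \<phi>"
 "app (x - y) \<phi> = app x \<phi> - app y \<phi>" "app (x * y) \<phi> = app x (app y \<phi>)"
proof -
 have "fun_linear (%_ :: nat => 'a. 0)" "fun_linear (%x :: nat => 'a. x)"
  "fun_linear (%\<phi>. app x \<phi> + app y \<phi>)" "fun_linear (%\<phi>. - app x \<phi>)" "fun_linear (%\<phi>. app x \<phi> - app y \<phi>)"
  "fun_linear (%\<phi>. app x (app y \<phi>))"
  by (auto simp: fun_linear_def app_linear fun_eq_iff algebra_simps)
 then show "app 0 \<phi> = 0" "app 1 \<phi> = \<phi>" "app (x + y) \<phi> = app x \<phi> + app y \<phi>" "app (- x) \<phi> = - app x \<phi>"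
  "app (x - y) \<phi> = app x \<phi> - app y \<phi>" "app (x * y) \<phi> = app x (app y \<phi>)"
  by (simp_all add: zero_endo_def one_endo_def plus_endo_def uminus_endo_def minus_endo_def times_endo_def app_Endo)
qed

instance
proof
 show "(0 :: 'a endo) ~= 1"
 proof
  assume "(0 :: 'a endo) = 1"
  then have "app (0 :: 'a endo) (%_. 1) 0 = app 1 (%_. 1) 0" by simp
  then show False by simp
 qed
qed (auto intro!: endo_eqI simp: app_linear algebra_simps)

end

definition escale :: "'k::field => 'k endo => 'k endo" where
 "escale c x = Endo (%\<phi>. fscale c (app x \<phi>))"

lemma app_escale [simp]: "app (escale c x) \<phi> = fscale c (app x \<phi>)"
proof -
 have "fun_linear (%\<phi>. fscale c (app x \<phi>))" by (auto simp: fun_linear_def app_linear fun_eq_iff algebra_simps)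
 then show ?thesis by (simp add: escale_def app_Endo)
qed

lemma app_sum_endo: "app (sum f S) \<phi> = (\<Sum>s\<in>S. app (f s) \<phi>)"
 by (induction S rule: infinite_finite_induct) simp_all

lemma sum_fun_apply: "(sum f S :: 'i => 'b::comm_monoid_add) i = (\<Sum>s\<in>S. f s i)"
 by (induction S rule: infinite_finite_induct) simp_all

interpretation E: k_algebra escale
 by unfold_locales (auto intro!: endo_eqI simp: app_linear algebra_simps)

definition proj :: "nat set => 'k::field endo" where
 "proj B = Endo (%\<phi> i. if i : B then \<phi> i else 0)"

lemma app_proj [simp]: "app (proj B) (\<phi> :: nat => 'k::field) i = (if i : B then \<phi> i else 0)"
proof -
 have "fun_linear (%\<phi> i. if i : B then \<phi> i else (0 :: 'k))" by (auto simp: fun_linear_def fun_eq_iff)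
 then show ?thesis unfolding proj_def by (subst app_Endo) auto
qed

lemma proj_mult: "proj B * proj C = proj (B \<inter> C)"
 by (rule endo_eqI) simp

lemma proj_empty: "proj {} = 0"
 by (rule endo_eqI) simp

lemma proj_UN_disjoint:
 assumes "finite V" "!!v w. v : V ==> w : V ==> v ~= w ==> B v \<inter> B w = {}"
 shows "(\<Sum>v\<in>V. proj (B v)) = (proj (\<Union>v\<in>V. B v) :: 'k::field endo)"
proof (rule endo_eqI)
 fix \<phi> :: "nat => 'k" and i
 show "app (\<Sum>v\<in>V. proj (B v)) \<phi> i = app (proj (\<Union>v\<in>V. B v)) \<phi> i"
 proof (cases "\<exists>v\<in>V. i : B v")
  case True
  then obtain v where v: "v : V" "i : B v" by blast
  then have "i : B w \<longleftrightarrow> w = v" if "w : V" for w using assms(2) that by blast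
  then have "(\<Sum>w\<in>V. if i : B w then \<phi> i else 0) = (\<Sum>w\<in>V. if w = v then \<phi> i else 0)"
   by (intro sum.cong) auto
  then show ?thesis using v assms(1) by (auto simp: app_sum_endo sum_fun_apply)
 next
  case False
  then show ?thesis by (auto simp: app_sum_endo sum_fun_apply intro!: sum.neutral)
 qed
qed

definition unit :: "nat => nat => 'k::field" where
 "unit i = (%j. if j = i then 1 else 0)"

lemma unit_apply: "unit i j = (if j = i then 1 else 0)"
 by (simp add: unit_def)

lemma unit_expansion:
 assumes "finite B" "!!i. i \<notin> B ==> \<phi> i = 0"
 shows "\<phi> = (\<Sum>i\<in>B. fscale (\<phi> i) (unit i))"
proof
 fix j
 have "(\<Sum>i\<in>B. fscale (\<phi> i) (unit i) j) = (\<Sum>i\<in>B. if i = j then \<phi> j else 0)"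
  by (rule sum.cong) (auto simp: unit_apply)
 then show "\<phi> j = (\<Sum>i\<in>B. fscale (\<phi> i) (unit i)) j" using assms by (simp add: sum_fun_apply)
qed

definition matrix_unit :: "nat \<times> nat => 'k::field endo" where
 "matrix_unit p = Endo (%\<phi>. fscale (\<phi> (snd p)) (unit (fst p)))"

lemma app_matrix_unit [simp]: "app (matrix_unit p) (\<phi> :: nat => 'k::field) = fscale (\<phi> (snd p)) (unit (fst p))"
proof -
 have "fun_linear (%\<phi>. fscale (\<phi> (snd p) :: 'k) (unit (fst p)))" by (auto simp: fun_linear_def fun_eq_iff algebra_simps)
 then show ?thesis by (simp add: matrix_unit_def app_Endo)
qed

text \<open>An operator in the corner is the finite matrix of its values on the vectors
  \<open>unit c\<close>, so the matrix units are a basis.\<close>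

lemma corner_proj_dim:
 assumes B: "finite B" and C: "finite C"
 shows "E.dim (E.corner (proj B) (proj C) :: 'k::field endo set) = card B * card C"
  "E.fin_dim (E.corner (proj B) (proj C) :: 'k endo set)"
proof -
 let ?S = "E.corner (proj B) (proj C) :: 'k endo set" and ?U = "matrix_unit ` (B \<times> C) :: 'k endo set"
 have inj: "inj (matrix_unit :: nat \<times> nat => 'k endo)"
 proof (rule injI)
  fix p q :: "nat \<times> nat" assume e: "(matrix_unit p :: 'k endo) = matrix_unit q"
  have "app (matrix_unit p) (unit (snd p)) (fst p) = app (matrix_unit q) (unit (snd p) :: nat => 'k) (fst p)" using e by simp
  then show "p = q" by (auto simp: unit_apply prod_eq_iff split: if_splits)
 qed
 have sub: "?U \<subseteq> ?S" unfolding E.corner_def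
  by (auto intro!: endo_eqI simp: unit_apply)
 have span: "?S \<subseteq> E.span ?U"
 proof
  fix x assume x: "x : ?S"
  have "x = (\<Sum>p\<in>B \<times> C. escale (app x (unit (snd p)) (fst p)) (matrix_unit p))"
  proof (rule endo_eqI)
   fix \<phi> :: "nat => 'k" and i
   let ?\<psi> = "app (proj C) \<phi>"
   have "app x \<phi> i = app (proj B * x * proj C) \<phi> i" using x by (simp add: E.corner_def)
   also have "\<dots> = (if i : B then app x ?\<psi> i else 0)" by simp
   also have "?\<psi> = (\<Sum>c\<in>C. fscale (?\<psi> c) (unit c))" by (rule unit_expansion[OF C]) simp
   also have "app x (\<Sum>c\<in>C. fscale (?\<psi> c) (unit c)) i = (\<Sum>c\<in>C. \<phi> c * app x (unit c) i)"
    unfolding app_sum app_linear sum_fun_apply by (rule sum.cong) simp_all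
   also have "(if i : B then (\<Sum>c\<in>C. \<phi> c * app x (unit c) i) else 0) =
     (\<Sum>b\<in>B. if b = i then (\<Sum>c\<in>C. \<phi> c * app x (unit c) b) else 0)" using B by simp
   also have "\<dots> = (\<Sum>b\<in>B. \<Sum>c\<in>C. app x (unit c) b * (\<phi> c * unit b i))"
    by (rule sum.cong) (auto simp: unit_apply mult.commute intro!: sum.cong)
   also have "\<dots> = (\<Sum>p\<in>B \<times> C. app x (unit (snd p)) (fst p) * (\<phi> (snd p) * unit (fst p) i))"
    by (simp add: sum.cartesian_product split_def)
   finally show "app x \<phi> i = app (\<Sum>p\<in>B \<times> C. escale (app x (unit (snd p)) (fst p)) (matrix_unit p)) \<phi> i"
    by (simp add: app_sum_endo sum_fun_apply)
  qed
  also have "\<dots> : E.span ?U" by (intro E.span_sum E.span_scale E.span_base) auto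
  finally show "x : E.span ?U" .
 qed
 have fin: "finite ?U" using B C by simp
 show "E.fin_dim ?S" unfolding E.fin_dim_def using fin span by blast
 have "E.independent ?U"
 proof (rule E.independent_if_scalars_zero[OF fin])
  fix u and x :: "'k endo" assume z: "(\<Sum>x\<in>?U. escale (u x) x) = 0" and "x : ?U"
  then obtain b c where bc: "b : B" "c : C" "x = matrix_unit (b, c)" by auto
  have "0 = app (\<Sum>x\<in>?U. escale (u x) x) (unit c) b" unfolding z by simp
  also have "\<dots> = app (\<Sum>p\<in>B \<times> C. escale (u (matrix_unit p)) (matrix_unit p)) (unit c) b"
   by (subst sum.reindex[OF inj_on_subset[OF inj]]) simp_all
  also have "\<dots> = (\<Sum>p\<in>B \<times> C. if p = (b, c) then u (matrix_unit p) else 0)"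
   unfolding app_sum_endo sum_fun_apply by (rule sum.cong) (auto simp: unit_apply)
  also have "\<dots> = u x" using bc B C by simp
  finally show "u x = 0" by simp
 qed
 moreover have "E.span ?U = E.span ?S"
  using sub span E.span_mono E.span_minimal[OF span E.subspace_span] by blast
 ultimately have "E.dim ?S = card ?U" using E.dim_eq_card by blast
 then show "E.dim ?S = card B * card C" using card_image[OF inj_on_subset[OF inj]] by (simp add: card_cartesian_product)
qed

section \<open>Positive quadratic forms and Dynkin diagrams\<close>

text \<open>For an edge with two ends the product is \<open>d x * d y\<close>, but a singleton would
  contribute \<open>d x\<close> instead of its square. The ends of an arrow must be known to differ
  before a sum over arrows is turned into a sum over edges.\<close>

definition edge_sum :: "(nat => nat) => nat set set => nat" where
 "edge_sum d E = (\<Sum>X\<in>E. \<Prod>x\<in>X. d x)"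

text \<open>Positivity of the Tits form of the diagram with a new vertex \<open>n\<close> joined to
  \<open>i\<close>, as a comparison of sums of naturals. Nonnegative vectors suffice as tests
  because the null roots of the Euclidean diagrams have positive entries.\<close>

definition attach_positive :: "nat => nat set set => nat => bool" where
 "attach_positive n E i \<longleftrightarrow>
   (\<forall>d. (\<exists>j\<le>n. d j ~= 0) --> edge_sum d E + d i * d n < (\<Sum>j\<le>n. (d j)\<^sup>2))"

section \<open>Test vectors on chains\<close>

fun sum_sq :: "nat list => nat" where
 "sum_sq [] = 0"
| "sum_sq (x # xs) = x\<^sup>2 + sum_sq xs"

fun sum_adj :: "nat list => nat" where
 "sum_adj (x # y # xs) = x * y + sum_adj (y # xs)"
| "sum_adj _ = 0"

text \<open>The vector that has the entries of the list from position \<open>lo\<close> on and is 0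
  elsewhere, so that test vectors can be placed on any stretch of a chain.\<close>

fun window :: "nat => nat list => nat => nat" where
 "window lo [] j = 0"
| "window lo (x # xs) j = (if j = lo then x else window (Suc lo) xs j)"

lemma window_below: "j < lo ==> window lo xs j = 0"
 by (induction lo xs j rule: window.induct) auto

lemma window_nth: "k < length xs ==> window lo xs (lo + k) = xs ! k"
proof (induction xs arbitrary: lo k)
 case (Cons x xs)
 then show ?case using Cons.IH[of "k - 1" "Suc lo"] by (cases k) auto
qed simp

lemma sum_window_sq: "lo + length xs \<le> N ==> (\<Sum>j<N. (window lo xs j)\<^sup>2) = sum_sq xs"
proof (induction xs arbitrary: lo)
 case (Cons x xs)
 have "(\<Sum>j<N. (window lo (x # xs) j)\<^sup>2) = x\<^sup>2 + (\<Sum>j\<in>{..<N} - {lo}. (window lo (x # xs) j)\<^sup>2)"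
  using Cons.prems by (subst sum.remove[of _ lo]) auto
 also have "(\<Sum>j\<in>{..<N} - {lo}. (window lo (x # xs) j)\<^sup>2) = (\<Sum>j<N. (window (Suc lo) xs j)\<^sup>2)"
  by (rule sum.mono_neutral_cong_left) (auto simp: window_below)
 finally show ?case using Cons by simp
qed simp

lemma sum_window_adj:
 "lo + length xs \<le> Suc N ==> (\<Sum>j<N. window lo xs j * window lo xs (Suc j)) = sum_adj xs"
proof (induction xs arbitrary: lo)
 case (Cons x xs)
 show ?case
 proof (cases xs)
  case Nil
  then show ?thesis by simp
 next
  case (Cons y ys)
  have lo: "lo < N" using Cons.prems Cons by simp
  have "(\<Sum>j<N. window lo (x # xs) j * window lo (x # xs) (Suc j)) =
    x * y + (\<Sum>j\<in>{..<N} - {lo}. window lo (x # xs) j * window lo (x # xs) (Suc j))"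
   using lo by (subst sum.remove[of _ lo]) (auto simp: Cons)
  also have "(\<Sum>j\<in>{..<N} - {lo}. window lo (x # xs) j * window lo (x # xs) (Suc j)) =
    (\<Sum>j<N. window (Suc lo) xs j * window (Suc lo) xs (Suc j))"
   by (rule sum.mono_neutral_cong_left) (auto simp: window_below)
  also have "\<dots> = sum_adj xs" using Cons.IH[of "Suc lo"] Cons.prems by simp
  finally show ?thesis by (simp add: Cons)
 qed
qed simp

lemma chain_edges_image: "chain_edges n = (%j. {j, Suc j}) ` {..<n - 1}"
 by (auto simp: chain_edges_def)

lemma inj_chain: "inj_on (%j. {j, Suc j}) S"
 by (rule inj_onI) (auto simp: doubleton_eq_iff)

lemma finite_chain_edges: "finite (chain_edges n)"
 by (simp add: chain_edges_image)

lemma card_chain_edges: "card (chain_edges n) = n - 1"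
 by (simp add: chain_edges_image card_image[OF inj_chain])

lemma edge_sum_chain: "edge_sum d (chain_edges n) = (\<Sum>j<n - 1. d j * d (Suc j))"
 unfolding edge_sum_def chain_edges_image by (simp add: sum.reindex[OF inj_chain])

lemma chain_edges_less: "X : chain_edges n ==> x : X ==> x < n"
 by (auto simp: chain_edges_def)

lemma branched_new: "2 \<le> n ==> {b, n - 1} \<notin> chain_edges (n - 1)"
 using chain_edges_less[of "{b, n - 1}" "n - 1" "n - 1"] by auto

lemma edge_sum_branched:
 assumes "2 \<le> n" "b < n - 1"
 shows "edge_sum d (branched_edges n b) = (\<Sum>j<n - 1 - 1. d j * d (Suc j)) + d b * d (n - 1)"
proof -
 have "edge_sum d (branched_edges n b) = (\<Prod>x\<in>{b, n - 1}. d x) + edge_sum d (chain_edges (n - 1))"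
  unfolding edge_sum_def branched_edges_def
  using finite_chain_edges branched_new[OF assms(1)] by (subst sum.insert) auto
 then show ?thesis using assms(2) by (simp add: edge_sum_chain)
qed

text \<open>Positivity evaluated at the vector with entries \<open>xs\<close> on the chain and
  \<open>c\<close> at the new vertex. A null root turns the strict inequality into an equality of
  its two sides and so excludes the position \<open>i\<close>.\<close>

lemma attach_chain_bound:
 assumes pos: "attach_positive n (chain_edges n) i" and i: "i < n"
  and xs: "lo + length xs \<le> n" and c: "c ~= 0"
 shows "sum_adj xs + window lo xs i * c < sum_sq xs + c\<^sup>2"
proof -
 let ?d = "%j. if j = n then c else window lo xs j"
 have "edge_sum ?d (chain_edges n) + ?d i * ?d n < (\<Sum>j\<le>n. (?d j)\<^sup>2)"
  using pos c unfolding attach_positive_def by (elim allE[of _ ?d]) auto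
 moreover have "edge_sum ?d (chain_edges n) = (\<Sum>j<n - 1. window lo xs j * window lo xs (Suc j))"
  unfolding edge_sum_chain by (rule sum.cong) auto
 moreover have "\<dots> = sum_adj xs" using xs i by (intro sum_window_adj) auto
 moreover have "(\<Sum>j\<le>n. (?d j)\<^sup>2) = (\<Sum>j<n. (window lo xs j)\<^sup>2) + c\<^sup>2"
  by (simp add: lessThan_Suc_atMost[symmetric])
 moreover have "(\<Sum>j<n. (window lo xs j)\<^sup>2) = sum_sq xs" using xs by (rule sum_window_sq)
 ultimately show ?thesis using i by simp
qed

lemma attach_branched_bound:
 assumes pos: "attach_positive n (branched_edges n b) i" and i: "i < n" and n: "2 \<le> n" and b: "b < n - 1"
  and xs: "lo + length xs \<le> n - 1" and c: "c ~= 0"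
 shows "sum_adj xs + window lo xs b * c' + (if i = n - 1 then c' else window lo xs i) * c
   < sum_sq xs + c'\<^sup>2 + c\<^sup>2"
proof -
 let ?d = "%j. if j = n then c else if j = n - 1 then c' else window lo xs j"
 have "edge_sum ?d (branched_edges n b) + ?d i * ?d n < (\<Sum>j\<le>n. (?d j)\<^sup>2)"
  using pos c unfolding attach_positive_def by (elim allE[of _ ?d]) auto
 moreover have "edge_sum ?d (branched_edges n b) =
   (\<Sum>j<n - 1 - 1. window lo xs j * window lo xs (Suc j)) + window lo xs b * c'"
  unfolding edge_sum_branched[OF n b]
  by (intro arg_cong2[of _ _ _ _ "(+)"] sum.cong) (use n b in auto)
 moreover have "(\<Sum>j<n - 1 - 1. window lo xs j * window lo xs (Suc j)) = sum_adj xs"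
  using xs n b by (intro sum_window_adj) auto
 moreover have "(\<Sum>j\<le>n. (?d j)\<^sup>2) = (\<Sum>j<n - 1. (window lo xs j)\<^sup>2) + c'\<^sup>2 + c\<^sup>2"
 proof -
  obtain m where m: "n = Suc m" using n by (cases n) auto
  show ?thesis unfolding m by (simp add: lessThan_Suc_atMost[symmetric])
 qed
 moreover have "(\<Sum>j<n - 1. (window lo xs j)\<^sup>2) = sum_sq xs" using xs by (rule sum_window_sq)
 ultimately show ?thesis using i by simp
qed

text \<open>The renumbering \<open>\<psi>\<close> is part of the definition because
  \<open>dynkin_diagram\<close> knows each diagram in one numbering only.\<close>

definition extends_to_dynkin :: "nat => nat set set => nat => bool" where
 "extends_to_dynkin n E i \<longleftrightarrow> (\<exists>\<psi> E'. dynkin_diagram (Suc n) E' \<and> bij_betw \<psi> {..<Suc n} {..<Suc n} \<and>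
   (%X. \<psi> ` X) ` insert {i, n} E = E')"

lemma extends_to_dynkinI:
 "dynkin_diagram (Suc n) E' ==> bij_betw \<psi> {..<Suc n} {..<Suc n} ==>
   (%X. \<psi> ` X) ` insert {i, n} E = E' ==> extends_to_dynkin n E i"
 unfolding extends_to_dynkin_def by blast

lemma extends_to_dynkin_id:
 "dynkin_diagram (Suc n) (insert {i, n} E) ==> extends_to_dynkin n E i"
 by (rule extends_to_dynkinI[of _ _ id]) auto

lemma chain_edges_Suc: "1 \<le> n ==> chain_edges (Suc n) = insert {n - 1, n} (chain_edges n)"
proof -
 assume "1 \<le> n"
 then obtain m where n: "n = Suc m" by (cases n) auto
 show ?thesis unfolding n chain_edges_image by (simp add: lessThan_Suc)
qed

text \<open>A vertex attached in front of the chain is renumbered 0 and pushes the others up. The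
  label \<open>m\<close> is separate from \<open>n\<close> because in type D the label of the new
  vertex exceeds the length of the chain.\<close>

lemma rotate_chain:
 assumes "1 \<le> n" and "n \<le> m"
 shows "(%X. (%j. if j = m then 0 else Suc j) ` X) ` insert {0, m} (chain_edges n) = chain_edges (Suc n)"
proof -
 have "(%X. (%j. if j = m then 0 else Suc j) ` X) ` chain_edges n = (%j. {Suc j, Suc (Suc j)}) ` {..<n - 1}"
  unfolding chain_edges_image image_image using assms(2) by (intro image_cong) auto
 moreover have "(%j. if j = m then 0 else Suc j) ` {0, m} = {0, Suc 0}" using assms by auto
 moreover have "chain_edges (Suc n) = insert {0, Suc 0} ((%j. {Suc j, Suc (Suc j)}) ` {..<n - 1})"
 proof -
  obtain k where n: "n = Suc k" using assms(1) by (cases n) auto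
  have "{..<Suc k} = insert 0 (Suc ` {..<k})" by (rule lessThan_Suc_eq_insert_0)
  then show ?thesis unfolding n chain_edges_image by (simp add: image_image)
 qed
 ultimately show ?thesis by (simp only: image_insert)
qed

lemma bij_rotate: "bij_betw (%j. if j = n then 0 else Suc j) {..<Suc n} {..<Suc n}"
 by (rule bij_betw_byWitness[of _ "%j. if j = 0 then n else j - 1"]) auto

lemma bij_reverse: "bij_betw (%j. if j < n then n - 1 - j else j) {..<Suc n} {..<Suc n}"
 by (rule bij_betw_byWitness[of _ "%j. if j < n then n - 1 - j else j"]) auto

lemma reverse_chain: "(%X. (%j. if j < n then n - 1 - j else j) ` X) ` chain_edges n = chain_edges n"
proof -
 have "(%X. (%j. if j < n then n - 1 - j else j) ` X) ` chain_edges n = (%j. {n - 1 - j, n - 1 - Suc j}) ` {..<n - 1}"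
  unfolding chain_edges_image image_image by (intro image_cong) auto
 also have "\<dots> = (%j. {Suc j, j}) ` ((%j. n - 1 - Suc j) ` {..<n - 1})"
  unfolding image_image by (intro image_cong) auto
 also have "(%j. n - 1 - Suc j) ` {..<n - 1} = {..<n - 1}"
 proof (intro equalityI subsetI)
  fix x assume "x : {..<n - 1}"
  then show "x : (%j. n - 1 - Suc j) ` {..<n - 1}"
   by (intro image_eqI[of _ _ "n - 1 - Suc x"]) auto
 qed auto
 finally show ?thesis unfolding chain_edges_image by (simp add: insert_commute)
qed

lemma extend_chain_reverse:
 assumes "i < n" "dynkin_diagram (Suc n) (insert {n - 1 - i, n} (chain_edges n))"
 shows "extends_to_dynkin n (chain_edges n) i"
proof (rule extends_to_dynkinI[OF assms(2) bij_reverse])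
 have "(%j. if j < n then n - 1 - j else j) ` {i, n} = {n - 1 - i, n}" using assms(1) by auto
 then show "(%X. (%j. if j < n then n - 1 - j else j) ` X) ` insert {i, n} (chain_edges n) =
   insert {n - 1 - i, n} (chain_edges n)"
  by (simp only: image_insert reverse_chain)
qed

text \<open>The new vertex creates arms with \<open>i\<close>, \<open>n - 1 - i\<close> and 1
  vertices. At an end this is type A, one step away from an end type D, two steps away type E as
  long as \<open>n < 8\<close>; everything else contains the extended \<open>E_7\<close> or
  \<open>E_8\<close>.\<close>

lemma extend_chain:
 assumes n: "1 \<le> n" and i: "i < n" and pos: "attach_positive n (chain_edges n) i"
 shows "extends_to_dynkin n (chain_edges n) i"
proof -
 have D: "dynkin_diagram (Suc n) (insert {n - 2, n} (chain_edges n))" if "3 \<le> n"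
  using dynkin_diagram.D[of "Suc n"] that unfolding branched_edges_def by simp
 have E: "dynkin_diagram (Suc n) (insert {2, n} (chain_edges n))" if "n : {5,6,7}"
  using dynkin_diagram.E[of "Suc n"] that unfolding branched_edges_def by auto
 \<comment> \<open>The two vectors, with 3 at the new vertex, are the null root of the extended
   \<open>E_8\<close>, laid along the chain in its two directions.\<close>
 have lt8: "n < 8" if i23: "i = 2 \<or> i = n - 3" and "3 \<le> n"
 proof (rule ccontr)
  assume n8: "\<not> n < 8"
  consider "i = 2" | "i = n - 3" using i23 by blast
  then show False
  proof cases
   case 1
   then show False
    using attach_chain_bound[OF pos i, of 0 "[2,4,6,5,4,3,2,1]" 3] n8 by (simp add: numeral_2_eq_2)
  next
   case 2
   have "window (n - 8) [1,2,3,4,5,6,4,2] ((n - 8) + 5) = [1,2,3,4,5,6,4,2] ! 5" by (rule window_nth) simp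
   moreover have "n - 8 + 5 = i" using 2 n8 by simp
   ultimately have "window (n - 8) [1,2,3,4,5,6,4,2] i = 6" by (simp del: window.simps)
   moreover have "n - 8 + length [1,2,3,4,5,6,4,2::nat] \<le> n" using n8 by simp
   ultimately show False
    using attach_chain_bound[OF pos i, of "n - 8" "[1,2,3,4,5,6,4,2]" 3] by (simp del: window.simps)
  qed
 qed
 \<comment> \<open>The null root of the extended \<open>E_7\<close>, with its branch vertex, of
   value 4, at \<open>i\<close>.\<close>
 have mid: False if "3 \<le> i" "i + 4 \<le> n"
 proof -
  have "window (i - 3) [1,2,3,4,3,2,1] ((i - 3) + 3) = [1,2,3,4,3,2,1] ! 3" by (rule window_nth) simp
  moreover have "i - 3 + 3 = i" using that by simp
  ultimately have "window (i - 3) [1,2,3,4,3,2,1] i = 4" by (simp del: window.simps)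
  moreover have "i - 3 + length [1,2,3,4,3,2,1::nat] \<le> n" using that by simp
  ultimately show False
   using attach_chain_bound[OF pos i, of "i - 3" "[1,2,3,4,3,2,1]" 2] by (simp del: window.simps)
 qed
 have "\<not> (3 \<le> i \<and> i + 4 \<le> n)" using mid by blast
 then have "i = n - 1 \<or> i = 0 \<or> (i = n - 2 \<and> 3 \<le> n) \<or> (i = 1 \<and> 3 \<le> n) \<or> (i = 2 \<and> 5 \<le> n) \<or> (i = n - 3 \<and> 5 \<le> n)"
  using i by arith
 then consider "i = n - 1" | "i = 0" | "i = n - 2" "3 \<le> n" | "i = 1" "3 \<le> n" | "i = 2" "5 \<le> n" | "i = n - 3" "5 \<le> n"
  by blast
 then show ?thesis
 proof cases
  case 1
  then show ?thesis using dynkin_diagram.A[of "Suc n"] chain_edges_Suc[OF n] by (intro extends_to_dynkin_id) simp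
 next
  case 2
  show ?thesis unfolding 2
   by (rule extends_to_dynkinI[OF _ bij_rotate rotate_chain[OF n order.refl]]) (simp add: dynkin_diagram.A)
 next
  case 3
  then show ?thesis using D by (intro extends_to_dynkin_id) simp
 next
  case 4
  then have e: "n - 1 - i = n - 2" by simp
  show ?thesis by (rule extend_chain_reverse[OF i]) (unfold e, rule D[OF 4(2)])
 next
  case 5
  have "n < 8" by (rule lt8) (use 5 in auto)
  then have "n : {5,6,7}" using 5(2) by auto
  then show ?thesis unfolding 5(1) by (intro extends_to_dynkin_id E)
 next
  case 6
  have e: "n - 1 - i = 2" using 6 by simp
  have "n < 8" by (rule lt8) (use 6 in auto)
  then have "n : {5,6,7}" using 6(2) by auto
  then show ?thesis by (intro extend_chain_reverse[OF i]) (unfold e, rule E)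
 qed
qed

lemma sum_sq_replicate: "sum_sq (1 # replicate m 2 @ [1]) = 4 * m + 2"
 by (induction m) auto

lemma sum_adj_replicate: "sum_adj (x # replicate (Suc m) 2 @ [1]) = 2 * x + 4 * m + 2"
 by (induction m arbitrary: x) auto

text \<open>For a diagram of fixed size the renumbering is a list, the image of \<open>j\<close> at
  position \<open>j\<close>, and the conditions become finite computations.\<close>

lemma extendI_list:
 assumes "distinct xs" "length xs = Suc n" "set xs = {..<Suc n}" "dynkin_diagram (Suc n) E'"
  "(%X. (%j. xs ! j) ` X) ` insert {i, n} E = E'"
 shows "extends_to_dynkin n E i"
 by (rule extends_to_dynkinI[OF assms(4) _ assms(5)]) (rule bij_betw_nth[OF assms(1)], use assms in auto)

lemma chain_edges_numeral:
 "chain_edges (Suc 0) = {}" "chain_edges (Suc (Suc n)) = insert {n, Suc n} (chain_edges (Suc n))"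
 using chain_edges_Suc[of "Suc n"] by (auto simp: chain_edges_def)

text \<open>On the end of the long arm the diagram stays in type D; on an inner vertex of the chain
  it contains an extended diagram of type D. On a short arm it becomes of type E for
  \<open>n\<close> from 5 to 7 and contains the extended \<open>E_8\<close> from
  \<open>n = 8\<close> on. For \<open>n = 4\<close> the three arms are alike and all give
  \<open>D_5\<close>.\<close>

lemma extend_D:
 assumes n: "4 \<le> n" and i: "i < n" and pos: "attach_positive n (branched_edges n (n - 3)) i"
 shows "extends_to_dynkin n (branched_edges n (n - 3)) i"
proof -
 note bound = attach_branched_bound[OF pos i]
 \<comment> \<open>The vector 1, 2, ..., 2, 1 with 1 at both attached vertices is the null root of
   an extended diagram of type D; \<open>m\<close> is the number of steps from \<open>i\<close> to
   the branch vertex.\<close>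
 have mid: False if i0: "1 \<le> i" "i \<le> n - 3"
 proof -
  define m where "m = n - 3 - i"
  define xs :: "nat list" where "xs = 1 # replicate (Suc m) 2 @ [1]"
  have "window (i - 1) xs (i - 1 + Suc m) = xs ! Suc m" "window (i - 1) xs (i - 1 + 1) = xs ! 1"
   by (rule window_nth; simp add: xs_def)+
  moreover have "i - 1 + Suc m = n - 3" "i - 1 + 1 = i" using i0 n by (simp_all add: m_def)
  moreover have "xs ! Suc m = 2" "xs ! 1 = 2" by (simp_all add: xs_def nth_append del: replicate_Suc)
  ultimately have w: "window (i - 1) xs (n - 3) = 2" "window (i - 1) xs i = 2" by simp_all
  have sums: "sum_sq xs = 4 * Suc m + 2" "sum_adj xs = 4 * m + 4"
   unfolding xs_def using sum_sq_replicate[of "Suc m"] sum_adj_replicate[of 1 m] by simp_all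
  have len: "i - 1 + length xs \<le> n - 1" using i0 n by (simp add: xs_def m_def)
  have "sum_adj xs + window (i - 1) xs (n - 3) * 1 + (if i = n - 1 then 1 else window (i - 1) xs i) * 1
    < sum_sq xs + 1\<^sup>2 + 1\<^sup>2"
   by (rule bound) (use n len in auto)
  then show False using i0 n unfolding w sums by (auto split: if_splits)
 qed
 \<comment> \<open>Both vectors are the null root of the extended \<open>E_8\<close>. Its arm with
   entries 4, 2 passes through \<open>n - 2\<close> in the first case and through
   \<open>n - 1\<close> in the second, and ends at the new vertex.\<close>
 have big: False if "8 \<le> n" "i = n - 2 \<or> i = n - 1"
  using that(2)
 proof
  assume i2: "i = n - 2"
  define xs :: "nat list" where "xs = [1,2,3,4,5,6,4]"
  have "window (n - 8) xs (n - 8 + 5) = xs ! 5" "window (n - 8) xs (n - 8 + 6) = xs ! 6"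
   by (rule window_nth; simp add: xs_def)+
  moreover have "n - 8 + 5 = n - 3" "n - 8 + 6 = n - 2" using that by auto
  ultimately have w: "window (n - 8) xs (n - 3) = 6" "window (n - 8) xs (n - 2) = 4" by (simp_all add: xs_def)
  have sums: "sum_sq xs = 107" "sum_adj xs = 94" "length xs = 7" by (simp_all add: xs_def)
  have "sum_adj xs + window (n - 8) xs (n - 3) * 3 + (if i = n - 1 then 3 else window (n - 8) xs i) * 2
    < sum_sq xs + 3\<^sup>2 + 2\<^sup>2"
   by (rule bound) (use that sums(3) in auto)
  then show False using that unfolding i2 w sums by (auto split: if_splits)
 next
  assume i1: "i = n - 1"
  define xs :: "nat list" where "xs = [1,2,3,4,5,6,3]"
  have "window (n - 8) xs (n - 8 + 5) = xs ! 5" by (rule window_nth) (simp add: xs_def)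
  moreover have "n - 8 + 5 = n - 3" using that by auto
  ultimately have w: "window (n - 8) xs (n - 3) = 6" by (simp add: xs_def)
  have sums: "sum_sq xs = 100" "sum_adj xs = 88" "length xs = 7" by (simp_all add: xs_def)
  have "sum_adj xs + window (n - 8) xs (n - 3) * 4 + (if i = n - 1 then 4 else window (n - 8) xs i) * 2
    < sum_sq xs + 4\<^sup>2 + 2\<^sup>2"
   by (rule bound) (use that sums(3) in auto)
  then show False using that unfolding i1 w sums by simp
 qed
 consider "i = 0" | "i = n - 2 \<or> i = n - 1" "n : {4,5,6,7}" using mid big i n by force
 then show ?thesis
 proof cases
  case 1
  have "(%X. (%j. if j = n then 0 else Suc j) ` X) ` insert {0, n} (branched_edges n (n - 3)) =
    branched_edges (Suc n) (Suc n - 3)"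
  proof -
   have "insert {0, n} (branched_edges n (n - 3)) = insert {n - 3, n - 1} (insert {0, n} (chain_edges (n - 1)))"
    unfolding branched_edges_def by (rule insert_commute)
   moreover have "(%X. (%j. if j = n then 0 else Suc j) ` X) ` insert {0, n} (chain_edges (n - 1)) = chain_edges n"
    using rotate_chain[of "n - 1" n] n by simp
   moreover have "(%j. if j = n then 0 else Suc j) ` {n - 3, n - 1} = {Suc n - 3, n}" using n by auto
   ultimately show ?thesis unfolding branched_edges_def by (simp only: image_insert) simp
  qed
  then show ?thesis unfolding 1
   by (rule extends_to_dynkinI[OF _ bij_rotate, rotated]) (use n dynkin_diagram.D[of "Suc n"] in simp_all)
 next
  case 2
  have D5: "dynkin_diagram (Suc 4) (branched_edges 5 2)" using dynkin_diagram.D[of 5] by simp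
  have E6: "dynkin_diagram (Suc 5) (branched_edges 6 2)" using dynkin_diagram.E[of 6] by simp
  have E7: "dynkin_diagram (Suc 6) (branched_edges 7 2)" using dynkin_diagram.E[of 7] by simp
  have E8: "dynkin_diagram (Suc 7) (branched_edges 8 2)" using dynkin_diagram.E[of 8] by simp
  note expand = branched_edges_def chain_edges_numeral numeral_eq_Suc
  have "(n = 4 \<and> (i = 2 \<or> i = 3)) \<or> (n = 5 \<and> (i = 3 \<or> i = 4)) \<or> (n = 6 \<and> (i = 4 \<or> i = 5)) \<or>
    (n = 7 \<and> (i = 5 \<or> i = 6))"
   using 2(2,1) by (elim insertE emptyE) simp_all
  then consider "n = 4" "i = 2" | "n = 4" "i = 3" | "n = 5" "i = 3" | "n = 5" "i = 4"
   | "n = 6" "i = 4" | "n = 6" "i = 5" | "n = 7" "i = 5" | "n = 7" "i = 6"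
   by (elim disjE conjE) (rule that; assumption)+
  then show ?thesis
  proof cases
   case 1 show ?thesis unfolding 1 by (rule extendI_list[of "[3,2,1,4,0]", OF _ _ _ D5]) (simp_all add: expand lessThan_Suc insert_commute)
  next
   case 2 show ?thesis unfolding 2 by (rule extendI_list[of "[3,2,4,1,0]", OF _ _ _ D5]) (simp_all add: expand lessThan_Suc insert_commute)
  next
   case 3 show ?thesis unfolding 3 by (rule extendI_list[of "[0,1,2,3,5,4]", OF _ _ _ E6]) (simp_all add: expand lessThan_Suc insert_commute)
  next
   case 4 show ?thesis unfolding 4 by (rule extendI_list[of "[0,1,2,5,3,4]", OF _ _ _ E6]) (simp_all add: expand lessThan_Suc insert_commute)
  next
   case 5 show ?thesis unfolding 5 by (rule extendI_list[of "[5,4,3,2,1,6,0]", OF _ _ _ E7]) (simp_all add: expand lessThan_Suc insert_commute)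
  next
   case 6 show ?thesis unfolding 6 by (rule extendI_list[of "[5,4,3,2,6,1,0]", OF _ _ _ E7]) (simp_all add: expand lessThan_Suc insert_commute)
  next
   case 7 show ?thesis unfolding 7 by (rule extendI_list[of "[6,5,4,3,2,1,7,0]", OF _ _ _ E8]) (simp_all add: expand lessThan_Suc insert_commute)
  next
   case 8 show ?thesis unfolding 8 by (rule extendI_list[of "[6,5,4,3,2,7,1,0]", OF _ _ _ E8]) (simp_all add: expand lessThan_Suc insert_commute)
  qed
 qed
qed

text \<open>Only a long arm of \<open>E_6\<close> and the longest arm of \<open>E_7\<close> can be
  extended. The other positions are excluded by null roots of extended diagrams: of type D for
  \<open>i\<close> from 1 to 5, of \<open>E_6\<close> for \<open>n - 1\<close>, of
  \<open>E_7\<close> for 0, and of \<open>E_8\<close> for 6.\<close>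

lemma extend_E:
 assumes n: "n : {6, 7, 8}" and i: "i < n" and pos: "attach_positive n (branched_edges n 2) i"
 shows "extends_to_dynkin n (branched_edges n 2) i"
proof -
 note bound = attach_branched_bound[OF pos i]
 have n6: "6 \<le> n" "n \<le> 8" using n by auto
 have "i ~= 1" using bound[of 0 "[1,2,2,1]" 1 1] n by (cases "i = 1") (auto simp: numeral_eq_Suc)
 moreover have "i ~= 2" using bound[of 1 "[1,2,1]" 1 1] n by (cases "i = 2") (auto simp: numeral_eq_Suc)
 moreover have "i ~= 3" using bound[of 1 "[1,2,2,1]" 1 1] n by (cases "i = 3") (auto simp: numeral_eq_Suc)
 moreover have "i ~= n - 1" using bound[of 0 "[1,2,3,2,1]" 1 2] n by (cases "i = n - 1") (auto simp: numeral_eq_Suc)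
 moreover have "i ~= 0" if "7 \<le> n" using bound[of 0 "[2,3,4,3,2,1]" 1 2] n that by (cases "i = 0") (auto simp: numeral_eq_Suc)
 moreover have "i ~= 4" if "7 \<le> n" using bound[of 1 "[1,2,2,2,1]" 1 1] n that by (cases "i = 4") (auto simp: numeral_eq_Suc)
 moreover have "i ~= 5" if "n = 8" using bound[of 1 "[1,2,2,2,2,1]" 1 1] that by (cases "i = 5") (auto simp: numeral_eq_Suc)
 moreover have "i ~= 6" if "n = 8" using bound[of 0 "[2,4,6,5,4,3,2]" 1 3] that by (cases "i = 6") (auto simp: numeral_eq_Suc)
 ultimately have thesis_cases: "(n = 6 \<and> i = 0) \<or> (n = 6 \<and> i = 4) \<or> (n = 7 \<and> i = 5)"
  using n i by (auto simp: numeral_eq_Suc less_Suc_eq)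
 have E7: "dynkin_diagram (Suc 6) (branched_edges 7 2)" using dynkin_diagram.E[of 7] by simp
 have E8: "dynkin_diagram (Suc 7) (branched_edges 8 2)" using dynkin_diagram.E[of 8] by simp
 note expand = branched_edges_def chain_edges_numeral numeral_eq_Suc
 from thesis_cases consider "n = 6" "i = 0" | "n = 6" "i = 4" | "n = 7" "i = 5" by blast
 then show ?thesis
 proof cases
  case 1 show ?thesis unfolding 1 by (rule extendI_list[of "[4,3,2,1,0,6,5]", OF _ _ _ E7]) (simp_all add: expand lessThan_Suc insert_commute)
 next
  case 2 show ?thesis unfolding 2 by (rule extendI_list[of "[0,1,2,3,4,6,5]", OF _ _ _ E7]) (simp_all add: expand lessThan_Suc insert_commute)
 next
  case 3 show ?thesis unfolding 3 by (rule extendI_list[of "[0,1,2,3,4,5,7,6]", OF _ _ _ E8]) (simp_all add: expand lessThan_Suc insert_commute)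
 qed
qed

lemma extend_dynkin:
 "dynkin_diagram n E ==> i < n ==> attach_positive n E i ==> extends_to_dynkin n E i"
 by (induction rule: dynkin_diagram.cases) (auto intro: extend_chain extend_D extend_E)

lemma dynkin_edges:
 assumes "dynkin_diagram n E"
 shows "finite E" "card E = n - 1" "1 \<le> n" "!!X. X : E ==> \<exists>x y. x ~= y \<and> X = {x, y} \<and> x < n \<and> y < n"
proof -
 have chain: "\<exists>x y. x ~= y \<and> X = {x, y} \<and> x < m \<and> y < m" if "X : chain_edges m" for X m
 proof -
  obtain j where "X = {j, Suc j}" "Suc j < m" using \<open>X : chain_edges m\<close> by (auto simp: chain_edges_def)
  then show ?thesis by (intro exI[of _ j] exI[of _ "Suc j"]) auto
 qed
 have branched: "finite (branched_edges m b) \<and> card (branched_edges m b) = m - 1 \<and>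
   (\<forall>X\<in>branched_edges m b. \<exists>x y. x ~= y \<and> X = {x, y} \<and> x < m \<and> y < m)" if m: "2 \<le> m" "b < m - 1" for m b
 proof (intro conjI ballI)
  show "finite (branched_edges m b)" by (simp add: branched_edges_def finite_chain_edges)
  show "card (branched_edges m b) = m - 1"
   unfolding branched_edges_def
   using m branched_new[OF m(1)] card_insert_disjoint[OF finite_chain_edges] by (simp add: card_chain_edges)
  fix X assume "X : branched_edges m b"
  then consider "X = {b, m - 1}" | "X : chain_edges (m - 1)" by (auto simp: branched_edges_def)
  then show "\<exists>x y. x ~= y \<and> X = {x, y} \<and> x < m \<and> y < m"
  proof cases
   case 1
   then show ?thesis using m by (intro exI[of _ b] exI[of _ "m - 1"]) auto
  next
   case 2
   then obtain x y where "x ~= y" "X = {x, y}" "x < m - 1" "y < m - 1" using chain by blast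
   then show ?thesis by (intro exI[of _ x] exI[of _ y]) auto
  qed
 qed
 have "1 \<le> n \<and> finite E \<and> card E = n - 1 \<and> (\<forall>X\<in>E. \<exists>x y. x ~= y \<and> X = {x, y} \<and> x < n \<and> y < n)"
  using assms
 proof cases
  case A
  then show ?thesis using chain finite_chain_edges card_chain_edges by simp
 next
  case D
  then show ?thesis using branched[of n "n - 3"] by simp
 next
  case E
  then show ?thesis using branched[of n 2] by auto
 qed
 then show "finite E" "card E = n - 1" "1 \<le> n" "!!X. X : E ==> \<exists>x y. x ~= y \<and> X = {x, y} \<and> x < n \<and> y < n"
  by simp_all
qed

section \<open>Positive Tits forms of quivers and Dynkin labellings\<close>

definition induced_arcs :: "'a set => ('a => 'v) => ('a => 'v) => 'v set => 'a set" where
 "induced_arcs A s t U = {a : A. s a : U \<and> t a : U}"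

definition dynkin_labelling :: "'a set => ('a => 'v) => ('a => 'v) => 'v set => bool" where
 "dynkin_labelling A s t U \<longleftrightarrow> (\<exists>n E \<phi>. dynkin_diagram n E \<and> bij_betw \<phi> U {..<n} \<and>
   bij_betw (%a. {\<phi> (s a), \<phi> (t a)}) (induced_arcs A s t U) E)"

text \<open>Positivity of the Tits form of the full subquiver on \<open>C\<close>, for vectors with
  nonnegative entries; comparing two sums avoids subtraction of naturals.\<close>

definition positive_form :: "'a set => ('a => 'v) => ('a => 'v) => 'v set => bool" where
 "positive_form A s t C \<longleftrightarrow> (\<forall>d :: 'v => nat. (\<exists>v\<in>C. d v ~= 0) -->
   (\<Sum>a\<in>induced_arcs A s t C. d (s a) * d (t a)) < (\<Sum>v\<in>C. (d v)\<^sup>2))"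

lemma positive_form_subset:
 assumes pos: "positive_form A s t C" and fin: "finite A" "finite C" and UC: "U \<subseteq> C"
 shows "positive_form A s t U"
 unfolding positive_form_def
proof (intro allI impI)
 fix d :: "'b => nat" assume "\<exists>v\<in>U. d v ~= 0"
 let ?d = "%v. if v : U then d v else 0"
 have "\<exists>v\<in>C. ?d v ~= 0" using \<open>\<exists>v\<in>U. d v ~= 0\<close> UC by auto
 then have "(\<Sum>a\<in>induced_arcs A s t C. ?d (s a) * ?d (t a)) < (\<Sum>v\<in>C. (?d v)\<^sup>2)"
  using pos[unfolded positive_form_def, rule_format, of ?d] by blast
 moreover have "(\<Sum>a\<in>induced_arcs A s t C. ?d (s a) * ?d (t a)) = (\<Sum>a\<in>induced_arcs A s t U. d (s a) * d (t a))"
  by (rule sum.mono_neutral_cong_right) (use fin UC in \<open>auto simp: induced_arcs_def\<close>)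
 moreover have "(\<Sum>v\<in>C. (?d v)\<^sup>2) = (\<Sum>v\<in>U. (d v)\<^sup>2)"
  by (rule sum.mono_neutral_cong_right) (use fin UC in auto)
 ultimately show "(\<Sum>a\<in>induced_arcs A s t U. d (s a) * d (t a)) < (\<Sum>v\<in>U. (d v)\<^sup>2)" by simp
qed

text \<open>At the constant vector 1 positivity says that the enlarged subquiver has fewer arrows
  than vertices. The old one already has \<open>n - 1\<close> arrows on \<open>n\<close> vertices,
  so \<open>a0\<close> is the only new arrow. Positivity can then be read on the diagram, where
  \<open>extend_dynkin\<close> applies.\<close>

lemma dynkin_labelling_insert:
 assumes pos: "positive_form A s t (insert w U)" and fin: "finite A" "finite U"
  and lab: "dynkin_labelling A s t U" and w: "w \<notin> U" and u: "u : U"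
  and a0: "a0 : A" "{s a0, t a0} = {u, w}"
 shows "dynkin_labelling A s t (insert w U)"
proof -
 obtain n E \<phi> where D: "dynkin_diagram n E" and b: "bij_betw \<phi> U {..<n}"
  and bE: "bij_betw (%a. {\<phi> (s a), \<phi> (t a)}) (induced_arcs A s t U) E"
  using lab unfolding dynkin_labelling_def by blast
 note DE = dynkin_edges[OF D]
 let ?W = "insert w U" and ?AU = "induced_arcs A s t U" and ?AW = "induced_arcs A s t (insert w U)"
 define \<phi>' where "\<phi>' v = (if v = w then n else \<phi> v)" for v
 have cU: "card U = n" using bij_betw_same_card[OF b] by simp
 have cA: "card ?AU = n - 1" using bij_betw_same_card[OF bE] DE by simp
 have "(\<Sum>a\<in>?AW. (1::nat) * 1) < (\<Sum>v\<in>?W. 1\<^sup>2)"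
  by (rule pos[unfolded positive_form_def, rule_format, of "%_. 1"]) auto
 then have cW: "card ?AW \<le> n" using cU fin w by simp
 have a0W: "a0 : ?AW" "a0 \<notin> ?AU" using a0 u w by (auto simp: induced_arcs_def doubleton_eq_iff)
 have AW: "?AW = insert a0 ?AU"
 proof (rule card_seteq[symmetric])
  show "finite ?AW" using fin by (simp add: induced_arcs_def)
  show "insert a0 ?AU \<subseteq> ?AW" using a0W by (auto simp: induced_arcs_def)
  have "finite ?AU" using fin by (simp add: induced_arcs_def)
  then show "card ?AW \<le> card (insert a0 ?AU)" using cA cW a0W(2) DE(3) by simp
 qed
 have b': "bij_betw \<phi>' ?W {..<Suc n}"
 proof -
  have "bij_betw \<phi>' U {..<n}" using b w by (subst bij_betw_cong[of _ _ \<phi>]) (auto simp: \<phi>'_def)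
  then have "bij_betw \<phi>' (U \<union> {w}) ({..<n} \<union> {n})" by (rule bij_betw_combine) (auto simp: bij_betw_def \<phi>'_def)
  then show ?thesis by (simp add: lessThan_Suc)
 qed
 have iU: "\<phi> u < n" using b u by (auto simp: bij_betw_def)
 define i where "i = \<phi> u"
 have bW: "bij_betw (%a. {\<phi>' (s a), \<phi>' (t a)}) ?AW (insert {i, n} E)"
 proof -
  have "bij_betw (%a. {\<phi>' (s a), \<phi>' (t a)}) ?AU E"
   using bE w by (subst bij_betw_cong[of _ _ "%a. {\<phi> (s a), \<phi> (t a)}"]) (auto simp: \<phi>'_def induced_arcs_def)
  moreover have "{\<phi>' (s a0), \<phi>' (t a0)} = \<phi>' ` {s a0, t a0}" by simp
  then have "{\<phi>' (s a0), \<phi>' (t a0)} = {i, n}" unfolding a0(2) using u w by (auto simp: \<phi>'_def i_def)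
  then have "bij_betw (%a. {\<phi>' (s a), \<phi>' (t a)}) {a0} {{i, n}}" by (simp add: bij_betw_def)
  moreover have "{i, n} \<notin> E" using DE(4)[of "{i, n}"] by (auto simp: doubleton_eq_iff)
  ultimately have "bij_betw (%a. {\<phi>' (s a), \<phi>' (t a)}) (?AU \<union> {a0}) (E \<union> {{i, n}})"
   by (intro bij_betw_combine) auto
  then show ?thesis unfolding AW by simp
 qed
 have "attach_positive n E i" unfolding attach_positive_def
 proof (intro allI impI)
  fix d assume d: "\<exists>j\<le>n. d j ~= (0::nat)"
  then obtain j where j: "j \<le> n" "d j ~= 0" by blast
  have "\<phi>' ` ?W = {..<Suc n}" using b' by (simp only: bij_betw_def)
  then have "j : \<phi>' ` ?W" using j(1) by (simp only: lessThan_iff less_Suc_eq_le)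
  then have "\<exists>v\<in>?W. d (\<phi>' v) ~= 0" using j(2) by blast
  then have "(\<Sum>a\<in>?AW. d (\<phi>' (s a)) * d (\<phi>' (t a))) < (\<Sum>v\<in>?W. (d (\<phi>' v))\<^sup>2)"
   by (rule pos[unfolded positive_form_def, rule_format, of "%v. d (\<phi>' v)"])
  moreover have "(\<Sum>v\<in>?W. (d (\<phi>' v))\<^sup>2) = (\<Sum>j\<le>n. (d j)\<^sup>2)"
   using sum.reindex_bij_betw[OF b', of "%j. (d j)\<^sup>2"] by (simp only: lessThan_Suc_atMost)
  moreover have "(\<Sum>a\<in>?AW. d (\<phi>' (s a)) * d (\<phi>' (t a))) = (\<Sum>X\<in>insert {i, n} E. \<Prod>x\<in>X. d x)"
  proof -
   have "(\<Sum>X\<in>insert {i, n} E. \<Prod>x\<in>X. d x) = (\<Sum>a\<in>?AW. \<Prod>x\<in>{\<phi>' (s a), \<phi>' (t a)}. d x)"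
    using sum.reindex_bij_betw[OF bW, of "%X. \<Prod>x\<in>X. d x"] by simp
   also have "\<dots> = (\<Sum>a\<in>?AW. d (\<phi>' (s a)) * d (\<phi>' (t a)))"
   proof (rule sum.cong)
    fix a assume a: "a : ?AW"
    have "{\<phi>' (s a), \<phi>' (t a)} : insert {i, n} E" using bij_betwE[OF bW] a by blast
    moreover have "i ~= n" using iU by (simp add: i_def)
    ultimately have "\<phi>' (s a) ~= \<phi>' (t a)"
     using DE(4)[of "{\<phi>' (s a), \<phi>' (t a)}"] by (auto simp: doubleton_eq_iff)
    then show "(\<Prod>x\<in>{\<phi>' (s a), \<phi>' (t a)}. d x) = d (\<phi>' (s a)) * d (\<phi>' (t a))" by simp
   qed simp
   finally show ?thesis by simp
  qed
  moreover have "{i, n} \<notin> E" using DE(4)[of "{i, n}"] by (auto simp: doubleton_eq_iff)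
  then have "(\<Sum>X\<in>insert {i, n} E. \<Prod>x\<in>X. d x) = edge_sum d E + d i * d n"
   using DE(1) iU by (simp add: edge_sum_def i_def)
  ultimately show "edge_sum d E + d i * d n < (\<Sum>j\<le>n. (d j)\<^sup>2)" by simp
 qed
 then obtain \<psi> E' where D': "dynkin_diagram (Suc n) E'" and bp: "bij_betw \<psi> {..<Suc n} {..<Suc n}"
  and im: "(%X. \<psi> ` X) ` insert {i, n} E = E'"
  using extend_dynkin[OF D, of i] iU unfolding extends_to_dynkin_def i_def by blast
 have inj: "inj_on (%X. \<psi> ` X) (insert {i, n} E)"
 proof (rule inj_onI)
  fix X Y assume "X : insert {i, n} E" "Y : insert {i, n} E" and eq: "\<psi> ` X = \<psi> ` Y"
  moreover have "X \<subseteq> {..<Suc n}" if "X : insert {i, n} E" for X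
   using that DE(4)[of X] iU by (auto simp: i_def)
  ultimately show "X = Y" using inj_on_image_eq_iff[of \<psi> "{..<Suc n}"] bp by (simp add: bij_betw_def)
 qed
 have "bij_betw (%X. \<psi> ` X) (insert {i, n} E) E'" using inj im by (simp add: bij_betw_def)
 from bij_betw_trans[OF bW this] have "bij_betw (%a. {(\<psi> \<circ> \<phi>') (s a), (\<psi> \<circ> \<phi>') (t a)}) ?AW E'"
  by (simp add: comp_def)
 with bij_betw_trans[OF b' bp] D' show ?thesis unfolding dynkin_labelling_def by blast
qed

text \<open>The labelled set grows from one vertex to \<open>C\<close>, one vertex at a time.
  Connectedness takes the form in which it is used: every proper nonempty part has an arrow leading
  out of it, in either direction. At a single vertex the constant vector 1 excludes loops.\<close>

lemma positive_connected_dynkin: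
 assumes pos: "positive_form A s t C" and fin: "finite A" "finite C" and ne: "C ~= {}"
  and conn: "!!U. U \<subset> C ==> U ~= {} ==> \<exists>a\<in>A. \<exists>u\<in>U. \<exists>w\<in>C - U. {s a, t a} = {u, w}"
 shows "dynkin_labelling A s t C"
proof -
 obtain v where v: "v : C" using ne by blast
 have "\<exists>U\<subseteq>C. card U = Suc k \<and> dynkin_labelling A s t U" if "Suc k \<le> card C" for k
  using that
 proof (induction k)
  case 0
  have "positive_form A s t {v}" using positive_form_subset[OF pos fin] v by blast
  then have "(\<Sum>a\<in>induced_arcs A s t {v}. (1::nat) * 1) < (\<Sum>v\<in>{v}. 1\<^sup>2)"
   unfolding positive_form_def by (elim allE[of _ "%_. 1"]) auto
  then have "induced_arcs A s t {v} = {}" using fin by (simp add: induced_arcs_def)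
  moreover have "chain_edges 1 = {}" by (simp add: chain_edges_def)
  ultimately have "dynkin_labelling A s t {v}"
   unfolding dynkin_labelling_def using dynkin_diagram.A[of 1]
   by (intro exI[of _ 1] exI[of _ "chain_edges 1"] exI[of _ "%_. 0"]) (auto simp: bij_betw_def)
  then show ?case using v by (intro exI[of _ "{v}"]) auto
 next
  case (Suc k)
  then obtain U where U: "U \<subseteq> C" "card U = Suc k" "dynkin_labelling A s t U" by auto
  have "U \<subset> C" "U ~= {}" using U(1,2) Suc.prems by auto
  from conn[OF this] obtain a u w where a: "a : A" "u : U" "w : C - U" "{s a, t a} = {u, w}"
   by blast
  have fU: "finite U" using U(1) fin finite_subset by blast
  have "dynkin_labelling A s t (insert w U)"
   by (rule dynkin_labelling_insert[OF positive_form_subset[OF pos fin] fin(1) fU U(3) _ a(2) a(1) a(4)])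
     (use a U in auto)
  then show ?case using a U fU by (intro exI[of _ "insert w U"]) auto
 qed
 from this[of "card C - 1"] obtain U where "U \<subseteq> C" "card U = card C" "dynkin_labelling A s t U"
  using ne fin by (auto simp: card_gt_0_iff)
 then show ?thesis using card_subset_eq[OF fin(2)] by blast
qed

text \<open>A component that is not Dynkin cannot have a positive form, and then neither can the
  whole quiver, because a vector on the component extends by 0. The vector on which positivity fails
  is \<open>d\<close>.\<close>

theorem not_dynkin_form:
 fixes Q :: "('v, 'a) pre_digraph"
 assumes "fin_digraph Q" "\<not> dynkin_quiver Q"
 obtains d :: "'v => nat" where "\<exists>v\<in>verts Q. d v ~= 0"
  "(\<Sum>v\<in>verts Q. (d v)\<^sup>2) \<le> (\<Sum>a\<in>arcs Q. d (tail Q a) * d (head Q a))"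
proof -
 interpret fin_digraph Q by fact
 interpret S: pair_wf_digraph "mk_symmetric Q" ..
 obtain S where S: "S : S.sccs_verts" and nd: "\<not> connected_dynkin_quiver (Q \<restriction> S)"
  using assms(2) unfolding dynkin_quiver_def by blast
 have sym: "v \<rightarrow>\<^sup>*\<^bsub>mk_symmetric Q\<^esub> u" if "u \<rightarrow>\<^sup>*\<^bsub>mk_symmetric Q\<^esub> v" for u v
  by (rule symmetric_reachable[OF symmetric_mk_symmetric that])
 have Sne: "S ~= {}" and Sr: "!!u v. u : S ==> v : S ==> u \<rightarrow>\<^sup>*\<^bsub>mk_symmetric Q\<^esub> v"
  and Sc: "!!u v. u : S ==> u \<rightarrow>\<^sup>*\<^bsub>mk_symmetric Q\<^esub> v ==> v : S"
  using S sym unfolding S.sccs_verts_def by blast+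
 have SV: "S \<subseteq> verts Q" using Sr S.reachable_in_verts by fastforce
 have "\<not> dynkin_labelling (arcs Q) (tail Q) (head Q) S"
  using nd unfolding connected_dynkin_quiver_def underlying_graph_iso_def dynkin_labelling_def
   induced_arcs_def by (simp add: induce_subgraph_def)
 moreover have "\<exists>a\<in>arcs Q. \<exists>u\<in>U. \<exists>w\<in>S - U. {tail Q a, head Q a} = {u, w}" if U: "U \<subset> S" "U ~= {}" for U
 proof (rule ccontr)
  assume no: "\<not> ?thesis"
  obtain u v where uv: "u : U" "v : S - U" using U by blast
  have "u \<rightarrow>\<^sup>*\<^bsub>mk_symmetric Q\<^esub> v" using Sr uv U by blast
  then have "v : U"
  proof (induction rule: S.reachable_induct)
   case base then show ?case using uv by blast
  next
   case (step x y)
   have xS: "x : S" using step U by blast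
   have "x \<rightarrow>\<^sup>*\<^bsub>mk_symmetric Q\<^esub> y" using step by (simp add: S.reachable_adjI)
   then have yS: "y : S" using Sc xS by blast
   from step have "(x, y) : parcs (mk_symmetric Q)" by simp
   then have "(\<exists>a\<in>arcs Q. tail Q a = x \<and> head Q a = y) \<or> (\<exists>a\<in>arcs Q. tail Q a = y \<and> head Q a = x)"
    by (auto simp: parcs_mk_symmetric arcs_ends_def arc_to_ends_def)
   then obtain a where a: "a : arcs Q" "{tail Q a, head Q a} = {x, y}" by (auto simp: insert_commute)
   show ?case
   proof (rule ccontr)
    assume "y \<notin> U"
    then show False using no a step(3) yS by blast
   qed
  qed
  then show False using uv by blast
 qed
 ultimately have "\<not> positive_form (arcs Q) (tail Q) (head Q) S"
  using positive_connected_dynkin[of "arcs Q" "tail Q" "head Q" S] SV Sne finite_subset[OF SV] by auto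
 then have "\<not> positive_form (arcs Q) (tail Q) (head Q) (verts Q)"
  using positive_form_subset[of "arcs Q" "tail Q" "head Q" "verts Q" S] SV by auto
 moreover have "induced_arcs (arcs Q) (tail Q) (head Q) (verts Q) = arcs Q" by (auto simp: induced_arcs_def)
 ultimately show thesis using that unfolding positive_form_def by (auto simp: not_less)
qed

section \<open>Localisation of categories\<close>

text \<open>The axioms of a category, with the identities in \<open>W\<close>: statements about the
  localisation are proved by rewriting zigzags. Hom sets may overlap, so compositions and classes
  carry their objects along.\<close>

locale localising_category =
 fixes C :: "('o, 'm, 'z) category_scheme" and W :: "'o => 'o => 'm set"
 assumes id_hom: "X : Ob C ==> Idt C X : Hom C X X"
  and id_W: "X : Ob C ==> Idt C X : W X X"
  and comp_hom: "[|X : Ob C; Y : Ob C; Z : Ob C; f : Hom C X Y; g : Hom C Y Z|] ==> Comp C X Y Z g f : Hom C X Z"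
  and comp_id_right: "[|X : Ob C; Y : Ob C; f : Hom C X Y|] ==> Comp C X X Y f (Idt C X) = f"
  and comp_id_left: "[|X : Ob C; Y : Ob C; f : Hom C X Y|] ==> Comp C X Y Y (Idt C Y) f = f"
  and comp_assoc: "[|X : Ob C; Y : Ob C; Z : Ob C; V : Ob C; f : Hom C X Y; g : Hom C Y Z; h : Hom C Z V|] ==>
   Comp C X Z V h (Comp C X Y Z g f) = Comp C X Y V (Comp C Y Z V h g) f"
begin

abbreviation "zz \<equiv> zigzag C W"
abbreviation "zeq \<equiv> zigzag_eq C W"
abbreviation "D \<equiv> localisation C W"
abbreviation "cls \<equiv> zigzag_class C W"

lemma zz_start: "zz X Y p ==> X : Ob C"
 by (induction rule: zigzag.induct) auto

lemma zz_end: "zz X Y p ==> Y : Ob C"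
 by (induction rule: zigzag.induct) auto

lemma zz_fwd: "X : Ob C ==> Y : Ob C ==> f : Hom C X Y ==> zz X Y [Fwd Y f]"
 by (intro zigzag.fwd zigzag.nil)

lemma zz_bwd: "X : Ob C ==> Y : Ob C ==> s : Hom C Y X ==> s : W Y X ==> zz X Y [Bwd Y s]"
 by (intro zigzag.bwd zigzag.nil)

lemma zz_append: "zz X Y p ==> zz Y Z q ==> zz X Z (p @ q)"
 by (induction arbitrary: q rule: zigzag.induct) (auto intro: zigzag.intros)

lemma zeq_zz: "zeq X Y p q ==> zz X Y p \<and> zz X Y q"
proof (induction rule: zigzag_eq.induct)
 case (comp X Y Z f g)
 then show ?case by (auto intro!: zigzag.intros comp_hom)
qed (auto intro: zigzag.intros zz_append id_hom)

lemma zeq_refl: "zz X Y p ==> zeq X Y p p"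
 by (rule zigzag_eq.refl)

lemma zeq_sym: "zeq X Y p q ==> zeq X Y q p"
 by (rule zigzag_eq.sym)

lemma zeq_trans [trans]: "zeq X Y p q ==> zeq X Y q r ==> zeq X Y p r"
 by (rule zigzag_eq.trans)

lemma zz_nil: "X : Ob C ==> zz X X []"
 by (rule zigzag.nil)

lemma zeq_inv_l: "X : Ob C ==> Y : Ob C ==> s : Hom C X Y ==> s : W X Y ==> zeq X X [Fwd Y s, Bwd X s] []"
 by (rule zigzag_eq.inv_l)

lemma zeq_inv_r: "X : Ob C ==> Y : Ob C ==> s : Hom C X Y ==> s : W X Y ==> zeq Y Y [Bwd X s, Fwd Y s] []"
 by (rule zigzag_eq.inv_r)

lemma zeq_left: "zeq X Y p p' ==> zz Y Z q ==> zeq X Z (p @ q) (p' @ q)"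
 by (intro zigzag_eq.append zeq_refl)

lemma zeq_right: "zz X Y p ==> zeq Y Z q q' ==> zeq X Z (p @ q) (p @ q')"
 by (intro zigzag_eq.append zeq_refl)

lemma zeq_comp:
 assumes "X : Ob C" "Y : Ob C" "Z : Ob C" "f : Hom C X Y" "g : Hom C Y Z" "Comp C X Y Z g f = h"
 shows "zeq X Z [Fwd Y f, Fwd Z g] [Fwd Z h]"
 using zigzag_eq.comp[OF assms(1-5)] assms(6) by simp

lemma zeq_square:
 assumes "X : Ob C" "Y : Ob C" "Y' : Ob C" "Z : Ob C" "f : Hom C X Y" "g : Hom C Y Z" "f' : Hom C X Y'" "g' : Hom C Y' Z"
  and "Comp C X Y Z g f = Comp C X Y' Z g' f'"
 shows "zeq X Z [Fwd Y f, Fwd Z g] [Fwd Y' f', Fwd Z g']"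
proof (rule zeq_trans)
 show "zeq X Z [Fwd Y f, Fwd Z g] [Fwd Z (Comp C X Y' Z g' f')]"
  by (rule zeq_comp) (use assms in auto)
 show "zeq X Z [Fwd Z (Comp C X Y' Z g' f')] [Fwd Y' f', Fwd Z g']"
  by (rule zeq_sym, rule zeq_comp) (use assms in auto)
qed

text \<open>A commuting square stays commuting when two parallel sides are inverted: insert the
  inverse of \<open>s\<close> and \<open>s\<close> in front, use the square, and cancel
  \<open>t\<close> against its inverse at the end.\<close>

lemma zeq_bwd_slide:
 assumes ob: "A : Ob C" "A' : Ob C" "B : Ob C" "B' : Ob C"
  and s: "s : Hom C A' A" "s : W A' A" and t: "t : Hom C B' B" "t : W B' B"
  and p: "zz A B p" and p': "zz A' B' p'"
  and sq: "zeq A' B (p' @ [Fwd B t]) ([Fwd A s] @ p)"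
 shows "zeq A B' (p @ [Bwd B' t]) ([Bwd A' s] @ p')"
proof -
 have zs: "zz A A' [Bwd A' s]" "zz A' A [Fwd A s]" "zz B B' [Bwd B' t]" "zz B' B [Fwd B t]"
  using ob s t by (auto intro: zz_fwd zz_bwd)
 have "zeq A B' (p @ [Bwd B' t]) (([Bwd A' s] @ [Fwd A s]) @ p @ [Bwd B' t])"
  using zeq_left[OF zeq_sym[OF zeq_inv_r[of A' A s]] zz_append[OF p zs(3)]] ob s by simp
 also have "zeq A B' (([Bwd A' s] @ [Fwd A s]) @ p @ [Bwd B' t]) ([Bwd A' s] @ (p' @ [Fwd B t]) @ [Bwd B' t])"
  using zeq_right[OF zs(1) zeq_left[OF zeq_sym[OF sq] zs(3)]] by simp
 also have "zeq A B' ([Bwd A' s] @ (p' @ [Fwd B t]) @ [Bwd B' t]) ([Bwd A' s] @ p')"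
  using zeq_right[OF zz_append[OF zs(1) p'] zeq_inv_l[of B' B t]] ob t by simp
 finally show ?thesis .
qed

subsection \<open>Functors and natural transformations\<close>

text \<open>A step stores only its target, while the morphism part of a functor depends on both
  ends; hence the current source is passed along.\<close>

fun zmap :: "('o => 'o) => ('o => 'o => 'm => 'm) => 'o => ('o, 'm) step list => ('o, 'm) step list" where
 "zmap F Fm X [] = []"
| "zmap F Fm X (Fwd Y f # p) = Fwd (F Y) (Fm X Y f) # zmap F Fm Y p"
| "zmap F Fm X (Bwd Y s # p) = Bwd (F Y) (Fm Y X s) # zmap F Fm Y p"

definition endofunctor :: "('o => 'o) => ('o => 'o => 'm => 'm) => bool" where
 "endofunctor F Fm \<longleftrightarrow> (\<forall>X\<in>Ob C. F X : Ob C \<and> Fm X X (Idt C X) = Idt C (F X)) \<and>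
   (\<forall>X\<in>Ob C. \<forall>Y\<in>Ob C. \<forall>f\<in>Hom C X Y. Fm X Y f : Hom C (F X) (F Y) \<and> (f : W X Y --> Fm X Y f : W (F X) (F Y))) \<and>
   (\<forall>X\<in>Ob C. \<forall>Y\<in>Ob C. \<forall>Z\<in>Ob C. \<forall>f\<in>Hom C X Y. \<forall>g\<in>Hom C Y Z.
    Fm X Z (Comp C X Y Z g f) = Comp C (F X) (F Y) (F Z) (Fm Y Z g) (Fm X Y f))"

lemma endofunctorD:
 assumes "endofunctor F Fm"
 shows "X : Ob C ==> F X : Ob C" "X : Ob C ==> Fm X X (Idt C X) = Idt C (F X)"
  "X : Ob C ==> Y : Ob C ==> f : Hom C X Y ==> Fm X Y f : Hom C (F X) (F Y)"
  "X : Ob C ==> Y : Ob C ==> f : Hom C X Y ==> f : W X Y ==> Fm X Y f : W (F X) (F Y)"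
  "X : Ob C ==> Y : Ob C ==> Z : Ob C ==> f : Hom C X Y ==> g : Hom C Y Z ==>
    Fm X Z (Comp C X Y Z g f) = Comp C (F X) (F Y) (F Z) (Fm Y Z g) (Fm X Y f)"
 using assms unfolding endofunctor_def by simp_all

lemma zmap_append: "zz X Y p ==> zmap F Fm X (p @ q) = zmap F Fm X p @ zmap F Fm Y q"
 by (induction rule: zigzag.induct) auto

lemma zmap_zz:
 assumes F: "endofunctor F Fm"
 shows "zz X Y p ==> zz (F X) (F Y) (zmap F Fm X p)"
proof (induction rule: zigzag.induct)
 case (nil X)
 then show ?case using endofunctorD[OF F] by (auto intro: zigzag.intros)
next
 case (fwd X f Y Z p)
 then show ?case using endofunctorD[OF F] zz_start[OF fwd(3)] by (auto intro: zigzag.intros)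
next
 case (bwd X s Y Z p)
 then show ?case using endofunctorD[OF F] zz_start[OF bwd(4)] by (auto intro: zigzag.intros)
qed

lemma zmap_zeq:
 assumes F: "endofunctor F Fm"
 shows "zeq X Y p q ==> zeq (F X) (F Y) (zmap F Fm X p) (zmap F Fm X q)"
proof (induction rule: zigzag_eq.induct)
 case (refl X Y p)
 then show ?case using zmap_zz[OF F] by (intro zeq_refl)
next
 case (append X Y p p' Z q q')
 have "zz X Y p" "zz X Y p'" using zeq_zz[OF append.hyps(1)] by auto
 then show ?case using zigzag_eq.append[OF append.IH] by (simp add: zmap_append)
next
 case (idt X)
 then show ?case by (simp add: endofunctorD[OF F] zigzag_eq.idt)
next
 case (comp X Y Z f g)
 then show ?case by (simp add: endofunctorD[OF F] zigzag_eq.comp)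
next
 case (inv_l X Y s)
 then show ?case by (simp add: endofunctorD[OF F] zigzag_eq.inv_l)
next
 case (inv_r X Y s)
 then show ?case by (simp add: endofunctorD[OF F] zigzag_eq.inv_r)
qed (auto intro: zeq_sym zeq_trans)

definition natural :: "('o => 'o) => ('o => 'o => 'm => 'm) => ('o => 'o) => ('o => 'o => 'm => 'm) => ('o => 'm) => bool" where
 "natural F Fm G Gm \<eta> \<longleftrightarrow> (\<forall>X\<in>Ob C. \<eta> X : Hom C (F X) (G X)) \<and>
   (\<forall>X\<in>Ob C. \<forall>Y\<in>Ob C. \<forall>f\<in>Hom C X Y.
    Comp C (F X) (F Y) (G Y) (\<eta> Y) (Fm X Y f) = Comp C (F X) (G X) (G Y) (Gm X Y f) (\<eta> X))"

text \<open>A natural transformation of functors on the category remains natural on the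
  localisation. Formal inverses are handled by \<open>zeq_bwd_slide\<close>, applied to the
  naturality square of the inverted morphism.\<close>

lemma zmap_natural:
 assumes F: "endofunctor F Fm" and G: "endofunctor G Gm" and nat: "natural F Fm G Gm \<eta>"
 shows "zz X Y p ==> zeq (F X) (G Y) (zmap F Fm X p @ [Fwd (G Y) (\<eta> Y)]) ([Fwd (G X) (\<eta> X)] @ zmap G Gm X p)"
proof (induction rule: zigzag.induct)
 case (nil X)
 then show ?case using endofunctorD(1)[OF F] endofunctorD(1)[OF G] nat
  by (auto simp: natural_def intro!: zeq_refl zz_fwd)
next
 note FD = endofunctorD[OF F] and GD = endofunctorD[OF G]
 have \<eta>: "!!X. X : Ob C ==> \<eta> X : Hom C (F X) (G X)"
  and sq: "!!X Y f. X : Ob C ==> Y : Ob C ==> f : Hom C X Y ==>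
   zeq (F X) (G Y) [Fwd (F Y) (Fm X Y f), Fwd (G Y) (\<eta> Y)] [Fwd (G X) (\<eta> X), Fwd (G Y) (Gm X Y f)]"
  using nat FD GD unfolding natural_def by (auto intro!: zeq_square)
 {
  case (fwd X f Y Z p)
  have Y: "Y : Ob C" and Z: "Z : Ob C" using zz_start[OF fwd(3)] zz_end[OF fwd(3)] by auto
  have "zeq (F X) (G Z) ([Fwd (F Y) (Fm X Y f)] @ zmap F Fm Y p @ [Fwd (G Z) (\<eta> Z)])
    ([Fwd (F Y) (Fm X Y f)] @ [Fwd (G Y) (\<eta> Y)] @ zmap G Gm Y p)"
   by (rule zeq_right[OF zz_fwd fwd(4)]) (use FD fwd Y in auto)
  also have "zeq (F X) (G Z) ([Fwd (F Y) (Fm X Y f)] @ [Fwd (G Y) (\<eta> Y)] @ zmap G Gm Y p)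
    ([Fwd (G X) (\<eta> X)] @ [Fwd (G Y) (Gm X Y f)] @ zmap G Gm Y p)"
   using zeq_left[OF sq[OF fwd(1) Y fwd(2)] zmap_zz[OF G fwd(3)]] by simp
  finally show ?case by simp
 next
  case (bwd X s Y Z p)
  have Y: "Y : Ob C" and Z: "Z : Ob C" using zz_start[OF bwd(4)] zz_end[OF bwd(4)] by auto
  have "zeq (F X) (G Y) ([Fwd (G X) (\<eta> X)] @ [Bwd (G Y) (Gm Y X s)]) ([Bwd (F Y) (Fm Y X s)] @ [Fwd (G Y) (\<eta> Y)])"
   by (rule zeq_bwd_slide[OF _ _ _ _ _ _ _ _ zz_fwd zz_fwd])
     (use FD GD \<eta> bwd Y sq[OF Y bwd(1) bwd(2)] in \<open>auto intro: zeq_sym\<close>)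
  from zeq_left[OF zeq_sym[OF this] zmap_zz[OF G bwd(4)]]
  have slide: "zeq (F X) (G Z) ([Bwd (F Y) (Fm Y X s)] @ [Fwd (G Y) (\<eta> Y)] @ zmap G Gm Y p)
    ([Fwd (G X) (\<eta> X)] @ [Bwd (G Y) (Gm Y X s)] @ zmap G Gm Y p)" by simp
  have "zeq (F X) (G Z) ([Bwd (F Y) (Fm Y X s)] @ zmap F Fm Y p @ [Fwd (G Z) (\<eta> Z)])
    ([Bwd (F Y) (Fm Y X s)] @ [Fwd (G Y) (\<eta> Y)] @ zmap G Gm Y p)"
   by (rule zeq_right[OF zz_bwd bwd(5)]) (use FD bwd Y in auto)
  from zeq_trans[OF this slide] show ?case by simp
 }
qed

lemma zmap_identity: "zmap (%X. X) (%X Y f. f) X p = p"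
 by (induction "%X::'o. X" "%(X::'o) (Y::'o) (f::'m). f" X p rule: zmap.induct) auto

lemma endofunctor_identity: "endofunctor (%X. X) (%X Y f. f)"
 by (simp add: endofunctor_def)

lemma endofunctor_const: "Z : Ob C ==> endofunctor (%X. Z) (%X Y f. Idt C Z)"
 by (auto simp: endofunctor_def id_hom id_W comp_id_left)

lemma zmap_const: "zz X Y p ==> Z : Ob C ==> zeq Z Z (zmap (%X. Z) (%X Y f. Idt C Z) X p) []"
proof (induction rule: zigzag.induct)
 case (nil X)
 then show ?case by (auto intro: zeq_refl zigzag.nil)
next
 case (fwd X f Y V p)
 from zigzag_eq.append[OF zigzag_eq.idt[of Z C W, OF fwd(5)] fwd(4)[OF fwd(5)]] show ?case by simp
next
 case (bwd X s Y V p)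
 have "zeq Z Z [Bwd Z (Idt C Z)] ([Fwd Z (Idt C Z)] @ [Bwd Z (Idt C Z)])"
  using zeq_left[OF zeq_sym[OF zigzag_eq.idt[of Z C W, OF bwd(6)]] zz_bwd] bwd(6) id_hom id_W by fastforce
 also have "zeq Z Z ([Fwd Z (Idt C Z)] @ [Bwd Z (Idt C Z)]) []"
  using zigzag_eq.inv_l[of Z C Z "Idt C Z" W] bwd(6) id_hom id_W by simp
 finally have "zeq Z Z [Bwd Z (Idt C Z)] []" .
 from zigzag_eq.append[OF this bwd(5)[OF bwd(6)]] show ?case by simp
qed

subsection \<open>Morphisms of the localisation\<close>

lemma cls_eq_iff: "zz X Y p ==> cls X Y p = cls X Y q \<longleftrightarrow> zeq X Y p q"
 unfolding zigzag_class_def by (auto intro: zeq_refl zeq_sym zeq_trans)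

lemma clsI: "zeq X Y p q ==> cls X Y p = cls X Y q"
 using zeq_zz cls_eq_iff by blast

lemma Ob_localisation [simp]: "Ob D = Ob C"
 by (simp add: localisation_def)

lemma Hom_localisation: "a : Hom D X Y \<longleftrightarrow> (\<exists>p. zz X Y p \<and> a = cls X Y p)"
 by (auto simp: localisation_def)

lemma cls_in_Hom: "zz X Y p ==> cls X Y p : Hom D X Y"
 by (auto simp: Hom_localisation)

lemma Idt_localisation: "Idt D X = cls X X []"
 by (simp add: localisation_def)

lemma Comp_localisation:
 assumes p: "zz X Y p" and q: "zz Y Z q"
 shows "Comp D X Y Z (cls Y Z q) (cls X Y p) = cls X Z (p @ q)"
proof -
 have "cls X Z (p' @ q') = cls X Z (p @ q)" if "p' : cls X Y p" "q' : cls Y Z q" for p' q'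
 proof -
  have "zeq X Y p p'" "zeq Y Z q q'" using that by (auto simp: zigzag_class_def)
  then have "zeq X Z (p @ q) (p' @ q')" by (rule zigzag_eq.append)
  from clsI[OF this] show ?thesis ..
 qed
 moreover have "p : cls X Y p" "q : cls Y Z q" using p q by (auto simp: zigzag_class_def intro: zeq_refl)
 ultimately have "(\<Union>p'\<in>cls X Y p. \<Union>q'\<in>cls Y Z q. cls X Z (p' @ q')) = cls X Z (p @ q)" by blast
 then show ?thesis by (simp add: localisation_def)
qed

definition zz_iso :: "'o => 'o => ('o, 'm) step list => ('o, 'm) step list => bool" where
 "zz_iso X Y p q \<longleftrightarrow> zz X Y p \<and> zz Y X q \<and> zeq X X (p @ q) [] \<and> zeq Y Y (q @ p) []"

lemma zz_isoI_fwd: "X : Ob C ==> Y : Ob C ==> s : Hom C X Y ==> s : W X Y ==> zz_iso X Y [Fwd Y s] [Bwd X s]"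
 by (simp add: zz_iso_def zz_fwd zz_bwd zigzag_eq.inv_l zigzag_eq.inv_r)

lemma zz_iso_sym: "zz_iso X Y p q ==> zz_iso Y X q p"
 by (auto simp: zz_iso_def)

lemma zz_iso_trans:
 assumes "zz_iso X Y p q" "zz_iso Y Z p' q'"
 shows "zz_iso X Z (p @ p') (q' @ q)"
proof -
 have cancel: "zeq A A ((r @ r') @ (t' @ t)) []"
  if "zz A B r" "zz B A t" "zeq B B (r' @ t') []" "zeq A A (r @ t) []" for A B r r' t t'
 proof -
  have "zeq A A (r @ (r' @ t') @ t) (r @ [] @ t)" by (rule zeq_right[OF that(1) zeq_left[OF that(3) that(2)]])
  then show ?thesis using zeq_trans[OF _ that(4)] by simp
 qed
 have a: "zz X Y p" "zz Y X q" "zeq X X (p @ q) []" "zeq Y Y (q @ p) []"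
  and b: "zz Y Z p'" "zz Z Y q'" "zeq Y Y (p' @ q') []" "zeq Z Z (q' @ p') []"
  using assms unfolding zz_iso_def by auto
 show ?thesis unfolding zz_iso_def
  using zz_append[OF a(1) b(1)] zz_append[OF b(2) a(2)] cancel[OF a(1,2) b(3) a(3)] cancel[OF b(2,1) a(4) b(4)]
  by blast
qed

lemma cat_iso_localisation: "cat_iso D X Y a \<longleftrightarrow> (\<exists>p q. a = cls X Y p \<and> zz_iso X Y p q)"
proof
 assume "cat_iso D X Y a"
 then obtain b where a: "a : Hom D X Y" and b: "b : Hom D Y X"
  and ab: "Comp D X Y X b a = Idt D X" "Comp D Y X Y a b = Idt D Y"
  unfolding cat_iso_def by blast
 obtain p q where p: "zz X Y p" "a = cls X Y p" and q: "zz Y X q" "b = cls Y X q"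
  using a b by (auto simp: Hom_localisation)
 have "zeq X X (p @ q) []" "zeq Y Y (q @ p) []"
  using ab p q by (auto simp: Comp_localisation Idt_localisation cls_eq_iff zz_append)
 then show "\<exists>p q. a = cls X Y p \<and> zz_iso X Y p q" using p q unfolding zz_iso_def by blast
next
 assume "\<exists>p q. a = cls X Y p \<and> zz_iso X Y p q"
 then obtain p q where a: "a = cls X Y p" and z: "zz X Y p" "zz Y X q" "zeq X X (p @ q) []" "zeq Y Y (q @ p) []"
  unfolding zz_iso_def by blast
 show "cat_iso D X Y a" unfolding cat_iso_def a
 proof (intro conjI bexI[OF _ cls_in_Hom[OF z(2)]])
  show "cls X Y p : Hom D X Y" by (rule cls_in_Hom[OF z(1)])
  show "Comp D X Y X (cls Y X q) (cls X Y p) = Idt D X"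
   unfolding Comp_localisation[OF z(1,2)] Idt_localisation by (rule clsI[OF z(3)])
  show "Comp D Y X Y (cls X Y p) (cls Y X q) = Idt D Y"
   unfolding Comp_localisation[OF z(2,1)] Idt_localisation by (rule clsI[OF z(4)])
 qed
qed

definition zz_coproduct where
 "zz_coproduct X Y Z i j \<longleftrightarrow> zz X Z i \<and> zz Y Z j \<and> (\<forall>V f g. zz X V f --> zz Y V g -->
   (\<exists>h. zz Z V h \<and> zeq X V (i @ h) f \<and> zeq Y V (j @ h) g \<and>
    (\<forall>h'. zz Z V h' --> zeq X V (i @ h') f --> zeq Y V (j @ h') g --> zeq Z V h h')))"

lemma is_coproduct_localisation: "is_coproduct D X Y Z \<longleftrightarrow> (\<exists>i j. zz_coproduct X Y Z i j)"
proof
 assume "is_coproduct D X Y Z"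
 then obtain a b where ob: "X : Ob C" "Y : Ob C" "Z : Ob C" and a: "a : Hom D X Z" and b: "b : Hom D Y Z"
  and U: "!!V f g. V : Ob C ==> f : Hom D X V ==> g : Hom D Y V ==>
   \<exists>!h. h : Hom D Z V \<and> Comp D X Z V h a = f \<and> Comp D Y Z V h b = g"
  unfolding is_coproduct_def by auto
 obtain i j where i: "zz X Z i" "a = cls X Z i" and j: "zz Y Z j" "b = cls Y Z j"
  using a b by (auto simp: Hom_localisation)
 have "\<exists>h. zz Z V h \<and> zeq X V (i @ h) f \<and> zeq Y V (j @ h) g \<and>
    (\<forall>h'. zz Z V h' --> zeq X V (i @ h') f --> zeq Y V (j @ h') g --> zeq Z V h h')"
  if f: "zz X V f" and g: "zz Y V g" for V f g
 proof -
  have tr: "(Comp D X Z V (cls Z V h) a = cls X V f) = zeq X V (i @ h) f"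
   "(Comp D Y Z V (cls Z V h) b = cls Y V g) = zeq Y V (j @ h) g" if "zz Z V h" for h
   using that i j by (simp_all add: Comp_localisation cls_eq_iff zz_append)
  from U[OF zz_end[OF f] cls_in_Hom[OF f] cls_in_Hom[OF g]] obtain c where c: "c : Hom D Z V"
   "Comp D X Z V c a = cls X V f" "Comp D Y Z V c b = cls Y V g"
   and un: "!!c'. c' : Hom D Z V ==> Comp D X Z V c' a = cls X V f ==> Comp D Y Z V c' b = cls Y V g ==> c' = c"
   by (elim ex1E) blast
  obtain h where h: "zz Z V h" "c = cls Z V h" using c(1) by (auto simp: Hom_localisation)
  show ?thesis
  proof (intro exI[of _ h] conjI allI impI)
   show "zz Z V h" by fact
   show "zeq X V (i @ h) f" "zeq Y V (j @ h) g" using c(2,3) tr[OF h(1)] h(2) by auto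
   fix h' assume h': "zz Z V h'" "zeq X V (i @ h') f" "zeq Y V (j @ h') g"
   have "cls Z V h' = c" by (rule un) (use h' tr[OF h'(1)] cls_in_Hom in auto)
   then have "cls Z V h = cls Z V h'" using h(2) by simp
   then show "zeq Z V h h'" unfolding cls_eq_iff[OF h(1)] .
  qed
 qed
 then show "\<exists>i j. zz_coproduct X Y Z i j" unfolding zz_coproduct_def using i j by blast
next
 assume "\<exists>i j. zz_coproduct X Y Z i j"
 then obtain i j where i: "zz X Z i" and j: "zz Y Z j"
  and U: "!!V f g. zz X V f ==> zz Y V g ==>
   (\<exists>h. zz Z V h \<and> zeq X V (i @ h) f \<and> zeq Y V (j @ h) g \<and>
    (\<forall>h'. zz Z V h' --> zeq X V (i @ h') f --> zeq Y V (j @ h') g --> zeq Z V h h'))"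
  unfolding zz_coproduct_def by auto
 have U': "\<exists>!h. h : Hom D Z V \<and> Comp D X Z V h (cls X Z i) = f \<and> Comp D Y Z V h (cls Y Z j) = g"
  if f: "f : Hom D X V" and g: "g : Hom D Y V" for V f g
 proof -
  obtain p q where p: "zz X V p" "f = cls X V p" and q: "zz Y V q" "g = cls Y V q"
   using f g by (auto simp: Hom_localisation)
  have tr: "(Comp D X Z V (cls Z V h) (cls X Z i) = f) = zeq X V (i @ h) p"
   "(Comp D Y Z V (cls Z V h) (cls Y Z j) = g) = zeq Y V (j @ h) q" if "zz Z V h" for h
   using that i j p q by (simp_all add: Comp_localisation cls_eq_iff zz_append)
  obtain h where h: "zz Z V h" "zeq X V (i @ h) p" "zeq Y V (j @ h) q"
   and un: "!!h'. zz Z V h' ==> zeq X V (i @ h') p ==> zeq Y V (j @ h') q ==> zeq Z V h h'"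
   using U[OF p(1) q(1)] by blast
  show ?thesis
  proof (rule ex1I[of _ "cls Z V h"])
   show "cls Z V h : Hom D Z V \<and> Comp D X Z V (cls Z V h) (cls X Z i) = f \<and>
     Comp D Y Z V (cls Z V h) (cls Y Z j) = g"
    using tr[OF h(1)] h cls_in_Hom by simp
   fix c assume c: "c : Hom D Z V \<and> Comp D X Z V c (cls X Z i) = f \<and> Comp D Y Z V c (cls Y Z j) = g"
   then obtain h' where h': "zz Z V h'" "c = cls Z V h'" by (auto simp: Hom_localisation)
   then have "zeq Z V h h'" using c tr[OF h'(1)] by (intro un) auto
   from clsI[OF this] show "c = cls Z V h" using h'(2) by simp
  qed
 qed
 then show "is_coproduct D X Y Z"
  unfolding is_coproduct_def Ob_localisation
 proof (intro conjI bexI[OF _ cls_in_Hom[OF i]] bexI[OF _ cls_in_Hom[OF j]] ballI)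
  show "X : Ob C" "Y : Ob C" "Z : Ob C" using zz_start[OF i] zz_start[OF j] zz_end[OF i] by auto
 qed (rule U')
qed

lemma zz_coproduct_unique:
 assumes c: "zz_coproduct X Y Z i j" and c': "zz_coproduct X Y Z' i' j'"
 shows "\<exists>p q. zz_iso Z Z' p q"
proof -
 have one: "zeq A A (p @ q) []"
  if c: "zz_coproduct X Y A i j" and p: "zz A B p" "zeq X B (i @ p) i'" "zeq Y B (j @ p) j'"
   and q: "zz B A q" "zeq X A (i' @ q) i" "zeq Y A (j' @ q) j" for A B i j i' j' p q
 proof -
  have ij: "zz X A i" "zz Y A j" using c by (auto simp: zz_coproduct_def)
  obtain h where un: "!!h'. zz A A h' ==> zeq X A (i @ h') i ==> zeq Y A (j @ h') j ==> zeq A A h h'"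
   using c ij unfolding zz_coproduct_def by blast
  have "zeq A A h (p @ q)"
  proof (rule un)
   show "zz A A (p @ q)" by (rule zz_append[OF p(1) q(1)])
   show "zeq X A (i @ p @ q) i" using zeq_trans[OF zeq_left[OF p(2) q(1)] q(2)] by simp
   show "zeq Y A (j @ p @ q) j" using zeq_trans[OF zeq_left[OF p(3) q(1)] q(3)] by simp
  qed
  moreover have "zeq A A h []"
   by (rule un) (use ij zz_nil[OF zz_end[OF ij(1)]] zeq_refl in auto)
  ultimately show ?thesis using zeq_trans[OF zeq_sym] by blast
 qed
 have ij: "zz X Z i" "zz Y Z j" "zz X Z' i'" "zz Y Z' j'" using c c' by (auto simp: zz_coproduct_def)
 obtain p where p: "zz Z Z' p" "zeq X Z' (i @ p) i'" "zeq Y Z' (j @ p) j'"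
  using c ij unfolding zz_coproduct_def by blast
 obtain q where q: "zz Z' Z q" "zeq X Z (i' @ q) i" "zeq Y Z (j' @ q) j"
  using c' ij unfolding zz_coproduct_def by blast
 show ?thesis using one[OF c p q] one[OF c' q p] p q unfolding zz_iso_def by blast
qed

subsection \<open>Zero objects\<close>

text \<open>A zero object of the category together with its unique morphisms, named by functions so
  that zigzags containing them can be written down.\<close>

definition zero_data :: "'o => ('o => 'm) => ('o => 'm) => bool" where
 "zero_data Z \<iota> \<tau> \<longleftrightarrow> Z : Ob C \<and> (\<forall>X\<in>Ob C. \<iota> X : Hom C Z X \<and> \<tau> X : Hom C X Z \<and>
   (\<forall>f\<in>Hom C Z X. f = \<iota> X) \<and> (\<forall>f\<in>Hom C X Z. f = \<tau> X))"

lemma zero_dataD: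
 assumes "zero_data Z \<iota> \<tau>"
 shows "Z : Ob C" "X : Ob C ==> \<iota> X : Hom C Z X" "X : Ob C ==> \<tau> X : Hom C X Z"
  "X : Ob C ==> f : Hom C Z X ==> f = \<iota> X" "X : Ob C ==> f : Hom C X Z ==> f = \<tau> X"
 using assms unfolding zero_data_def by blast+

text \<open>Uniqueness of morphisms out of a zero object has to be proved anew in the localisation.
  At a backward step along \<open>s\<close>, the morphism \<open>\<iota> X\<close> is rewritten as
  \<open>s\<close> after \<open>\<iota> Y\<close>, and \<open>s\<close> cancels.\<close>

lemma zz_from_zero:
 assumes Z: "zero_data Z \<iota> \<tau>"
 shows "zz X Y p ==> zeq Z Y ([Fwd X (\<iota> X)] @ p) [Fwd Y (\<iota> Y)]"
proof (induction rule: zigzag.induct)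
 case (nil X)
 then show ?case using Z by (auto simp: zero_data_def intro!: zeq_refl zz_fwd)
next
 case (fwd X f Y V p)
 have ob: "Z : Ob C" "Y : Ob C" using Z zz_start[OF fwd(3)] by (auto simp: zero_data_def)
 have i: "\<iota> X : Hom C Z X" using Z fwd(1) by (auto simp: zero_data_def)
 have e: "Comp C Z X Y f (\<iota> X) = \<iota> Y" using comp_hom[OF ob(1) fwd(1) ob(2) i fwd(2)] Z ob by (auto simp: zero_data_def)
 have "zeq Z V ([Fwd X (\<iota> X), Fwd Y f] @ p) ([Fwd Y (\<iota> Y)] @ p)"
  by (rule zeq_left[OF zeq_comp[OF ob(1) fwd(1) ob(2) i fwd(2) e] fwd(3)])
 from zeq_trans[OF this fwd(4)] show ?case by simp
next
 case (bwd X s Y V p)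
 have ob: "Z : Ob C" "Y : Ob C" using Z zz_start[OF bwd(4)] by (auto simp: zero_data_def)
 have i: "\<iota> Y : Hom C Z Y" using Z ob by (auto simp: zero_data_def)
 have e: "Comp C Z Y X s (\<iota> Y) = \<iota> X" using comp_hom[OF ob bwd(1) i bwd(2)] Z bwd(1) by (auto simp: zero_data_def)
 have "zeq Z Y [Fwd X (\<iota> X), Bwd Y s] [Fwd Y (\<iota> Y), Fwd X s, Bwd Y s]"
  using zeq_left[OF zeq_sym[OF zeq_comp[OF ob bwd(1) i bwd(2) e]] zz_bwd[OF bwd(1) ob(2) bwd(2,3)]] by simp
 also have "zeq Z Y [Fwd Y (\<iota> Y), Fwd X s, Bwd Y s] [Fwd Y (\<iota> Y)]"
  using zeq_right[OF zz_fwd[OF ob i] zeq_inv_l[OF ob(2) bwd(1) bwd(2,3)]] by simp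
 finally have "zeq Z V ([Fwd X (\<iota> X), Bwd Y s] @ p) ([Fwd Y (\<iota> Y)] @ p)" by (rule zeq_left) (rule bwd(4))
 from zeq_trans[OF this bwd(5)] show ?case by simp
qed

lemma zz_to_zero:
 assumes Z: "zero_data Z \<iota> \<tau>"
 shows "zz X Y p ==> zeq X Z (p @ [Fwd Z (\<tau> Y)]) [Fwd Z (\<tau> X)]"
proof (induction rule: zigzag.induct)
 case (nil X)
 then show ?case using Z by (auto simp: zero_data_def intro!: zeq_refl zz_fwd)
next
 case (fwd X f Y V p)
 have ob: "Z : Ob C" "Y : Ob C" using Z zz_start[OF fwd(3)] by (auto simp: zero_data_def)
 have i: "\<tau> Y : Hom C Y Z" using Z ob by (auto simp: zero_data_def)
 have e: "Comp C X Y Z (\<tau> Y) f = \<tau> X" using comp_hom[OF fwd(1) ob(2) ob(1) fwd(2) i] Z fwd(1) by (auto simp: zero_data_def)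
 have "zeq X Z ([Fwd Y f] @ p @ [Fwd Z (\<tau> V)]) ([Fwd Y f] @ [Fwd Z (\<tau> Y)])"
  by (rule zeq_right[OF zz_fwd[OF fwd(1) ob(2) fwd(2)] fwd(4)])
 from zeq_trans[OF this] zeq_comp[OF fwd(1) ob(2) ob(1) fwd(2) i e] show ?case by simp
next
 case (bwd X s Y V p)
 have ob: "Z : Ob C" "Y : Ob C" using Z zz_start[OF bwd(4)] by (auto simp: zero_data_def)
 have i: "\<tau> X : Hom C X Z" using Z bwd(1) by (auto simp: zero_data_def)
 have e: "Comp C Y X Z (\<tau> X) s = \<tau> Y" using comp_hom[OF ob(2) bwd(1) ob(1) bwd(2) i] Z ob by (auto simp: zero_data_def)
 have b: "zz X Y [Bwd Y s]" by (rule zz_bwd[OF bwd(1) ob(2) bwd(2,3)])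
 have "zeq X Z ([Bwd Y s] @ p @ [Fwd Z (\<tau> V)]) ([Bwd Y s] @ [Fwd Z (\<tau> Y)])"
  by (rule zeq_right[OF b bwd(5)])
 also have "zeq X Z ([Bwd Y s] @ [Fwd Z (\<tau> Y)]) ([Bwd Y s] @ [Fwd X s, Fwd Z (\<tau> X)])"
  by (rule zeq_right[OF b zeq_sym[OF zeq_comp[OF ob(2) bwd(1) ob(1) bwd(2) i e]]])
 also have "zeq X Z ([Bwd Y s] @ [Fwd X s, Fwd Z (\<tau> X)]) [Fwd Z (\<tau> X)]"
  using zeq_left[OF zeq_inv_r[OF ob(2) bwd(1) bwd(2,3)] zz_fwd[OF bwd(1) ob(1) i]] by simp
 finally show ?case by simp
qed

lemma zero_zz_unique:
 assumes Z: "zero_data Z \<iota> \<tau>"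
 shows "zz Z X p ==> zeq Z X p [Fwd X (\<iota> X)]" "zz X Z p ==> zeq X Z p [Fwd Z (\<tau> X)]"
proof -
 note ZD = zero_dataD[OF Z]
 have ob: "Z : Ob C" by (rule ZD(1))
 have i: "\<iota> Z = Idt C Z" "\<tau> Z = Idt C Z" using ZD(4,5)[OF ob id_hom[OF ob]] by simp_all
 have e: "zeq Z Z [] [Fwd Z (Idt C Z)]" by (rule zeq_sym, rule zigzag_eq.idt[OF ob])
 show "zeq Z X p [Fwd X (\<iota> X)]" if p: "zz Z X p"
  using zeq_trans[OF zeq_left[OF e p]] zz_from_zero[OF Z p] i by simp
 show "zeq X Z p [Fwd Z (\<tau> X)]" if p: "zz X Z p"
  using zeq_trans[OF zeq_right[OF p e]] zz_to_zero[OF Z p] i by simp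
qed

lemma zero_object_localisation:
 assumes Z: "zero_data Z \<iota> \<tau>"
 shows "zero_object D Z"
proof -
 have ob: "Z : Ob C" using Z by (simp add: zero_data_def)
 have "\<exists>!f. f : Hom D Z X" "\<exists>!f. f : Hom D X Z" if X: "X : Ob C" for X
 proof -
  have z: "zz Z X [Fwd X (\<iota> X)]" "zz X Z [Fwd Z (\<tau> X)]"
   using zero_dataD(1-3)[OF Z] X zz_fwd by blast+
  show "\<exists>!f. f : Hom D Z X"
  proof (rule ex1I[of "%f. f : Hom D Z X" "cls Z X [Fwd X (\<iota> X)]"])
   show "cls Z X [Fwd X (\<iota> X)] : Hom D Z X" by (rule cls_in_Hom[OF z(1)])
   fix f assume "f : Hom D Z X"
   then obtain p where p: "zz Z X p" "f = cls Z X p" unfolding Hom_localisation by blast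
   show "f = cls Z X [Fwd X (\<iota> X)]" unfolding p(2) by (rule clsI[OF zero_zz_unique(1)[OF Z p(1)]])
  qed
  show "\<exists>!f. f : Hom D X Z"
  proof (rule ex1I[of "%f. f : Hom D X Z" "cls X Z [Fwd Z (\<tau> X)]"])
   show "cls X Z [Fwd Z (\<tau> X)] : Hom D X Z" by (rule cls_in_Hom[OF z(2)])
   fix f assume "f : Hom D X Z"
   then obtain p where p: "zz X Z p" "f = cls X Z p" unfolding Hom_localisation by blast
   show "f = cls X Z [Fwd Z (\<tau> X)]" unfolding p(2) by (rule clsI[OF zero_zz_unique(2)[OF Z p(1)]])
  qed
 qed
 then show ?thesis using ob by (simp add: zero_object_def initial_object_def)
qed

text \<open>An initial object has only one endomorphism, so its identity equals the composite
  through \<open>Z\<close>. This serves the empty coproduct in \<open>add_closure\<close>, which is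
  only known to be initial.\<close>

lemma initial_object_iso_zero:
 assumes Z: "zero_data Z \<iota> \<tau>" and X: "initial_object D X"
 shows "\<exists>p q. zz_iso X Z p q"
proof -
 have ob: "X : Ob C" "Z : Ob C" using X zero_dataD(1)[OF Z] by (simp_all add: initial_object_def)
 have z: "zz Z X [Fwd X (\<iota> X)]" "zz X Z [Fwd Z (\<tau> X)]"
  using zero_dataD(1-3)[OF Z] ob(1) zz_fwd by blast+
 have "\<exists>!f. f : Hom D X X" using X ob(1) unfolding initial_object_def Ob_localisation by blast
 then obtain f where u: "!!y. y : Hom D X X ==> y = f" by blast
 have m: "cls X X [] : Hom D X X" "cls X X ([Fwd Z (\<tau> X)] @ [Fwd X (\<iota> X)]) : Hom D X X"
  by (intro cls_in_Hom zz_nil ob, intro cls_in_Hom zz_append[OF z(2,1)])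
 have "cls X X ([Fwd Z (\<tau> X)] @ [Fwd X (\<iota> X)]) = cls X X []" unfolding u[OF m(1)] u[OF m(2)] ..
 then have "zeq X X ([Fwd Z (\<tau> X)] @ [Fwd X (\<iota> X)]) []" unfolding cls_eq_iff[OF zz_append[OF z(2,1)]] .
 moreover have "zeq Z Z ([Fwd X (\<iota> X)] @ [Fwd Z (\<tau> X)]) []"
  by (rule zeq_trans[OF zero_zz_unique(1)[OF Z zz_append[OF z]] zeq_sym[OF zero_zz_unique(1)[OF Z zz_nil[OF ob(2)]]]])
 ultimately show ?thesis using z unfolding zz_iso_def by blast
qed

text \<open>Coproducts are determined only up to isomorphism, so any \<open>Y\<close> isomorphic to
  \<open>X\<close> is a coproduct of \<open>X\<close> and zero. In this way
  \<open>add_closure\<close> becomes closed under isomorphism.\<close>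

lemma coproduct_with_zero:
 assumes Z: "zero_data Z \<iota> \<tau>" and iso: "zz_iso X Y p q"
 shows "is_coproduct D X Z Y"
proof -
 have z: "zz X Y p" "zz Y X q" "zeq X X (p @ q) []" "zeq Y Y (q @ p) []" using iso by (auto simp: zz_iso_def)
 have ob: "Z : Ob C" "Y : Ob C" using zero_dataD(1)[OF Z] zz_end[OF z(1)] by blast+
 have j: "zz Z Y [Fwd Y (\<iota> Y)]" by (rule zz_fwd[OF ob zero_dataD(2)[OF Z ob(2)]])
 have "zz_coproduct X Z Y p [Fwd Y (\<iota> Y)]"
  unfolding zz_coproduct_def
 proof (intro conjI allI impI)
  fix V f g assume f: "zz X V f" and g: "zz Z V g"
  show "\<exists>h. zz Y V h \<and> zeq X V (p @ h) f \<and> zeq Z V ([Fwd Y (\<iota> Y)] @ h) g \<and>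
      (\<forall>h'. zz Y V h' --> zeq X V (p @ h') f --> zeq Z V ([Fwd Y (\<iota> Y)] @ h') g --> zeq Y V h h')"
  proof (intro exI[of _ "q @ f"] conjI allI impI)
   show "zz Y V (q @ f)" by (rule zz_append[OF z(2) f])
   show "zeq X V (p @ q @ f) f" using zeq_left[OF z(3) f] by simp
   show "zeq Z V ([Fwd Y (\<iota> Y)] @ q @ f) g"
    by (rule zeq_trans[OF zero_zz_unique(1)[OF Z zz_append[OF j zz_append[OF z(2) f]]]
       zeq_sym[OF zero_zz_unique(1)[OF Z g]]])
   fix h assume h: "zz Y V h" "zeq X V (p @ h) f"
   have "zeq Y V (q @ p @ h) (q @ f)" by (rule zeq_right[OF z(2) h(2)])
   moreover have "zeq Y V (q @ p @ h) h" using zeq_left[OF z(4) h(1)] by simp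
   ultimately show "zeq Y V (q @ f) h" by (rule zeq_trans[OF zeq_sym])
  qed
 qed (use z j in auto)
 then show ?thesis unfolding is_coproduct_localisation by blast
qed

end

section \<open>Coproducts in localisations\<close>

text \<open>A choice \<open>S\<close> of binary coproducts; by \<open>sum_W\<close> the sum functors
  preserve \<open>W\<close> and therefore act on zigzags.\<close>

locale localising_coproducts = localising_category C W
 for C :: "('o, 'm, 'z) category_scheme" and W :: "'o => 'o => 'm set" +
 fixes S :: "'o => 'o => 'o" and i j :: "'o => 'o => 'm"
 assumes S_ob: "X : Ob C ==> Y : Ob C ==> S X Y : Ob C"
  and i_hom: "X : Ob C ==> Y : Ob C ==> i X Y : Hom C X (S X Y)"
  and j_hom: "X : Ob C ==> Y : Ob C ==> j X Y : Hom C Y (S X Y)"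
  and copair_exists: "[|X : Ob C; Y : Ob C; Z : Ob C; f : Hom C X Z; g : Hom C Y Z|] ==>
   \<exists>h\<in>Hom C (S X Y) Z. Comp C X (S X Y) Z h (i X Y) = f \<and> Comp C Y (S X Y) Z h (j X Y) = g"
  and copair_unique: "[|X : Ob C; Y : Ob C; Z : Ob C; h : Hom C (S X Y) Z; h' : Hom C (S X Y) Z;
   Comp C X (S X Y) Z h (i X Y) = Comp C X (S X Y) Z h' (i X Y);
   Comp C Y (S X Y) Z h (j X Y) = Comp C Y (S X Y) Z h' (j X Y)|] ==> h = h'"
  and sum_W: "[|X : Ob C; X' : Ob C; Y : Ob C; Y' : Ob C; s : Hom C X X'; s : W X X'; t : Hom C Y Y'; t : W Y Y';
   h : Hom C (S X Y) (S X' Y'); Comp C X (S X Y) (S X' Y') h (i X Y) = Comp C X X' (S X' Y') (i X' Y') s;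
   Comp C Y (S X Y) (S X' Y') h (j X Y) = Comp C Y Y' (S X' Y') (j X' Y') t|] ==> h : W (S X Y) (S X' Y')"
begin

definition copair where
 "copair X Y Z f g = (SOME h. h : Hom C (S X Y) Z \<and> Comp C X (S X Y) Z h (i X Y) = f \<and> Comp C Y (S X Y) Z h (j X Y) = g)"

lemma copair:
 assumes "X : Ob C" "Y : Ob C" "Z : Ob C" "f : Hom C X Z" "g : Hom C Y Z"
 shows "copair X Y Z f g : Hom C (S X Y) Z" "Comp C X (S X Y) Z (copair X Y Z f g) (i X Y) = f"
  "Comp C Y (S X Y) Z (copair X Y Z f g) (j X Y) = g"
proof -
 have "\<exists>h. h : Hom C (S X Y) Z \<and> Comp C X (S X Y) Z h (i X Y) = f \<and> Comp C Y (S X Y) Z h (j X Y) = g"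
  using copair_exists[OF assms] by blast
 from someI_ex[OF this, folded copair_def]
 show "copair X Y Z f g : Hom C (S X Y) Z" "Comp C X (S X Y) Z (copair X Y Z f g) (i X Y) = f"
  "Comp C Y (S X Y) Z (copair X Y Z f g) (j X Y) = g" by blast+
qed

definition sum_map where
 "sum_map X X' Y Y' f g =
   copair X Y (S X' Y') (Comp C X X' (S X' Y') (i X' Y') f) (Comp C Y Y' (S X' Y') (j X' Y') g)"

lemma sum_map:
 assumes "X : Ob C" "X' : Ob C" "Y : Ob C" "Y' : Ob C" "f : Hom C X X'" "g : Hom C Y Y'"
 shows "sum_map X X' Y Y' f g : Hom C (S X Y) (S X' Y')"
  "Comp C X (S X Y) (S X' Y') (sum_map X X' Y Y' f g) (i X Y) = Comp C X X' (S X' Y') (i X' Y') f"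
  "Comp C Y (S X Y) (S X' Y') (sum_map X X' Y Y' f g) (j X Y) = Comp C Y Y' (S X' Y') (j X' Y') g"
proof -
 have o: "S X' Y' : Ob C" using S_ob assms by simp
 have h: "Comp C X X' (S X' Y') (i X' Y') f : Hom C X (S X' Y')" "Comp C Y Y' (S X' Y') (j X' Y') g : Hom C Y (S X' Y')"
  by (rule comp_hom[OF assms(1,2) o assms(5) i_hom[OF assms(2,4)]],
    rule comp_hom[OF assms(3,4) o assms(6) j_hom[OF assms(2,4)]])
 show "sum_map X X' Y Y' f g : Hom C (S X Y) (S X' Y')"
  "Comp C X (S X Y) (S X' Y') (sum_map X X' Y Y' f g) (i X Y) = Comp C X X' (S X' Y') (i X' Y') f"
  "Comp C Y (S X Y) (S X' Y') (sum_map X X' Y Y' f g) (j X Y) = Comp C Y Y' (S X' Y') (j X' Y') g"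
  unfolding sum_map_def using copair[OF assms(1,3) o h] by blast+
qed

lemma sum_map_comp:
 assumes o: "X : Ob C" "X' : Ob C" "X'' : Ob C" "Y : Ob C" "Y' : Ob C" "Y'' : Ob C"
  and f: "f : Hom C X X'" "f' : Hom C X' X''" and g: "g : Hom C Y Y'" "g' : Hom C Y' Y''"
 shows "Comp C (S X Y) (S X' Y') (S X'' Y'') (sum_map X' X'' Y' Y'' f' g') (sum_map X X' Y Y' f g)
  = sum_map X X'' Y Y'' (Comp C X X' X'' f' f) (Comp C Y Y' Y'' g' g)" (is "?l = ?r")
proof -
 have S: "S X Y : Ob C" "S X' Y' : Ob C" "S X'' Y'' : Ob C" using S_ob o by auto
 note a = sum_map[OF o(1,2,4,5) f(1) g(1)] and b = sum_map[OF o(2,3,5,6) f(2) g(2)]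
 have ff: "Comp C X X' X'' f' f : Hom C X X''" "Comp C Y Y' Y'' g' g : Hom C Y Y''"
  using comp_hom o f g by blast+
 note c = sum_map[OF o(1,3,4,6) ff]
 show ?thesis
 proof (rule copair_unique[OF o(1,4) S(3) comp_hom[OF S a(1) b(1)] c(1)])
  have "Comp C X (S X Y) (S X'' Y'') ?l (i X Y) = Comp C X X' (S X'' Y'') (Comp C X' (S X' Y') (S X'' Y'') (sum_map X' X'' Y' Y'' f' g') (i X' Y')) f"
   using comp_assoc[OF o(1) S(1,2,3) i_hom[OF o(1,4)] a(1) b(1)] a(2)
    comp_assoc[OF o(1,2) S(2,3) f(1) i_hom[OF o(2,5)] b(1)] by simp
  also have "\<dots> = Comp C X X'' (S X'' Y'') (i X'' Y'') (Comp C X X' X'' f' f)"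
   using b(2) comp_assoc[OF o(1,2,3) S(3) f i_hom[OF o(3,6)]] by simp
  finally show "Comp C X (S X Y) (S X'' Y'') ?l (i X Y) = Comp C X (S X Y) (S X'' Y'') ?r (i X Y)" using c(2) by simp
  have "Comp C Y (S X Y) (S X'' Y'') ?l (j X Y) = Comp C Y Y' (S X'' Y'') (Comp C Y' (S X' Y') (S X'' Y'') (sum_map X' X'' Y' Y'' f' g') (j X' Y')) g"
   using comp_assoc[OF o(4) S(1,2,3) j_hom[OF o(1,4)] a(1) b(1)] a(3)
    comp_assoc[OF o(4,5) S(2,3) g(1) j_hom[OF o(2,5)] b(1)] by simp
  also have "\<dots> = Comp C Y Y'' (S X'' Y'') (j X'' Y'') (Comp C Y Y' Y'' g' g)"
   using b(3) comp_assoc[OF o(4,5,6) S(3) g j_hom[OF o(3,6)]] by simp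
  finally show "Comp C Y (S X Y) (S X'' Y'') ?l (j X Y) = Comp C Y (S X Y) (S X'' Y'') ?r (j X Y)" using c(3) by simp
 qed
qed

lemma sum_map_id:
 assumes o: "X : Ob C" "Y : Ob C"
 shows "sum_map X X Y Y (Idt C X) (Idt C Y) = Idt C (S X Y)"
proof -
 have S: "S X Y : Ob C" using S_ob o by simp
 note a = sum_map[OF o(1,1,2,2) id_hom[OF o(1)] id_hom[OF o(2)]]
 show ?thesis
  by (rule copair_unique[OF o S a(1) id_hom[OF S]])
    (simp_all add: a(2,3) comp_id_right comp_id_left i_hom j_hom o S)
qed

lemma sum_map_W:
 assumes "X : Ob C" "X' : Ob C" "Y : Ob C" "Y' : Ob C" "f : Hom C X X'" "f : W X X'" "g : Hom C Y Y'" "g : W Y Y'"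
 shows "sum_map X X' Y Y' f g : W (S X Y) (S X' Y')"
 by (rule sum_W[OF assms]) (rule sum_map, use assms in simp_all)+

text \<open>The sum as a functor of one argument. Two zigzags of different shapes cannot be run in
  parallel, so the bifunctor is applied one argument at a time.\<close>

abbreviation "FL Y \<equiv> zmap (%X. S X Y) (%X X' f. sum_map X X' Y Y f (Idt C Y))"
abbreviation "FR X \<equiv> zmap (%Y. S X Y) (%Y Y' g. sum_map X X Y Y' (Idt C X) g)"

lemma FL_functor: "Y : Ob C ==> endofunctor (%X. S X Y) (%X X' f. sum_map X X' Y Y f (Idt C Y))"
 unfolding endofunctor_def
 by (intro conjI ballI impI) (simp_all add: S_ob sum_map_id sum_map sum_map_W id_hom id_W sum_map_comp comp_id_left)

lemma FR_functor: "X : Ob C ==> endofunctor (%Y. S X Y) (%Y Y' g. sum_map X X Y Y' (Idt C X) g)"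
 unfolding endofunctor_def
 by (intro conjI ballI impI) (simp_all add: S_ob sum_map_id sum_map sum_map_W id_hom id_W sum_map_comp comp_id_left)

lemma natural_i_FL: "Y : Ob C ==> natural (%X. X) (%X X' f. f) (%X. S X Y) (%X X' f. sum_map X X' Y Y f (Idt C Y)) (%X. i X Y)"
 unfolding natural_def by (auto simp: i_hom sum_map id_hom)

lemma natural_j_FR: "X : Ob C ==> natural (%Y. Y) (%Y Y' f. f) (%Y. S X Y) (%Y Y' g. sum_map X X Y Y' (Idt C X) g) (%Y. j X Y)"
 unfolding natural_def by (auto simp: j_hom sum_map id_hom)

lemma natural_j_FL: "Y : Ob C ==> natural (%X. Y) (%X X' f. Idt C Y) (%X. S X Y) (%X X' f. sum_map X X' Y Y f (Idt C Y)) (%X. j X Y)"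
 unfolding natural_def by (auto simp: j_hom sum_map id_hom)

lemma natural_i_FR: "X : Ob C ==> natural (%Y. X) (%Y Y' f. Idt C X) (%Y. S X Y) (%Y Y' g. sum_map X X Y Y' (Idt C X) g) (%Y. i X Y)"
 unfolding natural_def by (auto simp: i_hom sum_map id_hom)

lemma natural_FL:
 assumes "A : Ob C" "B : Ob C" "t : Hom C A B"
 shows "natural (%X. S X A) (%X X' f. sum_map X X' A A f (Idt C A)) (%X. S X B) (%X X' f. sum_map X X' B B f (Idt C B))
  (%X. sum_map X X A B (Idt C X) t)"
 unfolding natural_def using assms by (auto simp: sum_map id_hom sum_map_comp comp_id_left comp_id_right)

abbreviation "nabla Z \<equiv> copair Z Z Z (Idt C Z) (Idt C Z)"

lemma nabla_natural:
 assumes o: "A : Ob C" "B : Ob C" and f: "f : Hom C A B"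
 shows "Comp C (S A A) (S B B) B (nabla B) (sum_map A B A B f f) = Comp C (S A A) A B f (nabla A)"
proof -
 have S: "S A A : Ob C" "S B B : Ob C" using S_ob o by auto
 note n = copair[OF o(1) o(1) o(1) id_hom[OF o(1)] id_hom[OF o(1)]] and n' = copair[OF o(2) o(2) o(2) id_hom[OF o(2)] id_hom[OF o(2)]]
 note s = sum_map[OF o o f f]
 show ?thesis
 proof (rule copair_unique[OF o(1,1,2) comp_hom[OF S o(2) s(1) n'(1)] comp_hom[OF S(1) o n(1) f]])
  show "Comp C A (S A A) B (Comp C (S A A) (S B B) B (nabla B) (sum_map A B A B f f)) (i A A) =
   Comp C A (S A A) B (Comp C (S A A) A B f (nabla A)) (i A A)"
   using comp_assoc[OF o(1) S o(2) i_hom[OF o(1,1)] s(1) n'(1)] comp_assoc[OF o S(2) o(2) f i_hom[OF o(2,2)] n'(1)]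
    comp_assoc[OF o(1) S(1) o i_hom[OF o(1,1)] n(1) f]
   by (simp add: s n n' comp_id_left comp_id_right o f)
  show "Comp C A (S A A) B (Comp C (S A A) (S B B) B (nabla B) (sum_map A B A B f f)) (j A A) =
   Comp C A (S A A) B (Comp C (S A A) A B f (nabla A)) (j A A)"
   using comp_assoc[OF o(1) S o(2) j_hom[OF o(1,1)] s(1) n'(1)] comp_assoc[OF o S(2) o(2) f j_hom[OF o(2,2)] n'(1)]
    comp_assoc[OF o(1) S(1) o j_hom[OF o(1,1)] n(1) f]
   by (simp add: s n n' comp_id_left comp_id_right o f)
 qed
qed

lemma nabla_zz: "Z : Ob C ==> zz (S Z Z) Z [Fwd Z (nabla Z)]"
 by (intro zz_fwd S_ob copair id_hom)

lemma nabla_square: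
 assumes o: "A : Ob C" "B : Ob C" and f: "f : Hom C A B"
 shows "zeq (S A A) B ([Fwd (S B A) (sum_map A B A A f (Idt C A))] @ [Fwd (S B B) (sum_map B B A B (Idt C B) f)] @ [Fwd B (nabla B)])
  ([Fwd A (nabla A)] @ [Fwd B f])"
proof -
 have S: "S A A : Ob C" "S B B : Ob C" "S B A : Ob C" using S_ob o by auto
 have c: "Comp C (S A A) (S B A) (S B B) (sum_map B B A B (Idt C B) f) (sum_map A B A A f (Idt C A)) = sum_map A B A B f f"
  by (simp add: sum_map_comp o f id_hom comp_id_left comp_id_right)
 note n = copair(1)[OF o(1) o(1) o(1) id_hom[OF o(1)] id_hom[OF o(1)]] and n' = copair(1)[OF o(2) o(2) o(2) id_hom[OF o(2)] id_hom[OF o(2)]]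
 have "zeq (S A A) B ([Fwd (S B A) (sum_map A B A A f (Idt C A)), Fwd (S B B) (sum_map B B A B (Idt C B) f)] @ [Fwd B (nabla B)])
   ([Fwd (S B B) (sum_map A B A B f f)] @ [Fwd B (nabla B)])"
  by (rule zeq_left[OF zeq_comp[OF S(1,3,2) _ _ c] nabla_zz[OF o(2)]]) (simp_all add: sum_map o f id_hom)
 also have "zeq (S A A) B ([Fwd (S B B) (sum_map A B A B f f)] @ [Fwd B (nabla B)]) ([Fwd A (nabla A)] @ [Fwd B f])"
  using zeq_square[OF S(1,2) o(1) o(2) _ n' n f nabla_natural[OF o f]] by (simp add: sum_map o f)
 finally show ?thesis by simp
qed

text \<open>Naturality of the codiagonal with respect to zigzags: running \<open>h\<close> on the
  first copy, then on the second, then folding, is folding and then running \<open>h\<close> once.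
  In the induction the first step of the second copy is slid past the rest of the first copy, so
  that it meets the fold.\<close>

lemma fold_zigzag:
 "zz A Z h ==> zeq (S A A) Z (FL A A h @ FR Z A h @ [Fwd Z (nabla Z)]) ([Fwd A (nabla A)] @ h)"
proof (induction rule: zigzag.induct)
 case (nil X)
 then show ?case using nabla_zz by (simp add: zeq_refl)
next
 case (fwd A f B Z p)
 have B: "B : Ob C" and Z: "Z : Ob C" using zz_start[OF fwd(3)] zz_end[OF fwd(3)] by auto
 have S: "S A A : Ob C" "S B A : Ob C" "S B B : Ob C" "S Z A : Ob C" "S Z B : Ob C" "S Z Z : Ob C"
  using S_ob fwd(1) B Z by auto
 let ?a = "[Fwd (S B A) (sum_map A B A A f (Idt C A))]" and ?b = "[Fwd (S Z B) (sum_map Z Z A B (Idt C Z) f)]"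
  and ?c = "[Fwd (S B B) (sum_map B B A B (Idt C B) f)]" and ?n = "[Fwd Z (nabla Z)]"
 have a: "zz (S A A) (S B A) ?a" and b: "zz (S Z A) (S Z B) ?b" and c: "zz (S B A) (S B B) ?c" and n: "zz (S Z Z) Z ?n"
  using S fwd(1,2) B Z by (auto intro!: zz_fwd sum_map id_hom nabla_zz)
 have Lp: "zz (S B A) (S Z A) (FL A B p)" by (rule zmap_zz[OF FL_functor[OF fwd(1)] fwd(3)])
 have Rp: "zz (S Z B) (S Z Z) (FR Z B p)" by (rule zmap_zz[OF FR_functor[OF Z] fwd(3)])
 have slide: "zeq (S B A) (S Z B) (FL A B p @ ?b) (?c @ FL B B p)"
  by (rule zmap_natural[OF FL_functor[OF fwd(1)] FL_functor[OF B] natural_FL[OF fwd(1) B fwd(2)] fwd(3)])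
 have "zeq (S A A) Z (?a @ (FL A B p @ ?b) @ FR Z B p @ ?n) (?a @ (?c @ FL B B p) @ FR Z B p @ ?n)"
  by (rule zeq_right[OF a zeq_left[OF slide zz_append[OF Rp n]]])
 also have "zeq (S A A) Z (?a @ (?c @ FL B B p) @ FR Z B p @ ?n) ((?a @ ?c) @ ([Fwd B (nabla B)] @ p))"
  using zeq_right[OF zz_append[OF a c] fwd(4)] by simp
 also have "zeq (S A A) Z ((?a @ ?c) @ ([Fwd B (nabla B)] @ p)) (([Fwd A (nabla A)] @ [Fwd B f]) @ p)"
  using zeq_left[OF nabla_square[OF fwd(1) B fwd(2)] fwd(3)] by simp
 finally show ?case by simp
next
 case (bwd A s B Z p)
 have B: "B : Ob C" and Z: "Z : Ob C" using zz_start[OF bwd(4)] zz_end[OF bwd(4)] by auto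
 have S: "S A A : Ob C" "S B A : Ob C" "S B B : Ob C" "S Z A : Ob C" "S Z B : Ob C" "S Z Z : Ob C"
  using S_ob bwd(1) B Z by auto
 note iA = id_hom[OF bwd(1)] id_W[OF bwd(1)] and iB = id_hom[OF B] id_W[OF B] and iZ = id_hom[OF Z] id_W[OF Z]
 have h1: "sum_map B A A A s (Idt C A) : Hom C (S B A) (S A A)" "sum_map B A A A s (Idt C A) : W (S B A) (S A A)"
  and h2: "sum_map Z Z B A (Idt C Z) s : Hom C (S Z B) (S Z A)" "sum_map Z Z B A (Idt C Z) s : W (S Z B) (S Z A)"
  and h3: "sum_map B B B A (Idt C B) s : Hom C (S B B) (S B A)" "sum_map B B B A (Idt C B) s : W (S B B) (S B A)"
  using bwd(1-3) B Z iA iB iZ by (simp_all add: sum_map sum_map_W)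
 let ?a = "[Bwd (S B A) (sum_map B A A A s (Idt C A))]" and ?b = "[Bwd (S Z B) (sum_map Z Z B A (Idt C Z) s)]"
  and ?c = "[Bwd (S B B) (sum_map B B B A (Idt C B) s)]" and ?n = "[Fwd Z (nabla Z)]"
 have a: "zz (S A A) (S B A) ?a" and b: "zz (S Z A) (S Z B) ?b" and c: "zz (S B A) (S B B) ?c" and n: "zz (S Z Z) Z ?n"
  using S h1 h2 h3 Z by (auto intro!: zz_bwd nabla_zz)
 have LpA: "zz (S B A) (S Z A) (FL A B p)" by (rule zmap_zz[OF FL_functor[OF bwd(1)] bwd(4)])
 have LpB: "zz (S B B) (S Z B) (FL B B p)" by (rule zmap_zz[OF FL_functor[OF B] bwd(4)])
 have Rp: "zz (S Z B) (S Z Z) (FR Z B p)" by (rule zmap_zz[OF FR_functor[OF Z] bwd(4)])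
 have sq: "zeq (S B B) (S Z A) (FL B B p @ [Fwd (S Z A) (sum_map Z Z B A (Idt C Z) s)])
   ([Fwd (S B A) (sum_map B B B A (Idt C B) s)] @ FL A B p)"
  by (rule zmap_natural[OF FL_functor[OF B] FL_functor[OF bwd(1)] natural_FL[OF B bwd(1,2)] bwd(4)])
 have slide: "zeq (S B A) (S Z B) (FL A B p @ ?b) (?c @ FL B B p)"
  by (rule zeq_bwd_slide[OF S(2,3,4,5) h3 h2 LpA LpB sq])
 have "zeq (S B B) A (([Fwd (S B A) (sum_map B B B A (Idt C B) s)] @ [Fwd (S A A) (sum_map B A A A s (Idt C A))]) @ [Fwd A (nabla A)])
   ([Fwd B (nabla B)] @ [Fwd A s])"
 proof -
  have c1: "Comp C (S B B) (S B A) (S A A) (sum_map B A A A s (Idt C A)) (sum_map B B B A (Idt C B) s) = sum_map B A B A s s"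
   using bwd(1,2) B iA iB by (simp add: sum_map_comp comp_id_left comp_id_right)
  have "zeq (S B B) A ([Fwd (S B A) (sum_map B B B A (Idt C B) s), Fwd (S A A) (sum_map B A A A s (Idt C A))] @ [Fwd A (nabla A)])
   ([Fwd (S A A) (sum_map B A B A s s)] @ [Fwd A (nabla A)])"
   by (rule zeq_left[OF zeq_comp[OF S(3,2,1) h3(1) h1(1) c1] nabla_zz[OF bwd(1)]])
  also have "zeq (S B B) A ([Fwd (S A A) (sum_map B A B A s s)] @ [Fwd A (nabla A)]) ([Fwd B (nabla B)] @ [Fwd A s])"
   using zeq_square[OF S(3,1) B bwd(1) _ copair(1)[OF bwd(1,1,1) iA(1,1)] copair(1)[OF B B B iB(1,1)] bwd(2) nabla_natural[OF B bwd(1,2)]]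
    sum_map(1)[OF B bwd(1) B bwd(1) bwd(2,2)] by simp
  finally show ?thesis by simp
 qed
 then have sq2: "zeq (S B B) A ([Fwd B (nabla B)] @ [Fwd A s])
   ([Fwd (S B A) (sum_map B B B A (Idt C B) s)] @ [Fwd (S A A) (sum_map B A A A s (Idt C A))] @ [Fwd A (nabla A)])"
  using zeq_sym by simp
 have nA: "zz (S A A) A [Fwd A (nabla A)]" and nB: "zz (S B B) B [Fwd B (nabla B)]"
  by (rule nabla_zz[OF bwd(1)], rule nabla_zz[OF B])
 have fa: "zz (S B A) (S A A) [Fwd (S A A) (sum_map B A A A s (Idt C A))]" by (rule zz_fwd[OF S(2,1) h1(1)])
 have sl1: "zeq (S B A) B (([Fwd (S A A) (sum_map B A A A s (Idt C A))] @ [Fwd A (nabla A)]) @ [Bwd B s]) (?c @ [Fwd B (nabla B)])"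
  by (rule zeq_bwd_slide[OF S(2,3) bwd(1) B h3 bwd(2,3) zz_append[OF fa nA] nB sq2])
 have sl2: "zeq (S A A) B ([Fwd A (nabla A)] @ [Bwd B s]) (?a @ ?c @ [Fwd B (nabla B)])"
 proof -
  have bs: "zz A B [Bwd B s]" by (rule zz_bwd[OF bwd(1) B bwd(2,3)])
  have "zeq (S A A) B (?a @ ([Fwd (S A A) (sum_map B A A A s (Idt C A))] @ [Fwd A (nabla A)] @ [Bwd B s])) ([Fwd A (nabla A)] @ [Bwd B s])"
   using zeq_left[OF zeq_inv_r[OF S(2,1) h1] zz_append[OF nA bs]] by simp
  then show ?thesis using zeq_trans[OF zeq_sym zeq_right[OF a sl1]] by simp
 qed
 have "zeq (S A A) Z (?a @ (FL A B p @ ?b) @ FR Z B p @ ?n) (?a @ (?c @ FL B B p) @ FR Z B p @ ?n)"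
  by (rule zeq_right[OF a zeq_left[OF slide zz_append[OF Rp n]]])
 also have "zeq (S A A) Z (?a @ (?c @ FL B B p) @ FR Z B p @ ?n) ((?a @ ?c) @ ([Fwd B (nabla B)] @ p))"
  using zeq_right[OF zz_append[OF a c] bwd(5)] by simp
 also have "zeq (S A A) Z ((?a @ ?c) @ ([Fwd B (nabla B)] @ p)) (([Fwd A (nabla A)] @ [Bwd B s]) @ p)"
  using zeq_left[OF zeq_sym[OF sl2] bwd(4)] by simp
 finally show ?case by simp
qed

text \<open>Existence: run \<open>f\<close> on the first and \<open>g\<close> on the second summand,
  which ends in two copies of \<open>Z\<close>, and fold. Uniqueness: the identity of the sum is the
  map into two copies of the sum given by both inclusions, followed by the fold. By
  \<open>fold_zigzag\<close> a competitor \<open>h\<close> can be moved in front of the fold, where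
  only its restrictions to \<open>X\<close> and \<open>Y\<close> appear.\<close>

theorem zz_coproduct_sum:
 assumes o: "X : Ob C" "Y : Ob C"
 shows "zz_coproduct X Y (S X Y) [Fwd (S X Y) (i X Y)] [Fwd (S X Y) (j X Y)]"
 unfolding zz_coproduct_def
proof (intro conjI allI impI)
 have S: "S X Y : Ob C" using S_ob o by simp
 show iz: "zz X (S X Y) [Fwd (S X Y) (i X Y)]" and jz: "zz Y (S X Y) [Fwd (S X Y) (j X Y)]"
  by (rule zz_fwd[OF o(1) S i_hom[OF o]], rule zz_fwd[OF o(2) S j_hom[OF o]])
 let ?i = "[Fwd (S X Y) (i X Y)]" and ?j = "[Fwd (S X Y) (j X Y)]"
 fix Z f g assume f: "zz X Z f" and g: "zz Y Z g"
 have Z: "Z : Ob C" by (rule zz_end[OF f])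
 have SZ: "S Z Y : Ob C" "S Z Z : Ob C" using S_ob o Z by auto
 let ?n = "[Fwd Z (nabla Z)]"
 have n: "zz (S Z Z) Z ?n" by (rule nabla_zz[OF Z])
 have n_hom: "nabla Z : Hom C (S Z Z) Z" "Comp C Z (S Z Z) Z (nabla Z) (i Z Z) = Idt C Z"
  "Comp C Z (S Z Z) Z (nabla Z) (j Z Z) = Idt C Z" by (rule copair[OF Z Z Z id_hom[OF Z] id_hom[OF Z]])+
 have Lf: "zz (S X Y) (S Z Y) (FL Y X f)" by (rule zmap_zz[OF FL_functor[OF o(2)] f])
 have Rg: "zz (S Z Y) (S Z Z) (FR Z Y g)" by (rule zmap_zz[OF FR_functor[OF Z] g])
 let ?h = "FL Y X f @ FR Z Y g @ ?n"
 have ni: "zeq Z Z ([Fwd (S Z Z) (i Z Z)] @ ?n) []" "zeq Z Z ([Fwd (S Z Z) (j Z Z)] @ ?n) []"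
  using zeq_trans[OF zeq_comp[OF Z SZ(2) Z i_hom[OF Z Z] n_hom(1,2)] zigzag_eq.idt[OF Z]]
   zeq_trans[OF zeq_comp[OF Z SZ(2) Z j_hom[OF Z Z] n_hom(1,3)] zigzag_eq.idt[OF Z]] by simp_all
 have i1: "zeq X (S Z Y) (?i @ FL Y X f) (f @ [Fwd (S Z Y) (i Z Y)])"
  using zeq_sym[OF zmap_natural[OF endofunctor_identity FL_functor[OF o(2)] natural_i_FL[OF o(2)] f]]
  by (simp add: zmap_identity)
 have i2: "zeq Z (S Z Z) ([Fwd (S Z Y) (i Z Y)] @ FR Z Y g) [Fwd (S Z Z) (i Z Z)]"
  using zeq_trans[OF zeq_sym[OF zmap_natural[OF endofunctor_const[OF Z] FR_functor[OF Z] natural_i_FR[OF Z] g]]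
    zeq_left[OF zmap_const[OF g Z] zz_fwd[OF Z SZ(2) i_hom[OF Z Z]]]] by simp
 have j1: "zeq Y (S Z Y) (?j @ FL Y X f) [Fwd (S Z Y) (j Z Y)]"
  using zeq_trans[OF zeq_sym[OF zmap_natural[OF endofunctor_const[OF o(2)] FL_functor[OF o(2)] natural_j_FL[OF o(2)] f]]
    zeq_left[OF zmap_const[OF f o(2)] zz_fwd[OF o(2) SZ(1) j_hom[OF Z o(2)]]]] by simp
 have j2: "zeq Y (S Z Z) ([Fwd (S Z Y) (j Z Y)] @ FR Z Y g) (g @ [Fwd (S Z Z) (j Z Z)])"
  using zeq_sym[OF zmap_natural[OF endofunctor_identity FR_functor[OF Z] natural_j_FR[OF Z] g]]
  by (simp add: zmap_identity)
 show "\<exists>h. zz (S X Y) Z h \<and> zeq X Z (?i @ h) f \<and> zeq Y Z (?j @ h) g \<and>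
   (\<forall>h'. zz (S X Y) Z h' --> zeq X Z (?i @ h') f --> zeq Y Z (?j @ h') g --> zeq (S X Y) Z h h')"
 proof (intro exI[of _ ?h] conjI allI impI)
  show "zz (S X Y) Z ?h" by (intro zz_append[OF Lf] zz_append[OF Rg] n)
  have "zeq X Z ((?i @ FL Y X f) @ FR Z Y g @ ?n) ((f @ [Fwd (S Z Y) (i Z Y)]) @ FR Z Y g @ ?n)"
   by (rule zeq_left[OF i1 zz_append[OF Rg n]])
  also have "zeq X Z ((f @ [Fwd (S Z Y) (i Z Y)]) @ FR Z Y g @ ?n) (f @ [Fwd (S Z Z) (i Z Z)] @ ?n)"
   using zeq_right[OF f zeq_left[OF i2 n]] by simp
  also have "zeq X Z (f @ [Fwd (S Z Z) (i Z Z)] @ ?n) f" using zeq_right[OF f ni(1)] by simp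
  finally show "zeq X Z (?i @ ?h) f" by simp
  have "zeq Y Z ((?j @ FL Y X f) @ FR Z Y g @ ?n) ([Fwd (S Z Y) (j Z Y)] @ FR Z Y g @ ?n)"
   by (rule zeq_left[OF j1 zz_append[OF Rg n]])
  also have "zeq Y Z ([Fwd (S Z Y) (j Z Y)] @ FR Z Y g @ ?n) (g @ [Fwd (S Z Z) (j Z Z)] @ ?n)"
   using zeq_left[OF j2 n] by simp
  also have "zeq Y Z (g @ [Fwd (S Z Z) (j Z Z)] @ ?n) g" using zeq_right[OF g ni(2)] by simp
  finally show "zeq Y Z (?j @ ?h) g" by simp
  fix h assume h: "zz (S X Y) Z h" and hf: "zeq X Z (?i @ h) f" and hg: "zeq Y Z (?j @ h) g"
  let ?A = "S X Y"
  have SA: "S ?A Y : Ob C" "S ?A ?A : Ob C" "S Z ?A : Ob C" using S_ob S o Z by auto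
  let ?a = "[Fwd (S ?A Y) (sum_map X ?A Y Y (i X Y) (Idt C Y))]" and ?b = "[Fwd (S ?A ?A) (sum_map ?A ?A Y ?A (Idt C ?A) (j X Y))]"
   and ?c = "[Fwd (S Z ?A) (sum_map Z Z Y ?A (Idt C Z) (j X Y))]"
  note ha = sum_map[OF o(1) S o(2) o(2) i_hom[OF o] id_hom[OF o(2)]] and hb = sum_map[OF S S o(2) S id_hom[OF S] j_hom[OF o]]
   and hn = copair[OF S S S id_hom[OF S] id_hom[OF S]]
  have a: "zz ?A (S ?A Y) ?a" and b: "zz (S ?A Y) (S ?A ?A) ?b" and c: "zz (S Z Y) (S Z ?A) ?c"
   by (rule zz_fwd[OF S SA(1) ha(1)], rule zz_fwd[OF SA(1,2) hb(1)],
     rule zz_fwd[OF SZ(1) SA(3) sum_map(1)[OF Z Z o(2) S id_hom[OF Z] j_hom[OF o]]])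
  have "zeq ?A ?A (?a @ ?b @ [Fwd ?A (nabla ?A)]) []"
  proof -
   have c1: "Comp C ?A (S ?A Y) (S ?A ?A) (sum_map ?A ?A Y ?A (Idt C ?A) (j X Y)) (sum_map X ?A Y Y (i X Y) (Idt C Y))
     = sum_map X ?A Y ?A (i X Y) (j X Y)"
    by (simp add: sum_map_comp o S id_hom i_hom j_hom comp_id_left comp_id_right)
   note hs = sum_map[OF o(1) S o(2) S i_hom[OF o] j_hom[OF o]]
   have c2: "Comp C ?A (S ?A ?A) ?A (nabla ?A) (sum_map X ?A Y ?A (i X Y) (j X Y)) = Idt C ?A"
   proof (rule copair_unique[OF o S comp_hom[OF S SA(2) S hs(1) hn(1)] id_hom[OF S]])
    show "Comp C X ?A ?A (Comp C ?A (S ?A ?A) ?A (nabla ?A) (sum_map X ?A Y ?A (i X Y) (j X Y))) (i X Y) = Comp C X ?A ?A (Idt C ?A) (i X Y)"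
     using comp_assoc[OF o(1) S SA(2) S i_hom[OF o] hs(1) hn(1)] comp_assoc[OF o(1) S SA(2) S i_hom[OF o] i_hom[OF S S] hn(1)]
     by (simp add: hs hn comp_id_left o S i_hom)
    show "Comp C Y ?A ?A (Comp C ?A (S ?A ?A) ?A (nabla ?A) (sum_map X ?A Y ?A (i X Y) (j X Y))) (j X Y) = Comp C Y ?A ?A (Idt C ?A) (j X Y)"
     using comp_assoc[OF o(2) S SA(2) S j_hom[OF o] hs(1) hn(1)] comp_assoc[OF o(2) S SA(2) S j_hom[OF o] j_hom[OF S S] hn(1)]
     by (simp add: hs hn comp_id_left o S j_hom)
   qed
   have "zeq ?A ?A ([Fwd (S ?A Y) (sum_map X ?A Y Y (i X Y) (Idt C Y)), Fwd (S ?A ?A) (sum_map ?A ?A Y ?A (Idt C ?A) (j X Y))] @ [Fwd ?A (nabla ?A)])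
     ([Fwd (S ?A ?A) (sum_map X ?A Y ?A (i X Y) (j X Y))] @ [Fwd ?A (nabla ?A)])"
    by (rule zeq_left[OF zeq_comp[OF S SA(1,2) ha(1) hb(1) c1] nabla_zz[OF S]])
   also have "zeq ?A ?A ([Fwd (S ?A ?A) (sum_map X ?A Y ?A (i X Y) (j X Y))] @ [Fwd ?A (nabla ?A)]) [Fwd ?A (Idt C ?A)]"
    using zeq_comp[OF S SA(2) S hs(1) hn(1) c2] by simp
   also have "zeq ?A ?A [Fwd ?A (Idt C ?A)] []" by (rule zigzag_eq.idt[OF S])
   finally show ?thesis by simp
  qed
  from zeq_left[OF zeq_sym[OF this] h]
  have "zeq ?A Z h ((?a @ ?b) @ ([Fwd ?A (nabla ?A)] @ h))" by simp
  also have "zeq ?A Z ((?a @ ?b) @ ([Fwd ?A (nabla ?A)] @ h)) ((?a @ ?b) @ (FL ?A ?A h @ FR Z ?A h @ ?n))"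
   by (rule zeq_right[OF zz_append[OF a b] zeq_sym[OF fold_zigzag[OF h]]])
  also have "zeq ?A Z ((?a @ ?b) @ (FL ?A ?A h @ FR Z ?A h @ ?n)) (?a @ (FL Y ?A h @ ?c) @ FR Z ?A h @ ?n)"
  proof -
   have sl: "zeq (S ?A Y) (S Z ?A) (FL Y ?A h @ ?c) (?b @ FL ?A ?A h)"
    by (rule zmap_natural[OF FL_functor[OF o(2)] FL_functor[OF S] natural_FL[OF o(2) S j_hom[OF o]] h])
   show ?thesis
    using zeq_right[OF a zeq_left[OF zeq_sym[OF sl] zz_append[OF zmap_zz[OF FR_functor[OF Z] h] n]]] by simp
  qed
  also have "?a @ (FL Y ?A h @ ?c) @ FR Z ?A h @ ?n = FL Y X (?i @ h) @ FR Z Y (?j @ h) @ ?n" by simp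
  also have "zeq ?A Z (FL Y X (?i @ h) @ FR Z Y (?j @ h) @ ?n) ?h"
   by (rule zigzag_eq.append[OF zmap_zeq[OF FL_functor[OF o(2)] hf]
      zigzag_eq.append[OF zmap_zeq[OF FR_functor[OF Z] hg] zeq_refl[OF n]]])
  finally show "zeq ?A Z ?h h" by (rule zeq_sym)
 qed
qed

lemma is_coproduct_sum: "X : Ob C ==> Y : Ob C ==> is_coproduct D X Y (S X Y)"
 unfolding is_coproduct_localisation using zz_coproduct_sum by blast

lemma is_coproduct_iso_sum:
 assumes "is_coproduct D X Y Z"
 shows "\<exists>p q. zz_iso Z (S X Y) p q"
proof -
 obtain a b where c: "zz_coproduct X Y Z a b" using assms unfolding is_coproduct_localisation by blast
 then have "X : Ob C" "Y : Ob C" by (auto simp: zz_coproduct_def dest: zz_start)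
 from zz_coproduct_unique[OF c zz_coproduct_sum[OF this]] show ?thesis .
qed

end

section \<open>Linear maps\<close>

text \<open>Unlike \<open>mod_hom\<close> it allows different element types and says nothing outside
  the carrier: cohomology modules have sets as elements, and the modules of representations have
  functions.\<close>

definition linmap :: "('r, 'm) ring_scheme => ('r, 'u) module => ('r, 'w) module => ('u => 'w) => bool" where
 "linmap R M N f \<longleftrightarrow> (\<forall>x\<in>carrier M. f x : carrier N) \<and>
   (\<forall>x\<in>carrier M. \<forall>y\<in>carrier M. f (x \<oplus>[M] y) = f x \<oplus>[N] f y) \<and>
   (\<forall>a\<in>carrier R. \<forall>x\<in>carrier M. f (a \<odot>[M] x) = a \<odot>[N] f x)"

lemma mod_hom_iff: "f : mod_hom R M N \<longleftrightarrow> linmap R M N f \<and> f : extensional (carrier M)"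
 by (auto simp: mod_hom_def linmap_def PiE_iff)

lemma linmapD:
 assumes "linmap R M N f"
 shows "x : carrier M ==> f x : carrier N"
  "x : carrier M ==> y : carrier M ==> f (x \<oplus>[M] y) = f x \<oplus>[N] f y"
  "a : carrier R ==> x : carrier M ==> f (a \<odot>[M] x) = a \<odot>[N] f x"
 using assms unfolding linmap_def by blast+

lemma linmapI:
 assumes "!!x. x : carrier M ==> f x : carrier N"
  "!!x y. x : carrier M ==> y : carrier M ==> f (x \<oplus>[M] y) = f x \<oplus>[N] f y"
  "!!a x. a : carrier R ==> x : carrier M ==> f (a \<odot>[M] x) = a \<odot>[N] f x"
 shows "linmap R M N f"
 using assms unfolding linmap_def by blast

lemma linmap_restrict: "linmap R M N f ==> left_module R M ==> restrict f (carrier M) : mod_hom R M N"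
proof -
 assume f: "linmap R M N f" and M: "left_module R M"
 interpret M: left_module R M by fact
 show ?thesis unfolding mod_hom_iff
  by (intro conjI linmapI) (auto simp: linmapD[OF f] M.smult_closed)
qed

lemma linmap_comp: "linmap R M N f ==> linmap R N K g ==> linmap R M K (%x. g (f x))"
 unfolding linmap_def by simp

lemma linmap_zero_minus:
 assumes "left_module R M" "left_module R N" "linmap R M N f"
 shows "f \<zero>[M] = \<zero>[N]" "x : carrier M ==> f (\<ominus>[M] x) = \<ominus>[N] f x"
  "x : carrier M ==> y : carrier M ==> f (x \<ominus>[M] y) = f x \<ominus>[N] f y"
proof -
 interpret M: left_module R M by fact
 interpret N: left_module R N by fact
 note f = linmapD[OF assms(3)]
 have "f \<zero>[M] \<oplus>[N] f \<zero>[M] = f \<zero>[M] \<oplus>[N] \<zero>[N]" using f(2)[of "\<zero>[M]" "\<zero>[M]"] f(1) by simp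
 then show z: "f \<zero>[M] = \<zero>[N]" using f(1)[OF M.zero_closed] by simp
 show m: "f (\<ominus>[M] x) = \<ominus>[N] f x" if x: "x : carrier M" for x
 proof -
  have "f (\<ominus>[M] x) \<oplus>[N] f x = \<zero>[N]" using f(2)[of "\<ominus>[M] x" x] z M.l_neg[OF x] x by simp
  then show ?thesis using N.minus_equality[of "f (\<ominus>[M] x)" "f x"] f(1) x by simp
 qed
 show "x : carrier M ==> y : carrier M ==> f (x \<ominus>[M] y) = f x \<ominus>[N] f y"
  using f(2) m by (simp add: a_minus_def)
qed

context left_module
begin

lemma smult_zero_right: "a : carrier R ==> a \<odot>[M] \<zero>[M] = \<zero>[M]"
proof -
 assume a: "a : carrier R"
 have "a \<odot>[M] \<zero>[M] \<oplus>[M] a \<odot>[M] \<zero>[M] = a \<odot>[M] \<zero>[M] \<oplus>[M] \<zero>[M]"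
  using smult_r_distr[OF a, of "\<zero>[M]" "\<zero>[M]"] smult_closed[OF a] by simp
 then show ?thesis using smult_closed[OF a M.zero_closed] by simp
qed

lemma smult_minus_right: "a : carrier R ==> x : carrier M ==> a \<odot>[M] (\<ominus>[M] x) = \<ominus>[M] (a \<odot>[M] x)"
proof -
 assume a: "a : carrier R" and x: "x : carrier M"
 have "a \<odot>[M] (\<ominus>[M] x) \<oplus>[M] a \<odot>[M] x = \<zero>[M]"
  using smult_r_distr[OF a, of "\<ominus>[M] x" x] x smult_zero_right[OF a] M.l_neg[OF x] by simp
 then show ?thesis using M.minus_equality[of "a \<odot>[M] (\<ominus>[M] x)" "a \<odot>[M] x"] a x smult_closed by simp
qed

lemma smult_zero_left: "x : carrier M ==> \<zero>[R] \<odot>[M] x = \<zero>[M]"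
proof -
 assume x: "x : carrier M"
 have "\<zero>[R] \<odot>[M] x \<oplus>[M] \<zero>[R] \<odot>[M] x = \<zero>[R] \<odot>[M] x \<oplus>[M] \<zero>[M]"
  using smult_l_distr[OF _ _ x, of "\<zero>[R]" "\<zero>[R]"] smult_closed[OF _ x] by simp
 then show ?thesis using smult_closed[OF R.zero_closed x] by simp
qed

definition submod :: "'c set => bool" where
 "submod U \<longleftrightarrow> U \<subseteq> carrier M \<and> \<zero>[M] : U \<and> (\<forall>x\<in>U. \<forall>y\<in>U. x \<oplus>[M] y : U) \<and> (\<forall>a\<in>carrier R. \<forall>x\<in>U. a \<odot>[M] x : U)"

lemma finsum_in_submod:
 assumes U: "submod U" and r: "r : S \<rightarrow> carrier R" and S: "finite S" "S \<subseteq> U"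
 shows "finsum M (%s. r s \<odot>[M] s) S : U"
 using S(1) S(2) r
proof (induction S)
 case empty
 then show ?case using U by (simp add: submod_def)
next
 case (insert s S)
 have UM: "U \<subseteq> carrier M" using U by (simp add: submod_def)
 have "finsum M (%s. r s \<odot>[M] s) (insert s S) = r s \<odot>[M] s \<oplus>[M] finsum M (%s. r s \<odot>[M] s) S"
  using insert UM by (intro M.finsum_insert) (auto intro!: smult_closed)
 then show ?case using insert U by (auto simp: submod_def)
qed

end

text \<open>Testing generation by submodules replaces explicit finite sums in all later proofs. For
  the converse, the linear combinations of \<open>S\<close> themselves form a submodule containing
  \<open>S\<close>.\<close>

lemma finitely_generated_iff:
 assumes "left_module R M"
 shows "finitely_generated R M \<longleftrightarrow>
  (\<exists>S. finite S \<and> S \<subseteq> carrier M \<and> (\<forall>U. left_module.submod R M U --> S \<subseteq> U --> U = carrier M))"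
proof -
 interpret left_module R M by fact
 show ?thesis
proof
 assume "finitely_generated R M"
 then obtain S where S: "finite S" "S \<subseteq> carrier M"
  and car: "carrier M = {finsum M (%s. r s \<odot>[M] s) S | r. r : S \<rightarrow> carrier R}"
  unfolding finitely_generated_def by blast
 have "U = carrier M" if U: "submod U" and SU: "S \<subseteq> U" for U
 proof
  show "U \<subseteq> carrier M" using U by (simp add: submod_def)
  show "carrier M \<subseteq> U" unfolding car using finsum_in_submod[OF U _ S(1) SU] by blast
 qed
 then show "\<exists>S. finite S \<and> S \<subseteq> carrier M \<and> (\<forall>U. submod U --> S \<subseteq> U --> U = carrier M)" using S by blast
next
 assume "\<exists>S. finite S \<and> S \<subseteq> carrier M \<and> (\<forall>U. submod U --> S \<subseteq> U --> U = carrier M)"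
 then obtain S where S: "finite S" "S \<subseteq> carrier M" and gen: "!!U. submod U ==> S \<subseteq> U ==> U = carrier M" by blast
 let ?U = "{finsum M (%s. r s \<odot>[M] s) S | r. r : S \<rightarrow> carrier R}"
 have cl: "(%s. r s \<odot>[M] s) : S \<rightarrow> carrier M" if "r : S \<rightarrow> carrier R" for r
  using that S(2) by (auto intro!: smult_closed)
 have "submod ?U" unfolding submod_def
 proof (intro conjI ballI)
  show "?U \<subseteq> carrier M" using cl by auto
  have "finsum M (%s. \<zero>[R] \<odot>[M] s) S = \<zero>[M]"
  proof -
   have "finsum M (%s. \<zero>[R] \<odot>[M] s) S = finsum M (%s. \<zero>[M]) S"
    using S(2) smult_zero_left by (intro M.finsum_cong') auto
   then show ?thesis by simp
  qed
  then show "\<zero>[M] : ?U" by (intro CollectI exI[of _ "%_. \<zero>[R]"]) auto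
  fix x y assume "x : ?U" "y : ?U"
  then obtain r r' where r: "x = finsum M (%s. r s \<odot>[M] s) S" "r : S \<rightarrow> carrier R"
   and r': "y = finsum M (%s. r' s \<odot>[M] s) S" "r' : S \<rightarrow> carrier R" by blast
  have "x \<oplus>[M] y = finsum M (%s. r s \<odot>[M] s \<oplus>[M] r' s \<odot>[M] s) S"
   unfolding r(1) r'(1) by (rule M.finsum_addf[symmetric]) (use cl r r' in auto)
  also have "\<dots> = finsum M (%s. (r s \<oplus>[R] r' s) \<odot>[M] s) S"
   using r(2) r'(2) S(2) by (intro M.finsum_cong') (auto simp: smult_l_distr smult_closed Pi_def subset_iff)
  finally show "x \<oplus>[M] y : ?U" using r(2) r'(2) by (intro CollectI exI[of _ "%s. r s \<oplus>[R] r' s"]) auto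
 next
  fix a x assume a: "a : carrier R" and "x : ?U"
  then obtain r where r: "x = finsum M (%s. r s \<odot>[M] s) S" "r : S \<rightarrow> carrier R" by blast
  have "a \<odot>[M] finsum M (%s. r s \<odot>[M] s) T = finsum M (%s. (a \<otimes>[R] r s) \<odot>[M] s) T" if "T \<subseteq> S" for T
  proof -
   have "finite T" using that S(1) finite_subset by blast
   then show ?thesis using that
   proof (induction T)
    case empty
    then show ?case using smult_zero_right[OF a] by simp
   next
    case (insert s T)
    have s: "s : carrier M" "r s : carrier R" using insert.prems S(2) r(2) by auto
    have T: "(%s. r s \<odot>[M] s) : T \<rightarrow> carrier M" "(%s. (a \<otimes>[R] r s) \<odot>[M] s) : T \<rightarrow> carrier M"
     using insert.prems S(2) r(2) a by (auto intro!: smult_closed)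
    show ?case using insert s T a
     by (simp add: smult_closed smult_r_distr smult_assoc1)
   qed
  qed
  then show "a \<odot>[M] x : ?U" using r a by (intro CollectI exI[of _ "%s. a \<otimes>[R] r s"]) auto
 qed
 moreover have "S \<subseteq> ?U"
 proof
  fix s assume s: "s : S"
  let ?r = "%t. if t = s then \<one>[R] else \<zero>[R]"
  note z = smult_zero_left
  have "finsum M (%t. ?r t \<odot>[M] t) S = finsum M (%t. if s = t then t else \<zero>[M]) S"
   using S(2) z s by (intro M.finsum_cong') (auto simp: smult_one subset_iff)
  also have "\<dots> = s" using M.finsum_singleton[OF s S(1), of "%t. t"] S(2) by auto
  finally show "s : ?U" by (intro CollectI exI[of _ ?r]) auto
 qed
 ultimately have "?U = carrier M" by (rule gen)
 then show "finitely_generated R M" unfolding finitely_generated_def using S by blast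
qed
qed

lemma direct_sum_simps [simp]:
 "carrier (direct_sum M N) = {Tup x y | x y. x : carrier M \<and> y : carrier N}"
 "\<zero>[direct_sum M N] = Tup \<zero>[M] \<zero>[N]"
 "p \<oplus>[direct_sum M N] q = Tup (tfst p \<oplus>[M] tfst q) (tsnd p \<oplus>[N] tsnd q)"
 "a \<odot>[direct_sum M N] p = Tup (a \<odot>[M] tfst p) (a \<odot>[N] tsnd p)"
 by (simp_all add: direct_sum_def)

lemma left_module_direct_sum:
 assumes "left_module R M" "left_module R N"
 shows "left_module R (direct_sum M N)"
proof -
 interpret M: left_module R M by fact
 interpret N: left_module R N by fact
 have "abelian_group (direct_sum M N)"
 proof (rule abelian_groupI)
  fix x assume "x : carrier (direct_sum M N)"
  then obtain a b where x: "x = Tup a b" "a : carrier M" "b : carrier N" by auto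
  show "\<exists>y\<in>carrier (direct_sum M N). y \<oplus>[direct_sum M N] x = \<zero>[direct_sum M N]"
   by (rule bexI[of _ "Tup (\<ominus>[M] a) (\<ominus>[N] b)"]) (use x in \<open>auto simp: M.l_neg N.l_neg\<close>)
 qed (auto simp: M.a_ac N.a_ac)
 then show ?thesis
  by (intro left_module.intro left_module_axioms.intro M.R.ring_axioms)
    (auto simp: M.smult_closed N.smult_closed M.smult_l_distr N.smult_l_distr M.smult_r_distr N.smult_r_distr
     M.smult_assoc1 N.smult_assoc1 M.smult_one N.smult_one)
qed

lemma direct_sum_minus:
 assumes "left_module R M" "left_module R N" "x : carrier M" "y : carrier N"
 shows "\<ominus>[direct_sum M N] Tup x y = Tup (\<ominus>[M] x) (\<ominus>[N] y)"
proof -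
 interpret M: left_module R M by fact
 interpret N: left_module R N by fact
 interpret S: left_module R "direct_sum M N" by (rule left_module_direct_sum[OF assms(1,2)])
 show ?thesis by (rule S.minus_equality) (use assms in \<open>auto simp: M.l_neg N.l_neg\<close>)
qed

lemma finitely_generated_direct_sum:
 assumes M: "left_module R M" and N: "left_module R N" and fM: "finitely_generated R M" and fN: "finitely_generated R N"
 shows "finitely_generated R (direct_sum M N)"
proof -
 interpret M: left_module R M by fact
 interpret N: left_module R N by fact
 interpret S: left_module R "direct_sum M N" by (rule left_module_direct_sum[OF M N])
 obtain S1 where S1: "finite S1" "S1 \<subseteq> carrier M" "!!U. M.submod U ==> S1 \<subseteq> U ==> U = carrier M"
  using fM finitely_generated_iff[OF M] by blast
 obtain S2 where S2: "finite S2" "S2 \<subseteq> carrier N" "!!U. N.submod U ==> S2 \<subseteq> U ==> U = carrier N"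
  using fN finitely_generated_iff[OF N] by blast
 let ?S = "(%x. Tup x \<zero>[N]) ` S1 \<union> (%y. Tup \<zero>[M] y) ` S2"
 have "U = carrier (direct_sum M N)" if U: "S.submod U" and SU: "?S \<subseteq> U" for U
 proof
  have Ud: "U \<subseteq> carrier (direct_sum M N)" "Tup \<zero>[M] \<zero>[N] : U"
   and Ua: "!!p q. p : U ==> q : U ==> Tup (tfst p \<oplus>[M] tfst q) (tsnd p \<oplus>[N] tsnd q) : U"
   and Us: "!!a p. a : carrier R ==> p : U ==> Tup (a \<odot>[M] tfst p) (a \<odot>[N] tsnd p) : U"
   using U unfolding S.submod_def by simp_all
  show "U \<subseteq> carrier (direct_sum M N)" by fact
  have "{x : carrier M. Tup x \<zero>[N] : U} = carrier M"
  proof (rule S1(3))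
   show "M.submod {x : carrier M. Tup x \<zero>[N] : U}" unfolding M.submod_def
   proof (intro conjI ballI)
    fix x y assume "x : {x : carrier M. Tup x \<zero>[N] : U}" "y : {x : carrier M. Tup x \<zero>[N] : U}"
    then show "x \<oplus>[M] y : {x : carrier M. Tup x \<zero>[N] : U}"
     using Ua[of "Tup x \<zero>[N]" "Tup y \<zero>[N]"] by simp
   next
    fix a x assume "a : carrier R" "x : {x : carrier M. Tup x \<zero>[N] : U}"
    then show "a \<odot>[M] x : {x : carrier M. Tup x \<zero>[N] : U}"
     using Us[of a "Tup x \<zero>[N]"] by (simp add: M.smult_closed N.smult_zero_right)
   qed (use Ud in auto)
  qed (use S1 SU in auto)
  moreover have "{y : carrier N. Tup \<zero>[M] y : U} = carrier N"
  proof (rule S2(3))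
   show "N.submod {y : carrier N. Tup \<zero>[M] y : U}" unfolding N.submod_def
   proof (intro conjI ballI)
    fix x y assume "x : {y : carrier N. Tup \<zero>[M] y : U}" "y : {y : carrier N. Tup \<zero>[M] y : U}"
    then show "x \<oplus>[N] y : {y : carrier N. Tup \<zero>[M] y : U}"
     using Ua[of "Tup \<zero>[M] x" "Tup \<zero>[M] y"] by simp
   next
    fix a x assume "a : carrier R" "x : {y : carrier N. Tup \<zero>[M] y : U}"
    then show "a \<odot>[N] x : {y : carrier N. Tup \<zero>[M] y : U}"
     using Us[of a "Tup \<zero>[M] x"] by (simp add: N.smult_closed M.smult_zero_right)
   qed (use Ud in auto)
  qed (use S2 SU in auto)
  ultimately have e: "!!x. x : carrier M ==> Tup x \<zero>[N] : U" "!!y. y : carrier N ==> Tup \<zero>[M] y : U" by blast+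
  show "carrier (direct_sum M N) \<subseteq> U"
  proof
   fix p assume "p : carrier (direct_sum M N)"
   then obtain x y where p: "p = Tup x y" "x : carrier M" "y : carrier N" by auto
   show "p : U" using Ua[OF e(1)[OF p(2)] e(2)[OF p(3)]] p by simp
  qed
 qed
 then show ?thesis unfolding finitely_generated_iff[OF S.left_module_axioms]
  using S1(1,2) S2(1,2) by (intro exI[of _ ?S]) auto
qed

definition zero_module :: "('r, 'r tuple) module" where
 "zero_module = \<lparr>carrier = {Elem undefined}, monoid.mult = undefined, one = undefined,
   zero = Elem undefined, add = (%_ _. Elem undefined), module.smult = (%_ _. Elem undefined)\<rparr>"

lemma zero_module_simps [simp]:
 "carrier zero_module = {Elem undefined}" "\<zero>[zero_module] = Elem undefined"
 "x \<oplus>[zero_module] y = Elem undefined" "a \<odot>[zero_module] x = Elem undefined"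
 by (simp_all add: zero_module_def)

lemma zero_module: "ring R ==> left_module R zero_module \<and> finitely_generated R zero_module"
proof -
 assume R: "ring R"
 have "abelian_group (zero_module :: ('a, 'a tuple) module)" by (rule abelian_groupI) auto
 then interpret left_module R zero_module
  by (intro left_module.intro left_module_axioms.intro R) auto
 have "finitely_generated R zero_module" unfolding finitely_generated_iff[OF left_module_axioms] submod_def
  by (rule exI[of _ "{}"]) auto
 then show ?thesis using left_module_axioms by blast
qed

section \<open>Complexes\<close>

locale bounded_complexes = ring R for R :: "('r, 'm) ring_scheme" (structure)
begin

abbreviation "CC \<equiv> cpx_category R"
abbreviation "QQ \<equiv> quasi_iso R"

lemma cpxD:
 assumes "bounded_cpx R X"
 shows "left_module R (deg X i)" "finitely_generated R (deg X i)" "linmap R (deg X i) (deg X (i + 1)) (diff X i)"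
  "diff X i : extensional (elts X i)"
  "x : elts X i ==> diff X (i + 1) (diff X i x) = \<zero>[deg X (i + 1 + 1)]"
 using assms by (auto simp: bounded_cpx_def mod_hom_iff)

lemma cpx_diff:
 assumes X: "bounded_cpx R X"
 shows "x : elts X i ==> diff X i x : elts X (i + 1)"
  "x : elts X i ==> y : elts X i ==> diff X i (x \<oplus>[deg X i] y) = diff X i x \<oplus>[deg X (i + 1)] diff X i y"
  "a : carrier R ==> x : elts X i ==> diff X i (a \<odot>[deg X i] x) = a \<odot>[deg X (i + 1)] diff X i x"
  "diff X i \<zero>[deg X i] = \<zero>[deg X (i + 1)]"
  "x : elts X i ==> diff X i (\<ominus>[deg X i] x) = \<ominus>[deg X (i + 1)] diff X i x"
  "x : elts X i ==> y : elts X i ==> diff X i (x \<ominus>[deg X i] y) = diff X i x \<ominus>[deg X (i + 1)] diff X i y"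
 using linmapD[OF cpxD(3)[OF X]] linmap_zero_minus[OF cpxD(1)[OF X] cpxD(1)[OF X] cpxD(3)[OF X]] by simp_all

lemma chain_mapD:
 assumes "f : chain_map R X Y"
 shows "linmap R (deg X i) (deg Y i) (f i)" "f i : extensional (elts X i)"
  "x : elts X i ==> f (i + 1) (diff X i x) = diff Y i (f i x)"
 using assms by (auto simp: chain_map_def mod_hom_iff)

lemma chain_mapI:
 assumes "!!i. linmap R (deg X i) (deg Y i) (f i)" "!!i. f i : extensional (elts X i)"
  "!!i x. x : elts X i ==> f (i + 1) (diff X i x) = diff Y i (f i x)"
 shows "f : chain_map R X Y"
 using assms by (auto simp: chain_map_def mod_hom_iff)

lemma chain_map_simps:
 assumes X: "bounded_cpx R X" and Y: "bounded_cpx R Y" and f: "f : chain_map R X Y"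
 shows "x : elts X i ==> f i x : elts Y i"
  "x : elts X i ==> y : elts X i ==> f i (x \<oplus>[deg X i] y) = f i x \<oplus>[deg Y i] f i y"
  "a : carrier R ==> x : elts X i ==> f i (a \<odot>[deg X i] x) = a \<odot>[deg Y i] f i x"
  "f i \<zero>[deg X i] = \<zero>[deg Y i]"
  "x : elts X i ==> f i (\<ominus>[deg X i] x) = \<ominus>[deg Y i] f i x"
  "x : elts X i ==> y : elts X i ==> f i (x \<ominus>[deg X i] y) = f i x \<ominus>[deg Y i] f i y"
 using linmapD[OF chain_mapD(1)[OF f]] linmap_zero_minus[OF cpxD(1)[OF X] cpxD(1)[OF Y] chain_mapD(1)[OF f]] by simp_all

text \<open>The class of \<open>x\<close> modulo coboundaries. The coset makes sense for every
  element of degree \<open>i\<close>, which spares cocycle assumptions in the congruence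
  lemmas.\<close>

definition hcl :: "'r cpx => int => 'r tuple => 'r tuple set" where
 "hcl X i x = coboundaries X i +>\<^bsub>deg X i\<^esub> x"

lemma hcl_eq: "hcl X i x = {b \<oplus>[deg X i] x | b. b : coboundaries X i}"
 by (auto simp: hcl_def a_r_coset_def')

lemma cohomology_eq: "cohomology X i = hcl X i ` cocycles X i"
 by (auto simp: cohomology_def hcl_def)

lemma cocyclesD: "x : cocycles X i ==> x : elts X i" "x : cocycles X i ==> diff X i x = \<zero>[deg X (i + 1)]"
 by (auto simp: cocycles_def)

lemma coboundary_iff: "b : coboundaries X (i + 1) \<longleftrightarrow> (\<exists>x\<in>elts X i. b = diff X i x)"
 by (auto simp: coboundaries_def)

lemma coboundary_iff': "b : coboundaries X i \<longleftrightarrow> (\<exists>x\<in>elts X (i - 1). b = diff X (i - 1) x)"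
 by (auto simp: coboundaries_def)

lemma coboundaries_cocycles:
 assumes X: "bounded_cpx R X"
 shows "coboundaries X i \<subseteq> cocycles X i"
proof
 fix b assume "b : coboundaries X i"
 then obtain x where x: "x : elts X (i - 1)" "b = diff X (i - 1) x" by (auto simp: coboundaries_def)
 show "b : cocycles X i" unfolding cocycles_def x(2)
  using cpx_diff(1)[OF X x(1)] cpxD(5)[OF X x(1)] by simp
qed

lemma coboundaries_closed:
 assumes X: "bounded_cpx R X"
 shows "\<zero>[deg X i] : coboundaries X i"
  "b : coboundaries X i ==> c : coboundaries X i ==> b \<oplus>[deg X i] c : coboundaries X i"
  "b : coboundaries X i ==> \<ominus>[deg X i] b : coboundaries X i"
  "a : carrier R ==> b : coboundaries X i ==> a \<odot>[deg X i] b : coboundaries X i"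
proof -
 define k where "k = i - 1"
 have i: "i = k + 1" by (simp add: k_def)
 interpret M: left_module R "deg X k" by (rule cpxD(1)[OF X])
 show "\<zero>[deg X i] : coboundaries X i" unfolding i coboundary_iff
  by (rule bexI[of _ "\<zero>[deg X k]"]) (simp_all add: cpx_diff(4)[OF X])
 show "b : coboundaries X i ==> c : coboundaries X i ==> b \<oplus>[deg X i] c : coboundaries X i"
  unfolding i coboundary_iff
 proof (elim bexE)
  fix x y assume "x : elts X k" "y : elts X k" "b = diff X k x" "c = diff X k y"
  then show "\<exists>z\<in>elts X k. b \<oplus>[deg X (k + 1)] c = diff X k z"
   by (intro bexI[of _ "x \<oplus>[deg X k] y"]) (simp_all add: cpx_diff(2)[OF X])
 qed
 show "b : coboundaries X i ==> \<ominus>[deg X i] b : coboundaries X i"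
  unfolding i coboundary_iff
 proof (elim bexE)
  fix x assume "x : elts X k" "b = diff X k x"
  then show "\<exists>z\<in>elts X k. \<ominus>[deg X (k + 1)] b = diff X k z"
   by (intro bexI[of _ "\<ominus>[deg X k] x"]) (simp_all add: cpx_diff(5)[OF X])
 qed
 show "a : carrier R ==> b : coboundaries X i ==> a \<odot>[deg X i] b : coboundaries X i"
  unfolding i coboundary_iff
 proof (elim bexE)
  fix x assume "a : carrier R" "x : elts X k" "b = diff X k x"
  then show "\<exists>z\<in>elts X k. a \<odot>[deg X (k + 1)] b = diff X k z"
   by (intro bexI[of _ "a \<odot>[deg X k] x"]) (simp_all add: cpx_diff(3)[OF X] M.smult_closed)
 qed
qed

lemma cocycles_closed:
 assumes X: "bounded_cpx R X"
 shows "\<zero>[deg X i] : cocycles X i"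
  "b : cocycles X i ==> c : cocycles X i ==> b \<oplus>[deg X i] c : cocycles X i"
  "b : cocycles X i ==> \<ominus>[deg X i] b : cocycles X i"
  "b : cocycles X i ==> c : cocycles X i ==> b \<ominus>[deg X i] c : cocycles X i"
  "a : carrier R ==> b : cocycles X i ==> a \<odot>[deg X i] b : cocycles X i"
proof -
 interpret M: left_module R "deg X i" by (rule cpxD(1)[OF X])
 interpret N: left_module R "deg X (i + 1)" by (rule cpxD(1)[OF X])
 note d = cpx_diff[OF X]
 show "\<zero>[deg X i] : cocycles X i"
  "b : cocycles X i ==> c : cocycles X i ==> b \<oplus>[deg X i] c : cocycles X i"
  "b : cocycles X i ==> \<ominus>[deg X i] b : cocycles X i"
  "a : carrier R ==> b : cocycles X i ==> a \<odot>[deg X i] b : cocycles X i"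
  by (simp_all add: cocycles_def d M.smult_closed N.smult_zero_right)
 show "b : cocycles X i ==> c : cocycles X i ==> b \<ominus>[deg X i] c : cocycles X i"
  by (simp add: cocycles_def d) (simp add: a_minus_def)
qed

lemma hcl_eq_iff:
 assumes X: "bounded_cpx R X" and x: "x : elts X i" and y: "y : elts X i"
 shows "hcl X i x = hcl X i y \<longleftrightarrow> x \<ominus>[deg X i] y : coboundaries X i"
proof -
 interpret M: left_module R "deg X i" by (rule cpxD(1)[OF X])
 note B = coboundaries_closed[OF X]
 have Bc: "!!b. b : coboundaries X i ==> b : elts X i"
  using coboundaries_cocycles[OF X] cocyclesD(1) by blast
 have sub: "hcl X i x \<subseteq> hcl X i y" if "x : elts X i" "y : elts X i"
  "x \<ominus>[deg X i] y : coboundaries X i" for x y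
 proof
  fix z assume "z : hcl X i x"
  then obtain b where b: "b : coboundaries X i" "z = b \<oplus>[deg X i] x" by (auto simp: hcl_eq)
  have "z = (b \<oplus>[deg X i] (x \<ominus>[deg X i] y)) \<oplus>[deg X i] y"
   using b Bc that by (simp add: a_minus_def M.a_assoc M.l_neg)
  then show "z : hcl X i y" unfolding hcl_eq using B(2)[OF b(1) that(3)] by blast
 qed
 show ?thesis
 proof
  assume "hcl X i x = hcl X i y"
  moreover have "x : hcl X i x" unfolding hcl_eq using B(1) x by (intro CollectI exI[of _ "\<zero>[deg X i]"]) auto
  ultimately obtain b where b: "b : coboundaries X i" "x = b \<oplus>[deg X i] y" by (auto simp: hcl_eq)
  have "x \<ominus>[deg X i] y = b" unfolding b(2) using Bc[OF b(1)] y by (simp add: a_minus_def M.a_assoc M.r_neg)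
  then show "x \<ominus>[deg X i] y : coboundaries X i" using b by simp
 next
  assume xy: "x \<ominus>[deg X i] y : coboundaries X i"
  have "y \<ominus>[deg X i] x = \<ominus>[deg X i] (x \<ominus>[deg X i] y)"
   using x y by (simp add: a_minus_def M.minus_add M.a_comm)
  then have "y \<ominus>[deg X i] x : coboundaries X i" using B(3)[OF xy] by simp
  then show "hcl X i x = hcl X i y" using sub[OF x y xy] sub[OF y x] by blast
 qed
qed

lemma hcl_mem:
 assumes X: "bounded_cpx R X" and x: "x : elts X i"
 shows "z : hcl X i x ==> z : elts X i \<and> hcl X i z = hcl X i x" "x : hcl X i x"
proof -
 interpret M: left_module R "deg X i" by (rule cpxD(1)[OF X])
 have Bc: "!!b. b : coboundaries X i ==> b : elts X i"
  using coboundaries_cocycles[OF X] cocyclesD(1) by blast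
 show "x : hcl X i x" unfolding hcl_eq
  using coboundaries_closed(1)[OF X] x by (intro CollectI exI[of _ "\<zero>[deg X i]"]) auto
 assume "z : hcl X i x"
 then obtain b where b: "b : coboundaries X i" "z = b \<oplus>[deg X i] x" by (auto simp: hcl_eq)
 have z: "z : elts X i" using b Bc x by simp
 have "z \<ominus>[deg X i] x = b" unfolding b(2) using Bc[OF b(1)] x by (simp add: a_minus_def M.a_assoc M.r_neg)
 then show "z : elts X i \<and> hcl X i z = hcl X i x" using z b hcl_eq_iff[OF X z x] by simp
qed

lemma hcl_Union:
 assumes X: "bounded_cpx R X" and x: "x : elts X i"
  and F: "!!z. z : elts X i ==> hcl X i z = hcl X i x ==> F z = F x"
 shows "(\<Union>z\<in>hcl X i x. F z) = F x"
 using hcl_mem[OF X x] F by blast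

lemma chain_map_cocycle:
 assumes X: "bounded_cpx R X" and Y: "bounded_cpx R Y" and f: "f : chain_map R X Y"
 shows "x : cocycles X i ==> f i x : cocycles Y i" "b : coboundaries X i ==> f i b : coboundaries Y i"
proof -
 note s = chain_map_simps[OF X Y f]
 show "x : cocycles X i ==> f i x : cocycles Y i"
  using chain_mapD(3)[OF f, of x i, symmetric] s(1)[of x i] s(4)[of "i + 1"] by (simp add: cocycles_def)
 assume "b : coboundaries X i"
 then obtain x where x: "x : elts X (i - 1)" "b = diff X (i - 1) x" by (auto simp: coboundaries_def)
 have "f i b = diff Y (i - 1) (f (i - 1) x)" using chain_mapD(3)[OF f x(1)] x(2) by simp
 then show "f i b : coboundaries Y i" using s(1)[OF x(1)] unfolding coboundary_iff' by blast
qed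

lemma cohomology_map_hcl:
 assumes X: "bounded_cpx R X" and Y: "bounded_cpx R Y" and f: "f : chain_map R X Y" and x: "x : elts X i"
 shows "cohomology_map Y f i (hcl X i x) = hcl Y i (f i x)"
proof -
 have "(\<Union>z\<in>hcl X i x. hcl Y i (f i z)) = hcl Y i (f i x)"
 proof (rule hcl_Union[OF X x])
  fix z assume z: "z : elts X i" "hcl X i z = hcl X i x"
  then have "f i (z \<ominus>[deg X i] x) : coboundaries Y i"
   using chain_map_cocycle(2)[OF X Y f] hcl_eq_iff[OF X z(1) x] by blast
  then show "hcl Y i (f i z) = hcl Y i (f i x)"
   using chain_map_simps[OF X Y f] z(1) x hcl_eq_iff[OF Y] by metis
 qed
 then show ?thesis by (simp add: cohomology_map_def hcl_def)
qed

text \<open>The maps on cohomology are additive, so injectivity need only be tested at the zero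
  class. Later quasi-isomorphisms are verified in this elementwise form.\<close>

lemma quasi_iso_iff:
 assumes X: "bounded_cpx R X" and Y: "bounded_cpx R Y"
 shows "f : quasi_iso R X Y \<longleftrightarrow> f : chain_map R X Y \<and>
  (\<forall>i. (\<forall>x\<in>cocycles X i. f i x : coboundaries Y i --> x : coboundaries X i) \<and>
     (\<forall>y\<in>cocycles Y i. \<exists>x\<in>cocycles X i. y \<ominus>[deg Y i] f i x : coboundaries Y i))"
proof (cases "f : chain_map R X Y")
 case f: True
 note s = chain_map_simps[OF X Y f] and cm = cohomology_map_hcl[OF X Y f]
 have "bij_betw (cohomology_map Y f i) (cohomology X i) (cohomology Y i) \<longleftrightarrow>
   (\<forall>x\<in>cocycles X i. f i x : coboundaries Y i --> x : coboundaries X i) \<and>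
   (\<forall>y\<in>cocycles Y i. \<exists>x\<in>cocycles X i. y \<ominus>[deg Y i] f i x : coboundaries Y i)" for i
 proof -
  interpret M: left_module R "deg X i" by (rule cpxD(1)[OF X])
  interpret N: left_module R "deg Y i" by (rule cpxD(1)[OF Y])
  have zX: "!!x. x : elts X i ==> x \<ominus>[deg X i] \<zero>[deg X i] = x"
   and zY: "!!x. x : elts Y i ==> x \<ominus>[deg Y i] \<zero>[deg Y i] = x" by (simp_all add: a_minus_def)
  have inj: "inj_on (cohomology_map Y f i) (cohomology X i) \<longleftrightarrow>
   (\<forall>x\<in>cocycles X i. f i x : coboundaries Y i --> x : coboundaries X i)"
  proof
   assume inj: "inj_on (cohomology_map Y f i) (cohomology X i)"
   show "\<forall>x\<in>cocycles X i. f i x : coboundaries Y i --> x : coboundaries X i"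
   proof (intro ballI impI)
    fix x assume x: "x : cocycles X i" "f i x : coboundaries Y i"
    have xc: "x : elts X i" by (rule cocyclesD(1)[OF x(1)])
    have "hcl Y i (f i x) = hcl Y i (f i \<zero>[deg X i])"
     using hcl_eq_iff[OF Y s(1)[OF xc], of "\<zero>[deg Y i]"] x(2) zY[OF s(1)[OF xc]] s(4) by simp
    then have "cohomology_map Y f i (hcl X i x) = cohomology_map Y f i (hcl X i \<zero>[deg X i])"
     using cm xc by simp
    then have "hcl X i x = hcl X i \<zero>[deg X i]"
     by (rule inj_onD[OF inj]) (use x cocycles_closed(1)[OF X] in \<open>auto simp: cohomology_eq\<close>)
    then show "x : coboundaries X i" using hcl_eq_iff[OF X xc] zX[OF xc] by simp
   qed
  next
   assume h: "\<forall>x\<in>cocycles X i. f i x : coboundaries Y i --> x : coboundaries X i"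
   show "inj_on (cohomology_map Y f i) (cohomology X i)"
   proof (rule inj_onI)
    fix c c' assume c: "c : cohomology X i" "c' : cohomology X i" and eq: "cohomology_map Y f i c = cohomology_map Y f i c'"
    obtain x x' where x: "x : cocycles X i" "c = hcl X i x" and x': "x' : cocycles X i" "c' = hcl X i x'"
     using c by (auto simp: cohomology_eq)
    note xc = cocyclesD(1)[OF x(1)] and xc' = cocyclesD(1)[OF x'(1)]
    have "hcl Y i (f i x) = hcl Y i (f i x')" using eq cm[OF xc] cm[OF xc'] x(2) x'(2) by simp
    then have "f i (x \<ominus>[deg X i] x') : coboundaries Y i"
     using hcl_eq_iff[OF Y s(1)[OF xc] s(1)[OF xc']] s(6)[OF xc xc'] by simp
    then have "x \<ominus>[deg X i] x' : coboundaries X i" using h cocycles_closed(4)[OF X x(1) x'(1)] by blast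
    then show "c = c'" using hcl_eq_iff[OF X xc xc'] x(2) x'(2) by simp
   qed
  qed
  have map: "cohomology_map Y f i ` cohomology X i \<subseteq> cohomology Y i"
  proof -
   have "cohomology_map Y f i (hcl X i x) : cohomology Y i" if "x : cocycles X i" for x
    unfolding cm[OF cocyclesD(1)[OF that]] cohomology_eq by (rule imageI[OF chain_map_cocycle(1)[OF X Y f that]])
   then show ?thesis unfolding cohomology_eq[of X] by blast
  qed
  have im: "cohomology_map Y f i ` cohomology X i = (%x. hcl Y i (f i x)) ` cocycles X i"
   unfolding cohomology_eq[of X] image_image by (rule image_cong[OF HOL.refl cm[OF cocyclesD(1)]])
  have surj: "cohomology_map Y f i ` cohomology X i = cohomology Y i \<longleftrightarrow>
   (\<forall>y\<in>cocycles Y i. \<exists>x\<in>cocycles X i. y \<ominus>[deg Y i] f i x : coboundaries Y i)"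
  proof -
   have "hcl Y i y : cohomology_map Y f i ` cohomology X i \<longleftrightarrow> (\<exists>x\<in>cocycles X i. y \<ominus>[deg Y i] f i x : coboundaries Y i)"
    if y: "y : cocycles Y i" for y
   proof -
    have "hcl Y i y : cohomology_map Y f i ` cohomology X i \<longleftrightarrow> (\<exists>x\<in>cocycles X i. hcl Y i y = hcl Y i (f i x))"
     unfolding im by blast
    also have "\<dots> \<longleftrightarrow> (\<exists>x\<in>cocycles X i. y \<ominus>[deg Y i] f i x : coboundaries Y i)"
     by (rule bex_cong[OF HOL.refl]) (use hcl_eq_iff[OF Y cocyclesD(1)[OF y]] s(1) cocyclesD(1) in blast)
    finally show ?thesis .
   qed
   moreover have "cohomology_map Y f i ` cohomology X i = cohomology Y i \<longleftrightarrow>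
     (\<forall>y\<in>cocycles Y i. hcl Y i y : cohomology_map Y f i ` cohomology X i)"
    using map unfolding cohomology_eq[of Y] by blast
   ultimately show ?thesis by simp
  qed
  show ?thesis unfolding bij_betw_def inj surj ..
 qed
 then show ?thesis using f by (simp add: quasi_iso_def)
qed (simp add: quasi_iso_def)

lemma quasi_isoD: "f : quasi_iso R X Y ==> f : chain_map R X Y"
 by (simp add: quasi_iso_def)

end

lemma linmap_inv_into:
 assumes f: "linmap R M N f" and bij: "bij_betw f (carrier M) (carrier N)"
  and add: "!!x y. x : carrier M ==> y : carrier M ==> x \<oplus>[M] y : carrier M"
  and smult: "!!a x. a : carrier R ==> x : carrier M ==> a \<odot>[M] x : carrier M"
 shows "linmap R N M (inv_into (carrier M) f)"
proof (rule linmapI)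
 let ?g = "inv_into (carrier M) f"
 have gf: "?g (f x) = x" if "x : carrier M" for x using bij_betw_inv_into_left[OF bij that] .
 have fg: "f (?g y) = y" if "y : carrier N" for y using bij_betw_inv_into_right[OF bij that] .
 show g: "?g y : carrier M" if "y : carrier N" for y
  using bij_betw_apply[OF bij_betw_inv_into[OF bij] that] .
 show "?g (x \<oplus>[N] y) = ?g x \<oplus>[M] ?g y" if x: "x : carrier N" and y: "y : carrier N" for x y
  using gf[OF add[OF g[OF x] g[OF y]]] linmapD(2)[OF f g[OF x] g[OF y]] fg[OF x] fg[OF y] by simp
 show "?g (a \<odot>[N] x) = a \<odot>[M] ?g x" if a: "a : carrier R" and x: "x : carrier N" for a x
  using gf[OF smult[OF a g[OF x]]] linmapD(3)[OF f a g[OF x]] fg[OF x] by simp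
qed

context left_module
begin

lemma neg_zero [simp]: "\<ominus>[M] \<zero>[M] = \<zero>[M]"
 by (rule M.minus_equality) simp_all

lemma neg_eq_zero_iff: "x : carrier M ==> \<ominus>[M] x = \<zero>[M] \<longleftrightarrow> x = \<zero>[M]"
 using M.minus_minus[of x] by (metis neg_zero)

end

section \<open>The category of bounded complexes\<close>

definition sum_cpx :: "'r cpx => 'r cpx => 'r cpx" where
 "sum_cpx X Y = \<lparr>deg = (%i. direct_sum (deg X i) (deg Y i)),
   diff = (%i. \<lambda>p\<in>carrier (direct_sum (deg X i) (deg Y i)). Tup (diff X i (tfst p)) (diff Y i (tsnd p)))\<rparr>"

definition sum_incl1 :: "'r cpx => 'r cpx => 'r cpx_map" where
 "sum_incl1 X Y = (%i. \<lambda>x\<in>elts X i. Tup x \<zero>[deg Y i])"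

definition sum_incl2 :: "'r cpx => 'r cpx => 'r cpx_map" where
 "sum_incl2 X Y = (%i. \<lambda>y\<in>elts Y i. Tup \<zero>[deg X i] y)"

definition zero_cpx :: "'r cpx" where
 "zero_cpx = \<lparr>deg = (%i. zero_module), diff = (%i. \<lambda>x\<in>carrier zero_module. Elem undefined)\<rparr>"

context bounded_complexes
begin

lemma CC_simps [simp]:
 "Ob CC = {X. bounded_cpx R X}" "Hom CC = chain_map R" "Idt CC X = (%i. \<lambda>x\<in>elts X i. x)"
 "Comp CC X Y Z g f = (%i. compose (elts X i) (g i) (f i))"
 by (simp_all add: cpx_category_def)

lemma chain_map_id: "bounded_cpx R X ==> (%i. \<lambda>x\<in>elts X i. x) : chain_map R X X"
proof (rule chain_mapI)
 fix i assume X: "bounded_cpx R X"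
 interpret M: left_module R "deg X i" by (rule cpxD(1)[OF X])
 show "linmap R (deg X i) (deg X i) (\<lambda>x\<in>elts X i. x)"
  by (rule linmapI) (auto simp: M.smult_closed)
qed (auto simp: cpx_diff(1))

lemma chain_map_comp:
 assumes X: "bounded_cpx R X" and f: "f : chain_map R X Y" and g: "g : chain_map R Y Z"
 shows "(%i. compose (elts X i) (g i) (f i)) : chain_map R X Z"
proof (rule chain_mapI)
 fix i
 have "linmap R (deg X i) (deg Z i) (%x. g i (f i x))" by (rule linmap_comp[OF chain_mapD(1)[OF f] chain_mapD(1)[OF g]])
 then show "linmap R (deg X i) (deg Z i) (compose (elts X i) (g i) (f i))"
  using linmap_restrict[OF _ cpxD(1)[OF X]] by (simp add: mod_hom_iff compose_def)
 fix x assume x: "x : elts X i"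
 show "compose (elts X (i + 1)) (g (i + 1)) (f (i + 1)) (diff X i x) =
   diff Z i (compose (elts X i) (g i) (f i) x)"
  using x cpx_diff(1)[OF X x] chain_mapD(3)[OF f x] chain_mapD(3)[OF g linmapD(1)[OF chain_mapD(1)[OF f] x]]
  by (simp add: compose_eq)
qed (auto simp: compose_def)

lemma quasi_iso_id: "bounded_cpx R X ==> (%i. \<lambda>x\<in>elts X i. x) : quasi_iso R X X"
proof -
 assume X: "bounded_cpx R X"
 have "x \<ominus>[deg X i] x : coboundaries X i" if "x : elts X i" for x i
 proof -
  interpret M: left_module R "deg X i" by (rule cpxD(1)[OF X])
  show ?thesis using coboundaries_closed(1)[OF X] M.r_neg[OF that] by (simp add: a_minus_def)
 qed
 then show ?thesis unfolding quasi_iso_iff[OF X X]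
  by (intro conjI allI ballI impI chain_map_id[OF X]) (auto dest: cocyclesD(1) intro!: bexI)
qed

lemma bounded_cpxI:
 assumes "!!i. left_module R (deg X i)" "!!i. finitely_generated R (deg X i)"
  "!!i. linmap R (deg X i) (deg X (i + 1)) (diff X i)" "!!i. diff X i : extensional (elts X i)"
  "!!i x. x : elts X i ==> diff X (i + 1) (diff X i x) = \<zero>[deg X (i + 1 + 1)]"
  "!!i. \<bar>i\<bar> > n ==> elts X i = {\<zero>[deg X i]}"
 shows "bounded_cpx R X"
 unfolding bounded_cpx_def mod_hom_iff using assms by blast

lemma cpx_bound:
 assumes "bounded_cpx R X"
 obtains n where "!!i. \<bar>i\<bar> > n ==> elts X i = {\<zero>[deg X i]}"
 using assms unfolding bounded_cpx_def by blast

lemma bounded_zero_cpx: "bounded_cpx R zero_cpx"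
 by (rule bounded_cpxI[of _ 0]) (use zero_module[OF ring_axioms] in \<open>auto simp: zero_cpx_def linmap_def\<close>)

lemma bounded_sum_cpx:
 assumes X: "bounded_cpx R X" and Y: "bounded_cpx R Y"
 shows "bounded_cpx R (sum_cpx X Y)"
proof -
 obtain n where n: "!!i. \<bar>i\<bar> > n ==> elts X i = {\<zero>[deg X i]}" by (rule cpx_bound[OF X]) blast
 obtain m where m: "!!i. \<bar>i\<bar> > m ==> elts Y i = {\<zero>[deg Y i]}" by (rule cpx_bound[OF Y]) blast
 show ?thesis
 proof (rule bounded_cpxI[of _ "max n m"])
  fix i
  interpret M: left_module R "deg X i" by (rule cpxD(1)[OF X])
  interpret N: left_module R "deg Y i" by (rule cpxD(1)[OF Y])
  show "left_module R (deg (sum_cpx X Y) i)" "finitely_generated R (deg (sum_cpx X Y) i)"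
   by (simp_all add: sum_cpx_def left_module_direct_sum finitely_generated_direct_sum cpxD(1,2)[OF X] cpxD(1,2)[OF Y])
  show "linmap R (deg (sum_cpx X Y) i) (deg (sum_cpx X Y) (i + 1)) (diff (sum_cpx X Y) i)"
   by (rule linmapI) (auto simp: sum_cpx_def cpx_diff[OF X] cpx_diff[OF Y] M.smult_closed N.smult_closed)
  show "diff (sum_cpx X Y) i : extensional (elts (sum_cpx X Y) i)" by (simp add: sum_cpx_def)
  show "diff (sum_cpx X Y) (i + 1) (diff (sum_cpx X Y) i p) = \<zero>[deg (sum_cpx X Y) (i + 1 + 1)]"
   if "p : elts (sum_cpx X Y) i" for p
   using that by (auto simp: sum_cpx_def cpx_diff(1)[OF X] cpx_diff(1)[OF Y] cpxD(5)[OF X] cpxD(5)[OF Y])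
  show "elts (sum_cpx X Y) i = {\<zero>[deg (sum_cpx X Y) i]}" if "\<bar>i\<bar> > max n m"
   using that n m by (auto simp: sum_cpx_def)
 qed
qed

lemma sum_incl_chain_map:
 assumes X: "bounded_cpx R X" and Y: "bounded_cpx R Y"
 shows "sum_incl1 X Y : chain_map R X (sum_cpx X Y)" "sum_incl2 X Y : chain_map R Y (sum_cpx X Y)"
proof -
 show "sum_incl1 X Y : chain_map R X (sum_cpx X Y)"
 proof (rule chain_mapI)
  fix i
  interpret M: left_module R "deg X i" by (rule cpxD(1)[OF X])
  interpret N: left_module R "deg Y i" by (rule cpxD(1)[OF Y])
  show "linmap R (deg X i) (deg (sum_cpx X Y) i) (sum_incl1 X Y i)"
   by (rule linmapI) (auto simp: sum_cpx_def sum_incl1_def M.smult_closed N.smult_zero_right)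
  show "sum_incl1 X Y i : extensional (elts X i)" by (simp add: sum_incl1_def)
  show "sum_incl1 X Y (i + 1) (diff X i x) = diff (sum_cpx X Y) i (sum_incl1 X Y i x)" if "x : elts X i" for x
   using that by (auto simp: sum_cpx_def sum_incl1_def cpx_diff[OF X] cpx_diff(4)[OF Y])
 qed
 show "sum_incl2 X Y : chain_map R Y (sum_cpx X Y)"
 proof (rule chain_mapI)
  fix i
  interpret M: left_module R "deg X i" by (rule cpxD(1)[OF X])
  interpret N: left_module R "deg Y i" by (rule cpxD(1)[OF Y])
  show "linmap R (deg Y i) (deg (sum_cpx X Y) i) (sum_incl2 X Y i)"
   by (rule linmapI) (auto simp: sum_cpx_def sum_incl2_def N.smult_closed M.smult_zero_right)
  show "sum_incl2 X Y i : extensional (elts Y i)" by (simp add: sum_incl2_def)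
  show "sum_incl2 X Y (i + 1) (diff Y i x) = diff (sum_cpx X Y) i (sum_incl2 X Y i x)" if "x : elts Y i" for x
   using that by (auto simp: sum_cpx_def sum_incl2_def cpx_diff[OF Y] cpx_diff(4)[OF X])
 qed
qed

lemma cocycles_sum: "cocycles (sum_cpx X Y) i = {Tup x y | x y. x : cocycles X i \<and> y : cocycles Y i}"
 by (auto simp: cocycles_def sum_cpx_def)

lemma coboundaries_sum: "coboundaries (sum_cpx X Y) i = {Tup x y | x y. x : coboundaries X i \<and> y : coboundaries Y i}"
proof (intro equalityI subsetI)
 fix p assume "p : coboundaries (sum_cpx X Y) i"
 then show "p : {Tup x y | x y. x : coboundaries X i \<and> y : coboundaries Y i}"
  by (auto simp: coboundaries_def sum_cpx_def)
next
 fix p assume "p : {Tup x y | x y. x : coboundaries X i \<and> y : coboundaries Y i}"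
 then obtain x y where p: "p = Tup (diff X (i - 1) x) (diff Y (i - 1) y)" and xy: "x : elts X (i - 1)" "y : elts Y (i - 1)"
  by (auto simp: coboundaries_def)
 show "p : coboundaries (sum_cpx X Y) i" unfolding coboundary_iff' p
  by (rule bexI[of _ "Tup x y"]) (use xy in \<open>auto simp: sum_cpx_def\<close>)
qed

lemma sum_map_pointwise:
 assumes X: "bounded_cpx R X" and Y: "bounded_cpx R Y" and Z: "bounded_cpx R Z" and h: "h : chain_map R (sum_cpx X Y) Z"
  and x: "x : elts X i" and y: "y : elts Y i"
 shows "h i (Tup x y) = h i (sum_incl1 X Y i x) \<oplus>[deg Z i] h i (sum_incl2 X Y i y)"
proof -
 interpret M: left_module R "deg X i" by (rule cpxD(1)[OF X])
 interpret N: left_module R "deg Y i" by (rule cpxD(1)[OF Y])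
 have "Tup x y = sum_incl1 X Y i x \<oplus>[deg (sum_cpx X Y) i] sum_incl2 X Y i y"
  using x y by (simp add: sum_incl1_def sum_incl2_def sum_cpx_def)
 moreover have "sum_incl1 X Y i x : elts (sum_cpx X Y) i" "sum_incl2 X Y i y : elts (sum_cpx X Y) i"
  using x y by (auto simp: sum_incl1_def sum_incl2_def sum_cpx_def)
 ultimately show ?thesis using chain_map_simps(2)[OF bounded_sum_cpx[OF X Y] Z h] by simp
qed

lemma localising: "localising_category CC QQ"
proof
 fix X assume "X : Ob CC"
 then show "Idt CC X : Hom CC X X" "Idt CC X : QQ X X" using chain_map_id quasi_iso_id by simp_all
next
 fix X Y Z f g assume "X : Ob CC" "Y : Ob CC" "Z : Ob CC" "f : Hom CC X Y" "g : Hom CC Y Z"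
 then show "Comp CC X Y Z g f : Hom CC X Z" using chain_map_comp by simp
next
 fix X Y f assume "X : Ob CC" "Y : Ob CC" and f: "f : Hom CC X Y"
 then have f: "!!i. f i : extensional (elts X i)" "!!i x. x : elts X i ==> f i x : elts Y i"
  using chain_mapD(2) linmapD(1)[OF chain_mapD(1)] by fastforce+
 show "Comp CC X X Y f (Idt CC X) = f" "Comp CC X Y Y (Idt CC Y) f = f"
  unfolding CC_simps fun_eq_iff using f by (auto simp: compose_def restrict_def extensional_def)
next
 fix X Y Z V f g h assume "X : Ob CC" "Y : Ob CC" "Z : Ob CC" "V : Ob CC" "f : Hom CC X Y" "g : Hom CC Y Z" "h : Hom CC Z V"
 then have f: "!!i x. x : elts X i ==> f i x : elts Y i"
  using linmapD(1)[OF chain_mapD(1)] by fastforce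
 then show "Comp CC X Z V h (Comp CC X Y Z g f) = Comp CC X Y V (Comp CC Y Z V h g) f"
  unfolding CC_simps fun_eq_iff by (auto simp: compose_def restrict_def)
qed

lemma localising_sum: "localising_coproducts CC QQ sum_cpx sum_incl1 sum_incl2"
proof -
 interpret localising_category CC QQ by (rule localising)
 show ?thesis
 proof
  fix X Y assume "X : Ob CC" "Y : Ob CC"
  then show "sum_cpx X Y : Ob CC" "sum_incl1 X Y : Hom CC X (sum_cpx X Y)" "sum_incl2 X Y : Hom CC Y (sum_cpx X Y)"
   using bounded_sum_cpx sum_incl_chain_map by simp_all
 next
  fix X Y Z f g assume "X : Ob CC" "Y : Ob CC" "Z : Ob CC" "f : Hom CC X Z" "g : Hom CC Y Z"
  then have X: "bounded_cpx R X" and Y: "bounded_cpx R Y" and Z: "bounded_cpx R Z"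
   and f: "f : chain_map R X Z" and g: "g : chain_map R Y Z" by simp_all
  let ?h = "%i. \<lambda>p\<in>elts (sum_cpx X Y) i. f i (tfst p) \<oplus>[deg Z i] g i (tsnd p)"
  note fs = chain_map_simps[OF X Z f] and gs = chain_map_simps[OF Y Z g]
  have "?h : chain_map R (sum_cpx X Y) Z"
  proof (rule chain_mapI)
   fix i
   interpret M: left_module R "deg X i" by (rule cpxD(1)[OF X])
   interpret N: left_module R "deg Y i" by (rule cpxD(1)[OF Y])
   interpret K: left_module R "deg Z i" by (rule cpxD(1)[OF Z])
   show "linmap R (deg (sum_cpx X Y) i) (deg Z i) (?h i)"
    by (rule linmapI) (auto simp: sum_cpx_def fs gs M.smult_closed N.smult_closed K.a_ac K.smult_r_distr)
   show "?h i : extensional (elts (sum_cpx X Y) i)" by simp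
   show "?h (i + 1) (diff (sum_cpx X Y) i p) = diff Z i (?h i p)" if "p : elts (sum_cpx X Y) i" for p
    using that by (auto simp: sum_cpx_def fs gs cpx_diff[OF X] cpx_diff[OF Y] cpx_diff[OF Z] chain_mapD(3)[OF f] chain_mapD(3)[OF g])
  qed
  moreover have "Comp CC X (sum_cpx X Y) Z ?h (sum_incl1 X Y) = f"
  proof -
   have "compose (elts X i) (?h i) (sum_incl1 X Y i) x = f i x" for i x
   proof (cases "x : elts X i")
    case True
    interpret N: left_module R "deg Y i" by (rule cpxD(1)[OF Y])
    interpret K: left_module R "deg Z i" by (rule cpxD(1)[OF Z])
    show ?thesis using True by (simp add: compose_def sum_incl1_def sum_cpx_def fs gs)
   next
    case False then show ?thesis using chain_mapD(2)[OF f, of i] by (simp add: compose_def extensional_def)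
   qed
   then show ?thesis by (simp add: fun_eq_iff)
  qed
  moreover have "Comp CC Y (sum_cpx X Y) Z ?h (sum_incl2 X Y) = g"
  proof -
   have "compose (elts Y i) (?h i) (sum_incl2 X Y i) x = g i x" for i x
   proof (cases "x : elts Y i")
    case True
    interpret N: left_module R "deg X i" by (rule cpxD(1)[OF X])
    interpret K: left_module R "deg Z i" by (rule cpxD(1)[OF Z])
    show ?thesis using True by (simp add: compose_def sum_incl2_def sum_cpx_def fs gs)
   next
    case False then show ?thesis using chain_mapD(2)[OF g, of i] by (simp add: compose_def extensional_def)
   qed
   then show ?thesis by (simp add: fun_eq_iff)
  qed
  ultimately show "\<exists>h\<in>Hom CC (sum_cpx X Y) Z. Comp CC X (sum_cpx X Y) Z h (sum_incl1 X Y) = f \<and>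
    Comp CC Y (sum_cpx X Y) Z h (sum_incl2 X Y) = g" by (intro bexI[of _ ?h]) simp_all
 next
  fix X Y Z h h' assume "X : Ob CC" "Y : Ob CC" "Z : Ob CC" "h : Hom CC (sum_cpx X Y) Z" "h' : Hom CC (sum_cpx X Y) Z"
   and e1: "Comp CC X (sum_cpx X Y) Z h (sum_incl1 X Y) = Comp CC X (sum_cpx X Y) Z h' (sum_incl1 X Y)"
   and e2: "Comp CC Y (sum_cpx X Y) Z h (sum_incl2 X Y) = Comp CC Y (sum_cpx X Y) Z h' (sum_incl2 X Y)"
  then have X: "bounded_cpx R X" and Y: "bounded_cpx R Y" and Z: "bounded_cpx R Z"
   and h: "h : chain_map R (sum_cpx X Y) Z" and h': "h' : chain_map R (sum_cpx X Y) Z" by simp_all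
  have e1': "h i (sum_incl1 X Y i x) = h' i (sum_incl1 X Y i x)" if "x : elts X i" for i x
   using fun_cong[OF fun_cong[OF e1[unfolded CC_simps], of i], of x] that by (simp add: compose_def)
  have e2': "h i (sum_incl2 X Y i x) = h' i (sum_incl2 X Y i x)" if "x : elts Y i" for i x
   using fun_cong[OF fun_cong[OF e2[unfolded CC_simps], of i], of x] that by (simp add: compose_def)
  have "h i p = h' i p" for i p
  proof (cases "p : elts (sum_cpx X Y) i")
   case True
   then obtain x y where p: "p = Tup x y" "x : elts X i" "y : elts Y i" by (auto simp: sum_cpx_def)
   show ?thesis unfolding p(1) sum_map_pointwise[OF X Y Z h p(2,3)] sum_map_pointwise[OF X Y Z h' p(2,3)]
    using e1'[OF p(2)] e2'[OF p(3)] by simp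
  next
   case False
   then show ?thesis using chain_mapD(2)[OF h, of i] chain_mapD(2)[OF h', of i] by (simp add: extensional_def)
  qed
  then show "h = h'" by (simp add: fun_eq_iff)
 next
  fix X X' Y Y' s t h assume "X : Ob CC" "X' : Ob CC" "Y : Ob CC" "Y' : Ob CC" "s : Hom CC X X'" and sW: "s : QQ X X'"
   and "t : Hom CC Y Y'" and tW: "t : QQ Y Y'" and "h : Hom CC (sum_cpx X Y) (sum_cpx X' Y')"
   and e1: "Comp CC X (sum_cpx X Y) (sum_cpx X' Y') h (sum_incl1 X Y) = Comp CC X X' (sum_cpx X' Y') (sum_incl1 X' Y') s"
   and e2: "Comp CC Y (sum_cpx X Y) (sum_cpx X' Y') h (sum_incl2 X Y) = Comp CC Y Y' (sum_cpx X' Y') (sum_incl2 X' Y') t"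
  then have X: "bounded_cpx R X" "bounded_cpx R X'" and Y: "bounded_cpx R Y" "bounded_cpx R Y'"
   and s: "s : chain_map R X X'" and t: "t : chain_map R Y Y'" and h: "h : chain_map R (sum_cpx X Y) (sum_cpx X' Y')" by simp_all
  have ht: "h i (Tup x y) = Tup (s i x) (t i y)" if x: "x : elts X i" and y: "y : elts Y i" for i x y
  proof -
   interpret M: left_module R "deg X' i" by (rule cpxD(1)[OF X(2)])
   interpret N: left_module R "deg Y' i" by (rule cpxD(1)[OF Y(2)])
   have sx: "s i x : elts X' i" and ty: "t i y : elts Y' i"
    using chain_map_simps(1)[OF X s x] chain_map_simps(1)[OF Y t y] by auto
   have "h i (sum_incl1 X Y i x) = Tup (s i x) \<zero>[deg Y' i]"
    using fun_cong[OF fun_cong[OF e1[unfolded CC_simps], of i], of x] x sx by (simp add: compose_def sum_incl1_def)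
   moreover have "h i (sum_incl2 X Y i y) = Tup \<zero>[deg X' i] (t i y)"
    using fun_cong[OF fun_cong[OF e2[unfolded CC_simps], of i], of y] y ty by (simp add: compose_def sum_incl2_def)
   ultimately show ?thesis
    using sum_map_pointwise[OF X(1) Y(1) bounded_sum_cpx[OF X(2) Y(2)] h x y] sx ty by (simp add: sum_cpx_def)
  qed
  have sq: "!!i x. x : cocycles X i ==> s i x : coboundaries X' i ==> x : coboundaries X i"
   "!!i y. y : cocycles X' i ==> \<exists>x\<in>cocycles X i. y \<ominus>[deg X' i] s i x : coboundaries X' i"
   using sW unfolding quasi_iso_iff[OF X] by blast+
  have tq: "!!i x. x : cocycles Y i ==> t i x : coboundaries Y' i ==> x : coboundaries Y i"
   "!!i y. y : cocycles Y' i ==> \<exists>x\<in>cocycles Y i. y \<ominus>[deg Y' i] t i x : coboundaries Y' i"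
   using tW unfolding quasi_iso_iff[OF Y] by blast+
  show "h : QQ (sum_cpx X Y) (sum_cpx X' Y')"
   unfolding quasi_iso_iff[OF bounded_sum_cpx[OF X(1) Y(1)] bounded_sum_cpx[OF X(2) Y(2)]]
  proof (intro conjI allI ballI impI h)
   fix i p assume p: "p : cocycles (sum_cpx X Y) i" "h i p : coboundaries (sum_cpx X' Y') i"
   obtain x y where xy: "p = Tup x y" "x : cocycles X i" "y : cocycles Y i" using p(1) by (auto simp: cocycles_sum)
   then show "p : coboundaries (sum_cpx X Y) i"
    using p(2) ht[OF cocyclesD(1)[OF xy(2)] cocyclesD(1)[OF xy(3)]] sq(1) tq(1) by (auto simp: coboundaries_sum)
  next
   fix i p assume "p : cocycles (sum_cpx X' Y') i"
   then obtain x' y' where xy: "p = Tup x' y'" "x' : cocycles X' i" "y' : cocycles Y' i" by (auto simp: cocycles_sum)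
   obtain x where x: "x : cocycles X i" "x' \<ominus>[deg X' i] s i x : coboundaries X' i" using sq(2)[OF xy(2)] by blast
   obtain y where y: "y : cocycles Y i" "y' \<ominus>[deg Y' i] t i y : coboundaries Y' i" using tq(2)[OF xy(3)] by blast
   note xc = cocyclesD(1)[OF x(1)] and yc = cocyclesD(1)[OF y(1)]
   have "p \<ominus>[deg (sum_cpx X' Y') i] h i (Tup x y) = Tup (x' \<ominus>[deg X' i] s i x) (y' \<ominus>[deg Y' i] t i y)"
    unfolding ht[OF xc yc] a_minus_def xy(1)
    using direct_sum_minus[OF cpxD(1)[OF X(2)] cpxD(1)[OF Y(2)] chain_map_simps(1)[OF X s xc] chain_map_simps(1)[OF Y t yc]]
    by (simp add: sum_cpx_def)
   then show "\<exists>q\<in>cocycles (sum_cpx X Y) i. p \<ominus>[deg (sum_cpx X' Y') i] h i q : coboundaries (sum_cpx X' Y') i"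
    by (intro bexI[of _ "Tup x y"]) (use x y in \<open>auto simp: cocycles_sum coboundaries_sum\<close>)
  qed
 qed
qed

end

sublocale bounded_complexes \<subseteq> L: localising_coproducts "cpx_category R" "quasi_iso R" sum_cpx sum_incl1 sum_incl2
 by (rule localising_sum)

context bounded_complexes
begin

lemma zero_cpx_data: "L.zero_data zero_cpx (%X i. \<lambda>x\<in>carrier zero_module. \<zero>[deg X i]) (%X i. \<lambda>x\<in>elts X i. Elem undefined)"
 unfolding L.zero_data_def
proof (intro conjI ballI)
 show "zero_cpx : Ob CC" using bounded_zero_cpx by simp
 fix X assume "X : Ob CC"
 then have X: "bounded_cpx R X" by simp
 note Z = bounded_zero_cpx
 show "(%i. \<lambda>x\<in>carrier zero_module. \<zero>[deg X i]) : Hom CC zero_cpx X" unfolding CC_simps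
 proof (rule chain_mapI)
  fix i
  interpret M: left_module R "deg X i" by (rule cpxD(1)[OF X])
  show "linmap R (deg zero_cpx i) (deg X i) (\<lambda>x\<in>carrier zero_module. \<zero>[deg X i])"
   by (rule linmapI) (auto simp: zero_cpx_def M.smult_zero_right)
 qed (auto simp: zero_cpx_def cpx_diff(4)[OF X])
 show "(%i. \<lambda>x\<in>elts X i. Elem undefined) : Hom CC X zero_cpx" unfolding CC_simps
 proof (rule chain_mapI)
  fix i
  interpret M: left_module R "deg X i" by (rule cpxD(1)[OF X])
  show "linmap R (deg X i) (deg zero_cpx i) (\<lambda>x\<in>elts X i. Elem undefined)"
   by (rule linmapI) (auto simp: zero_cpx_def M.smult_closed)
 qed (auto simp: zero_cpx_def cpx_diff(1)[OF X])
 fix f assume "f : Hom CC zero_cpx X"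
 then have f: "f : chain_map R zero_cpx X" by simp
 show "f = (%i. \<lambda>x\<in>carrier zero_module. \<zero>[deg X i])"
  using chain_map_simps(4)[OF Z X f] chain_mapD(2)[OF f] by (auto simp: fun_eq_iff zero_cpx_def extensional_def)
next
 fix X f assume X: "X : Ob CC" and "f : Hom CC X zero_cpx"
 then have f: "f : chain_map R X zero_cpx" and X: "bounded_cpx R X" by simp_all
 show "f = (%i. \<lambda>x\<in>elts X i. Elem undefined)"
  using chain_map_simps(1)[OF X bounded_zero_cpx f] chain_mapD(2)[OF f] by (auto simp: fun_eq_iff zero_cpx_def extensional_def)
qed

section \<open>Shifts and cones\<close>

lemma bounded_shift_cpx:
 assumes X: "bounded_cpx R X"
 shows "bounded_cpx R (shift_cpx n X)"
proof -
 obtain m where m: "!!i. \<bar>i\<bar> > m ==> elts X i = {\<zero>[deg X i]}" by (rule cpx_bound[OF X]) blast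
 have ar: "i + 1 + n = i + n + 1" "i + 1 + 1 + n = i + n + 1 + 1" for i by simp_all
 show ?thesis
 proof (rule bounded_cpxI[of _ "m + \<bar>n\<bar>"])
  fix i
  interpret M: left_module R "deg X (i + n)" by (rule cpxD(1)[OF X])
  interpret N: left_module R "deg X (i + n + 1)" by (rule cpxD(1)[OF X])
  interpret K': left_module R "deg X (2 + (i + n))" by (rule cpxD(1)[OF X])
  show "left_module R (deg (shift_cpx n X) i)" "finitely_generated R (deg (shift_cpx n X) i)"
   using cpxD[OF X] by (simp_all add: shift_cpx_def)
  show "linmap R (deg (shift_cpx n X) i) (deg (shift_cpx n X) (i + 1)) (diff (shift_cpx n X) i)"
   by (rule linmapI) (auto simp: shift_cpx_def ar cpx_diff[OF X] M.smult_closed N.minus_add N.smult_minus_right)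
  show "diff (shift_cpx n X) i : extensional (elts (shift_cpx n X) i)" by (simp add: shift_cpx_def)
  show "diff (shift_cpx n X) (i + 1) (diff (shift_cpx n X) i p) = \<zero>[deg (shift_cpx n X) (i + 1 + 1)]"
   if "p : elts (shift_cpx n X) i" for p
   using that K'.neg_zero by (auto simp: shift_cpx_def ar cpx_diff[OF X] cpxD(5)[OF X]) (simp_all add: add.assoc)
  show "elts (shift_cpx n X) i = {\<zero>[deg (shift_cpx n X) i]}" if "\<bar>i\<bar> > m + \<bar>n\<bar>"
   using that m[of "i + n"] by (simp add: shift_cpx_def)
 qed
qed

lemma cocycles_shift:
 assumes X: "bounded_cpx R X"
 shows "cocycles (shift_cpx n X) i = cocycles X (i + n)"
proof -
 interpret N: left_module R "deg X (i + n + 1)" by (rule cpxD(1)[OF X])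
 have ar: "i + 1 + n = i + n + 1" by simp
 have "\<ominus>[deg X (i + n + 1)] diff X (i + n) x = \<zero>[deg X (i + n + 1)] \<longleftrightarrow> diff X (i + n) x = \<zero>[deg X (i + n + 1)]"
  if "x : elts X (i + n)" for x
  using N.neg_eq_zero_iff[OF cpx_diff(1)[OF X that]] .
 then show ?thesis by (auto simp: cocycles_def shift_cpx_def ar)
qed

lemma coboundaries_shift:
 assumes X: "bounded_cpx R X"
 shows "coboundaries (shift_cpx n X) i = coboundaries X (i + n)"
proof -
 interpret M: left_module R "deg X (i + n - 1)" by (rule cpxD(1)[OF X])
 have ar: "i - 1 + n = i + n - 1" "i - 1 + n + 1 = i + n" by simp_all
 have d: "\<ominus>[deg X (i + n)] diff X (i + n - 1) x = diff X (i + n - 1) (\<ominus>[deg X (i + n - 1)] x)"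
  if "x : elts X (i + n - 1)" for x
  using cpx_diff(5)[OF X that] by simp
 show ?thesis
 proof (cases "even n")
  case True then show ?thesis by (simp add: coboundaries_def shift_cpx_def ar)
 next
  case False
  have "(%x. \<ominus>[deg X (i + n)] diff X (i + n - 1) x) ` elts X (i + n - 1) =
    diff X (i + n - 1) ` (%x. \<ominus>[deg X (i + n - 1)] x) ` elts X (i + n - 1)"
   unfolding image_image by (rule image_cong) (simp_all add: d)
  also have "(%x. \<ominus>[deg X (i + n - 1)] x) ` elts X (i + n - 1) = elts X (i + n - 1)"
  proof (intro equalityI subsetI)
   fix x assume "x : elts X (i + n - 1)"
   then show "x : (%x. \<ominus>[deg X (i + n - 1)] x) ` elts X (i + n - 1)"
    by (intro image_eqI[of _ _ "\<ominus>[deg X (i + n - 1)] x"]) simp_all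
  qed auto
  finally show ?thesis using False by (simp add: coboundaries_def shift_cpx_def ar)
 qed
qed

lemma shift_functor: "L.endofunctor (shift_cpx n) (%_ _. shift_map n)"
 unfolding L.endofunctor_def
proof (intro conjI ballI impI)
 fix X assume "X : Ob CC"
 then show "shift_cpx n X : Ob CC" "shift_map n (Idt CC X) = Idt CC (shift_cpx n X)"
  using bounded_shift_cpx by (simp_all add: shift_map_def shift_cpx_def restrict_def fun_eq_iff)
next
 fix X Y f assume "X : Ob CC" "Y : Ob CC" "f : Hom CC X Y"
 then have X: "bounded_cpx R X" and Y: "bounded_cpx R Y" and f: "f : chain_map R X Y" by simp_all
 have ar: "i + 1 + n = i + n + 1" for i by simp
 have c: "shift_map n f : chain_map R (shift_cpx n X) (shift_cpx n Y)"
 proof (rule chain_mapI)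
  fix i
  show "linmap R (deg (shift_cpx n X) i) (deg (shift_cpx n Y) i) (shift_map n f i)"
   "shift_map n f i : extensional (elts (shift_cpx n X) i)"
   using chain_mapD(1,2)[OF f] by (simp_all add: shift_cpx_def shift_map_def)
  fix x assume "x : elts (shift_cpx n X) i"
  then show "shift_map n f (i + 1) (diff (shift_cpx n X) i x) = diff (shift_cpx n Y) i (shift_map n f i x)"
   using chain_map_simps[OF X Y f] chain_mapD(3)[OF f] cpx_diff(1)[OF X] by (simp add: shift_cpx_def shift_map_def ar)
 qed
 then show "shift_map n f : Hom CC (shift_cpx n X) (shift_cpx n Y)" by simp
 show "shift_map n f : QQ (shift_cpx n X) (shift_cpx n Y)" if "f : QQ X Y"
  using that unfolding quasi_iso_iff[OF X Y] quasi_iso_iff[OF bounded_shift_cpx[OF X] bounded_shift_cpx[OF Y]]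
   cocycles_shift[OF X] cocycles_shift[OF Y] coboundaries_shift[OF X] coboundaries_shift[OF Y]
  using c by (simp add: shift_map_def) (simp add: shift_cpx_def)
next
 fix X Y Z f g
 show "shift_map n (Comp CC X Y Z g f) = Comp CC (shift_cpx n X) (shift_cpx n Y) (shift_cpx n Z) (shift_map n g) (shift_map n f)"
  by (simp add: shift_map_def shift_cpx_def)
qed

lemma shift_zmap: "map (map_step (shift_cpx n) (shift_map n)) p = L.zmap (shift_cpx n) (%_ _. shift_map n) X p"
proof (induction p arbitrary: X)
 case (Cons a p)
 then show ?case by (cases a) simp_all
qed simp

text \<open>The triangle of a chain map is compared with itself through identities, so this is the
  value of the shift functor that enters the last square.\<close>

lemma derived_shift_id:
 assumes X: "bounded_cpx R X"
 shows "derived_shift R n X X (L.cls X X []) = L.cls (shift_cpx n X) (shift_cpx n X) []"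
proof -
 have "L.cls (shift_cpx n X) (shift_cpx n X) (map (map_step (shift_cpx n) (shift_map n)) p) = L.cls (shift_cpx n X) (shift_cpx n X) []"
  if "p : L.cls X X []" for p
 proof -
  have "L.zeq X X [] p" using that by (simp add: zigzag_class_def)
  from L.zmap_zeq[OF shift_functor this, of n] show ?thesis
   unfolding shift_zmap[of n p X] using L.clsI L.zeq_sym by fastforce
 qed
 moreover have "[] : L.cls X X []" using X by (auto simp: zigzag_class_def intro!: L.zeq_refl L.zz_nil)
 ultimately show ?thesis unfolding derived_shift_def by blast
qed

lemma bounded_cone:
 assumes X: "bounded_cpx R X" and Y: "bounded_cpx R Y" and f: "f : chain_map R X Y"
 shows "bounded_cpx R (cone X Y f)"
proof -
 obtain n where n: "!!i. \<bar>i\<bar> > n ==> elts X i = {\<zero>[deg X i]}" by (rule cpx_bound[OF X]) blast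
 obtain m where m: "!!i. \<bar>i\<bar> > m ==> elts Y i = {\<zero>[deg Y i]}" by (rule cpx_bound[OF Y]) blast
 note fs = chain_map_simps[OF X Y f] and fd = chain_mapD(3)[OF f]
 show ?thesis
 proof (rule bounded_cpxI[of _ "max (n + 1) m"])
  fix i
  interpret M: left_module R "deg X (i + 1)" by (rule cpxD(1)[OF X])
  interpret N: left_module R "deg Y i" by (rule cpxD(1)[OF Y])
  interpret M1: left_module R "deg X (i + 1 + 1)" by (rule cpxD(1)[OF X])
  interpret N1: left_module R "deg Y (i + 1)" by (rule cpxD(1)[OF Y])
  interpret M2': left_module R "deg X (3 + i)" by (rule cpxD(1)[OF X])
  interpret N2': left_module R "deg Y (2 + i)" by (rule cpxD(1)[OF Y])
  interpret M1': left_module R "deg X (2 + i)" by (rule cpxD(1)[OF X])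
  show "left_module R (deg (cone X Y f) i)" "finitely_generated R (deg (cone X Y f) i)"
   by (simp_all add: cone_def left_module_direct_sum finitely_generated_direct_sum cpxD(1,2)[OF X] cpxD(1,2)[OF Y])
  show "linmap R (deg (cone X Y f) i) (deg (cone X Y f) (i + 1)) (diff (cone X Y f) i)"
   using cpx_diff(1)[OF X, of _ "i + 1"] by (intro linmapI) (auto simp: cone_def cpx_diff[OF X] cpx_diff[OF Y] fs M.smult_closed N.smult_closed
     M1'.minus_add M1'.smult_minus_right N1.smult_r_distr N1.a_ac)
  show "diff (cone X Y f) i : extensional (elts (cone X Y f) i)" by (simp add: cone_def)
  show "diff (cone X Y f) (i + 1) (diff (cone X Y f) i p) = \<zero>[deg (cone X Y f) (i + 1 + 1)]"
   if "p : elts (cone X Y f) i" for p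
  proof -
   obtain x y where p: "p = Tup x y" "x : elts X (i + 1)" "y : elts Y i" using \<open>p : _\<close> by (auto simp: cone_def)
   have dx: "diff X (i + 1) x : elts X (i + 1 + 1)" and dy: "diff Y i y : elts Y (i + 1)"
    using cpx_diff(1)[OF X p(2)] cpx_diff(1)[OF Y p(3)] by auto
   have "f (i + 1 + 1) (\<ominus>[deg X (i + 1 + 1)] diff X (i + 1) x) \<oplus>[deg Y (i + 1 + 1)]
     diff Y (i + 1) (f (i + 1) x \<oplus>[deg Y (i + 1)] diff Y i y) = \<zero>[deg Y (i + 1 + 1)]"
    using fs(5)[OF dx] fd[OF p(2)] cpx_diff(2)[OF Y fs(1)[OF p(2)] dy] cpxD(5)[OF Y p(3)] cpx_diff(1)[OF Y fs(1)[OF p(2)]]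
    by (simp add: N2'.l_neg)
   moreover have "\<ominus>[deg X (i + 1 + 1 + 1)] diff X (i + 1 + 1) (\<ominus>[deg X (i + 1 + 1)] diff X (i + 1) x) = \<zero>[deg X (i + 1 + 1 + 1)]"
    using cpx_diff(5)[OF X dx] cpxD(5)[OF X p(2)] by simp
   ultimately show ?thesis unfolding p(1) using p(2,3) dx dy fs(1)[OF p(2)] by (simp add: cone_def)
  qed
  show "elts (cone X Y f) i = {\<zero>[deg (cone X Y f) i]}" if "\<bar>i\<bar> > max (n + 1) m"
   using that n[of "i + 1"] m[of i] by (auto simp: cone_def)
 qed
qed

lemma cone_incl_chain_map:
 assumes X: "bounded_cpx R X" and Y: "bounded_cpx R Y" and f: "f : chain_map R X Y"
 shows "cone_incl X Y : chain_map R Y (cone X Y f)"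
proof (rule chain_mapI)
 fix i
 interpret M: left_module R "deg X (i + 1)" by (rule cpxD(1)[OF X])
 interpret N: left_module R "deg Y i" by (rule cpxD(1)[OF Y])
 interpret M1: left_module R "deg X (i + 1 + 1)" by (rule cpxD(1)[OF X])
 interpret N1: left_module R "deg Y (i + 1)" by (rule cpxD(1)[OF Y])
 interpret M1': left_module R "deg X (2 + i)" by (rule cpxD(1)[OF X])
 show "linmap R (deg Y i) (deg (cone X Y f) i) (cone_incl X Y i)"
  by (rule linmapI) (auto simp: cone_def cone_incl_def N.smult_closed M.smult_zero_right)
 show "cone_incl X Y i : extensional (elts Y i)" by (simp add: cone_incl_def)
 show "cone_incl X Y (i + 1) (diff Y i y) = diff (cone X Y f) i (cone_incl X Y i y)" if "y : elts Y i" for y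
  using that M1'.neg_zero by (simp add: cone_def cone_incl_def cpx_diff[OF X] cpx_diff(1)[OF Y] chain_map_simps[OF X Y f])
qed

lemma cone_proj_chain_map:
 assumes X: "bounded_cpx R X" and Y: "bounded_cpx R Y" and f: "f : chain_map R X Y"
 shows "cone_proj X Y : chain_map R (cone X Y f) (shift_cpx 1 X)"
proof (rule chain_mapI)
 fix i
 interpret M: left_module R "deg X (i + 1)" by (rule cpxD(1)[OF X])
 interpret N: left_module R "deg Y i" by (rule cpxD(1)[OF Y])
 interpret M1: left_module R "deg X (i + 1 + 1)" by (rule cpxD(1)[OF X])
 interpret N1: left_module R "deg Y (i + 1)" by (rule cpxD(1)[OF Y])
 show "linmap R (deg (cone X Y f) i) (deg (shift_cpx 1 X) i) (cone_proj X Y i)"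
  by (rule linmapI) (auto simp: cone_def cone_proj_def shift_cpx_def N.smult_closed M.smult_closed)
 show "cone_proj X Y i : extensional (elts (cone X Y f) i)" by (simp add: cone_proj_def cone_def)
 show "cone_proj X Y (i + 1) (diff (cone X Y f) i y) = diff (shift_cpx 1 X) i (cone_proj X Y i y)"
  if "y : elts (cone X Y f) i" for y
 proof -
  obtain u v where y: "y = Tup u v" "u : elts X (i + 1)" "v : elts Y i" using \<open>y : _\<close> by (auto simp: cone_def)
  have "\<ominus>[deg X (i + 1 + 1)] diff X (i + 1) u : elts X (i + 1 + 1)"
   "f (i + 1) u \<oplus>[deg Y (i + 1)] diff Y i v : elts Y (i + 1)"
   by (rule M1.a_inv_closed[OF cpx_diff(1)[OF X y(2)]])
    (rule N1.a_closed[OF chain_map_simps(1)[OF X Y f y(2)] cpx_diff(1)[OF Y y(3)]])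
  then show ?thesis using y by (simp add: cone_def cone_proj_def shift_cpx_def)
 qed
qed

text \<open>With \<open>X\<close> acyclic the cone has the cohomology of \<open>Y\<close>. If
  \<open>(0, y)\<close> is the boundary of \<open>(u, v)\<close>, then \<open>u\<close> is a
  cocycle, hence a coboundary, and so \<open>y = f u + d v\<close> is a coboundary too.\<close>

lemma cone_incl_quasi_iso:
 assumes X: "bounded_cpx R X" and Y: "bounded_cpx R Y" and f: "f : chain_map R X Y"
  and acyclic: "!!i. cocycles X i \<subseteq> coboundaries X i"
 shows "cone_incl X Y : quasi_iso R Y (cone X Y f)"
 unfolding quasi_iso_iff[OF Y bounded_cone[OF X Y f]]
proof (intro conjI allI ballI impI cone_incl_chain_map[OF X Y f])
 note fs = chain_map_simps[OF X Y f] and fd = chain_mapD(3)[OF f]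
 {
  fix i y assume y: "y : cocycles Y i" and b: "cone_incl X Y i y : coboundaries (cone X Y f) i"
  define k where "k = i - 1"
  have i: "i = k + 1" by (simp add: k_def)
  interpret M1: left_module R "deg X (k + 1 + 1)" by (rule cpxD(1)[OF X])
  have yc: "y : elts Y (k + 1)" using cocyclesD(1)[OF y] by (simp add: i)
  obtain u v where uv: "u : elts X (k + 1)" "v : elts Y k"
   and e: "Tup \<zero>[deg X (k + 1 + 1)] y = Tup (\<ominus>[deg X (k + 1 + 1)] diff X (k + 1) u) (f (k + 1) u \<oplus>[deg Y (k + 1)] diff Y k v)"
   using b yc unfolding i coboundary_iff by (auto simp: cone_incl_def cone_def)
  have "diff X (k + 1) u = \<zero>[deg X (k + 1 + 1)]"
   using e M1.neg_eq_zero_iff[OF cpx_diff(1)[OF X uv(1)]] by auto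
  then have "u : cocycles X (k + 1)" using uv(1) by (simp add: cocycles_def)
  then have "u : coboundaries X (k + 1)" using acyclic by blast
  then have "f (k + 1) u : coboundaries Y (k + 1)" by (rule chain_map_cocycle(2)[OF X Y f])
  moreover have "diff Y k v : coboundaries Y (k + 1)" using uv(2) coboundary_iff by blast
  ultimately show "y : coboundaries Y i" unfolding i using e coboundaries_closed(2)[OF Y] by simp
 next
  fix i p assume p: "p : cocycles (cone X Y f) i"
  interpret M: left_module R "deg X (i + 1)" by (rule cpxD(1)[OF X])
  interpret N: left_module R "deg Y i" by (rule cpxD(1)[OF Y])
  interpret M1: left_module R "deg X (i + 1 + 1)" by (rule cpxD(1)[OF X])
  interpret N1: left_module R "deg Y (i + 1)" by (rule cpxD(1)[OF Y])
  obtain x y where xy: "p = Tup x y" "x : elts X (i + 1)" "y : elts Y i"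
   and z: "\<ominus>[deg X (i + 1 + 1)] diff X (i + 1) x = \<zero>[deg X (i + 1 + 1)]"
    "f (i + 1) x \<oplus>[deg Y (i + 1)] diff Y i y = \<zero>[deg Y (i + 1)]"
   using p by (auto simp: cocycles_def cone_def)
  have "diff X (i + 1) x = \<zero>[deg X (i + 1 + 1)]"
   using z(1) M1.neg_eq_zero_iff[OF cpx_diff(1)[OF X xy(2)]] by simp
  then have "x : cocycles X (i + 1)" unfolding cocycles_def using xy(2) by blast
  then have "x : coboundaries X (i + 1)" using acyclic by blast
  then obtain u where u: "u : elts X i" "x = diff X i u" unfolding coboundary_iff by blast
  define k where "k = i - 1"
  have i: "i = k + 1" by (simp add: k_def)
  interpret X1: left_module R "deg X i" by (rule cpxD(1)[OF X])
  \<comment> \<open>The boundary of \<open>(- u, 0)\<close> is \<open>(x, - f u)\<close>;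
    subtracting it from the cocycle \<open>(x, y)\<close> leaves
    \<open>(0, y + f u)\<close>.\<close>
  define y' where "y' = y \<oplus>[deg Y i] f i u"
  have fu: "f i u : elts Y i" by (rule fs(1)[OF u(1)])
  have y'c: "y' : cocycles Y i"
   using z(2) fd[OF u(1)] xy(3) fu cpx_diff(2)[OF Y xy(3) fu] cpx_diff(1)[OF Y xy(3)] cpx_diff(1)[OF Y fu] u(2)
   unfolding y'_def cocycles_def by (simp add: N1.a_comm)
  have y'd: "y' : elts Y i" by (rule cocyclesD(1)[OF y'c])
  have "p \<ominus>[deg (cone X Y f) i] cone_incl X Y i y' = Tup (diff X i u) (\<ominus>[deg Y i] f i u)"
   unfolding a_minus_def xy(1)
   using direct_sum_minus[OF M.left_module_axioms N.left_module_axioms M.zero_closed y'd] xy(2,3) y'd u fu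
   by (simp add: cone_incl_def cone_def y'_def N.minus_add N.a_assoc[symmetric] N.r_neg)
  also have "\<dots> = diff (cone X Y f) k (Tup (\<ominus>[deg X (k + 1)] u) \<zero>[deg Y k])"
  proof -
   interpret Yk: left_module R "deg Y k" by (rule cpxD(1)[OF Y])
   have "Tup (\<ominus>[deg X (k + 1)] u) \<zero>[deg Y k] : carrier (direct_sum (deg X (k + 1)) (deg Y k))"
    using u(1) X1.a_inv_closed by (simp add: i)
   then show ?thesis
    using u(1) fu cpx_diff(4)[OF Y, of k] cpx_diff(5)[OF X u(1)] cpx_diff(1)[OF X u(1)] fs(5)[OF u(1)]
     N.a_inv_closed[OF fu] N.r_zero[OF N.a_inv_closed[OF fu]] M.minus_minus
    unfolding i by (simp add: cone_def)
  qed
  finally have "p \<ominus>[deg (cone X Y f) i] cone_incl X Y i y' : coboundaries (cone X Y f) i"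
  proof -
   assume e: "p \<ominus>[deg (cone X Y f) i] cone_incl X Y i y' = diff (cone X Y f) k (Tup (\<ominus>[deg X (k + 1)] u) \<zero>[deg Y k])"
   interpret Yk: left_module R "deg Y k" by (rule cpxD(1)[OF Y])
   have "Tup (\<ominus>[deg X (k + 1)] u) \<zero>[deg Y k] : elts (cone X Y f) k"
    using u(1) X1.a_inv_closed by (simp add: i cone_def)
   then show ?thesis unfolding e unfolding i coboundary_iff by blast
  qed
  then show "\<exists>y\<in>cocycles Y i. p \<ominus>[deg (cone X Y f) i] cone_incl X Y i y : coboundaries (cone X Y f) i"
   using y'c by blast
 }
qed

end

section \<open>Cohomology as a functor on the derived category\<close>

context bounded_complexes
begin

text \<open>The operations are unions over all representatives; by the congruence lemmas the members
  of the union coincide, so nothing has to be chosen.\<close>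

definition hmod :: "'r cpx => int => ('r, 'r tuple set) module" where
 "hmod X i = \<lparr>carrier = cohomology X i, monoid.mult = undefined, one = undefined, zero = hcl X i \<zero>[deg X i],
   add = (%c d. \<Union>x\<in>c. \<Union>y\<in>d. hcl X i (x \<oplus>[deg X i] y)), module.smult = (%a c. \<Union>x\<in>c. hcl X i (a \<odot>[deg X i] x))\<rparr>"

lemma hmod_simps [simp]: "carrier (hmod X i) = cohomology X i" "\<zero>[hmod X i] = hcl X i \<zero>[deg X i]"
 by (simp_all add: hmod_def)

lemma hcl_add_cong:
 assumes X: "bounded_cpx R X" and c: "x : elts X i" "x' : elts X i" "y : elts X i" "y' : elts X i"
  and e: "hcl X i x = hcl X i x'" "hcl X i y = hcl X i y'"
 shows "hcl X i (x \<oplus>[deg X i] y) = hcl X i (x' \<oplus>[deg X i] y')"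
proof -
 interpret M: left_module R "deg X i" by (rule cpxD(1)[OF X])
 have "(x \<oplus>[deg X i] y) \<ominus>[deg X i] (x' \<oplus>[deg X i] y') = (x \<ominus>[deg X i] x') \<oplus>[deg X i] (y \<ominus>[deg X i] y')"
  using c by (simp add: a_minus_def M.minus_add M.a_ac)
 then show ?thesis
  using e hcl_eq_iff[OF X] c coboundaries_closed(2)[OF X] by simp
qed

lemma hcl_smult_cong:
 assumes X: "bounded_cpx R X" and c: "x : elts X i" "x' : elts X i" "a : carrier R"
  and e: "hcl X i x = hcl X i x'"
 shows "hcl X i (a \<odot>[deg X i] x) = hcl X i (a \<odot>[deg X i] x')"
proof -
 interpret M: left_module R "deg X i" by (rule cpxD(1)[OF X])
 have "(a \<odot>[deg X i] x) \<ominus>[deg X i] (a \<odot>[deg X i] x') = a \<odot>[deg X i] (x \<ominus>[deg X i] x')"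
  using c by (simp add: a_minus_def M.smult_minus_right M.smult_r_distr)
 then show ?thesis
  using e hcl_eq_iff[OF X] c coboundaries_closed(4)[OF X] M.smult_closed by simp
qed

lemma hmod_add:
 assumes X: "bounded_cpx R X" and x: "x : elts X i" and y: "y : elts X i"
 shows "hcl X i x \<oplus>[hmod X i] hcl X i y = hcl X i (x \<oplus>[deg X i] y)"
proof -
 have "hcl X i (x' \<oplus>[deg X i] y') = hcl X i (x \<oplus>[deg X i] y)" if "x' : hcl X i x" "y' : hcl X i y" for x' y'
  using hcl_mem(1)[OF X x that(1)] hcl_mem(1)[OF X y that(2)] x y by (intro hcl_add_cong[OF X]) auto
 note e = this
 have "(\<Union>x'\<in>hcl X i x. \<Union>y'\<in>hcl X i y. hcl X i (x' \<oplus>[deg X i] y')) = hcl X i (x \<oplus>[deg X i] y)"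
 proof (intro equalityI subsetI)
  fix z assume "z : (\<Union>x'\<in>hcl X i x. \<Union>y'\<in>hcl X i y. hcl X i (x' \<oplus>[deg X i] y'))"
  then obtain x' y' where z: "x' : hcl X i x" "y' : hcl X i y" "z : hcl X i (x' \<oplus>[deg X i] y')" by blast
  show "z : hcl X i (x \<oplus>[deg X i] y)" using z(3) unfolding e[OF z(1,2)] .
 next
  fix z assume "z : hcl X i (x \<oplus>[deg X i] y)"
  then show "z : (\<Union>x'\<in>hcl X i x. \<Union>y'\<in>hcl X i y. hcl X i (x' \<oplus>[deg X i] y'))"
   by (rule UN_I[OF hcl_mem(2)[OF X x] UN_I[OF hcl_mem(2)[OF X y]]])
 qed
 then show ?thesis by (simp only: hmod_def ring.simps)
qed

lemma hmod_smult:
 assumes X: "bounded_cpx R X" and x: "x : elts X i" and a: "a : carrier R"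
 shows "a \<odot>[hmod X i] hcl X i x = hcl X i (a \<odot>[deg X i] x)"
proof -
 have "hcl X i (a \<odot>[deg X i] x') = hcl X i (a \<odot>[deg X i] x)" if "x' : hcl X i x" for x'
  using hcl_mem(1)[OF X x that] x a by (intro hcl_smult_cong[OF X]) auto
 note e = this
 have "(\<Union>x'\<in>hcl X i x. hcl X i (a \<odot>[deg X i] x')) = hcl X i (a \<odot>[deg X i] x)"
 proof (intro equalityI subsetI)
  fix z assume "z : (\<Union>x'\<in>hcl X i x. hcl X i (a \<odot>[deg X i] x'))"
  then obtain x' where z: "x' : hcl X i x" "z : hcl X i (a \<odot>[deg X i] x')" by blast
  show "z : hcl X i (a \<odot>[deg X i] x)" using z(2) unfolding e[OF z(1)] .
 next
  fix z assume "z : hcl X i (a \<odot>[deg X i] x)"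
  then show "z : (\<Union>x'\<in>hcl X i x. hcl X i (a \<odot>[deg X i] x'))"
   by (rule UN_I[OF hcl_mem(2)[OF X x]])
 qed
 then show ?thesis by (simp only: hmod_def module.simps)
qed

lemma hmod_closed:
 assumes X: "bounded_cpx R X"
 shows "c : cohomology X i ==> d : cohomology X i ==> c \<oplus>[hmod X i] d : cohomology X i"
  "a : carrier R ==> c : cohomology X i ==> a \<odot>[hmod X i] c : cohomology X i"
  "hcl X i \<zero>[deg X i] : cohomology X i"
proof -
 show "c \<oplus>[hmod X i] d : cohomology X i" if c: "c : cohomology X i" and d: "d : cohomology X i"
 proof -
  obtain x y where x: "x : cocycles X i" "c = hcl X i x" and y: "y : cocycles X i" "d = hcl X i y"
   using c d unfolding cohomology_eq by blast
  show ?thesis unfolding x(2) y(2) hmod_add[OF X cocyclesD(1)[OF x(1)] cocyclesD(1)[OF y(1)]] cohomology_eq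
   by (rule imageI[OF cocycles_closed(2)[OF X x(1) y(1)]])
 qed
 show "a \<odot>[hmod X i] c : cohomology X i" if a: "a : carrier R" and c: "c : cohomology X i"
 proof -
  obtain x where x: "x : cocycles X i" "c = hcl X i x" using c unfolding cohomology_eq by blast
  show ?thesis unfolding x(2) hmod_smult[OF X cocyclesD(1)[OF x(1)] a] cohomology_eq
   by (rule imageI[OF cocycles_closed(5)[OF X a x(1)]])
 qed
 show "hcl X i \<zero>[deg X i] : cohomology X i" unfolding cohomology_eq by (rule imageI[OF cocycles_closed(1)[OF X]])
qed

lemma cohomology_map_linmap:
 assumes X: "bounded_cpx R X" and Y: "bounded_cpx R Y" and f: "f : chain_map R X Y"
 shows "linmap R (hmod X i) (hmod Y i) (cohomology_map Y f i)"
proof (rule linmapI)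
 note cm = cohomology_map_hcl[OF X Y f] and fs = chain_map_simps[OF X Y f]
 interpret M: left_module R "deg X i" by (rule cpxD(1)[OF X])
 show "cohomology_map Y f i c : carrier (hmod Y i)" if c: "c : carrier (hmod X i)" for c
 proof -
  obtain x where x: "x : cocycles X i" "c = hcl X i x" using c by (auto simp: cohomology_eq)
  show ?thesis using cm[OF cocyclesD(1)[OF x(1)]] chain_map_cocycle(1)[OF X Y f x(1)] x(2) by (simp add: cohomology_eq)
 qed
 show "cohomology_map Y f i (c \<oplus>[hmod X i] d) = cohomology_map Y f i c \<oplus>[hmod Y i] cohomology_map Y f i d"
  if "c : carrier (hmod X i)" "d : carrier (hmod X i)" for c d
 proof -
  obtain x y where xy: "x : cocycles X i" "c = hcl X i x" "y : cocycles X i" "d = hcl X i y" using \<open>c : _\<close> \<open>d : _\<close> by (auto simp: cohomology_eq)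
  note xc = cocyclesD(1)[OF xy(1)] and yc = cocyclesD(1)[OF xy(3)]
  show ?thesis unfolding xy(2,4) hmod_add[OF X xc yc] cm[OF xc] cm[OF yc] cm[OF M.a_closed[OF xc yc]]
   hmod_add[OF Y fs(1)[OF xc] fs(1)[OF yc]] fs(2)[OF xc yc] ..
 qed
 show "cohomology_map Y f i (a \<odot>[hmod X i] c) = a \<odot>[hmod Y i] cohomology_map Y f i c"
  if "a : carrier R" "c : carrier (hmod X i)" for a c
 proof -
  obtain x where x: "x : cocycles X i" "c = hcl X i x" using \<open>c : _\<close> by (auto simp: cohomology_eq)
  note xc = cocyclesD(1)[OF x(1)] and a = \<open>a : carrier R\<close>
  show ?thesis unfolding x(2) hmod_smult[OF X xc a] cm[OF xc] cm[OF M.smult_closed[OF a xc]]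
   hmod_smult[OF Y fs(1)[OF xc] a] fs(3)[OF a xc] ..
 qed
qed

lemma cohomology_map_id:
 assumes X: "bounded_cpx R X" and c: "c : cohomology X i"
 shows "cohomology_map X (%i. \<lambda>x\<in>elts X i. x) i c = c"
proof -
 obtain x where x: "x : cocycles X i" "c = hcl X i x" using c by (auto simp: cohomology_eq)
 show ?thesis using cohomology_map_hcl[OF X X chain_map_id[OF X] cocyclesD(1)[OF x(1)]] cocyclesD(1)[OF x(1)] x(2) by simp
qed

lemma cohomology_map_comp:
 assumes X: "bounded_cpx R X" and Y: "bounded_cpx R Y" and Z: "bounded_cpx R Z"
  and f: "f : chain_map R X Y" and g: "g : chain_map R Y Z" and c: "c : cohomology X i"
 shows "cohomology_map Z (%i. compose (elts X i) (g i) (f i)) i c = cohomology_map Z g i (cohomology_map Y f i c)"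
proof -
 obtain x where x: "x : cocycles X i" "c = hcl X i x" using c by (auto simp: cohomology_eq)
 note xc = cocyclesD(1)[OF x(1)]
 show ?thesis
  using cohomology_map_hcl[OF X Z chain_map_comp[OF X f g] xc] cohomology_map_hcl[OF X Y f xc]
   cohomology_map_hcl[OF Y Z g chain_map_simps(1)[OF X Y f xc]] xc x(2) by (simp add: compose_eq)
qed

text \<open>The functor \<open>H^i\<close> on the localisation, evaluated on representatives: a
  formal inverse acts by the inverse of the bijection that a quasi-isomorphism induces.\<close>

primrec hzig :: "int => 'r cpx => ('r cpx, 'r cpx_map) step list => 'r tuple set => 'r tuple set" where
 "hzig i X [] c = c"
| "hzig i X (s # p) c = (case s of
   Fwd Y f => hzig i Y p (cohomology_map Y f i c)
  | Bwd Y f => hzig i Y p (inv_into (cohomology Y i) (cohomology_map X f i) c))"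

lemma quasi_iso_bij: "s : quasi_iso R X Y ==> bij_betw (cohomology_map Y s i) (cohomology X i) (cohomology Y i)"
 by (simp add: quasi_iso_def)

lemma zigzag_bounded: "zigzag CC QQ X Y p ==> bounded_cpx R X \<and> bounded_cpx R Y"
 using L.zz_start L.zz_end by fastforce

lemma linmap_bwd:
 assumes X: "bounded_cpx R X" and Y: "bounded_cpx R Y" and s: "s : quasi_iso R Y X"
 shows "linmap R (hmod X i) (hmod Y i) (inv_into (cohomology Y i) (cohomology_map X s i))"
 using linmap_inv_into[OF cohomology_map_linmap[OF Y X quasi_isoD[OF s], of i]] quasi_iso_bij[OF s, of i] hmod_closed[OF Y]
 by simp

lemma linmap_hzig: "zigzag CC QQ X Y p ==> linmap R (hmod X i) (hmod Y i) (hzig i X p)"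
proof (induction rule: zigzag.induct)
 case (nil X)
 then show ?case by (auto simp: linmap_def hmod_closed)
next
 case (fwd X f Y Z p)
 have "bounded_cpx R X" "bounded_cpx R Y" using fwd zigzag_bounded by auto
 from linmap_comp[OF cohomology_map_linmap[OF this] fwd.IH] fwd.hyps show ?case by simp
next
 case (bwd X s Y Z p)
 have "bounded_cpx R X" "bounded_cpx R Y" using bwd zigzag_bounded by auto
 from linmap_comp[OF linmap_bwd[OF this bwd.hyps(3)] bwd.IH] show ?case by simp
qed

lemma hzig_append: "zigzag CC QQ X Y p ==> hzig i X (p @ q) c = hzig i Y q (hzig i X p c)"
 by (induction arbitrary: c rule: zigzag.induct) auto

lemma hzig_eq: "zigzag_eq CC QQ X Y p q ==> c : cohomology X i ==> hzig i X p c = hzig i X q c"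
proof (induction arbitrary: c rule: zigzag_eq.induct)
 case (append X Y p p' Y' q q')
 have z: "zigzag CC QQ X Y p" "zigzag CC QQ X Y p'" using L.zeq_zz[OF append.hyps(1)] by auto
 have "hzig i X p c : cohomology Y i" using linmapD(1)[OF linmap_hzig[OF z(1)]] append.prems by simp
 then show ?case using append by (simp add: hzig_append[OF z(1)] hzig_append[OF z(2)])
next
 case (idt X)
 then show ?case by (simp add: cohomology_map_id)
next
 case (comp X Y Z f g)
 then show ?case by (simp add: cohomology_map_comp)
next
 case (inv_l X Y s)
 then show ?case using bij_betw_inv_into_left[OF quasi_iso_bij] by simp
next
 case (inv_r X Y s)
 then show ?case using bij_betw_inv_into_right[OF quasi_iso_bij] by simp
qed auto

lemma hzig_iso:
 assumes "L.zz_iso X Y p q" and "c : cohomology X i"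
 shows "hzig i Y q (hzig i X p c) = c"
proof -
 have "zigzag CC QQ X Y p" "zigzag_eq CC QQ X X (p @ q) []" using assms(1) by (auto simp: L.zz_iso_def)
 then show ?thesis using hzig_eq[of X X "p @ q" "[]" c i] hzig_append[of X Y p i q c] assms(2) by simp
qed

section \<open>Acyclic complexes and the cohomology of direct sums\<close>

definition acyclic_cpx :: "'r cpx => bool" where
 "acyclic_cpx X \<longleftrightarrow> (\<forall>i. cocycles X i \<subseteq> coboundaries X i)"

lemma acyclic_iff:
 assumes X: "bounded_cpx R X"
 shows "acyclic_cpx X \<longleftrightarrow> (\<forall>i. \<forall>c\<in>cohomology X i. c = \<zero>[hmod X i])"
proof -
 have "hcl X i x = hcl X i \<zero>[deg X i] \<longleftrightarrow> x : coboundaries X i" if x: "x : cocycles X i" for i x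
 proof -
  interpret M: left_module R "deg X i" by (rule cpxD(1)[OF X])
  show ?thesis using hcl_eq_iff[OF X cocyclesD(1)[OF x] M.zero_closed] cocyclesD(1)[OF x] by (simp add: a_minus_def)
 qed
 then show ?thesis unfolding acyclic_cpx_def cohomology_eq by auto
qed

lemma acyclic_iso:
 assumes iso: "L.zz_iso X Y p q" and Y: "acyclic_cpx Y"
 shows "acyclic_cpx X"
proof -
 have z: "zigzag CC QQ X Y p" "zigzag CC QQ Y X q" using iso by (auto simp: L.zz_iso_def)
 have b: "bounded_cpx R X" "bounded_cpx R Y" using zigzag_bounded[OF z(1)] by auto
 have "c = \<zero>[hmod X i]" if c: "c : cohomology X i" for c i
 proof -
  have "hzig i X p c : cohomology Y i" "hzig i X p \<zero>[hmod X i] : cohomology Y i"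
   using linmapD(1)[OF linmap_hzig[OF z(1)]] c hmod_closed(3)[OF b(1)] by auto
  then have "hzig i X p c = hzig i X p \<zero>[hmod X i]" using Y unfolding acyclic_iff[OF b(2)] by metis
  then show ?thesis using hzig_iso[OF iso c] hzig_iso[OF iso, of "\<zero>[hmod X i]" i] hmod_closed(3)[OF b(1)] by simp
 qed
 then show ?thesis unfolding acyclic_iff[OF b(1)] by blast
qed

lemma acyclic_zero_cpx: "acyclic_cpx zero_cpx"
 by (auto simp: acyclic_cpx_def cocycles_def coboundaries_def zero_cpx_def)

definition sum_proj1 :: "'r cpx => 'r cpx => 'r cpx_map" where
 "sum_proj1 X Y = (%i. \<lambda>p\<in>elts (sum_cpx X Y) i. tfst p)"

definition sum_proj2 :: "'r cpx => 'r cpx => 'r cpx_map" where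
 "sum_proj2 X Y = (%i. \<lambda>p\<in>elts (sum_cpx X Y) i. tsnd p)"

lemma sum_proj_chain_map:
 assumes X: "bounded_cpx R X" and Y: "bounded_cpx R Y"
 shows "sum_proj1 X Y : chain_map R (sum_cpx X Y) X" "sum_proj2 X Y : chain_map R (sum_cpx X Y) Y"
proof -
 have "linmap R (deg (sum_cpx X Y) i) (deg X i) (sum_proj1 X Y i) \<and> linmap R (deg (sum_cpx X Y) i) (deg Y i) (sum_proj2 X Y i)" for i
 proof -
  interpret M: left_module R "deg X i" by (rule cpxD(1)[OF X])
  interpret N: left_module R "deg Y i" by (rule cpxD(1)[OF Y])
  show ?thesis by (intro conjI linmapI) (auto simp: sum_cpx_def sum_proj1_def sum_proj2_def M.smult_closed N.smult_closed)
 qed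
 then show "sum_proj1 X Y : chain_map R (sum_cpx X Y) X" "sum_proj2 X Y : chain_map R (sum_cpx X Y) Y"
  by (auto intro!: chain_mapI simp: sum_proj1_def sum_proj2_def sum_cpx_def cpx_diff(1)[OF X] cpx_diff(1)[OF Y])
qed

lemma cohomology_sum_decompose:
 assumes X: "bounded_cpx R X" and Y: "bounded_cpx R Y" and c: "c : cohomology (sum_cpx X Y) i"
 shows "c = cohomology_map (sum_cpx X Y) (sum_incl1 X Y) i (cohomology_map X (sum_proj1 X Y) i c)
  \<oplus>[hmod (sum_cpx X Y) i] cohomology_map (sum_cpx X Y) (sum_incl2 X Y) i (cohomology_map Y (sum_proj2 X Y) i c)"
proof -
 note S = bounded_sum_cpx[OF X Y]
 interpret M: left_module R "deg X i" by (rule cpxD(1)[OF X])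
 interpret N: left_module R "deg Y i" by (rule cpxD(1)[OF Y])
 obtain p where p: "p : cocycles (sum_cpx X Y) i" "c = hcl (sum_cpx X Y) i p" using c by (auto simp: cohomology_eq)
 obtain x y where xy: "p = Tup x y" "x : cocycles X i" "y : cocycles Y i" using p(1) by (auto simp: cocycles_sum)
 note xc = cocyclesD(1)[OF xy(2)] and yc = cocyclesD(1)[OF xy(3)] and pc = cocyclesD(1)[OF p(1)]
 have e: "sum_proj1 X Y i p = x" "sum_proj2 X Y i p = y" using pc unfolding xy(1) by (simp_all add: sum_proj1_def sum_proj2_def)
 have i: "sum_incl1 X Y i x : elts (sum_cpx X Y) i" "sum_incl2 X Y i y : elts (sum_cpx X Y) i"
  using xc yc by (auto simp: sum_incl1_def sum_incl2_def sum_cpx_def)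
 have "sum_incl1 X Y i x \<oplus>[deg (sum_cpx X Y) i] sum_incl2 X Y i y = p" unfolding xy(1)
  using xc yc by (simp add: sum_incl1_def sum_incl2_def sum_cpx_def)
 then show ?thesis
  using cohomology_map_hcl[OF S X sum_proj_chain_map(1)[OF X Y] pc] cohomology_map_hcl[OF S Y sum_proj_chain_map(2)[OF X Y] pc]
   cohomology_map_hcl[OF X S sum_incl_chain_map(1)[OF X Y] xc] cohomology_map_hcl[OF Y S sum_incl_chain_map(2)[OF X Y] yc]
   hmod_add[OF S i] p(2) e by simp
qed

lemma cohomology_sum_proj_incl:
 assumes X: "bounded_cpx R X" and Y: "bounded_cpx R Y" and c: "c : cohomology X i"
 shows "cohomology_map X (sum_proj1 X Y) i (cohomology_map (sum_cpx X Y) (sum_incl1 X Y) i c) = c"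
proof -
 note S = bounded_sum_cpx[OF X Y]
 interpret N: left_module R "deg Y i" by (rule cpxD(1)[OF Y])
 obtain x where x: "x : cocycles X i" "c = hcl X i x" using c by (auto simp: cohomology_eq)
 note xc = cocyclesD(1)[OF x(1)]
 have i: "sum_incl1 X Y i x : elts (sum_cpx X Y) i" using xc by (auto simp: sum_incl1_def sum_cpx_def)
 have e: "sum_proj1 X Y i (sum_incl1 X Y i x) = x" using i xc by (simp add: sum_proj1_def) (simp add: sum_incl1_def)
 show ?thesis
  using cohomology_map_hcl[OF X S sum_incl_chain_map(1)[OF X Y] xc] cohomology_map_hcl[OF S X sum_proj_chain_map(1)[OF X Y] i] x(2) e
  by simp
qed

lemma hmod_shift: "bounded_cpx R X ==> hmod (shift_cpx n X) i = hmod X (i + n)"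
 by (simp add: hmod_def cohomology_def hcl_def coboundaries_shift cocycles_shift)
  (simp add: shift_cpx_def)

section \<open>The derived category and its underlying localisation\<close>

abbreviation "DB \<equiv> bounded_derived_category R"

lemma DB_simps [simp]: "Shift_ob DB = shift_cpx" "Triangles DB = distinguished_triangles R" "Ob DB = {X. bounded_cpx R X}"
 "Hom DB = Hom L.D" "Comp DB = Comp L.D" "Idt DB = Idt L.D"
 by (simp_all add: bounded_derived_category_def category.defs localisation_def cpx_category_def)

lemma DB_is_coproduct: "is_coproduct DB X Y Z \<longleftrightarrow> is_coproduct L.D X Y Z"
 unfolding is_coproduct_def by simp

lemma DB_initial: "initial_object DB X \<longleftrightarrow> initial_object L.D X"
 unfolding initial_object_def by simp

lemma DB_zero: "zero_object DB X \<longleftrightarrow> zero_object L.D X"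
 unfolding zero_object_def initial_object_def by simp

end

section \<open>Endomorphisms that factor through the cohomology of a generator\<close>

text \<open>The addition of \<open>V\<close> is that of its type, so that sums of maps into
  \<open>V\<close> can be written with \<open>sum_list\<close>. The elements of \<open>V\<close>
  need not be tuples: \<open>V\<close> meets complexes only through linear maps from and to their
  cohomology.\<close>

locale cohomology_factorisations = bounded_complexes R for R :: "('r, 'm) ring_scheme" (structure) +
 fixes M :: "'r cpx" and V :: "('r, 'u :: ab_group_add) module"
 assumes M: "bounded_cpx R M"
  and V_add: "x : carrier V ==> y : carrier V ==> x \<oplus>[V] y = x + y"
begin

definition fac :: "('u => 'u) => bool" where
 "fac h \<longleftrightarrow> (\<exists>I. (\<forall>(j, f, g)\<in>set I. linmap R V (hmod M j) f \<and> linmap R (hmod M j) V g) \<and>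
   (\<forall>x\<in>carrier V. h x = (\<Sum>(j, f, g)\<leftarrow>I. g (f x))))"

text \<open>Every endomorphism of \<open>V\<close> that factors through a cohomology module of
  \<open>X\<close> is a finite sum of ones that factor through the cohomology of \<open>M\<close>.
  The property passes to everything from which the first level over \<open>M\<close> is built,
  including arbitrary isomorphic copies.\<close>

definition good :: "'r cpx => bool" where
 "good X \<longleftrightarrow> bounded_cpx R X \<and> (\<forall>i f g. linmap R V (hmod X i) f --> linmap R (hmod X i) V g --> fac (%x. g (f x)))"

lemma good_bounded: "good X ==> bounded_cpx R X"
 by (simp add: good_def)

lemma fac_zero: "(!!x. x : carrier V ==> h x = 0) ==> fac h"
 unfolding fac_def by (rule exI[of _ "[]"]) simp

lemma fac_add:
 assumes "fac h" "fac h'" "!!x. x : carrier V ==> k x = h x + h' x"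
 shows "fac k"
proof -
 obtain I I' where
  "\<forall>(j, f, g)\<in>set I. linmap R V (hmod M j) f \<and> linmap R (hmod M j) V g" "\<forall>x\<in>carrier V. h x = (\<Sum>(j, f, g)\<leftarrow>I. g (f x))"
  "\<forall>(j, f, g)\<in>set I'. linmap R V (hmod M j) f \<and> linmap R (hmod M j) V g" "\<forall>x\<in>carrier V. h' x = (\<Sum>(j, f, g)\<leftarrow>I'. g (f x))"
  using assms unfolding fac_def by blast
 then show ?thesis unfolding fac_def using assms(3) by (intro exI[of _ "I @ I'"]) auto
qed

lemma good_generator: "good M"
 unfolding good_def
proof (intro conjI allI impI M)
 fix i f g assume "linmap R V (hmod M i) f" "linmap R (hmod M i) V g"
 then show "fac (%x. g (f x))" unfolding fac_def by (intro exI[of _ "[(i, f, g)]"]) simp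
qed

lemma good_iso:
 assumes iso: "L.zz_iso X Y p q" and Y: "good Y"
 shows "good X"
 unfolding good_def
proof (intro conjI allI impI)
 have z: "zigzag CC QQ X Y p" "zigzag CC QQ Y X q" using iso by (auto simp: L.zz_iso_def)
 show "bounded_cpx R X" using zigzag_bounded[OF z(1)] by simp
 fix i f g assume f: "linmap R V (hmod X i) f" and g: "linmap R (hmod X i) V g"
 have "fac (%x. g (hzig i Y q (hzig i X p (f x))))"
  using Y linmap_comp[OF f linmap_hzig[OF z(1)]] linmap_comp[OF linmap_hzig[OF z(2)] g] unfolding good_def by blast
 moreover have "hzig i Y q (hzig i X p (f x)) = f x" if "x : carrier V" for x
  using hzig_iso[OF iso] linmapD(1)[OF f that] by simp
 ultimately show "fac (%x. g (f x))" unfolding fac_def by simp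
qed

lemma good_acyclic:
 assumes X: "bounded_cpx R X" and ac: "acyclic_cpx X"
 shows "good X"
 unfolding good_def
proof (intro conjI allI impI X)
 fix i f g assume f: "linmap R V (hmod X i) f" and g: "linmap R (hmod X i) V g"
 let ?z = "\<zero>[hmod X i]"
 have z: "?z : carrier (hmod X i)" using hmod_closed(3)[OF X] by simp
 have e: "c = ?z" if "c : carrier (hmod X i)" for c using ac that unfolding acyclic_iff[OF X] by simp
 have "?z \<oplus>[hmod X i] ?z = ?z" using e[of "?z \<oplus>[hmod X i] ?z"] hmod_closed(1)[OF X] z by simp
 then have "g ?z = g ?z + g ?z" using linmapD(2)[OF g z z] V_add linmapD(1)[OF g z] by simp
 then have "g ?z = 0" by simp
 then show "fac (%x. g (f x))" using e linmapD(1)[OF f] by (intro fac_zero) metis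
qed

lemma good_sum:
 assumes "good X" "good Y"
 shows "good (sum_cpx X Y)"
 unfolding good_def
proof (intro conjI allI impI)
 note X = good_bounded[OF assms(1)] and Y = good_bounded[OF assms(2)]
 show S: "bounded_cpx R (sum_cpx X Y)" by (rule bounded_sum_cpx[OF X Y])
 fix i f g assume f: "linmap R V (hmod (sum_cpx X Y) i) f" and g: "linmap R (hmod (sum_cpx X Y) i) V g"
 let ?i1 = "cohomology_map (sum_cpx X Y) (sum_incl1 X Y) i" and ?p1 = "cohomology_map X (sum_proj1 X Y) i"
 let ?i2 = "cohomology_map (sum_cpx X Y) (sum_incl2 X Y) i" and ?p2 = "cohomology_map Y (sum_proj2 X Y) i"
 have l: "linmap R (hmod X i) (hmod (sum_cpx X Y) i) ?i1" "linmap R (hmod Y i) (hmod (sum_cpx X Y) i) ?i2"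
  "linmap R (hmod (sum_cpx X Y) i) (hmod X i) ?p1" "linmap R (hmod (sum_cpx X Y) i) (hmod Y i) ?p2"
  by (rule cohomology_map_linmap[OF X S sum_incl_chain_map(1)[OF X Y]], rule cohomology_map_linmap[OF Y S sum_incl_chain_map(2)[OF X Y]],
   rule cohomology_map_linmap[OF S X sum_proj_chain_map(1)[OF X Y]], rule cohomology_map_linmap[OF S Y sum_proj_chain_map(2)[OF X Y]])
 have "fac (%x. g (?i1 (?p1 (f x))))" "fac (%x. g (?i2 (?p2 (f x))))"
  using assms linmap_comp[OF f l(3)] linmap_comp[OF l(1) g] linmap_comp[OF f l(4)] linmap_comp[OF l(2) g] unfolding good_def by blast+
 then show "fac (%x. g (f x))"
 proof (rule fac_add)
  fix x assume x: "x : carrier V"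
  have fx: "f x : carrier (hmod (sum_cpx X Y) i)" by (rule linmapD(1)[OF f x])
  have c: "?i1 (?p1 (f x)) : carrier (hmod (sum_cpx X Y) i)" "?i2 (?p2 (f x)) : carrier (hmod (sum_cpx X Y) i)"
   using linmapD(1)[OF l(1) linmapD(1)[OF l(3) fx]] linmapD(1)[OF l(2) linmapD(1)[OF l(4) fx]] by auto
  have "g (f x) = g (?i1 (?p1 (f x)) \<oplus>[hmod (sum_cpx X Y) i] ?i2 (?p2 (f x)))"
   using cohomology_sum_decompose[OF X Y] fx by simp
  also have "\<dots> = g (?i1 (?p1 (f x))) + g (?i2 (?p2 (f x)))"
   unfolding linmapD(2)[OF g c] by (rule V_add[OF linmapD(1)[OF g c(1)] linmapD(1)[OF g c(2)]])
  finally show "g (f x) = g (?i1 (?p1 (f x))) + g (?i2 (?p2 (f x)))" .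
 qed
qed

lemma good_summand:
 assumes X: "bounded_cpx R X" and Y: "bounded_cpx R Y" and S: "good (sum_cpx X Y)"
 shows "good X"
 unfolding good_def
proof (intro conjI allI impI X)
 fix i f g assume f: "linmap R V (hmod X i) f" and g: "linmap R (hmod X i) V g"
 let ?i1 = "cohomology_map (sum_cpx X Y) (sum_incl1 X Y) i" and ?p1 = "cohomology_map X (sum_proj1 X Y) i"
 note Sb = good_bounded[OF S]
 have "fac (%x. g (?p1 (?i1 (f x))))"
  using S linmap_comp[OF f cohomology_map_linmap[OF X Sb sum_incl_chain_map(1)[OF X Y]]]
   linmap_comp[OF cohomology_map_linmap[OF Sb X sum_proj_chain_map(1)[OF X Y]] g] unfolding good_def by blast
 moreover have "?p1 (?i1 (f x)) = f x" if "x : carrier V" for x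
  using cohomology_sum_proj_incl[OF X Y] linmapD(1)[OF f that] by simp
 ultimately show "fac (%x. g (f x))" unfolding fac_def by simp
qed

lemma good_shift: "good X ==> good (shift_cpx n X)"
 using bounded_shift_cpx[of X n] hmod_shift[of X n] unfolding good_def by auto

lemma good_initial:
 assumes "initial_object DB X"
 shows "good X"
proof -
 have "initial_object L.D X" using assms DB_initial by simp
 then obtain p q where "L.zz_iso X zero_cpx p q" using L.initial_object_iso_zero[OF zero_cpx_data] by blast
 then show ?thesis using good_iso good_acyclic[OF bounded_zero_cpx acyclic_zero_cpx] by blast
qed

lemma good_add_closure:
 assumes "!!X. X : \<X> ==> good X" and "X : add_closure DB \<X>"
 shows "good X"
 using assms(2)
proof (induction rule: add_closure.induct)
 case (base X) then show ?case by (rule assms(1))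
next
 case (empty_coproduct Z) then show ?case by (rule good_initial)
next
 case (coproduct X Y Z)
 then obtain p q where "L.zz_iso Z (sum_cpx X Y) p q" using L.is_coproduct_iso_sum DB_is_coproduct by blast
 then show ?case using good_iso good_sum coproduct by blast
next
 case (direct_factor Z X Y)
 then obtain p q where pq: "L.zz_iso Z (sum_cpx X Y) p q" using L.is_coproduct_iso_sum DB_is_coproduct by blast
 have "good (sum_cpx X Y)" using good_iso[OF L.zz_iso_sym[OF pq]] direct_factor by blast
 moreover have "bounded_cpx R X" "bounded_cpx R Y" using direct_factor(2) by (auto simp: is_coproduct_def)
 ultimately show ?case using good_summand by blast
next
 case (shift X n) then show ?case by (simp add: good_shift)
qed

text \<open>In the first level the left term of a triangle is a zero object. The complex
  \<open>X'\<close> representing it is acyclic, so the cone of \<open>f\<close> is isomorphic to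
  \<open>Y'\<close>, and \<open>X\<close> is isomorphic to \<open>X2\<close>.\<close>

lemma good_extension:
 assumes X1: "zero_object DB X1" and X2: "good X2" and t: "(X1, X, X2, u, v, w) : distinguished_triangles R"
 shows "good X"
proof -
 obtain X' Y' f a b c where X': "bounded_cpx R X'" and Y': "bounded_cpx R Y'" and f: "f : chain_map R X' Y'"
  and iso: "cat_iso L.D X1 X' a" "cat_iso L.D X Y' b" "cat_iso L.D X2 (cone X' Y' f) c"
  using t unfolding distinguished_triangles_def Let_def by auto
 have "initial_object L.D X1" using X1 DB_initial by (simp add: zero_object_def)
 then obtain p q where "L.zz_iso X1 zero_cpx p q" using L.initial_object_iso_zero[OF zero_cpx_data] by blast
 moreover obtain p' q' where "L.zz_iso X1 X' p' q'" using iso(1) L.cat_iso_localisation by blast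
 ultimately have "acyclic_cpx X'" by (metis acyclic_iso L.zz_iso_trans L.zz_iso_sym acyclic_zero_cpx)
 then have qi: "cone_incl X' Y' : quasi_iso R Y' (cone X' Y' f)"
  using cone_incl_quasi_iso[OF X' Y' f] unfolding acyclic_cpx_def by blast
 have i2: "L.zz_iso Y' (cone X' Y' f) [Fwd (cone X' Y' f) (cone_incl X' Y')] [Bwd Y' (cone_incl X' Y')]"
  using Y' bounded_cone[OF X' Y' f] qi quasi_isoD[OF qi] by (intro L.zz_isoI_fwd) auto
 obtain p q where i1: "L.zz_iso X Y' p q" using iso(2) L.cat_iso_localisation by blast
 obtain p' q' where i3: "L.zz_iso X2 (cone X' Y' f) p' q'" using iso(3) L.cat_iso_localisation by blast
 show ?thesis by (rule good_iso[OF L.zz_iso_trans[OF i1 L.zz_iso_trans[OF i2 L.zz_iso_sym[OF i3]]] X2])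
qed

lemma good_generated: "X : generated DB {M} 1 ==> good X"
proof -
 assume "X : generated DB {M} 1"
 then have "X : add_closure DB (extensions DB {Z. zero_object DB Z} (add_closure DB {M}))" by (simp add: diamond_def)
 then show ?thesis
 proof (rule good_add_closure[rotated])
  fix X assume "X : extensions DB {Z. zero_object DB Z} (add_closure DB {M})"
  then obtain X1 X2 f g h where "zero_object DB X1" "X2 : add_closure DB {M}" "(X1, X, X2, f, g, h) : distinguished_triangles R"
   by (auto simp: extensions_def)
  moreover have "good X2" using good_add_closure[of "{M}"] good_generator \<open>X2 : _\<close> by blast
  ultimately show "good X" using good_extension by blast
 qed
qed

end

section \<open>Modules over path algebras\<close>

locale quiver_algebra = fin_digraph Q
 for Q :: "('v, 'a) pre_digraph" +
 fixes A :: "('v \<times> 'a list => 'k::field) ring"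
 assumes A_def: "A = path_algebra Q" and acyclic: "acyclic_quiver Q"
begin

lemma ring_A: "ring A"
 unfolding A_def by (rule path_algebra_ring[OF fin_digraph_axioms])

sublocale B: bounded_complexes A
 by (intro bounded_complexes.intro ring_A)

definition target :: "'v \<times> 'a list => 'v" where
 "target p = awlast (fst p) (snd p)"

definition ending :: "'v => ('v \<times> 'a list) set" where
 "ending v = {p : paths Q. target p = v}"

lemma paths_iff: "(u, p) : paths Q \<longleftrightarrow> awalk u p (awlast u p)"
 by (auto simp: paths_def)

text \<open>A path that visits a vertex twice contains a closed path, so acyclicity makes every path
  an \<open>apath\<close>. Hence the path algebra is finite dimensional.\<close>

lemma finite_paths: "finite (paths Q)"
proof -
 have "distinct (awalk_verts u p)" if "awalk u p v" for u p v
 proof (rule ccontr)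
  assume "\<not> distinct (awalk_verts u p)"
  from awalk_not_distinct_decomp[OF that this] obtain w r where "awalk w r w" "r ~= []" by auto
  then show False using acyclic unfolding acyclic_quiver_def by blast
 qed
 note distinct = this
 have "paths Q \<subseteq> (%(u, p, v). (u, p)) ` {(u, p, v). apath u p v}"
 proof clarify
  fix u p assume "(u, p) : paths Q"
  then obtain v where "awalk u p v" by (auto simp: paths_def)
  then have "apath u p v" using distinct by (simp add: apath_def)
  then show "(u, p) : (%(u, p, v). (u, p)) ` {(u, p, v). apath u p v}"
   by (intro image_eqI[of _ _ "(u, p, v)"]) simp_all
 qed
 then show ?thesis using apaths_finite_triple finite_subset by blast
qed

lemma closed_path_trivial: "(u, p) : paths Q ==> awlast u p = u ==> p = []"
 using acyclic by (force simp: acyclic_quiver_def paths_iff)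

text \<open>Finite support is automatic because there are only finitely many paths.\<close>

lemma carrier_A: "f : carrier A \<longleftrightarrow> (\<forall>p. f p ~= 0 --> p : paths Q)"
proof -
 have "finite {p. f p ~= 0}" if "{p. f p ~= 0} \<subseteq> paths Q" using that finite_paths by (rule finite_subset)
 then show ?thesis unfolding A_def path_algebra_def partial_object.simps mem_Collect_eq by blast
qed

lemma A_simps:
 "\<zero>[A] = (%_. 0)" "f \<oplus>[A] g = (%p. f p + g p)" "\<one>[A] = (%(u, p). if u : verts Q \<and> p = [] then 1 else 0)"
 by (simp_all add: A_def path_algebra_def)

lemma A_mult: "(f \<otimes>[A] g) (u, p) = (\<Sum>i\<le>length p. f (u, take i p) * g (awlast u (take i p), drop i p))"
 by (simp add: A_def path_algebra_def)

lemma A_minus: "f : carrier A ==> \<ominus>[A] f = (%p. - f p)"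
 by (rule B.minus_equality) (auto simp: A_simps carrier_A)

definition sc :: "'k => 'v \<times> 'a list => 'k" where
 "sc c = (%p. c * \<one>[A] p)"

definition idem :: "'v => 'v \<times> 'a list => 'k" where
 "idem v = (%p. if p = (v, []) then 1 else 0)"

definition path :: "'v \<times> 'a list => 'v \<times> 'a list => 'k" where
 "path q = (%p. if p = q then 1 else 0)"

lemma mult_scale: "(%p. c * f p) \<otimes>[A] g = (%p. c * (f \<otimes>[A] g) p)" "f \<otimes>[A] (%p. c * g p) = (%p. c * (f \<otimes>[A] g) p)"
 by (auto simp: fun_eq_iff A_mult sum_distrib_left algebra_simps)

lemma sc_closed: "sc c : carrier A"
 using B.one_closed by (auto simp: sc_def carrier_A)

lemma sc_mult: "f : carrier A ==> sc c \<otimes>[A] f = (%p. c * f p)" "f : carrier A ==> f \<otimes>[A] sc c = (%p. c * f p)"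
 by (simp_all add: sc_def mult_scale)

lemma sc_simps: "sc (c + d) = sc c \<oplus>[A] sc d" "sc 0 = \<zero>[A]" "sc 1 = \<one>[A]" "sc (c * d) = sc c \<otimes>[A] sc d"
 "f : carrier A ==> sc c \<otimes>[A] f = f \<otimes>[A] sc c" "sc (- c) = \<ominus>[A] sc c"
proof -
 show "f : carrier A ==> sc c \<otimes>[A] f = f \<otimes>[A] sc c" by (simp add: sc_mult)
 show "sc (- c) = \<ominus>[A] sc c" unfolding A_minus[OF sc_closed] by (simp add: sc_def)
 show "sc (c * d) = sc c \<otimes>[A] sc d" unfolding sc_mult(1)[OF sc_closed] by (simp add: sc_def mult.assoc)
qed (auto simp: A_simps(1,2) fun_eq_iff sc_def algebra_simps)

lemma idem_closed: "v : verts Q ==> idem v : carrier A"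
 by (auto simp: idem_def carrier_A paths_iff awalk_Nil_iff)

lemma path_closed: "q : paths Q ==> path q : carrier A"
 by (auto simp: path_def carrier_A)

lemma idem_mult: "idem v \<otimes>[A] f = (%p. if fst p = v then f p else 0)"
proof (rule ext, clarify)
 fix u p
 have "(idem v \<otimes>[A] f) (u, p) = (\<Sum>i\<le>length p. if i = 0 then (if u = v then f (u, p) else 0) else 0)"
  unfolding A_mult by (rule sum.cong) (auto simp: idem_def)
 then show "(idem v \<otimes>[A] f) (u, p) = (if fst (u, p) = v then f (u, p) else 0)" by simp
qed

lemma mult_idem: "f \<otimes>[A] idem v = (%p. if target p = v then f p else 0)"
proof (rule ext, clarify)
 fix u p
 have "(f \<otimes>[A] idem v) (u, p) = (\<Sum>i\<le>length p. if i = length p then (if awlast u p = v then f (u, p) else 0) else 0)"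
  unfolding A_mult by (rule sum.cong) (auto simp: idem_def)
 then show "(f \<otimes>[A] idem v) (u, p) = (if target (u, p) = v then f (u, p) else 0)" by (simp add: target_def)
qed

lemma idem_idem: "idem v \<otimes>[A] idem v = idem v"
 unfolding idem_mult by (auto simp: fun_eq_iff idem_def)

text \<open>A derivative of Fox type: it keeps the paths of \<open>f\<close> that start with the
  arrow \<open>a\<close> and strips this arrow. An element is determined by its constant
  coefficients and its derivatives.\<close>

definition der :: "'a => ('v \<times> 'a list => 'k) => 'v \<times> 'a list => 'k" where
 "der a f = (%(u, p). if u = head Q a then f (tail Q a, a # p) else 0)"

lemma awlast_Cons: "awlast u (a # p) = awlast (head Q a) p"
 by (cases p) auto

lemma der_closed: "f : carrier A ==> der a f : carrier A"
 unfolding carrier_A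
 by (clarsimp simp: der_def split: if_splits) (force simp only: paths_iff awalk_Cons_iff awlast_Cons)

text \<open>The second term comes from the factorisation of \<open>a # p\<close> with trivial first
  factor. It vanishes when \<open>f\<close> has no constant coefficient at the tail of
  \<open>a\<close>; then \<open>der a\<close> acts on \<open>f\<close> alone.\<close>

lemma der_mult: "der a (f \<otimes>[A] g) = der a f \<otimes>[A] g \<oplus>[A] (%p. f (tail Q a, []) * der a g p)"
proof (rule ext, clarify)
 fix u p
 show "der a (f \<otimes>[A] g) (u, p) = (der a f \<otimes>[A] g \<oplus>[A] (%p. f (tail Q a, []) * der a g p)) (u, p)"
 proof (cases "u = head Q a")
  case True
  have "(f \<otimes>[A] g) (tail Q a, a # p) = f (tail Q a, []) * g (tail Q a, a # p)
    + (\<Sum>i\<le>length p. f (tail Q a, a # take i p) * g (awlast (head Q a) (take i p), drop i p))"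
   unfolding A_mult by (simp only: list.size(4) add_0_right add_Suc_right sum.atMost_Suc_shift) (simp add: awlast_Cons)
  then show ?thesis using True by (simp add: der_def A_simps A_mult add.commute)
 next
  case False
  then show ?thesis by (simp add: der_def A_simps A_mult)
 qed
qed

lemma der_add: "der a (f \<oplus>[A] g) = der a f \<oplus>[A] der a g"
 by (auto simp: der_def A_simps fun_eq_iff)

text \<open>The supports of the two kinds of left ideals in use: all paths ending at
  \<open>v\<close> give the indecomposable projective \<open>A e_v\<close>, and the empty set gives
  the zero module for the degrees in which a shifted projective vanishes.\<close>

definition left_closed :: "('v \<times> 'a list) set => bool" where
 "left_closed U \<longleftrightarrow> U = {} \<or> (\<exists>v\<in>verts Q. U = ending v)"

definition supported :: "('v \<times> 'a list) set => ('v \<times> 'a list => 'k) set" where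
 "supported U = {f : carrier A. \<forall>p. f p ~= 0 --> p : U}"

lemma left_closed_ending: "v : verts Q ==> left_closed (ending v)" and left_closed_empty: "left_closed {}"
 by (auto simp: left_closed_def)

lemma supported_empty: "f : supported {} \<longleftrightarrow> f = \<zero>[A]"
 by (auto simp: supported_def A_simps carrier_A)

lemma supported_ending: "f : supported (ending v) \<longleftrightarrow> f : carrier A \<and> f \<otimes>[A] idem v = f"
 unfolding mult_idem supported_def ending_def carrier_A fun_eq_iff by auto

lemma supported_closed:
 assumes "left_closed U"
 shows "\<zero>[A] : supported U" "f : supported U ==> g : supported U ==> f \<oplus>[A] g : supported U"
  "f : supported U ==> \<ominus>[A] f : supported U" "r : carrier A ==> f : supported U ==> r \<otimes>[A] f : supported U"
  "f : supported U ==> f : carrier A"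
proof -
 show c: "f : supported U ==> f : carrier A" for f by (simp add: supported_def)
 show "\<zero>[A] : supported U" using B.zero_closed by (auto simp: supported_def A_simps(1))
 show "f : supported U ==> g : supported U ==> f \<oplus>[A] g : supported U"
  using B.add.m_closed[of f g] by (force simp: supported_def A_simps(2))
 show "f : supported U ==> \<ominus>[A] f : supported U"
  using B.a_inv_closed[of f] by (auto simp: supported_def A_minus)
 assume r: "r : carrier A" and f: "f : supported U"
 from assms consider "U = {}" | v where "v : verts Q" "U = ending v" unfolding left_closed_def by blast
 then show "r \<otimes>[A] f : supported U"
 proof cases
  case 1
  then show ?thesis using f r by (simp add: supported_empty)
 next
  case 2
  then show ?thesis using f r idem_closed B.m_assoc[of r f "idem v"] by (simp add: supported_ending)
 qed
qed

primrec (nonexhaustive) unelem :: "'r tuple => 'r" where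
 "unelem (Elem r) = r"

definition pm :: "('v \<times> 'a list) set => ('v \<times> 'a list => 'k, ('v \<times> 'a list => 'k) tuple) module" where
 "pm U = \<lparr>carrier = Elem ` supported U, monoid.mult = undefined, one = undefined, zero = Elem \<zero>[A],
   add = (%x y. Elem (unelem x \<oplus>[A] unelem y)), module.smult = (%r x. Elem (r \<otimes>[A] unelem x))\<rparr>"

lemma pm_simps [simp]: "carrier (pm U) = Elem ` supported U" "\<zero>[pm U] = Elem \<zero>[A]"
 "x \<oplus>[pm U] y = Elem (unelem x \<oplus>[A] unelem y)" "r \<odot>[pm U] x = Elem (r \<otimes>[A] unelem x)"
 by (simp_all add: pm_def)

lemma pm_left_module:
 assumes U: "left_closed U"
 shows "left_module A (pm U)"
proof -
 note s = supported_closed[OF U]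
 have "abelian_group (pm U)"
 proof (rule abelian_groupI)
  fix x assume "x : carrier (pm U)"
  then obtain f where "x = Elem f" "f : supported U" by auto
  then show "\<exists>y\<in>carrier (pm U). y \<oplus>[pm U] x = \<zero>[pm U]"
   using s by (intro bexI[of _ "Elem (\<ominus>[A] f)"]) (auto simp: B.l_neg)
 qed (use s in \<open>auto simp: B.a_ac\<close>)
 then show ?thesis
  by (intro left_module.intro left_module_axioms.intro ring_A) (use s in \<open>auto simp: B.l_distr B.r_distr B.m_assoc\<close>)
qed

lemma pm_finitely_generated:
 assumes U: "left_closed U"
 shows "finitely_generated A (pm U)"
proof -
 interpret M: left_module A "pm U" by (rule pm_left_module[OF U])
 from U consider "U = {}" | v where "v : verts Q" "U = ending v" unfolding left_closed_def by blast
 then show ?thesis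
 proof cases
  case 1
  then show ?thesis unfolding finitely_generated_iff[OF M.left_module_axioms] M.submod_def
   by (intro exI[of _ "{}"]) (auto simp: supported_empty)
 next
  case 2
  have e: "idem v : supported U" using 2 idem_closed idem_idem by (simp add: supported_ending)
  have "Elem f : V" if "M.submod V" "Elem (idem v) : V" "f : supported U" for V f
  proof -
   have "f \<odot>[pm U] Elem (idem v) : V" using that(1,2) supported_closed(5)[OF U that(3)] unfolding M.submod_def by blast
   then show ?thesis using that(3) 2 by (simp add: supported_ending)
  qed
  note gen = this
  have "V = carrier (pm U)" if V: "M.submod V" and i: "{Elem (idem v)} \<subseteq> V" for V
  proof
   show "V \<subseteq> carrier (pm U)" using V unfolding M.submod_def by (rule conjunct1)
   show "carrier (pm U) \<subseteq> V" unfolding pm_simps(1) by (rule image_subsetI) (rule gen[OF V], use i in simp_all)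
  qed
  moreover have "{Elem (idem v)} \<subseteq> carrier (pm U)" using e by simp
  ultimately have "finite {Elem (idem v)} \<and> {Elem (idem v)} \<subseteq> carrier (pm U) \<and>
    (\<forall>V. M.submod V --> {Elem (idem v)} \<subseteq> V --> V = carrier (pm U))" by simp
  then show ?thesis unfolding finitely_generated_iff[OF M.left_module_axioms] by (rule exI)
 qed
qed

end

section \<open>Finite spanning lists over the ground field\<close>

locale path_module = quiver_algebra Q A + M: left_module A M
 for Q :: "('v, 'a) pre_digraph" and A :: "('v \<times> 'a list => 'k::field) ring"
  and M :: "('v \<times> 'a list => 'k, 'u) module"
begin

abbreviation ks :: "'k => 'u => 'u" where "ks c x \<equiv> sc c \<odot>[M] x"

lemma ks_closed: "x : carrier M ==> ks c x : carrier M"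
 by (rule M.smult_closed[OF sc_closed])

lemma ks_simps:
 "x : carrier M ==> ks (c + d) x = ks c x \<oplus>[M] ks d x" "x : carrier M ==> ks 0 x = \<zero>[M]" "x : carrier M ==> ks 1 x = x"
 "x : carrier M ==> ks (c * d) x = ks c (ks d x)" "x : carrier M ==> ks (- c) x = \<ominus>[M] ks c x"
 "x : carrier M ==> y : carrier M ==> ks c (x \<oplus>[M] y) = ks c x \<oplus>[M] ks c y"
 "r : carrier A ==> x : carrier M ==> r \<odot>[M] ks c x = ks c (r \<odot>[M] x)" "ks c \<zero>[M] = \<zero>[M]"
proof -
 show add: "ks (c + d) x = ks c x \<oplus>[M] ks d x" if "x : carrier M" for c d x
  using that by (simp add: sc_simps(1) M.smult_l_distr sc_closed)
 show z: "x : carrier M ==> ks 0 x = \<zero>[M]" for x by (simp add: sc_simps(2) M.smult_zero_left)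
 show "x : carrier M ==> ks 1 x = x" by (simp add: sc_simps(3) M.smult_one)
 show "x : carrier M ==> ks (c * d) x = ks c (ks d x)" by (simp add: sc_simps(4) M.smult_assoc1 sc_closed)
 show "ks (- c) x = \<ominus>[M] ks c x" if x: "x : carrier M"
  by (rule M.minus_equality[symmetric]) (use add[OF x, of "- c" c] z[OF x] ks_closed[OF x] in simp_all)
 show "x : carrier M ==> y : carrier M ==> ks c (x \<oplus>[M] y) = ks c x \<oplus>[M] ks c y"
  by (simp add: M.smult_r_distr sc_closed)
 show "r : carrier A ==> x : carrier M ==> r \<odot>[M] ks c x = ks c (r \<odot>[M] x)"
  by (simp add: M.smult_assoc1[symmetric] sc_closed sc_simps(5))
 show "ks c \<zero>[M] = \<zero>[M]" by (rule M.smult_zero_right[OF sc_closed])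
qed

text \<open>Coefficients are taken from a sequence on \<open>nat\<close>, of which the first
  \<open>length ys\<close> values count. Thus \<open>klin ys\<close> is a linear map from the
  sequence space on which \<open>endo\<close> acts.\<close>

primrec klin :: "'u list => (nat => 'k) => 'u" where
 "klin [] c = \<zero>[M]"
| "klin (y # ys) c = ks (c 0) y \<oplus>[M] klin ys (%n. c (Suc n))"

lemma klin_closed: "set ys \<subseteq> carrier M ==> klin ys c : carrier M"
 by (induction ys arbitrary: c) (auto simp: ks_closed)

lemma klin_add: "set ys \<subseteq> carrier M ==> klin ys (%n. c n + d n) = klin ys c \<oplus>[M] klin ys d"
proof (induction ys arbitrary: c d)
 case (Cons y ys)
 then have "y : carrier M" "klin ys c : carrier M" for c using klin_closed by auto
 then show ?case using Cons by (simp add: ks_simps(1) ks_closed M.a_ac)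
qed simp

lemma klin_scale: "set ys \<subseteq> carrier M ==> klin ys (%n. b * c n) = ks b (klin ys c)"
proof (induction ys arbitrary: c)
 case (Cons y ys)
 then have "y : carrier M" "klin ys c : carrier M" for c using klin_closed by auto
 then show ?case using Cons by (simp add: ks_simps ks_closed)
qed (simp add: ks_simps)

lemma klin_cong: "(!!n. n < length ys ==> c n = d n) ==> klin ys c = klin ys d"
proof (induction ys arbitrary: c d)
 case (Cons y ys)
 have "klin ys (%n. c (Suc n)) = klin ys (%n. d (Suc n))" by (rule Cons.IH) (simp add: Cons.prems)
 then show ?case using Cons.prems[of 0] by simp
qed simp

lemma klin_zero: "set ys \<subseteq> carrier M ==> klin ys (%_. 0) = \<zero>[M]"
 by (induction ys) (auto simp: ks_simps)

definition kspan :: "'u list => 'u set" where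
 "kspan ys = range (klin ys)"

lemma kspan_closed:
 assumes "set ys \<subseteq> carrier M"
 shows "\<zero>[M] : kspan ys" "x : kspan ys ==> y : kspan ys ==> x \<oplus>[M] y : kspan ys" "x : kspan ys ==> ks c x : kspan ys"
  "x : kspan ys ==> x : carrier M"
proof -
 show "\<zero>[M] : kspan ys" unfolding kspan_def using klin_zero[OF assms] by (metis rangeI)
 show "x : kspan ys ==> y : kspan ys ==> x \<oplus>[M] y : kspan ys"
  unfolding kspan_def using klin_add[OF assms] by (auto intro: range_eqI[OF HOL.sym])
 show "ks c x : kspan ys" if x: "x : kspan ys"
 proof -
  obtain d where "x = klin ys d" using x by (auto simp: kspan_def)
  then have "ks c x = klin ys (%n. c * d n)" using klin_scale[OF assms] by simp
  then show ?thesis unfolding kspan_def by blast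
 qed
 show "x : kspan ys ==> x : carrier M" unfolding kspan_def using klin_closed[OF assms] by blast
qed

lemma kspan_Cons: "x : kspan (y # ys) \<longleftrightarrow> (\<exists>c w. w : kspan ys \<and> x = ks c y \<oplus>[M] w)"
proof
 assume "x : kspan (y # ys)"
 then show "\<exists>c w. w : kspan ys \<and> x = ks c y \<oplus>[M] w" by (auto simp: kspan_def)
next
 assume "\<exists>c w. w : kspan ys \<and> x = ks c y \<oplus>[M] w"
 then obtain c d where "x = ks c y \<oplus>[M] klin ys d" by (auto simp: kspan_def)
 then have "x = klin (y # ys) (%n. case n of 0 => c | Suc n => d n)" by simp
 then show "x : kspan (y # ys)" unfolding kspan_def by blast
qed

lemma kspan_base: "set ys \<subseteq> carrier M ==> y : set ys ==> y : kspan ys"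
proof (induction ys)
 case (Cons z ys)
 have z: "z : carrier M" and ys: "set ys \<subseteq> carrier M" using Cons.prems by auto
 show ?case
 proof (cases "y = z")
  case True
  then show ?thesis unfolding kspan_Cons using kspan_closed(1)[OF ys] z
   by (intro exI[of _ 1] exI[of _ "\<zero>[M]"]) (simp add: ks_simps)
 next
  case False
  then have "y : kspan ys" using Cons by auto
  then show ?thesis unfolding kspan_Cons using z kspan_closed(4)[OF ys]
   by (intro exI[of _ 0] exI[of _ y]) (simp add: ks_simps)
 qed
qed simp

text \<open>Elimination of one vector \<open>y\<close> at a time: if some element of
  \<open>N\<close> involves \<open>y\<close> with nonzero coefficient, it becomes a pivot that
  removes \<open>y\<close> from all other elements.\<close>

lemma subspace_kspan:
 assumes "set ys \<subseteq> carrier M" "N \<subseteq> kspan ys"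
  and N: "\<zero>[M] : N" "!!x y. x : N ==> y : N ==> x \<oplus>[M] y : N" "!!c x. x : N ==> ks c x : N"
 shows "\<exists>zs. set zs \<subseteq> N \<and> N \<subseteq> kspan zs"
 using assms
proof (induction ys arbitrary: N)
 case Nil
 then show ?case by (intro exI[of _ "[]"]) (auto simp: kspan_def)
next
 case (Cons y ys)
 note N = Cons.prems(3-5)
 have y: "y : carrier M" and ys: "set ys \<subseteq> carrier M" using Cons.prems by auto
 note sp = kspan_closed[OF ys]
 have Nc: "N \<subseteq> carrier M" using Cons.prems(2) kspan_closed(4)[OF Cons.prems(1)] by blast
 have "\<exists>zs. set zs \<subseteq> N \<inter> kspan ys \<and> N \<inter> kspan ys \<subseteq> kspan zs"
  by (rule Cons.IH[OF ys]) (use N sp in auto)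
 then obtain zs where zs: "set zs \<subseteq> N \<inter> kspan ys" "N \<inter> kspan ys \<subseteq> kspan zs" by blast
 have zsc: "set zs \<subseteq> carrier M" using zs(1) Nc by blast
 show ?case
 proof (cases "\<exists>c w. c ~= 0 \<and> w : kspan ys \<and> ks c y \<oplus>[M] w : N")
  case False
  have "N \<subseteq> kspan ys"
  proof
   fix x assume x: "x : N"
   then obtain c w where w: "w : kspan ys" "x = ks c y \<oplus>[M] w" using Cons.prems(2) kspan_Cons by blast
   then have "c = 0" using False x by blast
   then show "x : kspan ys" using w sp(4)[OF w(1)] y by (simp add: ks_simps)
  qed
  then show ?thesis using zs by blast
 next
  case True
  then obtain c w where c: "c ~= 0" "w : kspan ys" "ks c y \<oplus>[M] w : N" by blast
  let ?z = "ks c y \<oplus>[M] w"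
  have "x : kspan (?z # zs)" if x: "x : N" for x
  proof -
   obtain d w' where w': "w' : kspan ys" "x = ks d y \<oplus>[M] w'" using Cons.prems(2) x kspan_Cons by blast
   note wc = sp(4)[OF c(2)] sp(4)[OF w'(1)]
   let ?x' = "x \<oplus>[M] ks (- (d / c)) ?z"
   have "ks (- (d / c)) ?z = ks (- d) y \<oplus>[M] ks (- (d / c)) w"
    using c(1) wc y ks_closed by (simp add: ks_simps(6) ks_simps(4)[symmetric])
   then have "?x' = (ks d y \<oplus>[M] ks (- d) y) \<oplus>[M] (w' \<oplus>[M] ks (- (d / c)) w)"
    unfolding w'(2) using wc y ks_closed by (simp add: M.a_ac)
   also have "\<dots> = w' \<oplus>[M] ks (- (d / c)) w"
    using wc y ks_closed ks_simps(1)[OF y, of d "- d"] by (simp add: ks_simps(2))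
   finally have "?x' : kspan ys" using sp(2)[OF w'(1) sp(3)[OF c(2)]] by simp
   moreover have "?x' : N" using N(2)[OF x N(3)[OF c(3)]] .
   ultimately have "?x' : kspan zs" using zs(2) by blast
   moreover have "x = ks (d / c) ?z \<oplus>[M] ?x'"
   proof -
    have zc: "?z : carrier M" and xc: "x : carrier M" using c(3) x Nc by auto
    have "ks (d / c) ?z \<oplus>[M] ?x' = x \<oplus>[M] (ks (d / c) ?z \<oplus>[M] ks (- (d / c)) ?z)"
     using M.a_lcomm[OF ks_closed[OF zc] xc ks_closed[OF zc]] .
    also have "\<dots> = x" unfolding ks_simps(1)[OF zc, symmetric] using xc zc by (simp add: ks_simps(2))
    finally show ?thesis ..
   qed
   ultimately show ?thesis unfolding kspan_Cons by blast
  qed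
  then show ?thesis using zs(1) c(3) by (intro exI[of _ "?z # zs"]) auto
 qed
qed

lemma restricted_smult_kspan:
 assumes ys: "set ys \<subseteq> carrier M" and x: "x : carrier M" and r: "r : carrier A" and P: "finite P" "P \<subseteq> paths Q"
  and gen: "!!p. p : paths Q ==> path p \<odot>[M] x : set ys"
 shows "(%p. if p : P then r p else 0) \<odot>[M] x : kspan ys"
 using P
proof (induction P)
 case empty
 have "(%p. if p : {} then r p else 0) = \<zero>[A]" by (simp add: A_simps)
 then show ?case using M.smult_zero_left[OF x] kspan_closed(1)[OF ys] by simp
next
 case (insert q P)
 let ?r = "%p. if p : P then r p else 0"
 have rc: "?r : carrier A" using insert.prems by (auto simp: carrier_A)
 have q: "path q : carrier A" using insert.prems path_closed by blast
 have "(%p. if p : insert q P then r p else 0) = sc (r q) \<otimes>[A] path q \<oplus>[A] ?r"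
  unfolding sc_mult(1)[OF q] using insert.hyps(2) by (auto simp: A_simps path_def fun_eq_iff)
 then have "(%p. if p : insert q P then r p else 0) \<odot>[M] x = ks (r q) (path q \<odot>[M] x) \<oplus>[M] ?r \<odot>[M] x"
  using x rc q sc_closed by (simp add: M.smult_l_distr M.smult_assoc1 B.m_closed)
 moreover have "path q \<odot>[M] x : kspan ys" using gen insert.prems by (intro kspan_base[OF ys]) auto
 ultimately show ?case using insert kspan_closed[OF ys] by simp
qed

text \<open>There are finitely many paths, and they span the algebra; their products with the
  generators span the module over the field. The elements whose multiples all lie in this span form
  a submodule containing the generators.\<close>

lemma finitely_spanned:
 assumes fg: "finitely_generated A M"
 shows "\<exists>ys. set ys \<subseteq> carrier M \<and> carrier M \<subseteq> kspan ys"
proof -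
 obtain S where S: "finite S" "S \<subseteq> carrier M" "!!U. M.submod U ==> S \<subseteq> U ==> U = carrier M"
  using fg finitely_generated_iff[OF M.left_module_axioms] by blast
 have "finite ((%(p, x). path p \<odot>[M] x) ` (paths Q \<times> S))" using S(1) finite_paths by simp
 then obtain ys where ys: "set ys = (%(p, x). path p \<odot>[M] x) ` (paths Q \<times> S)" using finite_list by blast
 have ysc: "set ys \<subseteq> carrier M" unfolding ys using S(2) path_closed by (auto intro!: M.smult_closed)
 note sp = kspan_closed[OF ysc]
 let ?U = "{x : carrier M. \<forall>r\<in>carrier A. r \<odot>[M] x : kspan ys}"
 have "M.submod ?U" unfolding M.submod_def
  using sp by (auto simp: M.smult_closed M.smult_zero_right M.smult_r_distr M.smult_assoc1[symmetric] B.m_closed)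
 moreover have "S \<subseteq> ?U"
 proof -
  have "r \<odot>[M] x : kspan ys" if x: "x : S" and r: "r : carrier A" for x r
  proof -
   have "(%p. if p : paths Q then r p else 0) = r" using r by (auto simp: carrier_A fun_eq_iff)
   moreover have "path p \<odot>[M] x : set ys" if "p : paths Q" for p
    unfolding ys using that x by (intro image_eqI[of _ _ "(p, x)"]) auto
   moreover have "x : carrier M" using x S(2) by blast
   ultimately show ?thesis
    using restricted_smult_kspan[OF ysc _ r finite_paths subset_refl, of x] by simp
  qed
  then show ?thesis using S(2) by blast
 qed
 ultimately have U: "?U = carrier M" by (rule S(3))
 have "x : kspan ys" if "x : carrier M" for x
 proof -
  have "\<one>[A] \<odot>[M] x : kspan ys" using that U B.one_closed by blast
  then show ?thesis using M.smult_one[OF that] by simp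
 qed
 then show ?thesis using ysc by blast
qed

lemma submod_kspan:
 assumes "finitely_generated A M" and N: "M.submod N"
 shows "\<exists>zs. set zs \<subseteq> N \<and> N \<subseteq> kspan zs"
proof -
 obtain ys where ys: "set ys \<subseteq> carrier M" "carrier M \<subseteq> kspan ys" using finitely_spanned[OF assms(1)] by blast
 show ?thesis by (rule subspace_kspan[OF ys(1)]) (use N ys(2) sc_closed in \<open>auto simp: M.submod_def\<close>)
qed

lemma kspan_submod: "M.submod U ==> set zs \<subseteq> U ==> kspan zs \<subseteq> U"
proof (induction zs)
 case Nil
 then show ?case by (auto simp: kspan_def M.submod_def)
next
 case (Cons z zs)
 then have "ks c z \<oplus>[M] w : U" if "w : kspan zs" for c w
  using that sc_closed unfolding M.submod_def by auto
 then show ?case by (auto simp: kspan_Cons)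
qed

text \<open>The idempotents of the vertices add up to 1; the induction builds this sum vertex by
  vertex.\<close>

lemma idems_generate:
 assumes U: "M.submod U" and x: "x : carrier M" and "!!v. v : verts Q ==> idem v \<odot>[M] x : U"
 shows "x : U"
proof -
 have "(%(u, p). if u : W \<and> p = [] then 1 else 0) \<odot>[M] x : U" if "finite W" "W \<subseteq> verts Q" for W
  using that
 proof (induction W)
  case empty
  have "(%(u :: 'v, p :: 'a list). if u : {} \<and> p = [] then 1 else 0) = \<zero>[A]" by (simp add: A_simps split_def)
  then show ?case using U M.smult_zero_left[OF x] by (simp add: M.submod_def)
 next
  case (insert v W)
  have "(%(u, p). if u : insert v W \<and> p = [] then 1 else 0) = idem v \<oplus>[A] (%(u, p). if u : W \<and> p = [] then 1 else 0)"
   using insert.hyps(2) by (auto simp: A_simps idem_def fun_eq_iff)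
  moreover have "(%(u, p). if u : W \<and> p = [] then 1 else 0) : carrier A"
   using insert.prems by (auto simp: carrier_A paths_iff awalk_Nil_iff split: if_splits)
  ultimately show ?case using insert assms U idem_closed[of v] by (simp add: M.smult_l_distr M.submod_def)
 qed
 from this[OF finite_verts subset_refl] show ?thesis using M.smult_one[OF x] by (simp add: A_simps)
qed

text \<open>An element fixed by \<open>idem v\<close> is the same as a map out of the projective
  \<open>A e_v\<close>. Such generators arise by applying all vertex idempotents to a finite
  spanning list.\<close>

lemma homogeneous_generators:
 assumes "finitely_generated A M" and N: "M.submod N"
 shows "\<exists>G. finite G \<and> (\<forall>(v, x)\<in>G. v : verts Q \<and> x : N \<and> idem v \<odot>[M] x = x) \<and>
  (\<forall>U. M.submod U --> (\<forall>(v, x)\<in>G. x : U) --> N \<subseteq> U)"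
proof -
 obtain zs where zs: "set zs \<subseteq> N" "N \<subseteq> kspan zs" using submod_kspan[OF assms] by blast
 have Nc: "N \<subseteq> carrier M" using N by (simp add: M.submod_def)
 let ?G = "(%(v, z). (v, idem v \<odot>[M] z)) ` (verts Q \<times> set zs)"
 have "v : verts Q \<and> x : N \<and> idem v \<odot>[M] x = x" if "(v, x) : ?G" for v x
 proof -
  obtain z where z: "v : verts Q" "z : set zs" "x = idem v \<odot>[M] z" using \<open>(v, x) : ?G\<close> by auto
  have zN: "z : N" and zc: "z : carrier M" using z(2) zs(1) Nc by auto
  show ?thesis using z(1) zN N idem_closed[OF z(1)] M.smult_assoc1[OF idem_closed[OF z(1)] idem_closed[OF z(1)] zc] idem_idem[of v]
   unfolding z(3) by (simp add: M.submod_def)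
 qed
 moreover have "N \<subseteq> U" if U: "M.submod U" and G: "\<forall>(v, x)\<in>?G. x : U" for U
 proof -
  have "set zs \<subseteq> U"
  proof
   fix z assume z: "z : set zs"
   show "z : U" by (rule idems_generate[OF U]) (use z zs(1) Nc G in auto)
  qed
  then show ?thesis using kspan_submod[OF U] zs(2) by blast
 qed
 moreover have "finite ?G" using finite_verts by simp
 ultimately show ?thesis by (intro exI[of _ ?G]) blast
qed

end

section \<open>Sums of shifted projective modules\<close>

lemma linmap_image_submod:
 assumes M: "left_module R M" and N: "left_module R N" and f: "linmap R M N f"
 shows "left_module.submod R N (f ` carrier M)"
proof -
 interpret M: left_module R M by fact
 interpret N: left_module R N by fact
 note l = linmapD[OF f] and z = linmap_zero_minus(1)[OF M N f]
 show ?thesis unfolding N.submod_def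
 proof (intro conjI ballI)
  show "f ` carrier M \<subseteq> carrier N" using l(1) by blast
  show "\<zero>[N] : f ` carrier M" using z by (intro image_eqI[of _ _ "\<zero>[M]"]) simp_all
  show "x \<oplus>[N] y : f ` carrier M" if "x : f ` carrier M" "y : f ` carrier M" for x y
  proof -
   obtain a b where "a : carrier M" "b : carrier M" "x = f a" "y = f b" using \<open>x : _\<close> \<open>y : _\<close> by blast
   then show ?thesis by (intro image_eqI[of _ _ "a \<oplus>[M] b"]) (simp_all add: l)
  qed
  show "r \<odot>[N] x : f ` carrier M" if "r : carrier R" "x : f ` carrier M" for r x
  proof -
   obtain a where "a : carrier M" "x = f a" using \<open>x : _\<close> by blast
   then show ?thesis using \<open>r : _\<close> by (intro image_eqI[of _ _ "r \<odot>[M] a"]) (simp_all add: l M.smult_closed)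
  qed
 qed
qed

context quiver_algebra
begin

type_synonym ('w, 'b, 'c) generator = "'w \<times> int \<times> ('w \<times> 'b list => 'c) tuple"

abbreviation piece :: "'v => int => int => ('v \<times> 'a list) set" where
 "piece v n i \<equiv> if i = n then ending v else {}"

definition gen :: "'v => int => ('v \<times> 'a list => 'k) cpx" where
 "gen v n = \<lparr>deg = (%i. pm (piece v n i)), diff = (%i. \<lambda>x\<in>carrier (pm (piece v n i)). Elem \<zero>[A])\<rparr>"

text \<open>The third component of an entry is a label of arbitrary type: for \<open>evm\<close> it
  holds the image of the generator, and a list of projectives alone can carry the unit
  element.\<close>

primrec fsum :: "('v \<times> int \<times> 'x) list => ('v \<times> 'a list => 'k) cpx" where
 "fsum [] = zero_cpx"
| "fsum (t # L) = sum_cpx (gen (fst t) (fst (snd t))) (fsum L)"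

definition valid :: "('v \<times> int \<times> 'x) list => bool" where
 "valid L \<longleftrightarrow> fst ` set L \<subseteq> verts Q"

lemma valid_Cons [simp]: "valid (t # L) \<longleftrightarrow> fst t : verts Q \<and> valid L"
 by (auto simp: valid_def)

lemma left_closed_piece: "v : verts Q ==> left_closed (piece v n i)"
 by (simp add: left_closed_ending left_closed_empty)

lemma deg_gen: "deg (gen v n) i = pm (piece v n i)"
 by (simp add: gen_def)

lemma diff_gen: "x : elts (gen v n) i ==> diff (gen v n) i x = Elem \<zero>[A]"
 by (simp add: gen_def)

lemma bounded_gen:
 assumes v: "v : verts Q"
 shows "bounded_cpx A (gen v n)"
proof (rule B.bounded_cpxI[of _ "\<bar>n\<bar>"])
 fix i
 note p = left_closed_piece[OF v]
 show "left_module A (deg (gen v n) i)" "finitely_generated A (deg (gen v n) i)"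
  unfolding deg_gen by (rule pm_left_module[OF p], rule pm_finitely_generated[OF p])
 note c = supported_closed[OF p]
 show "linmap A (deg (gen v n) i) (deg (gen v n) (i + 1)) (diff (gen v n) i)"
 proof (rule linmapI)
  fix x assume x: "x : elts (gen v n) i"
  show "diff (gen v n) i x : elts (gen v n) (i + 1)"
   unfolding diff_gen[OF x] unfolding deg_gen pm_simps by (rule imageI[OF c(1)])
  interpret M: left_module A "deg (gen v n) i" unfolding deg_gen by (rule pm_left_module[OF p])
  show "diff (gen v n) i (x \<oplus>[deg (gen v n) i] y) = diff (gen v n) i x \<oplus>[deg (gen v n) (i + 1)] diff (gen v n) i y"
   if y: "y : elts (gen v n) i" for y
   unfolding diff_gen[OF x] diff_gen[OF y] diff_gen[OF M.a_closed[OF x y]] unfolding deg_gen pm_simps by (simp add: A_simps)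
  show "diff (gen v n) i (a \<odot>[deg (gen v n) i] x) = a \<odot>[deg (gen v n) (i + 1)] diff (gen v n) i x" if a: "a : carrier A" for a
   unfolding diff_gen[OF x] diff_gen[OF M.smult_closed[OF a x]] unfolding deg_gen pm_simps using a by simp
 qed
 show "diff (gen v n) i : extensional (elts (gen v n) i)" unfolding gen_def by simp
 show "diff (gen v n) (i + 1) (diff (gen v n) i x) = \<zero>[deg (gen v n) (i + 1 + 1)]" if x: "x : elts (gen v n) i" for x
 proof -
  have "Elem \<zero>[A] : elts (gen v n) (i + 1)" unfolding deg_gen pm_simps by (rule imageI[OF c(1)])
  from diff_gen[OF this] show ?thesis unfolding diff_gen[OF x] deg_gen pm_simps .
 qed
 show "elts (gen v n) i = {\<zero>[deg (gen v n) i]}" if "\<bar>i\<bar> > \<bar>n\<bar>"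
  using that unfolding deg_gen by (auto simp: supported_empty)
qed

lemma bounded_fsum: "valid L ==> bounded_cpx A (fsum L)"
 by (induction L) (simp_all add: fsum.simps B.bounded_zero_cpx B.bounded_sum_cpx bounded_gen)

lemma deg_fsum:
 "deg (fsum []) i = zero_module" "deg (fsum (t # L)) i = direct_sum (pm (piece (fst t) (fst (snd t)) i)) (deg (fsum L) i)"
 by (simp_all add: zero_cpx_def sum_cpx_def deg_gen)

declare fsum.simps [simp del]

lemma carrier_fsum_Cons:
 assumes "z : elts (fsum (t # L)) i"
 obtains b y where "z = Tup (Elem b) y" "b : supported (piece (fst t) (fst (snd t)) i)" "y : elts (fsum L) i"
 using assms unfolding deg_fsum by auto

lemma diff_fsum: "z : elts (fsum L) i ==> diff (fsum L) i z = \<zero>[deg (fsum L) (i + 1)]"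
proof (induction L arbitrary: z)
 case Nil
 then show ?case by (simp add: fsum.simps zero_cpx_def)
next
 case (Cons t L)
 obtain b y where z: "z = Tup (Elem b) y" "b : supported (piece (fst t) (fst (snd t)) i)" "y : elts (fsum L) i"
  using carrier_fsum_Cons[OF Cons.prems] .
 have "diff (gen (fst t) (fst (snd t))) i (Elem b) = Elem \<zero>[A]" by (rule diff_gen) (use z in \<open>simp add: deg_gen\<close>)
 then show ?case using z Cons.IH[OF z(3)] by (simp add: fsum.simps sum_cpx_def deg_gen)
qed

lemma cocycles_fsum: "cocycles (fsum L) i = elts (fsum L) i"
 using diff_fsum by (auto simp: cocycles_def)

lemma coboundaries_fsum:
 assumes "valid L"
 shows "coboundaries (fsum L) i = {\<zero>[deg (fsum L) i]}"
proof -
 interpret M: left_module A "deg (fsum L) (i - 1)" by (rule B.cpxD(1)[OF bounded_fsum[OF assms]])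
 show ?thesis using diff_fsum[of _ L "i - 1"] M.zero_closed by (auto simp: coboundaries_def intro!: image_eqI[of _ _ "\<zero>[deg (fsum L) (i - 1)]"])
qed

text \<open>Components are addressed by the generator rather than by its position. The first
  occurrence is read, hence the condition \<open>distinct\<close> in later lemmas.\<close>

primrec coef :: "('v \<times> int \<times> 'x) list => ('v \<times> 'a list => 'k) tuple => 'v \<times> int \<times> 'x => 'v \<times> 'a list => 'k" where
 "coef [] z g = \<zero>[A]"
| "coef (t # L) z g = (if g = t then unelem (tfst z) else coef L (tsnd z) g)"

lemma coef_supported:
 "z : elts (fsum L) i ==> g : set L ==> coef L z g : supported (piece (fst g) (fst (snd g)) i)"
proof (induction L arbitrary: z)
 case (Cons t L)
 then show ?case by (elim carrier_fsum_Cons) (auto split: if_splits)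
qed simp

lemma coef_zero_imp_zero:
 "z : elts (fsum L) i ==> distinct L ==> (!!g. g : set L ==> coef L z g = \<zero>[A]) ==> z = \<zero>[deg (fsum L) i]"
proof (induction L arbitrary: z)
 case Nil
 then show ?case by (simp add: deg_fsum)
next
 case (Cons t L)
 obtain b y where z: "z = Tup (Elem b) y" "y : elts (fsum L) i" using carrier_fsum_Cons[OF Cons.prems(1)] by metis
 have "b = \<zero>[A]" using Cons.prems(3)[of t] z by simp
 moreover have "y = \<zero>[deg (fsum L) i]"
 proof (rule Cons.IH[OF z(2)])
  show "distinct L" using Cons.prems(2) by simp
  fix g assume g: "g : set L"
  then have "g ~= t" using Cons.prems(2) by auto
  then show "coef L y g = \<zero>[A]" using Cons.prems(3)[of g] g z by simp
 qed
 ultimately show ?case using z by (simp add: deg_fsum)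
qed

primrec derz :: "'a => ('v \<times> int \<times> 'x) list => ('v \<times> 'a list => 'k) tuple => ('v \<times> 'a list => 'k) tuple" where
 "derz a [] z = z"
| "derz a (t # L) z = Tup (Elem (der a (unelem (tfst z)))) (derz a L (tsnd z))"

lemma der_supported:
 assumes "f : supported (piece v n i)"
 shows "der a f : supported (piece v n i)"
proof -
 have f: "f : carrier A" "!!p. f p ~= 0 ==> p : piece v n i" using assms unfolding supported_def by blast+
 have "(u, p) : piece v n i" if "der a f (u, p) ~= 0" for u p
 proof -
  have u: "u = head Q a" and n: "f (tail Q a, a # p) ~= 0" using that by (auto simp: der_def split: if_splits)
  have "(u, p) : paths Q" using der_closed[OF f(1)] that by (simp add: carrier_A)
  moreover have "(tail Q a, a # p) : piece v n i" by (rule f(2)[OF n])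
  ultimately show ?thesis using u by (cases "i = n") (simp_all add: ending_def target_def awlast_Cons)
 qed
 then show ?thesis using der_closed[OF f(1)] by (auto simp: supported_def)
qed

lemma derz_closed: "z : elts (fsum L) i ==> derz a L z : elts (fsum L) i"
proof (induction L arbitrary: z)
 case (Cons t L)
 then show ?case by (elim carrier_fsum_Cons) (simp add: deg_fsum der_supported)
qed simp

lemma coef_derz: "g : set L ==> coef L (derz a L z) g = der a (coef L z g)"
 by (induction L arbitrary: z) auto

lemma derz_add:
 "y : elts (fsum L) i ==> z : elts (fsum L) i ==>
  derz a L (y \<oplus>[deg (fsum L) i] z) = derz a L y \<oplus>[deg (fsum L) i] derz a L z"
proof (induction L arbitrary: y z)
 case (Cons t L)
 obtain b y' c z' where "y = Tup (Elem b) y'" "y' : elts (fsum L) i" "z = Tup (Elem c) z'" "z' : elts (fsum L) i"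
  using carrier_fsum_Cons[OF Cons.prems(1)] carrier_fsum_Cons[OF Cons.prems(2)] by metis
 then show ?case using Cons.IH by (simp add: deg_fsum der_add)
qed (simp add: deg_fsum)

lemma derz_smult:
 assumes "b : carrier A" "b (tail Q a, []) = 0"
 shows "z : elts (fsum L) i ==> derz a L (b \<odot>[deg (fsum L) i] z) = der a b \<odot>[deg (fsum L) i] z"
proof (induction L arbitrary: z)
 case Nil
 then show ?case by (simp add: deg_fsum)
next
 case (Cons t L)
 then show ?case using assms by (elim carrier_fsum_Cons) (simp add: deg_fsum der_mult A_simps)
qed

lemma derz_zero: "derz a L \<zero>[deg (fsum L) i] = \<zero>[deg (fsum L) i]"
proof (induction L)
 case (Cons t L)
 have "der a \<zero>[A] = \<zero>[A]" by (auto simp: der_def A_simps fun_eq_iff)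
 then show ?case using Cons by (simp add: deg_fsum)
qed simp

definition etm :: "(int => ('v \<times> 'a list => 'k, ('v \<times> 'a list => 'k) tuple) module) => int => ('v, 'a, 'k) generator =>
  ('v \<times> 'a list => 'k) => ('v \<times> 'a list => 'k) tuple" where
 "etm D i t b = (if fst (snd t) = i then b \<odot>[D i] snd (snd t) else \<zero>[D i])"

lemma etm_simps:
 assumes D: "left_module A (D i)" and x: "snd (snd t) : carrier (D (fst (snd t)))"
 shows "b : carrier A ==> etm D i t b : carrier (D i)"
  "b : carrier A ==> b' : carrier A ==> etm D i t (b \<oplus>[A] b') = etm D i t b \<oplus>[D i] etm D i t b'"
  "b : carrier A ==> a : carrier A ==> etm D i t (a \<otimes>[A] b) = a \<odot>[D i] etm D i t b"
  "etm D i t \<zero>[A] = \<zero>[D i]"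
proof -
 interpret M: left_module A "D i" by (rule D)
 show "b : carrier A ==> etm D i t b : carrier (D i)"
  "b : carrier A ==> b' : carrier A ==> etm D i t (b \<oplus>[A] b') = etm D i t b \<oplus>[D i] etm D i t b'"
  "b : carrier A ==> a : carrier A ==> etm D i t (a \<otimes>[A] b) = a \<odot>[D i] etm D i t b"
  "etm D i t \<zero>[A] = \<zero>[D i]"
  using x by (cases "fst (snd t) = i"; simp add: etm_def M.smult_closed M.smult_l_distr M.smult_assoc1 M.smult_zero_right M.smult_zero_left)+
qed

text \<open>The map from the sum of shifted projectives that sends each generator to its label. The
  condition \<open>idem v x = x\<close> in \<open>entries\<close> ensures that the generator
  \<open>idem v\<close> of \<open>A e_v\<close> is really sent to \<open>x\<close>.\<close>

primrec evm :: "(int => ('v \<times> 'a list => 'k, ('v \<times> 'a list => 'k) tuple) module) => ('v, 'a, 'k) generator list => int =>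
  ('v \<times> 'a list => 'k) tuple => ('v \<times> 'a list => 'k) tuple" where
 "evm D [] i z = \<zero>[D i]"
| "evm D (t # L) i z = etm D i t (unelem (tfst z)) \<oplus>[D i] evm D L i (tsnd z)"

definition entries :: "(int => ('v \<times> 'a list => 'k, ('v \<times> 'a list => 'k) tuple) module) => ('v, 'a, 'k) generator set => bool" where
 "entries D G \<longleftrightarrow> (\<forall>(v, n, x)\<in>G. v : verts Q \<and> x : carrier (D n) \<and> idem v \<odot>[D n] x = x)"

lemma entries_Cons [simp]: "entries D (insert t G) \<longleftrightarrow> (fst t : verts Q \<and> snd (snd t) : carrier (D (fst (snd t))) \<and>
  idem (fst t) \<odot>[D (fst (snd t))] snd (snd t) = snd (snd t)) \<and> entries D G"
 by (auto simp: entries_def split_def)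

lemma entries_valid: "entries D (set L) ==> valid L"
 by (auto simp: entries_def valid_def)

lemma evm_linmap:
 assumes D: "!!i. left_module A (D i)"
 shows "entries D (set L) ==> linmap A (deg (fsum L) i) (D i) (evm D L i)"
proof (induction L)
 case Nil
 interpret M: left_module A "D i" by (rule D)
 show ?case by (rule linmapI) (simp_all add: M.smult_zero_right)
next
 case (Cons t L)
 interpret M: left_module A "D i" by (rule D)
 have l: "linmap A (deg (fsum L) i) (D i) (evm D L i)" using Cons by simp
 note ls = linmapD[OF l]
 have p: "left_closed (piece (fst t) (fst (snd t)) i)" using Cons.prems by (intro left_closed_piece) simp
 note sc = supported_closed(5)[OF p]
 have x: "snd (snd t) : carrier (D (fst (snd t)))" using Cons.prems by simp
 note es = etm_simps[of D i t, OF D x]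
 show ?case
 proof (rule linmapI)
  fix z assume "z : elts (fsum (t # L)) i"
  then obtain b y where z: "z = Tup (Elem b) y" "b : supported (piece (fst t) (fst (snd t)) i)" "y : elts (fsum L) i"
   by (rule carrier_fsum_Cons)
  show "evm D (t # L) i z : carrier (D i)" using z ls(1)[OF z(3)] sc[OF z(2)] by (simp add: es)
  show "evm D (t # L) i (a \<odot>[deg (fsum (t # L)) i] z) = a \<odot>[D i] evm D (t # L) i z" if a: "a : carrier A" for a
   using z a ls(3)[OF a z(3)] ls(1)[OF z(3)] sc[OF z(2)]
   by (simp add: deg_fsum es M.smult_r_distr)
  fix z' assume "z' : elts (fsum (t # L)) i"
  then obtain b' y' where z': "z' = Tup (Elem b') y'" "b' : supported (piece (fst t) (fst (snd t)) i)" "y' : elts (fsum L) i"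
   by (rule carrier_fsum_Cons)
  show "evm D (t # L) i (z \<oplus>[deg (fsum (t # L)) i] z') = evm D (t # L) i z \<oplus>[D i] evm D (t # L) i z'"
   using z z' ls(1)[OF z(3)] ls(1)[OF z'(3)] ls(2)[OF z(3) z'(3)] sc[OF z(2)] sc[OF z'(2)]
   by (simp add: deg_fsum es M.a_ac)
 qed
qed

lemma evm_hits:
 assumes D: "!!i. left_module A (D i)"
 shows "entries D (set L) ==> (v, i, x) : set L ==> \<exists>z\<in>elts (fsum L) i. evm D L i z = x"
proof (induction L)
 case (Cons t L)
 interpret M: left_module A "D i" by (rule D)
 have e: "entries D (set L)" using Cons.prems by simp
 interpret S: left_module A "deg (fsum L) i" by (rule B.cpxD(1)[OF bounded_fsum[OF entries_valid[OF e]]])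
 have p: "left_closed (piece (fst t) (fst (snd t)) i)" using Cons.prems by (intro left_closed_piece) simp
 show ?case
 proof (cases "t = (v, i, x)")
  case True
  have v: "v : verts Q" "x : carrier (D i)" "idem v \<odot>[D i] x = x" using Cons.prems(1) True by auto
  have "idem v : supported (ending v)" using v(1) idem_closed idem_idem by (simp add: supported_ending)
  moreover have "evm D L i \<zero>[deg (fsum L) i] = \<zero>[D i]"
   by (rule linmap_zero_minus(1)[OF S.left_module_axioms D evm_linmap[OF D e]])
  ultimately show ?thesis using v True
   by (intro bexI[of _ "Tup (Elem (idem v)) \<zero>[deg (fsum L) i]"]) (simp_all add: deg_fsum etm_def)
 next
  case False
  then obtain z where z: "z : elts (fsum L) i" "evm D L i z = x" using Cons.IH[OF e] Cons.prems(2) by auto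
  have "snd (snd t) : carrier (D (fst (snd t)))" using Cons.prems by simp
  note es = etm_simps[of D i t, OF D this]
  have "x : carrier (D i)" using z linmapD(1)[OF evm_linmap[OF D e]] by blast
  then show ?thesis using z supported_closed(1)[OF p]
   by (intro bexI[of _ "Tup (Elem \<zero>[A]) z"]) (simp_all add: deg_fsum es)
 qed
qed simp

text \<open>Separates the contribution of one generator from those of the others, which lie in any
  submodule \<open>U\<close> containing their labels.\<close>

lemma evm_split:
 assumes D: "left_module A (D i)" and U: "left_module.submod A (D i) U"
 shows "z : elts (fsum L) i ==> entries D (set L) ==> distinct L ==> \<forall>(w, n, y)\<in>set L - {(v, i, x)}. n = i --> y : U ==>
  ((v, i, x) : set L --> (\<exists>u\<in>U. evm D L i z = coef L z (v, i, x) \<odot>[D i] x \<oplus>[D i] u)) \<and>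
  ((v, i, x) \<notin> set L --> evm D L i z : U)"
proof (induction L arbitrary: z)
 case Nil
 interpret M: left_module A "D i" by (rule D)
 show ?case using U by (simp add: M.submod_def)
next
 case (Cons t L)
 interpret M: left_module A "D i" by (rule D)
 have Uc: "U \<subseteq> carrier (D i)" and U0: "\<zero>[D i] : U" and Ua: "!!x y. x : U ==> y : U ==> x \<oplus>[D i] y : U"
  and Us: "!!a x. a : carrier A ==> x : U ==> a \<odot>[D i] x : U" using U by (auto simp: M.submod_def)
 obtain b y where z: "z = Tup (Elem b) y" "b : supported (piece (fst t) (fst (snd t)) i)" "y : elts (fsum L) i"
  using Cons.prems(1) by (rule carrier_fsum_Cons)
 have p: "left_closed (piece (fst t) (fst (snd t)) i)" using Cons.prems by (intro left_closed_piece) simp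
 have b: "b : carrier A" by (rule supported_closed(5)[OF p z(2)])
 have IH: "((v, i, x) : set L --> (\<exists>u\<in>U. evm D L i y = coef L y (v, i, x) \<odot>[D i] x \<oplus>[D i] u)) \<and>
  ((v, i, x) \<notin> set L --> evm D L i y : U)"
  by (rule Cons.IH[OF z(3)]) (use Cons.prems in auto)
 show ?case
 proof (cases "t = (v, i, x)")
  case True
  then have "(v, i, x) \<notin> set L" using Cons.prems(3) by auto
  then show ?thesis using True z IH by (auto simp: etm_def)
 next
  case False
  have h: "etm D i t b : U"
  proof (cases "fst (snd t) = i")
   case True
   have "t : set (t # L) - {(v, i, x)}" using False by simp
   from bspec[OF Cons.prems(4) this] have "snd (snd t) : U" using True by (cases t) simp
   then show ?thesis using True Us[OF b] by (simp add: etm_def)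
  qed (simp add: etm_def U0)
  show ?thesis
  proof (cases "(v, i, x) : set L")
   case True
   then obtain u where u: "u : U" "evm D L i y = coef L y (v, i, x) \<odot>[D i] x \<oplus>[D i] u" using IH by blast
   have "coef L y (v, i, x) : supported (piece v i i)" using coef_supported[OF z(3) True] by simp
   then have "coef L y (v, i, x) : carrier A" by (simp add: supported_def)
   moreover have "x : carrier (D i)" using Cons.prems(2) True by (auto simp: entries_def)
   ultimately have "coef L y (v, i, x) \<odot>[D i] x : carrier (D i)" by (rule M.smult_closed)
   then have "evm D (t # L) i z = coef (t # L) z (v, i, x) \<odot>[D i] x \<oplus>[D i]
     (etm D i t b \<oplus>[D i] u)"
    using False u h Uc z by (simp add: subset_iff M.a_lcomm)
   then show ?thesis using True False Ua[OF h u(1)] by auto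
  next
   case nin: False
   then show ?thesis using IH Ua[OF h] z False by auto
  qed
 qed
qed

text \<open>For coefficients without constant term only the coefficients are differentiated, not the
  labels; a relation among the labels thus turns into a relation with shorter coefficients.\<close>

lemma evm_derz:
 assumes L: "valid L"
 shows "z : elts (fsum L') i ==> entries (%i. deg (fsum L) (i + 1)) (set L') ==> distinct L' ==>
  (!!g. g : set L' ==> coef L' z g (tail Q a, []) = 0) ==>
  derz a L (evm (%i. deg (fsum L) (i + 1)) L' i z) = evm (%i. deg (fsum L) (i + 1)) L' i (derz a L' z)"
proof (induction L' arbitrary: z)
 case Nil
 then show ?case by (simp add: derz_zero)
next
 case (Cons t L')
 let ?D = "%i. deg (fsum L) (i + 1)"
 note D = B.cpxD(1)[OF bounded_fsum[OF L]]
 interpret M: left_module A "deg (fsum L) (i + 1)" by (rule D)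
 obtain b y where z: "z = Tup (Elem b) y" "b : supported (piece (fst t) (fst (snd t)) i)" "y : elts (fsum L') i"
  using Cons.prems(1) by (rule carrier_fsum_Cons)
 have b: "b : carrier A" using z(2) by (simp add: supported_def)
 have b0: "b (tail Q a, []) = 0" using Cons.prems(4)[of t] z by simp
 have e: "entries ?D (set L')" and x: "snd (snd t) : carrier (?D (fst (snd t)))" using Cons.prems(2) by simp_all
 have IH: "derz a L (evm ?D L' i y) = evm ?D L' i (derz a L' y)"
 proof (rule Cons.IH[OF z(3) e])
  show "distinct L'" using Cons.prems(3) by simp
  fix g assume g: "g : set L'"
  then have "g ~= t" using Cons.prems(3) by auto
  then show "coef L' y g (tail Q a, []) = 0" using Cons.prems(4)[of g] g z by simp
 qed
 have ec: "evm ?D L' i y : carrier (?D i)" by (rule linmapD(1)[OF evm_linmap[OF D e] z(3)])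
 have tc: "etm ?D i t b : carrier (?D i)"
  by (rule etm_simps(1)[of ?D i t b, OF D x b])
 have "derz a L (evm ?D (t # L') i z) =
   derz a L (etm ?D i t b) \<oplus>[?D i] derz a L (evm ?D L' i y)"
  using derz_add[OF tc ec] z by simp
 moreover have "derz a L (etm ?D i t b) =
   etm ?D i t (der a b)"
  using derz_smult[OF b b0, of "snd (snd t)" L "i + 1"] x by (cases "fst (snd t) = i") (simp_all add: etm_def derz_zero)
 ultimately show ?case using IH z by simp
qed

text \<open>
 An irredundant generating family of a submodule of a projective module is free: the constant
 coefficients of a relation vanish by irredundancy, and stripping first arrows turns it into
 relations of lower degree.
\<close>

definition irredundant :: "(int => ('v \<times> 'a list => 'k, ('v \<times> 'a list => 'k) tuple) module) => ('v, 'a, 'k) generator set => bool" where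
 "irredundant D G \<longleftrightarrow> (\<forall>(v, i, x)\<in>G. \<exists>U. left_module.submod A (D i) U \<and> x \<notin> U \<and>
   (\<forall>(w, n, y)\<in>G - {(v, i, x)}. n = i --> y : U))"

text \<open>The quiver is acyclic, so the only path from \<open>v\<close> to \<open>v\<close> is
  trivial, and multiplying the coefficient \<open>b\<close> by \<open>idem v\<close> leaves a
  multiple of \<open>idem v\<close>. If that multiple were nonzero, the relation could be solved for
  the label \<open>x\<close> in the submodule \<open>U\<close> of the others.\<close>

lemma relation_constant_coef:
 assumes D: "!!i. left_module A (D i)" and e: "entries D (set L)" and d: "distinct L" and irr: "irredundant D (set L)"
  and z: "z : elts (fsum L) i" "evm D L i z = \<zero>[D i]" and g: "g : set L"
 shows "coef L z g (u, []) = 0"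
proof (rule ccontr)
 assume nz: "coef L z g (u, []) ~= 0"
 obtain v n x where gv: "g = (v, n, x)" by (cases g) auto
 define b where "b = coef L z g"
 have bs: "b : supported (piece v n i)" unfolding b_def using coef_supported[OF z(1) g] by (simp only: gv fst_conv snd_conv)
 have n: "n = i"
 proof (rule ccontr)
  assume "n ~= i"
  then have "b = \<zero>[A]" using bs by (auto simp: supported_empty split: if_splits)
  then show False using nz by (simp add: b_def A_simps)
 qed
 have bE: "b : supported (ending v)" using bs n by simp
 have b: "b : carrier A" using bE by (simp add: supported_def)
 have "(u, []) : ending v" using bE nz by (auto simp: supported_def b_def)
 then have u: "u = v" by (simp add: ending_def target_def)
 interpret M: left_module A "D i" by (rule D)
 interpret M: path_module Q A "D i" by unfold_locales
 have v: "v : verts Q" "x : carrier (D i)" "idem v \<odot>[D i] x = x" using e g gv n by (auto simp: entries_def)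
 obtain U where U: "M.submod U" "x \<notin> U" "\<forall>(w, n, y)\<in>set L - {(v, i, x)}. n = i --> y : U"
  using irr g gv n unfolding irredundant_def by blast
 obtain y where y: "y : U" "evm D L i z = b \<odot>[D i] x \<oplus>[D i] y"
  using evm_split[OF D U(1) z(1) e d U(3)] g gv n by (auto simp: b_def)
 have yc: "y : carrier (D i)" and Us: "!!a w. a : carrier A ==> w : U ==> a \<odot>[D i] w : U"
  using y(1) U(1) by (auto simp: M.submod_def)
 have "b \<odot>[D i] x = \<ominus>[D i] y"
  using y(2) z(2) M.minus_equality[of "b \<odot>[D i] x" y] M.smult_closed[OF b v(2)] yc by simp
 also have "\<dots> = sc (- 1) \<odot>[D i] y" using M.ks_simps(5)[OF yc, of 1] M.ks_simps(3)[OF yc] by simp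
 finally have bx: "b \<odot>[D i] x : U" using Us[OF sc_closed y(1)] by simp
 define c where "c = b (v, [])"
 have c: "c ~= 0" using nz u by (simp add: c_def b_def)
 have "idem v \<otimes>[A] b = sc c \<otimes>[A] idem v"
 proof -
  have "(if fst p = v then b p else 0) = c * idem v p" for p
  proof (cases "fst p = v \<and> b p ~= 0")
   case True
   then have "p : ending v" using bE unfolding supported_def by blast
   then have "snd p = []" using closed_path_trivial[of "fst p" "snd p"] True by (cases p) (simp add: ending_def target_def)
   then show ?thesis using True by (cases p) (auto simp: idem_def c_def)
  next
   case False
   then show ?thesis by (auto simp: idem_def c_def)
  qed
  then show ?thesis unfolding idem_mult sc_mult(1)[OF idem_closed[OF v(1)]] by (simp add: fun_eq_iff)
 qed
 then have "idem v \<odot>[D i] (b \<odot>[D i] x) = sc c \<odot>[D i] x"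
  using M.smult_assoc1[OF idem_closed[OF v(1)] b v(2)] M.smult_assoc1[OF sc_closed idem_closed[OF v(1)] v(2), of c] v(3) by simp
 then have "sc c \<odot>[D i] x : U" using Us[OF idem_closed[OF v(1)] bx] by simp
 then have "sc (inverse c) \<odot>[D i] (sc c \<odot>[D i] x) : U" by (rule Us[OF sc_closed])
 then have "x : U" using M.ks_simps(4)[OF v(2), of "inverse c" c] M.ks_simps(3)[OF v(2)] c by simp
 then show False using U(2) by simp
qed

lemma irredundant_free:
 assumes L: "valid L" and e: "entries (%i. deg (fsum L) (i + 1)) (set L')" and d: "distinct L'"
  and irr: "irredundant (%i. deg (fsum L) (i + 1)) (set L')"
  and z: "z : elts (fsum L') i" "evm (%i. deg (fsum L) (i + 1)) L' i z = \<zero>[deg (fsum L) (i + 1)]"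
 shows "z = \<zero>[deg (fsum L') i]"
proof (rule coef_zero_imp_zero[OF z(1) d])
 fix g assume g: "g : set L'"
 note D = B.cpxD(1)[OF bounded_fsum[OF L]]
 have "coef L' z g (u, p) = 0" for u p
  using z
 \<comment> \<open>The relation changes in the induction: the coefficient of \<open>z\<close> at
   \<open>a # p\<close> is the coefficient at \<open>p\<close> of the differentiated
   relation.\<close>
 proof (induction p arbitrary: u z)
  case Nil
  then show ?case using relation_constant_coef[OF D e d irr _ _ g] by blast
 next
  case (Cons a p)
  note z = Cons.prems
  have "derz a L (evm (%i. deg (fsum L) (i + 1)) L' i z) = evm (%i. deg (fsum L) (i + 1)) L' i (derz a L' z)"
   by (rule evm_derz[OF L z(1) e d]) (rule relation_constant_coef[OF D e d irr z])
  then have "evm (%i. deg (fsum L) (i + 1)) L' i (derz a L' z) = \<zero>[deg (fsum L) (i + 1)]"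
   unfolding z(2) derz_zero by simp
  then have "coef L' (derz a L' z) g (head Q a, p) = 0" by (rule Cons.IH[OF derz_closed[OF z(1)]])
  then have 0: "coef L' z g (tail Q a, a # p) = 0" unfolding coef_derz[OF g] by (simp add: der_def)
  show ?case
  proof (rule ccontr)
   assume n: "coef L' z g (u, a # p) ~= 0"
   then have "(u, a # p) : paths Q" using coef_supported[OF z(1) g] by (simp add: supported_def carrier_A)
   then have "u = tail Q a" by (simp add: paths_iff awalk_Cons_iff)
   then show False using n 0 by simp
  qed
 qed
 then show "coef L' z g = \<zero>[A]" by (auto simp: A_simps fun_eq_iff)
qed

section \<open>Generating families of graded submodules\<close>

definition gens :: "(int => ('v \<times> 'a list => 'k, ('v \<times> 'a list => 'k) tuple) module) => (int => ('v \<times> 'a list => 'k) tuple set) =>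
  ('v, 'a, 'k) generator set => bool" where
 "gens D N G \<longleftrightarrow> (\<forall>i U. left_module.submod A (D i) U --> (\<forall>(v, n, x)\<in>G. n = i --> x : U) --> N i \<subseteq> U)"

text \<open>Homogeneous generators are chosen in each of the finitely many degrees up to the bound;
  in the other degrees \<open>N i\<close> lies in every submodule.\<close>

lemma graded_generators:
 assumes D: "!!i. left_module A (D i)" "!!i. finitely_generated A (D i)" and N: "!!i. left_module.submod A (D i) (N i)"
  and n: "!!i. \<bar>i\<bar> > n ==> N i \<subseteq> {\<zero>[D i]}"
 shows "\<exists>G. finite G \<and> entries D G \<and> (\<forall>(v, m, x)\<in>G. x : N m) \<and> gens D N G"
proof -
 define \<Phi> where "\<Phi> i G \<longleftrightarrow> finite G \<and> (\<forall>(v, x)\<in>G. v : verts Q \<and> x : N i \<and> idem v \<odot>[D i] x = x) \<and>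
  (\<forall>U. left_module.submod A (D i) U --> (\<forall>(v, x)\<in>G. x : U) --> N i \<subseteq> U)" for i G
 have "\<exists>G. \<Phi> i G" for i
 proof -
  interpret M: left_module A "D i" by (rule D)
  interpret M: path_module Q A "D i" by unfold_locales
  show ?thesis unfolding \<Phi>_def by (rule M.homogeneous_generators[OF D(2) N])
 qed
 then obtain H where "!!i. \<Phi> i (H i)" by metis
 note H = this[unfolded \<Phi>_def]
 have H1: "finite (H i)" and H2: "(v, x) : H i ==> v : verts Q \<and> x : N i \<and> idem v \<odot>[D i] x = x"
  and H3: "left_module.submod A (D i) U ==> (!!v x. (v, x) : H i ==> x : U) ==> N i \<subseteq> U" for i U v x
  using H[of i] by auto
 let ?G = "\<Union>i\<in>{- n..n}. (%(v, x). (v, i, x)) ` H i"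
 have G: "(v, m, x) : ?G \<longleftrightarrow> m : {- n..n} \<and> (v, x) : H m" for v m x by auto
 have Nc: "N i \<subseteq> carrier (D i)" for i using N[of i] unfolding left_module.submod_def[OF D(1)] by (rule conjunct1)
 have "finite ?G" using H1 by simp
 moreover have "entries D ?G" unfolding entries_def
 proof (clarsimp simp only: G)
  fix v m x assume "(v, x) : H m"
  from H2[OF this] show "v : verts Q \<and> x : carrier (D m) \<and> idem v \<odot>[D m] x = x" using Nc[of m] by blast
 qed
 moreover have "\<forall>(v, m, x)\<in>?G. x : N m"
 proof (clarsimp simp only: G)
  fix v m x assume "(v, x) : H m"
  from H2[OF this] show "x : N m" by blast
 qed
 moreover have "gens D N ?G" unfolding gens_def
 proof (intro allI impI)
  fix i U assume U: "left_module.submod A (D i) U" and g: "\<forall>(v, m, x)\<in>?G. m = i --> x : U"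
  show "N i \<subseteq> U"
  proof (cases "\<bar>i\<bar> > n")
   case True
   have "\<zero>[D i] : U" using U unfolding left_module.submod_def[OF D(1)] by (elim conjE)
   then show ?thesis using n[OF True] by auto
  next
   case False
   then have i: "i : {- n..n}" by auto
   show ?thesis
   proof (rule H3[OF U])
    fix v x assume "(v, x) : H i"
    then have "(v, i, x) : ?G" using G i by blast
    from bspec[OF g this] show "x : U" by simp
   qed
  qed
 qed
 ultimately show ?thesis by (intro exI[of _ ?G] conjI)
qed

text \<open>A generating family of least cardinality will do: a label that lies in every submodule
  containing the other labels of its degree could be dropped.\<close>

lemma irredundant_generators:
 assumes D: "!!i. left_module A (D i)" "!!i. finitely_generated A (D i)" and N: "!!i. left_module.submod A (D i) (N i)"
  and n: "!!i. \<bar>i\<bar> > n ==> N i \<subseteq> {\<zero>[D i]}"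
 shows "\<exists>G. finite G \<and> entries D G \<and> (\<forall>(v, m, x)\<in>G. x : N m) \<and> gens D N G \<and> irredundant D G"
proof -
 define P where "P G \<longleftrightarrow> finite G \<and> entries D G \<and> (\<forall>(v, m, x)\<in>G. x : N m) \<and> gens D N G" for G
 have "\<exists>G. P G" unfolding P_def by (rule graded_generators[of D N n, OF assms])
 then obtain G0 where "P G0" ..
 from ex_has_least_nat[of P, OF this, of card] obtain G where G: "P G" "!!G'. P G' ==> card G \<le> card G'" by (elim exE conjE) simp
 have "irredundant D G" unfolding irredundant_def
 proof (rule ccontr)
  assume "\<not> (\<forall>(v, i, x)\<in>G. \<exists>U. left_module.submod A (D i) U \<and> x \<notin> U \<and> (\<forall>(w, n, y)\<in>G - {(v, i, x)}. n = i --> y : U))"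
  then obtain t where t: "t : G" "\<not> (case t of (v, i, x) => \<exists>U. left_module.submod A (D i) U \<and> x \<notin> U \<and> (\<forall>(w, n, y)\<in>G - {(v, i, x)}. n = i --> y : U))"
   unfolding Ball_def not_all not_imp by (elim exE conjE)
  obtain v i x where "t = (v, i, x)" by (cases t)
  note t = t[unfolded this split_conv]
  have g: "(v, i, x) : G" by (rule t(1))
  have all: "x : U" if "left_module.submod A (D i) U" "\<forall>(w, n, y)\<in>G - {(v, i, x)}. n = i --> y : U" for U
  proof (rule ccontr)
   assume "x \<notin> U"
   with that have "\<exists>U. left_module.submod A (D i) U \<and> x \<notin> U \<and> (\<forall>(w, n, y)\<in>G - {(v, i, x)}. n = i --> y : U)"
    by (intro exI[of _ U] conjI)
   with t(2) show False by (rule notE)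
  qed
  let ?G = "G - {(v, i, x)}"
  have "gens D N ?G" unfolding gens_def
  proof (intro allI impI)
   fix j U assume U: "left_module.submod A (D j) U" and m: "\<forall>(v, n, x)\<in>?G. n = j --> x : U"
   have "x : U" if "j = i" using all[of U] m U that by simp
   note xU = this
   have "\<forall>(v, n, x)\<in>G. n = j --> x : U"
   proof clarify
    fix v' x' assume g': "(v', j, x') : G"
    show "x' : U"
    proof (cases "(v', j, x') = (v, i, x)")
     case True
     then show ?thesis using xU by simp
    next
     case False
     then have "(v', j, x') : ?G" using g' by simp
     from bspec[OF m this] show ?thesis by simp
    qed
   qed
   then show "N j \<subseteq> U" using G(1) U unfolding P_def gens_def by simp
  qed
  then have "P ?G" using G(1) unfolding P_def entries_def by simp
  then have "card G \<le> card ?G" by (rule G(2))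
  moreover have "finite G" using G(1) by (simp add: P_def)
  ultimately show False using card_Diff1_less[OF _ g] by fastforce
 qed
 then show ?thesis using G(1) unfolding P_def by (intro exI[of _ G]) simp
qed

lemma evm_surj:
 assumes D: "!!i. left_module A (D i)" and e: "entries D (set L)" and g: "gens D N (set L)" and x: "x : N i"
 shows "\<exists>z\<in>elts (fsum L) i. evm D L i z = x"
proof -
 have "left_module.submod A (D i) (evm D L i ` elts (fsum L) i)"
  by (rule linmap_image_submod[OF B.cpxD(1)[OF bounded_fsum[OF entries_valid[OF e]]] D evm_linmap[OF D e]])
 moreover have "\<forall>(v, n, x)\<in>set L. n = i --> x : evm D L i ` elts (fsum L) i"
 proof (clarify)
  fix v x assume "(v, i, x) : set L"
  from evm_hits[OF D e this] show "x : evm D L i ` elts (fsum L) i" by (elim bexE) (rule image_eqI, simp_all)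
 qed
 ultimately have "N i \<subseteq> evm D L i ` elts (fsum L) i" using g unfolding gens_def by simp
 then show ?thesis using x by blast
qed

definition evc :: "('v \<times> 'a list => 'k) cpx => ('v, 'a, 'k) generator list => ('v \<times> 'a list => 'k) cpx_map" where
 "evc X L = (%i. \<lambda>z\<in>elts (fsum L) i. evm (deg X) L i z)"

text \<open>The differential of \<open>fsum L\<close> is zero, so compatibility says that all values
  are cocycles, and it is enough to know this for the labels.\<close>

lemma evc_chain_map:
 assumes X: "bounded_cpx A X" and e: "entries (deg X) (set L)" and c: "!!v n x. (v, n, x) : set L ==> x : cocycles X n"
 shows "evc X L : chain_map A (fsum L) X"
proof (rule B.chain_mapI)
 fix i
 note D = B.cpxD(1)[OF X] and S = bounded_fsum[OF entries_valid[OF e]]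
 have l: "linmap A (deg (fsum L) i) (deg X i) (evm (deg X) L i)" for i by (rule evm_linmap[OF D e])
 show "linmap A (deg (fsum L) i) (deg X i) (evc X L i)"
  using linmap_restrict[OF l B.cpxD(1)[OF S]] by (simp add: evc_def mod_hom_iff)
 show "evc X L i : extensional (elts (fsum L) i)" by (simp add: evc_def)
 fix z assume z: "z : elts (fsum L) i"
 interpret S1: left_module A "deg (fsum L) (i + 1)" by (rule B.cpxD(1)[OF S])
 have "diff X i (evm (deg X) L' i y) = \<zero>[deg X (i + 1)]" if "y : elts (fsum L') i" "set L' \<subseteq> set L" for L' y
  using that
 proof (induction L' arbitrary: y)
  case Nil
  then show ?case by (simp add: B.cpx_diff(4)[OF X])
 next
  case (Cons t L')
  interpret M: left_module A "deg X i" by (rule D)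
  interpret N: left_module A "deg X (i + 1)" by (rule D)
  obtain b y' where y: "y = Tup (Elem b) y'" "b : supported (piece (fst t) (fst (snd t)) i)" "y' : elts (fsum L') i"
   using Cons.prems(1) by (rule carrier_fsum_Cons)
  have b: "b : carrier A" using y(2) by (simp add: supported_def)
  have e': "entries (deg X) (set L')" using e Cons.prems(2) unfolding entries_def by auto
  have "snd (snd t) : cocycles X (fst (snd t))" using c[of "fst t" "fst (snd t)" "snd (snd t)"] Cons.prems(2) by simp
  then have x: "snd (snd t) : elts X (fst (snd t))" "diff X (fst (snd t)) (snd (snd t)) = \<zero>[deg X (fst (snd t) + 1)]"
   by (auto simp: cocycles_def)
  have m: "evm (deg X) L' i y' : elts X i" by (rule linmapD(1)[OF evm_linmap[OF D e'] y(3)])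
  have "diff X i (evm (deg X) L' i y') = \<zero>[deg X (i + 1)]" using Cons.IH[OF y(3)] Cons.prems(2) by simp
  moreover have "diff X i (etm (deg X) i t b) = \<zero>[deg X (i + 1)]"
   using x b by (cases "fst (snd t) = i") (simp_all add: etm_def B.cpx_diff(3,4)[OF X] N.smult_zero_right)
  ultimately show ?case
   using y(1) m etm_simps(1)[of "deg X" i t, OF D x(1) b] by (simp add: B.cpx_diff(2)[OF X])
 qed
 from this[OF z] show "evc X L (i + 1) (diff (fsum L) i z) = diff X i (evc X L i z)"
  using z linmap_zero_minus(1)[OF B.cpxD(1)[OF S] D l] unfolding diff_fsum[OF z] by (simp add: evc_def)
qed

end

section \<open>The upper bound\<close>

context bounded_complexes
begin

lemma add_closure_bounded:
 assumes "!!X. X : \<X> ==> bounded_cpx R X" and "X : add_closure DB \<X>"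
 shows "bounded_cpx R X"
 using assms(2)
proof (induction rule: add_closure.induct)
 case (base X) then show ?case by (rule assms(1))
next
 case (empty_coproduct Z) then show ?case by (simp add: initial_object_def)
next
 case (coproduct X Y Z) then show ?case by (simp add: is_coproduct_def)
next
 case (direct_factor Z X Y) then show ?case by (simp add: is_coproduct_def)
next
 case (shift X n) then show ?case by (simp add: bounded_shift_cpx)
qed

lemma generated_bounded: "X : generated DB \<X> (Suc n) ==> bounded_cpx R X"
 by (simp add: diamond_def, rule add_closure_bounded[rotated], assumption) (simp add: extensions_def)

lemma zero_cpx_add_closure: "zero_cpx : add_closure DB \<X>"
proof (rule add_closure.empty_coproduct)
 show "initial_object DB zero_cpx" using L.zero_object_localisation[OF zero_cpx_data] by (simp add: DB_initial zero_object_def)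
qed

lemma iso_add_closure:
 assumes "L.zz_iso X Y p q" and "X : add_closure DB \<X>"
 shows "Y : add_closure DB \<X>"
 by (rule add_closure.coproduct[OF assms(2) zero_cpx_add_closure])
  (use L.coproduct_with_zero[OF zero_cpx_data assms(1)] in \<open>simp add: DB_is_coproduct\<close>)

lemma is_coproduct_commute: "is_coproduct C X Y Z ==> is_coproduct C Y X Z"
proof -
 assume "is_coproduct C X Y Z"
 then obtain i j where o: "X : Ob C" "Y : Ob C" "Z : Ob C" and i: "i : Hom C X Z" and j: "j : Hom C Y Z"
  and u: "!!W f g. W : Ob C ==> f : Hom C X W ==> g : Hom C Y W ==> \<exists>!h. h : Hom C Z W \<and> Comp C X Z W h i = f \<and> Comp C Y Z W h j = g"
  unfolding is_coproduct_def by blast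
 have "\<exists>!h. h : Hom C Z W \<and> Comp C Y Z W h j = g \<and> Comp C X Z W h i = f"
  if "W : Ob C" "g : Hom C Y W" "f : Hom C X W" for W f g
  using u[OF that(1,3,2)] by (simp only: conj_commute[of "Comp C Y Z W _ j = g"])
 then show ?thesis unfolding is_coproduct_def using o i j by blast
qed

lemma quasi_iso_add_closure:
 assumes X: "bounded_cpx R X" and Y: "bounded_cpx R Y" and f: "f : quasi_iso R X Y"
 shows "X : add_closure DB \<X> ==> Y : add_closure DB \<X>" "Y : add_closure DB \<X> ==> X : add_closure DB \<X>"
proof -
 have i: "L.zz_iso X Y [Fwd Y f] [Bwd X f]" using X Y f quasi_isoD[OF f] by (intro L.zz_isoI_fwd) auto
 show "X : add_closure DB \<X> ==> Y : add_closure DB \<X>" by (rule iso_add_closure[OF i])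
 show "Y : add_closure DB \<X> ==> X : add_closure DB \<X>" by (rule iso_add_closure[OF L.zz_iso_sym[OF i]])
qed

lemma standard_triangle:
 assumes X: "bounded_cpx R X" and Y: "bounded_cpx R Y" and f: "f : chain_map R X Y"
 shows "\<exists>u v w. (X, Y, cone X Y f, u, v, w) : distinguished_triangles R"
proof -
 let ?Z = "cone X Y f" and ?S = "shift_cpx 1 X"
 let ?u = "derived_hom R X Y f" and ?v = "derived_hom R Y ?Z (cone_incl X Y)" and ?w = "derived_hom R ?Z ?S (cone_proj X Y)"
 note Z = bounded_cone[OF X Y f] and S = bounded_shift_cpx[OF X, of 1]
 have zu: "zigzag CC QQ X Y [Fwd Y f]" and zv: "zigzag CC QQ Y ?Z [Fwd ?Z (cone_incl X Y)]" and zw: "zigzag CC QQ ?Z ?S [Fwd ?S (cone_proj X Y)]"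
  using X Y Z S f cone_incl_chain_map[OF X Y f] cone_proj_chain_map[OF X Y f] by (auto intro!: L.zz_fwd)
 have zn: "zigzag CC QQ W W []" if "bounded_cpx R W" for W using that by (intro L.zz_nil) simp
 have iso: "cat_iso L.D W W (L.cls W W [])" if W: "bounded_cpx R W" for W
  unfolding cat_iso_def using L.cls_in_Hom[OF zn[OF W]] L.Comp_localisation[OF zn[OF W] zn[OF W]]
  by (intro conjI bexI[of _ "L.cls W W []"]) (simp_all add: L.Idt_localisation)
 have o: "X : Ob L.D" "Y : Ob L.D" "?Z : Ob L.D" using X Y Z by simp_all
 have h: "?u : Hom L.D X Y" "?v : Hom L.D Y ?Z" "?w : Hom L.D ?Z ?S"
  unfolding derived_hom_def using L.cls_in_Hom[OF zu] L.cls_in_Hom[OF zv] L.cls_in_Hom[OF zw] by simp_all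
 have c: "Comp L.D X Y Y (L.cls Y Y []) ?u = Comp L.D X X Y ?u (L.cls X X [])"
  "Comp L.D Y ?Z ?Z (L.cls ?Z ?Z []) ?v = Comp L.D Y Y ?Z ?v (L.cls Y Y [])"
  "Comp L.D ?Z ?S ?S (derived_shift R 1 X X (L.cls X X [])) ?w = Comp L.D ?Z ?Z ?S ?w (L.cls ?Z ?Z [])"
  unfolding derived_hom_def derived_shift_id[OF X]
  using L.Comp_localisation[OF zu zn[OF Y]] L.Comp_localisation[OF zn[OF X] zu]
   L.Comp_localisation[OF zv zn[OF Z]] L.Comp_localisation[OF zn[OF Y] zv]
   L.Comp_localisation[OF zw zn[OF S]] L.Comp_localisation[OF zn[OF Z] zw] by simp_all
 note i = iso[OF X] iso[OF Y] iso[OF Z]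
 have "(X, Y, ?Z, ?u, ?v, ?w) : distinguished_triangles R"
  unfolding distinguished_triangles_def Let_def mem_Collect_eq split_conv
  by (intro conjI o h, rule bexI[OF _ o(1)], rule bexI[OF _ o(2)], rule bexI[OF _ f], rule exI[of _ "L.cls X X []"],
    rule exI[of _ "L.cls Y Y []"], rule exI[of _ "L.cls ?Z ?Z []"]) (intro conjI i c)
 then show ?thesis by blast
qed

text \<open>The chain map from the zero complex to \<open>Y\<close> gives a triangle with left term
  zero, and its cone is quasi-isomorphic to \<open>Y\<close>.\<close>

lemma generated_one:
 assumes Y: "Y : add_closure DB {M}" and M: "bounded_cpx R M"
 shows "Y : generated DB {M} 1"
proof -
 have Yb: "bounded_cpx R Y" using add_closure_bounded[OF _ Y] M by blast
 obtain f where f: "f : chain_map R zero_cpx Y" using L.zero_dataD(2)[OF zero_cpx_data, of Y] Yb by auto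
 note C = bounded_cone[OF bounded_zero_cpx Yb f]
 have "cone_incl zero_cpx Y : quasi_iso R Y (cone zero_cpx Y f)"
  by (rule cone_incl_quasi_iso[OF bounded_zero_cpx Yb f]) (use acyclic_zero_cpx in \<open>simp add: acyclic_cpx_def\<close>)
 then have "cone zero_cpx Y f : add_closure DB {M}" using quasi_iso_add_closure(1)[OF Yb C] Y by blast
 moreover have "zero_object DB zero_cpx" using L.zero_object_localisation[OF zero_cpx_data] by (simp add: DB_zero)
 moreover obtain u v w where "(zero_cpx, Y, cone zero_cpx Y f, u, v, w) : distinguished_triangles R"
  using standard_triangle[OF bounded_zero_cpx Yb f] by blast
 ultimately have "Y : extensions DB {Z. zero_object DB Z} (add_closure DB {M})"
  unfolding extensions_def DB_simps mem_Collect_eq using Yb by blast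
 then show ?thesis by (simp add: diamond_def add_closure.base)
qed

end

context quiver_algebra
begin

text \<open>An equality of complexes, not merely an isomorphism: the sign in the shifted
  differential is invisible because the differential is zero.\<close>

lemma shift_gen:
 assumes v: "v : verts Q"
 shows "shift_cpx (- n) (gen v 0) = gen v n"
proof -
 have d: "diff (gen v 0) (i - n) x = Elem \<zero>[A]" if "x : elts (gen v 0) (i - n)" for i x
  by (rule diff_gen[OF that])
 have g: "deg (gen v 0) (i - n) = deg (gen v n) i" for i by (simp add: deg_gen)
 have m: "\<ominus>[deg (gen v 0) (i - n + 1)] (Elem \<zero>[A]) = Elem \<zero>[A]" for i
 proof -
  interpret M: left_module A "deg (gen v 0) (i - n + 1)" by (rule B.cpxD(1)[OF bounded_gen[OF v]])
  show ?thesis using M.neg_zero unfolding deg_gen pm_simps .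
 qed
 have "diff (shift_cpx (- n) (gen v 0)) i = diff (gen v n) i" for i
 proof
  fix x show "diff (shift_cpx (- n) (gen v 0)) i x = diff (gen v n) i x"
  proof (cases "x : elts (gen v n) i")
   case True
   then show ?thesis using d[of x i] m g[of i] diff_gen[OF True] by (simp add: shift_cpx_def)
  next
   case False
   then show ?thesis using g[of i] by (simp add: shift_cpx_def) (simp add: gen_def)
  qed
 qed
 moreover have "deg (shift_cpx (- n) (gen v 0)) = deg (gen v n)" using g by (simp add: shift_cpx_def fun_eq_iff)
 ultimately show ?thesis by (intro cpx.equality) (auto simp: fun_eq_iff)
qed

lemma gen_in_add_closure:
 "valid L ==> fsum L : add_closure B.DB \<X> ==> t : set L ==> gen (fst t) (fst (snd t)) : add_closure B.DB \<X>"
proof (induction L)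
 case (Cons s L)
 have "gen (fst s) (fst (snd s)) : Ob (cpx_category A)" "fsum L : Ob (cpx_category A)"
  using Cons.prems(1) by (simp_all add: bounded_gen bounded_fsum)
 then have c: "is_coproduct B.DB (gen (fst s) (fst (snd s))) (fsum L) (fsum (s # L))"
  unfolding B.DB_is_coproduct fsum.simps by (rule B.L.is_coproduct_sum)
 show ?case
 proof (cases "t = s")
  case True
  then show ?thesis using add_closure.direct_factor[OF Cons.prems(2) c] by simp
 next
  case False
  have "fsum L : add_closure B.DB \<X>" by (rule add_closure.direct_factor[OF Cons.prems(2) B.is_coproduct_commute[OF c]])
  then show ?thesis using Cons False by simp
 qed
qed simp

lemma fsum_in_add_closure:
 assumes "!!v. v : verts Q ==> gen v 0 : add_closure B.DB \<X>"
 shows "valid L ==> fsum L : add_closure B.DB \<X>"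
proof (induction L)
 case Nil
 show ?case unfolding fsum.simps by (rule B.zero_cpx_add_closure)
next
 case (Cons s L)
 have "gen (fst s) (fst (snd s)) : Ob (cpx_category A)" "fsum L : Ob (cpx_category A)"
  using Cons.prems by (simp_all add: bounded_gen bounded_fsum)
 then have c: "is_coproduct B.DB (gen (fst s) (fst (snd s))) (fsum L) (fsum (s # L))"
  unfolding B.DB_is_coproduct fsum.simps by (rule B.L.is_coproduct_sum)
 have v: "fst s : verts Q" using Cons.prems by simp
 have "gen (fst s) (fst (snd s)) : add_closure B.DB \<X>"
  using add_closure.shift[OF assms[OF v], of "- fst (snd s)"] shift_gen[OF v] by simp
 then show ?case using add_closure.coproduct[OF _ Cons.IH c] Cons.prems by simp
qed

text \<open>Allows generators to be relabelled, from elements of a submodule to cocycles of the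
  cone, without changing the complex.\<close>

lemma fsum_map: "fsum (map (%t. (fst t, fst (snd t), h t)) L) = fsum L"
 by (induction L) (simp_all add: fsum.simps)

text \<open>A chain map out of a sum of shifted projectives is a choice of homogeneous cocycles. For
  \<open>\<epsilon>\<close> any generators of the cocycles of \<open>X\<close> are taken; for
  \<open>\<eta>\<close> irredundant generators of the submodules \<open>K\<close>, so that freeness
  gives injectivity on cohomology.\<close>

lemma projective_approximation:
 assumes X: "bounded_cpx A X"
 obtains L L' :: "('v, 'a, 'k) generator list" and \<epsilon> \<eta> where "valid L" "\<epsilon> : chain_map A (fsum L) X" "valid L'"
  "\<eta> : quasi_iso A (fsum L') (cone (fsum L) X \<epsilon>)"
proof -
 note D = B.cpxD(1)[OF X]
 obtain n where n: "!!i. \<bar>i\<bar> > n ==> elts X i = {\<zero>[deg X i]}" by (rule B.cpx_bound[OF X]) blast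
 have sub: "left_module.submod A (deg X i) (cocycles X i)" for i
  unfolding left_module.submod_def[OF D] using B.cocycles_closed[OF X] B.cocyclesD(1) by (auto simp: subset_iff)
 have "\<exists>G. finite G \<and> entries (deg X) G \<and> (\<forall>(v, m, x)\<in>G. x : cocycles X m) \<and> gens (deg X) (cocycles X) G"
 proof (rule graded_generators[of "deg X" "cocycles X" n])
  show "cocycles X i \<subseteq> {\<zero>[deg X i]}" if "\<bar>i\<bar> > n" for i using n[OF that] B.cocyclesD(1) by auto
 qed (use B.cpxD[OF X] sub in auto)
 then obtain G where G: "finite G" "entries (deg X) G" "!!v m x. (v, m, x) : G ==> x : cocycles X m" "gens (deg X) (cocycles X) G"
  by (elim exE conjE) fastforce
 obtain L where L: "set L = G" using finite_list[OF G(1)] by blast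
 have eL: "entries (deg X) (set L)" using G(2) L by simp
 have vL: "valid L" by (rule entries_valid[OF eL])
 define \<epsilon> where "\<epsilon> = evc X L"
 have eps: "\<epsilon> : chain_map A (fsum L) X" unfolding \<epsilon>_def by (rule evc_chain_map[OF X eL]) (use G(3) L in blast)
 note F = bounded_fsum[OF vL] and es = B.chain_map_simps[OF bounded_fsum[OF vL] X eps]
 let ?D = "%i. deg (fsum L) (i + 1)" and ?C = "cone (fsum L) X \<epsilon>"
 note C = B.bounded_cone[OF F X eps]
 have eps_surj: "\<exists>z\<in>elts (fsum L) i. \<epsilon> i z = x" if x: "x : cocycles X i" for x i
 proof -
  obtain z where "z : elts (fsum L) i" "evm (deg X) L i z = x"
   using evm_surj[OF D eL, of "cocycles X" x i] G(4) L x by auto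
  then show ?thesis by (intro bexI[of _ z]) (simp_all add: \<epsilon>_def evc_def)
 qed
 \<comment> \<open>The kernel of the map from \<open>fsum L\<close> to the cohomology of
   \<open>X\<close>, in degree \<open>i + 1\<close>. As \<open>\<epsilon>\<close> hits every cocycle
   and \<open>fsum L\<close> has zero differential, the first component identifies
   \<open>H^i\<close> of the cone with \<open>K i\<close>.\<close>
 define K where "K i = {z : carrier (?D i). \<epsilon> (i + 1) z : coboundaries X (i + 1)}" for i
 have Ksub: "left_module.submod A (?D i) (K i)" for i
 proof -
  interpret M: left_module A "?D i" by (rule B.cpxD(1)[OF F])
  show ?thesis unfolding M.submod_def K_def
   using B.coboundaries_closed[OF X] es by (auto simp: M.smult_closed)
 qed
 obtain m where m: "!!i. \<bar>i\<bar> > m ==> elts (fsum L) i = {\<zero>[deg (fsum L) i]}" by (rule B.cpx_bound[OF F]) blast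
 have "\<exists>G. finite G \<and> entries ?D G \<and> (\<forall>(v, m, x)\<in>G. x : K m) \<and> gens ?D K G \<and> irredundant ?D G"
 proof (rule irredundant_generators[of ?D K "m + 1"])
  show "K i \<subseteq> {\<zero>[?D i]}" if "\<bar>i\<bar> > m + 1" for i using m[of "i + 1"] that by (auto simp: K_def)
 qed (use B.cpxD[OF F] Ksub in auto)
 then obtain G' where G': "finite G'" "entries ?D G'" "!!v m x. (v, m, x) : G' ==> x : K m" "gens ?D K G'" "irredundant ?D G'"
  by (elim exE conjE) fastforce
 obtain L' where L': "set L' = G'" "distinct L'" using finite_distinct_list[OF G'(1)] by blast
 have eL': "entries ?D (set L')" using G'(2) L' by simp
 have vL': "valid L'" by (rule entries_valid[OF eL'])
 \<comment> \<open>A generator of \<open>K\<close> is sent by \<open>\<epsilon>\<close> to a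
   coboundary. Applying \<open>idem v\<close> to a preimage makes it homogeneous for the vertex of
   the generator.\<close>
 have "\<exists>w. w : elts X (fst (snd t)) \<and> \<epsilon> (fst (snd t) + 1) (snd (snd t)) = diff X (fst (snd t)) w \<and> idem (fst t) \<odot>[deg X (fst (snd t))] w = w"
  if tG: "t : G'" for t
 proof -
  obtain v j x where t: "t = (v, j, x)" by (cases t) auto
  have v: "v : verts Q" "x : carrier (?D j)" "idem v \<odot>[?D j] x = x" using G'(2) tG t by (auto simp: entries_def)
  have "x : K j" using G'(3) tG t by blast
  then obtain w0 where w0: "w0 : elts X j" "\<epsilon> (j + 1) x = diff X j w0" by (auto simp: K_def B.coboundary_iff)
  interpret M: left_module A "deg X j" by (rule D)
  note e = idem_closed[OF v(1)]
  have "diff X j (idem v \<odot>[deg X j] w0) = idem v \<odot>[deg X (j + 1)] diff X j w0" by (rule B.cpx_diff(3)[OF X e w0(1)])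
  also have "\<dots> = \<epsilon> (j + 1) x" using es(3)[OF e v(2)] v(3) w0(2) by simp
  finally show ?thesis
   using t w0(1) e M.smult_closed M.smult_assoc1[OF e e w0(1)] idem_idem[of v] by (intro exI[of _ "idem v \<odot>[deg X j] w0"]) simp
 qed
 then obtain w where w: "!!t. t : G' ==> w t : elts X (fst (snd t))"
  "!!t. t : G' ==> \<epsilon> (fst (snd t) + 1) (snd (snd t)) = diff X (fst (snd t)) (w t)"
  "!!t. t : G' ==> idem (fst t) \<odot>[deg X (fst (snd t))] w t = w t" by metis
 \<comment> \<open>The lift \<open>(x, - w)\<close> of the generator \<open>x\<close> of
   \<open>K\<close> is a cocycle of the cone, since its boundary is
   \<open>(0, \<epsilon> x - d w)\<close>.\<close>
 let ?h = "%t. Tup (snd (snd t)) (\<ominus>[deg X (fst (snd t))] w t)"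
 define L2 where "L2 = map (%t. (fst t, fst (snd t), ?h t)) L'"
 have FL2: "fsum L2 = fsum L'" unfolding L2_def by (rule fsum_map)
 have degC: "deg ?C i = direct_sum (?D i) (deg X i)" for i by (simp add: cone_def)
 have diffC: "diff ?C i (Tup a b) = Tup (\<zero>[deg (fsum L) (i + 1 + 1)]) (\<epsilon> (i + 1) a \<oplus>[deg X (i + 1)] diff X i b)"
  if a: "a : carrier (?D i)" "b : elts X i" for a b i
 proof -
  interpret S2: left_module A "deg (fsum L) (i + 1 + 1)" by (rule B.cpxD(1)[OF F])
  show ?thesis using a diff_fsum[OF a(1)] S2.neg_zero by (simp add: cone_def)
 qed
 have ent: "fst t : verts Q \<and> ?h t : elts ?C (fst (snd t)) \<and> idem (fst t) \<odot>[deg ?C (fst (snd t))] ?h t = ?h t \<and>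
   ?h t : cocycles ?C (fst (snd t))" if tG: "t : G'" for t
 proof -
  obtain v j x where t: "t = (v, j, x)" by (cases t) auto
  have v: "v : verts Q" "x : carrier (?D j)" "idem v \<odot>[?D j] x = x" using G'(2) tG t by (auto simp: entries_def)
  have wt: "w t : elts X j" "\<epsilon> (j + 1) x = diff X j (w t)" "idem v \<odot>[deg X j] w t = w t"
   using w[OF tG] by (simp_all add: t)
  interpret M: left_module A "deg X j" by (rule D)
  interpret M1: left_module A "deg X (j + 1)" by (rule D)
  note mw = M.a_inv_closed[OF wt(1)]
  have c: "Tup x (\<ominus>[deg X j] w t) : elts ?C j" using v(2) mw by (simp add: degC)
  have "diff ?C j (Tup x (\<ominus>[deg X j] w t)) = \<zero>[deg ?C (j + 1)]"
   unfolding diffC[OF v(2) mw] wt(2) B.cpx_diff(5)[OF X wt(1)] M1.r_neg[OF B.cpx_diff(1)[OF X wt(1)]] by (simp add: degC)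
  then show ?thesis using v c M.smult_minus_right[OF idem_closed[OF v(1)] wt(1)] wt(3)
   by (simp add: t cocycles_def) (simp add: degC t)
 qed
 have e2: "entries (deg ?C) (set L2)" unfolding entries_def
 proof clarify
  fix v j y assume "(v, j, y) : set L2"
  then obtain t where "t : G'" "v = fst t" "j = fst (snd t)" "y = ?h t" using L'(1) by (auto simp: L2_def)
  with ent[of t] show "v : verts Q \<and> y : elts ?C j \<and> idem v \<odot>[deg ?C j] y = y" by simp
 qed
 have c2: "y : cocycles ?C j" if "(v, j, y) : set L2" for v j y
 proof -
  obtain t where "t : G'" "j = fst (snd t)" "y = ?h t" using L'(1) \<open>(v, j, y) : set L2\<close> by (auto simp: L2_def)
  with ent[of t] show ?thesis by simp
 qed
 define \<eta> where "\<eta> = evc ?C L2"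
 have eta: "\<eta> : chain_map A (fsum L2) ?C" unfolding \<eta>_def by (rule evc_chain_map[OF C e2 c2])
 \<comment> \<open>In the first component \<open>\<eta>\<close> is the evaluation at the irredundant
   generators of \<open>K\<close>. A boundary of the cone has first component zero, so injectivity
   on cohomology reduces to \<open>irredundant_free\<close>.\<close>
 have eta_fst: "tfst (evm (deg ?C) T i z) = evm ?D T' i z"
  if "T = map (%t. (fst t, fst (snd t), ?h t)) T'" "z : elts (fsum T') i" for T T' i z
  using that
 proof (induction T' arbitrary: T z)
  case Nil
  then show ?case by (simp add: degC)
 next
  case (Cons t T')
  then show ?case by (elim carrier_fsum_Cons) (simp add: degC etm_def)
 qed
 have eta_qi: "\<eta> : quasi_iso A (fsum L2) ?C"
  unfolding B.quasi_iso_iff[OF bounded_fsum[OF vL', folded FL2] C]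
 proof (intro conjI allI ballI impI eta)
  fix i z assume z: "z : cocycles (fsum L2) i" and b: "\<eta> i z : coboundaries ?C i"
  have zc: "z : elts (fsum L') i" using B.cocyclesD(1)[OF z] FL2 by simp
  obtain p where p: "p : elts ?C (i - 1)" "\<eta> i z = diff ?C (i - 1) p" using b by (auto simp: B.coboundary_iff')
  obtain a y where ay: "p = Tup a y" "a : carrier (?D (i - 1))" "y : elts X (i - 1)" using p(1) by (auto simp: degC)
  have "tfst (\<eta> i z) = \<zero>[?D i]" unfolding p(2) ay(1) diffC[OF ay(2,3)] by simp
  then have "evm ?D L' i z = \<zero>[?D i]" using eta_fst[OF L2_def zc] zc FL2 by (simp add: \<eta>_def evc_def)
  then have "z = \<zero>[deg (fsum L') i]" using irredundant_free[OF vL eL' L'(2) _ zc] G'(5) L'(1) by simp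
  then show "z : coboundaries (fsum L2) i" unfolding FL2 coboundaries_fsum[OF vL'] by simp
 next
  fix i p assume p: "p : cocycles ?C i"
  interpret M: left_module A "deg X i" by (rule D)
  interpret M1: left_module A "deg X (i + 1)" by (rule D)
  interpret S: left_module A "?D i" by (rule B.cpxD(1)[OF F])
  obtain z y where zy: "p = Tup z y" "z : carrier (?D i)" "y : elts X i" using B.cocyclesD(1)[OF p] by (auto simp: degC)
  have e0: "\<epsilon> (i + 1) z \<oplus>[deg X (i + 1)] diff X i y = \<zero>[deg X (i + 1)]"
   using B.cocyclesD(2)[OF p] unfolding zy(1) diffC[OF zy(2,3)] by (simp add: degC)
  have "\<epsilon> (i + 1) z = \<ominus>[deg X (i + 1)] diff X i y"
   using M1.minus_equality[OF e0 B.cpx_diff(1)[OF X zy(3)] es(1)[OF zy(2)]] ..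
  also have "\<dots> = diff X i (\<ominus>[deg X i] y)" using B.cpx_diff(5)[OF X zy(3)] ..
  finally have "z : K i" using zy(2,3) M.a_inv_closed unfolding K_def B.coboundary_iff by blast
  then obtain b where b: "b : elts (fsum L') i" "evm ?D L' i b = z"
   using evm_surj[OF B.cpxD(1)[OF F] eL', of K z i] G'(4) L'(1) by auto
  have bc: "b : cocycles (fsum L2) i" unfolding cocycles_fsum FL2 by (rule b(1))
  have eb: "\<eta> i b : cocycles ?C i" by (rule B.chain_map_cocycle(1)[OF bounded_fsum[OF vL', folded FL2] C eta bc])
  have "tfst (\<eta> i b) = z" using eta_fst[OF L2_def b(1)] b FL2 by (simp add: \<eta>_def evc_def)
  then obtain y' where y': "\<eta> i b = Tup z y'" "y' : elts X i" using B.cocyclesD(1)[OF eb] by (auto simp: degC)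
  have q: "p \<ominus>[deg ?C i] \<eta> i b = Tup \<zero>[?D i] (y \<ominus>[deg X i] y')"
   unfolding a_minus_def zy(1) y'(1) degC direct_sum_minus[OF S.left_module_axioms M.left_module_axioms zy(2) y'(2)]
   using zy(2) by (simp add: S.r_neg)
  have "p \<ominus>[deg ?C i] \<eta> i b : cocycles ?C i" by (rule B.cocycles_closed(4)[OF C p eb])
  from B.cocyclesD(2)[OF this]
  have "\<epsilon> (i + 1) \<zero>[?D i] \<oplus>[deg X (i + 1)] diff X i (y \<ominus>[deg X i] y') = \<zero>[deg X (i + 1)]"
   unfolding q using diffC[OF S.zero_closed M.minus_closed[OF zy(3) y'(2)]] by (simp add: degC)
  then have "diff X i (y \<ominus>[deg X i] y') = \<zero>[deg X (i + 1)]"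
   using es(4) B.cpx_diff(1)[OF X M.minus_closed[OF zy(3) y'(2)]] by simp
  then have "y \<ominus>[deg X i] y' : cocycles X i" using M.minus_closed[OF zy(3) y'(2)] by (simp add: cocycles_def)
  \<comment> \<open>The difference \<open>(0, y - y')\<close> that remains is the boundary of
    \<open>(x, 0)\<close>, because \<open>\<epsilon>\<close> hits the cocycle
    \<open>y - y'\<close>.\<close>
  then obtain x where x: "x : elts (fsum L) i" "\<epsilon> i x = y \<ominus>[deg X i] y'" using eps_surj by blast
  define k where "k = i - 1"
  have i: "i = k + 1" by (simp add: k_def)
  interpret Mk: left_module A "deg X k" by (rule D)
  have xk: "x : carrier (?D k)" using x(1) by (simp add: i)
  have "Tup \<zero>[?D i] (y \<ominus>[deg X i] y') = diff ?C k (Tup x \<zero>[deg X k])"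
   unfolding diffC[OF xk Mk.zero_closed] B.cpx_diff(4)[OF X]
   using x(2) es(1)[OF x(1)] M.r_zero unfolding i by simp
  moreover have "Tup x \<zero>[deg X k] : elts ?C k" using xk by (simp add: degC)
  ultimately have "p \<ominus>[deg ?C i] \<eta> i b : coboundaries ?C i" unfolding q unfolding i B.coboundary_iff by blast
  then show "\<exists>x\<in>cocycles (fsum L2) i. p \<ominus>[deg ?C i] \<eta> i x : coboundaries ?C i" using bc by blast
 qed
 have "valid L2" using vL' by (auto simp: L2_def valid_def)
 then show ?thesis using that vL eps eta_qi by blast
qed

theorem generated_two: "\<exists>M. bounded_cpx A M \<and> generated B.DB {M} 2 = {X. bounded_cpx A X}"
proof -
 obtain vs where vs: "set vs = verts Q" using finite_list[OF finite_verts] by blast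
 let ?L = "map (%v. (v, 0 :: int, ())) vs"
 have vL: "valid ?L" using vs by (auto simp: valid_def)
 let ?M = "fsum ?L"
 note M = bounded_fsum[OF vL]
 have g: "gen v 0 : add_closure B.DB {?M}" if "v : verts Q" for v
  using gen_in_add_closure[OF vL add_closure.base[of ?M "{?M}"], of "(v, 0, ())"] that vs by auto
 have f: "fsum L : add_closure B.DB {?M}" if "valid L" for L :: "('v, 'a, 'k) generator list"
  by (rule fsum_in_add_closure[OF g that])
 have "X : generated B.DB {?M} 2" if X: "bounded_cpx A X" for X
 proof -
  obtain L L' :: "('v, 'a, 'k) generator list" and \<epsilon> \<eta> where h: "valid L" "\<epsilon> : chain_map A (fsum L) X" "valid L'"
   "\<eta> : quasi_iso A (fsum L') (cone (fsum L) X \<epsilon>)" by (rule projective_approximation[OF X])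
  have "fsum L : generated B.DB {?M} 1" by (rule B.generated_one[OF f[OF h(1)] M])
  moreover have "cone (fsum L) X \<epsilon> : add_closure B.DB {?M}"
   by (rule B.quasi_iso_add_closure(1)[OF bounded_fsum[OF h(3)] B.bounded_cone[OF bounded_fsum[OF h(1)] X h(2)] h(4) f[OF h(3)]])
  moreover obtain u v w where "(fsum L, X, cone (fsum L) X \<epsilon>, u, v, w) : distinguished_triangles A"
   using B.standard_triangle[OF bounded_fsum[OF h(1)] X h(2)] by blast
  ultimately have "X : extensions B.DB (generated B.DB {?M} 1) (add_closure B.DB {?M})"
   unfolding extensions_def B.DB_simps mem_Collect_eq using X by blast
  then have "X : generated B.DB {?M} (Suc 1)" unfolding generated.simps(2) diamond_def by (rule add_closure.base)
  then show ?thesis by (simp add: numeral_2_eq_2)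
 qed
 moreover have "bounded_cpx A X" if "X : generated B.DB {?M} 2" for X
  using that B.generated_bounded[of X "{?M}" 1] by (simp add: numeral_2_eq_2)
 ultimately show ?thesis using M by blast
qed

end

section \<open>Representations as modules over the path algebra\<close>

text \<open>The coordinates in \<open>Bs v\<close> span the space at \<open>v\<close>; choosing
  these sets disjoint makes the projections orthogonal, and their cardinalities form the dimension
  vector.\<close>

locale graded_operators = quiver_algebra Q A
 for Q :: "('v, 'a) pre_digraph" and A :: "('v \<times> 'a list => 'k::field) ring" +
 fixes Bs :: "'v => nat set"
 assumes finite_Bs: "v : verts Q ==> finite (Bs v)"
  and disjoint_Bs: "v : verts Q ==> w : verts Q ==> v ~= w ==> Bs v \<inter> Bs w = {}"
begin

abbreviation BB :: "nat set" where "BB \<equiv> \<Union>v\<in>verts Q. Bs v"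

definition ev :: "'v => 'k endo" where "ev v = proj (Bs v)"

lemma finite_BB: "finite BB"
 using finite_Bs finite_verts by simp

lemma sum_ev: "sum ev (verts Q) = proj BB"
 unfolding ev_def by (rule proj_UN_disjoint[OF finite_verts disjoint_Bs])

sublocale O: operator_reps escale "verts Q" "arcs Q" "tail Q" "head Q" ev
proof
 show "a : arcs Q ==> tail Q a : verts Q" "a : arcs Q ==> head Q a : verts Q" for a by simp_all
 show "v : verts Q ==> w : verts Q ==> ev v * ev w = (if v = w then ev v else 0)" for v w
  using disjoint_Bs[of v w] by (simp add: ev_def proj_mult proj_empty)
 show "E.fin_dim (E.corner (sum ev (verts Q)) (sum ev (verts Q)))"
  unfolding sum_ev by (rule corner_proj_dim(2)[OF finite_BB finite_BB])
qed simp_all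

lemma total_eq: "O.total = proj BB"
 by (simp add: O.total_def sum_ev)

definition V :: "(nat => 'k) set" where
 "V = {\<phi>. \<forall>i. i \<notin> BB --> \<phi> i = 0}"

lemma V_iff: "\<phi> : V \<longleftrightarrow> app O.total \<phi> = \<phi>"
 by (auto simp: V_def total_eq fun_eq_iff)

lemma total_in_V: "app O.total \<phi> : V"
 by (auto simp: V_def total_eq)

lemma V_zero: "0 : V" and V_add: "\<phi> : V ==> \<psi> : V ==> \<phi> + \<psi> : V"
 by (auto simp: V_def)

lemma V_fscale: "\<phi> : V ==> fscale c \<phi> : V"
 by (auto simp: V_def)

end

locale graded_rep = graded_operators Q A Bs
 for Q :: "('v, 'a) pre_digraph" and A :: "('v \<times> 'a list => 'k::field) ring" and Bs +
 fixes x :: "'a => 'k endo"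
 assumes rep: "x : O.reps"
begin

lemma x_ev: "a : arcs Q ==> ev (tail Q a) * x a = x a" "a : arcs Q ==> x a * ev (head Q a) = x a"
proof -
 assume a: "a : arcs Q"
 have c: "x a : E.corner (ev (tail Q a)) (ev (head Q a))" using rep a by (simp add: O.reps_def families_def)
 have i: "ev v * ev v = ev v" for v by (simp add: ev_def proj_mult)
 show "ev (tail Q a) * x a = x a" "x a * ev (head Q a) = x a"
  using O.cornerD(1)[OF c i] O.cornerD(2)[OF c i] by auto
qed

text \<open>The first arrow of a path is applied last, in agreement with the product that reads
  \<open>p\<close> before \<open>q\<close> and with left modules.\<close>

primrec act :: "'a list => 'v => 'k endo" where
 "act [] u = ev u"
| "act (a # p) u = x a * act p (head Q a)"

lemma act_ev: "awalk u p v ==> ev u * act p u = act p u \<and> act p u * ev v = act p u"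
proof (induction p arbitrary: u)
 case Nil
 then show ?case by (simp add: awalk_Nil_iff ev_def proj_mult)
next
 case (Cons a p)
 then have a: "a : arcs Q" "u = tail Q a" "awalk (head Q a) p v" by (auto simp: awalk_Cons_iff)
 show ?case using Cons.IH[OF a(3)] x_ev(1)[OF a(1)] a(2) by (simp add: mult.assoc) (simp add: mult.assoc[symmetric])
qed

lemma act_append: "awalk u p v ==> awalk v q w ==> act (p @ q) u = act p u * act q v"
proof (induction p arbitrary: u)
 case Nil
 then show ?case using act_ev[of v q w] by (simp add: awalk_Nil_iff)
next
 case (Cons a p)
 then show ?case by (simp add: awalk_Cons_iff mult.assoc)
qed

definition pact :: "'v \<times> 'a list => 'k endo" where "pact p = act (snd p) (fst p)"

lemma pact_mult:
 assumes p: "p : paths Q" and q: "q : paths Q"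
 shows "pact p * pact q = (if target p = fst q then pact (fst p, snd p @ snd q) else 0)"
proof -
 obtain u r where pu: "p = (u, r)" by (cases p)
 obtain w s where qw: "q = (w, s)" by (cases q)
 have r: "awalk u r (target p)" and s: "awalk w s (target q)" using p q by (auto simp: pu qw paths_iff target_def)
 have v: "target p : verts Q" "w : verts Q" using awalk_last_in_verts[OF r] awalk_hd_in_verts[OF s] by auto
 show ?thesis
 proof (cases "target p = w")
  case True
  then show ?thesis using act_append[OF r] s by (simp add: pact_def pu qw)
 next
  case False
  have "pact p * pact q = (pact p * ev (target p)) * (ev w * pact q)" using act_ev[OF r] act_ev[OF s] by (simp add: pact_def pu qw)
  also have "\<dots> = pact p * (ev (target p) * ev w) * pact q" by (simp only: mult.assoc)
  also have "\<dots> = 0" using O.e_orth[OF v] False by simp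
  finally show ?thesis using False by (simp add: qw)
 qed
qed

text \<open>The homomorphism from the path algebra to the operators that extends \<open>x\<close>.
  It is unital only in the corner: the image of \<open>sc 1\<close> is \<open>total\<close>, not
  1.\<close>

definition rho :: "('v \<times> 'a list => 'k) => 'k endo" where
 "rho f = (\<Sum>p\<in>paths Q. escale (f p) (pact p))"

lemma rho_add: "rho (f \<oplus>[A] g) = rho f + rho g"
 by (simp add: rho_def A_simps E.scale_left_distrib sum.distrib)

lemma rho_single:
 assumes "finite S" "S \<subseteq> paths Q" "!!p. p \<notin> S ==> f p = 0"
 shows "rho f = (\<Sum>p\<in>S. escale (f p) (pact p))"
 unfolding rho_def by (rule sum.mono_neutral_right[OF finite_paths assms(2)]) (simp add: assms(3))

lemma rho_idem: "v : verts Q ==> rho (idem v) = ev v"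
 by (subst rho_single[of "{(v, [])}"]) (auto simp: idem_def pact_def paths_iff awalk_Nil_iff)

lemma rho_arrow: "a : arcs Q ==> rho (path (tail Q a, [a])) = x a"
 using x_ev(2) by (subst rho_single[of "{(tail Q a, [a])}"]) (auto simp: path_def pact_def paths_iff awalk_Cons_iff awalk_Nil_iff)

lemma rho_sc: "rho (sc c) = escale c O.total"
proof -
 have "rho (sc c) = (\<Sum>p\<in>(%v. (v, [])) ` verts Q. escale (sc c p) (pact p))"
  by (rule rho_single) (auto simp: paths_iff awalk_Nil_iff sc_def A_simps split: if_splits)
 also have "\<dots> = (\<Sum>v\<in>verts Q. escale c (ev v))"
  by (subst sum.reindex) (auto simp: inj_on_def sc_def A_simps pact_def intro!: sum.cong)
 finally show ?thesis by (simp add: O.total_def E.scale_sum_right)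
qed

text \<open>Pairs of composable paths correspond to paths with a marked cutting position; products
  of paths that do not compose vanish by orthogonality of the \<open>ev v\<close>. The sum over
  cutting positions is the product of the path algebra.\<close>

lemma rho_mult:
 assumes f: "f : carrier A" and g: "g : carrier A"
 shows "rho (f \<otimes>[A] g) = rho f * rho g"
proof -
 let ?P = "paths Q"
 let ?S = "{(p, q). p : ?P \<and> q : ?P \<and> target p = fst q}"
 have tk: "(u, take i p) : ?P \<and> (awlast u (take i p), drop i p) : ?P" if "(u, p) : ?P" for u p i
 proof -
  have "awalk u (take i p @ drop i p) (awlast u p)" using that by (simp add: paths_iff)
  then show ?thesis unfolding awalk_append_iff paths_iff by (auto dest: awlast_of_awalk)
 qed
 have "rho f * rho g = (\<Sum>p\<in>?P. \<Sum>q\<in>?P. escale (f p * g q) (pact p * pact q))"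
  unfolding rho_def sum_product by (simp add: E.scale_mult_left E.scale_mult_right mult.commute)
 also have "\<dots> = (\<Sum>(p, q)\<in>?P \<times> ?P. escale (f p * g q) (pact p * pact q))" by (simp add: sum.cartesian_product)
 also have "\<dots> = (\<Sum>(p, q)\<in>?S. escale (f p * g q) (pact p * pact q))"
  by (rule sum.mono_neutral_right) (auto simp: finite_paths pact_mult split: if_splits)
 also have "\<dots> = (\<Sum>(p, q)\<in>?S. escale (f p * g q) (pact (fst p, snd p @ snd q)))"
  by (rule sum.cong) (auto simp: pact_mult)
 also have "\<dots> = (\<Sum>(r, i)\<in>Sigma ?P (%r. {..length (snd r)}).
   escale (f (fst r, take i (snd r)) * g (awlast (fst r) (take i (snd r)), drop i (snd r))) (pact r))"
 proof (rule sum.reindex_bij_witness[where j = "%(p, q). ((fst p, snd p @ snd q), length (snd p))"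
    and i = "%(r, i). ((fst r, take i (snd r)), (awlast (fst r) (take i (snd r)), drop i (snd r)))"])
  fix b assume b: "b : ?S"
  obtain u r w s where bb: "b = ((u, r), (w, s))" by (cases b) auto
  have w: "w = awlast u r" "awalk u r w" "awalk w s (awlast w s)" using b by (auto simp: bb target_def paths_iff)
  have "awalk u (r @ s) (awlast w s)" by (rule awalk_appendI[OF w(2,3)])
  then have "(u, r @ s) : ?P" by (auto simp: paths_def)
  then show "(%(p, q). ((fst p, snd p @ snd q), length (snd p))) b : Sigma ?P (%r. {..length (snd r)})" by (simp add: bb)
  show "(case (case b of (p, q) => ((fst p, snd p @ snd q), length (snd p))) of (r, i) =>
    ((fst r, take i (snd r)), (awlast (fst r) (take i (snd r)), drop i (snd r)))) = b"
   using w(1) by (simp add: bb)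
  show "(case (case b of (p, q) => ((fst p, snd p @ snd q), length (snd p))) of (r, i) =>
    escale (f (fst r, take i (snd r)) * g (awlast (fst r) (take i (snd r)), drop i (snd r))) (pact r)) =
   (case b of (p, q) => escale (f p * g q) (pact (fst p, snd p @ snd q)))" using w(1) by (simp add: bb)
 next
  fix b assume b: "b : Sigma ?P (%r. {..length (snd r)})"
  obtain u p i where bb: "b = ((u, p), i)" by (cases b) auto
  have "(u, p) : ?P" "i \<le> length p" using b by (auto simp: bb)
  then show "(case b of (r, i) => ((fst r, take i (snd r)), (awlast (fst r) (take i (snd r)), drop i (snd r)))) : ?S"
   "(case (case b of (r, i) => ((fst r, take i (snd r)), (awlast (fst r) (take i (snd r)), drop i (snd r)))) of
     (p, q) => ((fst p, snd p @ snd q), length (snd p))) = b"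
   using tk[of u p i] by (simp_all add: bb target_def min_def)
 qed
 also have "\<dots> = (\<Sum>r\<in>?P. \<Sum>i\<le>length (snd r). escale (f (fst r, take i (snd r)) * g (awlast (fst r) (take i (snd r)), drop i (snd r))) (pact r))"
  by (rule sum.Sigma[symmetric]) (simp_all add: finite_paths)
 also have "\<dots> = rho (f \<otimes>[A] g)"
  unfolding rho_def by (rule sum.cong) (auto simp: A_mult E.scale_sum_left)
 finally show ?thesis ..
qed

lemma pact_total: "p : paths Q ==> O.total * pact p = pact p \<and> pact p * O.total = pact p"
proof -
 assume p: "p : paths Q"
 have w: "awalk (fst p) (snd p) (target p)" using p by (cases p) (simp add: paths_iff target_def)
 have v: "fst p : verts Q" "target p : verts Q" using awalk_last_in_verts[OF w] awalk_hd_in_verts[OF w] by auto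
 have e: "ev (fst p) * pact p = pact p" "pact p * ev (target p) = pact p" using act_ev[OF w] by (auto simp: pact_def)
 have "O.total * pact p = (O.total * ev (fst p)) * pact p" using e(1) by (simp add: mult.assoc)
 moreover have "pact p * O.total = pact p * (ev (target p) * O.total)" using e(2) by (simp add: mult.assoc[symmetric])
 ultimately show ?thesis using e O.total_e(1)[OF v(1)] O.total_e(2)[OF v(2)] by simp
qed

lemma rho_total: "O.total * rho f = rho f" "rho f * O.total = rho f"
 using pact_total by (simp_all add: rho_def sum_distrib_left sum_distrib_right E.scale_mult_left E.scale_mult_right)

section \<open>The representation as a module and as a stalk complex\<close>

definition VM :: "('v \<times> 'a list => 'k, nat => 'k) module" where
 "VM = \<lparr>carrier = V, monoid.mult = undefined, one = undefined, zero = 0, add = (+), module.smult = (%f. app (rho f))\<rparr>"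

lemma VM_simps [simp]: "carrier VM = V" "\<zero>[VM] = 0" "\<phi> \<oplus>[VM] \<psi> = \<phi> + \<psi>" "f \<odot>[VM] \<phi> = app (rho f) \<phi>"
 by (simp_all add: VM_def)

lemma rho_in_V: "app (rho f) \<phi> : V"
 using arg_cong[OF rho_total(1)[of f], of "%y. app y \<phi>"] by (simp add: V_iff)

lemma rho_sc_V: "\<phi> : V ==> app (rho (sc c)) \<phi> = fscale c \<phi>"
 by (simp add: rho_sc V_iff)

text \<open>An injective code of sequences in the universe of tuples: the value at \<open>i\<close>
  is stored at the argument lists of length \<open>i\<close>. The coded function need not belong to
  the path algebra.\<close>

definition emb :: "(nat => 'k) => ('v \<times> 'a list => 'k) tuple" where
 "emb \<phi> = Elem (%p. \<phi> (length (snd p)))"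

definition unemb :: "('v \<times> 'a list => 'k) tuple => nat => 'k" where
 "unemb z i = unelem z (undefined, replicate i undefined)"

lemma unemb_emb [simp]: "unemb (emb \<phi>) = \<phi>"
 by (simp add: unemb_def emb_def fun_eq_iff)

text \<open>The module \<open>VM\<close> again, with elements in the universe that objects of the
  category require; \<open>VM\<close> keeps the addition of the function type, as
  \<open>cohomology_factorisations\<close> demands.\<close>

definition EM :: "('v \<times> 'a list => 'k, ('v \<times> 'a list => 'k) tuple) module" where
 "EM = \<lparr>carrier = emb ` V, monoid.mult = undefined, one = undefined, zero = emb 0,
   add = (%y z. emb (unemb y + unemb z)), module.smult = (%f z. emb (app (rho f) (unemb z)))\<rparr>"

lemma EM_simps [simp]: "carrier EM = emb ` V" "\<zero>[EM] = emb 0" "y \<oplus>[EM] z = emb (unemb y + unemb z)"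
 "f \<odot>[EM] z = emb (app (rho f) (unemb z))"
 by (simp_all add: EM_def)

lemma EM_left_module: "left_module A EM"
proof -
 have "abelian_group EM"
 proof (rule abelian_groupI)
  fix z assume "z : carrier EM"
  then obtain \<phi> where z: "z = emb \<phi>" "\<phi> : V" by auto
  have "- \<phi> : V" using z(2) by (auto simp: V_def)
  then show "\<exists>y\<in>carrier EM. y \<oplus>[EM] z = \<zero>[EM]" using z(1) by (intro bexI[of _ "emb (- \<phi>)"]) simp_all
 qed (auto simp: V_zero V_add add.assoc add.commute add.left_commute simp del: plus_fun_apply zero_fun_apply)
 moreover have "app (rho \<one>[A]) \<phi> = \<phi>" if "\<phi> : V" for \<phi>
  using rho_sc_V[OF that, of 1] by (simp add: sc_simps(3) fscale_def)
 ultimately show ?thesis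
  by (intro left_module.intro left_module_axioms.intro ring_A)
   (auto simp: rho_in_V rho_add rho_mult app_linear simp del: plus_fun_apply zero_fun_apply)
qed

lemma EM_finitely_generated: "finitely_generated A EM"
proof -
 interpret M: left_module A EM by (rule EM_left_module)
 have u: "unit i : V" if "i : BB" for i using that by (auto simp: V_def unit_apply)
 have "emb \<phi> : U" if U: "M.submod U" "emb ` unit ` BB \<subseteq> U" and \<phi>: "\<phi> : V" for U \<phi>
 proof -
  have Us: "\<zero>[EM] : U" "!!y z. y : U ==> z : U ==> y \<oplus>[EM] z : U" "!!f z. f : carrier A ==> z : U ==> f \<odot>[EM] z : U"
   using U(1) unfolding M.submod_def by blast+
  have "emb (\<Sum>i\<in>S. fscale (\<phi> i) (unit i)) : U" if "finite S" "S \<subseteq> BB" for S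
   using that
  proof (induction S)
   case empty
   show ?case unfolding sum.empty using Us(1) by (simp only: EM_simps)
  next
   case (insert i S)
   have i: "i : BB" using insert.prems by simp
   have "sc (\<phi> i) \<odot>[EM] emb (unit i) : U" by (rule Us(3)[OF sc_closed]) (use U(2) i in blast)
   then have "emb (fscale (\<phi> i) (unit i)) : U" by (simp add: rho_sc_V[OF u[OF i]])
   from Us(2)[OF this insert.IH[OF subset_trans[OF subset_insertI insert.prems]]] show ?case
    by (simp only: EM_simps unemb_emb sum.insert[OF insert.hyps])
  qed
  from this[OF finite_BB subset_refl] show ?thesis
   using unit_expansion[OF finite_BB, of \<phi>] \<phi> by (simp add: V_def)
 qed
 note gen = this
 have "U = carrier EM" if U: "M.submod U" "emb ` unit ` BB \<subseteq> U" for U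
 proof
  show "U \<subseteq> carrier EM" using U(1) unfolding M.submod_def by (rule conjunct1)
  show "carrier EM \<subseteq> U" unfolding EM_simps by (rule image_subsetI) (rule gen[OF U])
 qed
 moreover have "emb ` unit ` BB \<subseteq> carrier EM" using u by auto
 moreover have "finite (emb ` unit ` BB)" using finite_BB by simp
 ultimately show ?thesis unfolding finitely_generated_iff[OF EM_left_module] by (intro exI[of _ "emb ` unit ` BB"]) simp
qed

definition stalk :: "('v \<times> 'a list => 'k) cpx" where
 "stalk = \<lparr>deg = (%i. if i = 0 then EM else zero_module),
   diff = (%i. \<lambda>z\<in>carrier (if i = 0 then EM else zero_module). \<zero>[if i + 1 = 0 then EM else zero_module])\<rparr>"

lemma deg_stalk: "deg stalk i = (if i = 0 then EM else zero_module)"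
 by (simp add: stalk_def)

lemma diff_stalk: "z : elts stalk i ==> diff stalk i z = \<zero>[deg stalk (i + 1)]"
 by (simp add: stalk_def)

lemma deg_stalk_module: "left_module A (deg stalk i)" "finitely_generated A (deg stalk i)"
 using EM_left_module EM_finitely_generated zero_module[OF ring_A] by (simp_all add: deg_stalk)

lemma bounded_stalk: "bounded_cpx A stalk"
proof (rule B.bounded_cpxI[of _ 0])
 fix i
 interpret M: left_module A "deg stalk i" by (rule deg_stalk_module)
 interpret N: left_module A "deg stalk (i + 1)" by (rule deg_stalk_module)
 show "left_module A (deg stalk i)" "finitely_generated A (deg stalk i)" by (rule deg_stalk_module)+
 show "linmap A (deg stalk i) (deg stalk (i + 1)) (diff stalk i)"
  by (rule linmapI) (simp_all add: diff_stalk M.smult_closed N.smult_zero_right del: EM_simps)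
 show "diff stalk i : extensional (elts stalk i)" by (simp add: stalk_def)
 show "diff stalk (i + 1) (diff stalk i z) = \<zero>[deg stalk (i + 1 + 1)]" if "z : elts stalk i" for z
  unfolding diff_stalk[OF that] by (rule diff_stalk[OF N.zero_closed])
 show "elts stalk i = {\<zero>[deg stalk i]}" if "\<bar>i\<bar> > 0" using that by (simp add: deg_stalk)
qed

text \<open>The coboundaries in degree 0 vanish, so passing to classes identifies \<open>VM\<close>
  with \<open>H^0\<close> of the stalk complex; its identity therefore factors through a cohomology
  module of \<open>stalk\<close>.\<close>

lemma stalk_cohomology:
 "linmap A VM (B.hmod stalk 0) (%\<phi>. B.hcl stalk 0 (emb \<phi>))"
 "bij_betw (%\<phi>. B.hcl stalk 0 (emb \<phi>)) V (cohomology stalk 0)"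
proof -
 note S = bounded_stalk
 have d: "deg stalk 0 = EM" by (simp add: deg_stalk)
 interpret M: left_module A EM by (rule EM_left_module)
 have c: "emb \<phi> : elts stalk 0" if "\<phi> : V" for \<phi> using that by (simp add: d)
 have z: "cocycles stalk 0 = emb ` V" using diff_stalk[of _ 0] by (auto simp: cocycles_def d)
 have b: "coboundaries stalk 0 = {emb 0}"
  using diff_stalk[of _ "-1"] by (auto simp: coboundaries_def deg_stalk)
 show "linmap A VM (B.hmod stalk 0) (%\<phi>. B.hcl stalk 0 (emb \<phi>))"
 proof (rule linmapI)
  show "B.hcl stalk 0 (emb \<phi>) : carrier (B.hmod stalk 0)" if "\<phi> : carrier VM" for \<phi>
   using that by (simp add: B.cohomology_eq z)
  show "B.hcl stalk 0 (emb (\<phi> \<oplus>[VM] \<psi>)) = B.hcl stalk 0 (emb \<phi>) \<oplus>[B.hmod stalk 0] B.hcl stalk 0 (emb \<psi>)"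
   if "\<phi> : carrier VM" "\<psi> : carrier VM" for \<phi> \<psi>
   using B.hmod_add[OF S c c, of \<phi> \<psi>] that by (simp add: d)
  show "B.hcl stalk 0 (emb (f \<odot>[VM] \<phi>)) = f \<odot>[B.hmod stalk 0] B.hcl stalk 0 (emb \<phi>)"
   if "f : carrier A" "\<phi> : carrier VM" for f \<phi>
   using B.hmod_smult[OF S c, of \<phi> f] that by (simp add: d)
 qed
 have "inj_on (%\<phi>. B.hcl stalk 0 (emb \<phi>)) V"
 proof (rule inj_onI)
  fix \<phi> \<psi> assume v: "\<phi> : V" "\<psi> : V" and e: "B.hcl stalk 0 (emb \<phi>) = B.hcl stalk 0 (emb \<psi>)"
  have "emb \<phi> \<ominus>[EM] emb \<psi> = \<zero>[EM]" using B.hcl_eq_iff[OF S c[OF v(1)] c[OF v(2)]] e by (simp add: b d)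
  then have "\<ominus>[EM] (\<ominus>[EM] emb \<psi>) = emb \<phi>"
   unfolding a_minus_def by (rule M.minus_equality) (use v M.a_inv_closed in \<open>simp_all add: a_inv_def\<close>)
  moreover have "\<ominus>[EM] (\<ominus>[EM] emb \<psi>) = emb \<psi>" by (rule M.minus_minus) (use v in simp)
  ultimately have "emb \<phi> = emb \<psi>" by simp
  then show "\<phi> = \<psi>" using unemb_emb by metis
 qed
 then show "bij_betw (%\<phi>. B.hcl stalk 0 (emb \<phi>)) V (cohomology stalk 0)"
  unfolding bij_betw_def B.cohomology_eq z image_image by simp
qed

text \<open>A finite factorisation of the identity of \<open>V\<close> through the cohomology of \<open>M\<close> lifts along \<open>k\<^sup>D \<rightarrow> H\<^sup>j M\<close>.\<close>

lemma factorisation: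
 assumes M: "bounded_cpx A M" and good: "stalk : generated B.DB {M} 1"
  and zs: "!!j. set (zs j) \<subseteq> cocycles M j" "!!j z. z : cocycles M j ==> z : path_module.kspan A (deg M j) (zs j)"
   "!!j. length (zs j) \<le> D" and n: "!!j. \<bar>j\<bar> > n ==> elts M j = {\<zero>[deg M j]}"
 shows "O.factors_through (proj {..<D}) {- n..n} x"
proof -
 interpret C: cohomology_factorisations A M VM by unfold_locales (simp_all add: M)
 have "C.good stalk" by (rule C.good_generated[OF good])
 let ?s = "%\<phi>. B.hcl stalk 0 (emb \<phi>)"
 have "linmap A (B.hmod stalk 0) VM (inv_into V ?s)"
  using linmap_inv_into[OF stalk_cohomology(1)] stalk_cohomology(2) V_add rho_in_V by simp
 then have "C.fac (%\<phi>. inv_into V ?s (?s \<phi>))" using \<open>C.good stalk\<close> stalk_cohomology(1) unfolding C.good_def by blast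
 then obtain I0 where I0': "\<forall>(j, f, g)\<in>set I0. linmap A VM (B.hmod M j) f \<and> linmap A (B.hmod M j) VM g"
  and sum0': "\<forall>\<phi>\<in>carrier VM. inv_into V ?s (?s \<phi>) = (\<Sum>(j, f, g)\<leftarrow>I0. g (f \<phi>))" unfolding C.fac_def by (elim exE conjE)
 have I0: "linmap A VM (B.hmod M j) f \<and> linmap A (B.hmod M j) VM g" if "(j, f, g) : set I0" for j f g
  using bspec[OF I0' that] by simp
 have sum0: "inv_into V ?s (?s \<phi>) = (\<Sum>(j, f, g)\<leftarrow>I0. g (f \<phi>))" if "\<phi> : V" for \<phi>
  by (rule bspec[OF sum0']) (use that in simp)
 \<comment> \<open>Terms in degrees where \<open>M\<close> vanishes are zero and are dropped, so
   that the remaining degrees lie in the finite set of classes.\<close>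
 define I where "I = filter (%(j, f, g). \<bar>j\<bar> \<le> n) I0"
 have lin: "linmap A VM (B.hmod M j) f" "linmap A (B.hmod M j) VM g" "\<bar>j\<bar> \<le> n" if "(j, f, g) : set I" for j f g
  using that I0 by (auto simp: I_def)
 have zero: "f 0 = B.hcl M j \<zero>[deg M j]" if f: "linmap A VM (B.hmod M j) f" for f j
 proof -
  interpret Mj: left_module A "deg M j" by (rule B.cpxD(1)[OF M])
  have "f 0 : cohomology M j" using linmapD(1)[OF f] V_zero by simp
  then obtain z where z: "z : cocycles M j" "f 0 = B.hcl M j z" by (auto simp: B.cohomology_eq)
  have "f (\<zero>[A] \<odot>[VM] 0) = \<zero>[A] \<odot>[B.hmod M j] f 0" by (rule linmapD(3)[OF f]) (simp_all add: V_zero)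
  then show ?thesis using z B.hmod_smult[OF M B.cocyclesD(1)[OF z(1)], of "\<zero>[A]"] Mj.smult_zero_left[OF B.cocyclesD(1)[OF z(1)]]
   by (simp add: app_zero del: zero_fun_apply)
 qed
 have sum: "\<phi> = (\<Sum>(j, f, g)\<leftarrow>I. g (f \<phi>))" if \<phi>: "\<phi> : V" for \<phi>
 proof -
  have "(case t of (j, f, g) => g (f \<phi>)) = 0" if t: "t : set I0" "\<not> (case t of (j, f, g) => \<bar>j\<bar> \<le> n)" for t
  proof -
   obtain j f g where tt: "t = (j, f, g)" by (cases t) auto
   have f: "linmap A VM (B.hmod M j) f" and g: "linmap A (B.hmod M j) VM g" using I0 t(1) tt by auto
   have c: "cohomology M j = {B.hcl M j \<zero>[deg M j]}"
   proof -
    have "elts M j = {\<zero>[deg M j]}" using n[of j] t(2) tt by simp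
    then have "cocycles M j = {\<zero>[deg M j]}" using B.cocyclesD(1)[of _ M j] B.cocycles_closed(1)[OF M, of j] by blast
    then show ?thesis by (simp add: B.cohomology_eq)
   qed
   have "f \<phi> = f 0" using linmapD(1)[OF f] \<phi> c V_zero by auto
   moreover have "f (0 + 0) = f 0 \<oplus>[B.hmod M j] f 0" using linmapD(2)[OF f, of 0 0] V_zero by simp
   moreover have "g (f 0 \<oplus>[B.hmod M j] f 0) = g (f 0) + g (f 0)" using linmapD(2)[OF g, of "f 0" "f 0"] linmapD(1)[OF f, of 0] V_zero by simp
   ultimately show ?thesis using tt by (simp add: add_0_right)
  qed
  then have "(\<Sum>(j, f, g)\<leftarrow>I. g (f \<phi>)) = (\<Sum>(j, f, g)\<leftarrow>I0. g (f \<phi>))"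
   unfolding I_def by (intro sum_list_map_filter) auto
  then show ?thesis using sum0[OF \<phi>] bij_betw_inv_into_left[OF stalk_cohomology(2) \<phi>] by simp
 qed
 \<comment> \<open>The linear surjection from coefficient sequences onto \<open>H^j M\<close>, which
   depends on the first \<open>D\<close> coefficients only. Lifting along it turns maps into and out
   of \<open>H^j M\<close> into operators on the sequence space.\<close>
 define p where "p j c = B.hcl M j (path_module.klin A (deg M j) (zs j) c)" for j c
 have PM: "path_module Q A (deg M j)" for j
  by (intro path_module.intro quiver_algebra_axioms B.cpxD(1)[OF M])
 have zc: "set (zs j) \<subseteq> elts M j" for j using zs(1) B.cocyclesD(1) by blast
 have pc: "p j c : cohomology M j" for j c
 proof -
  interpret P: path_module Q A "deg M j" by (rule PM)
  have "P.M.submod (cocycles M j)"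
   unfolding P.M.submod_def using B.cocycles_closed[OF M] B.cocyclesD(1) by (auto simp: subset_iff)
  then have "P.klin (zs j) c : cocycles M j" using P.kspan_submod[OF _ zs(1)] unfolding P.kspan_def by blast
  then show ?thesis by (simp add: p_def B.cohomology_eq)
 qed
 have p_add: "p j (c + c') = p j c \<oplus>[B.hmod M j] p j c'" for j c c'
 proof -
  interpret P: path_module Q A "deg M j" by (rule PM)
  show ?thesis using P.klin_add[OF zc[of j], of c c'] B.hmod_add[OF M P.klin_closed[OF zc] P.klin_closed[OF zc]]
   by (simp add: p_def plus_fun_def)
 qed
 have p_scale: "p j (fscale a c) = sc a \<odot>[B.hmod M j] p j c" for j a c
 proof -
  interpret P: path_module Q A "deg M j" by (rule PM)
  show ?thesis using P.klin_scale[OF zc[of j], of a c] B.hmod_smult[OF M P.klin_closed[OF zc] sc_closed]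
   by (simp add: p_def fscale_def)
 qed
 have p_zero: "p j 0 = B.hcl M j \<zero>[deg M j]" for j
 proof -
  interpret P: path_module Q A "deg M j" by (rule PM)
  show ?thesis using P.klin_zero[OF zc[of j]] by (simp add: p_def zero_fun_def)
 qed
 have p_cong: "p j c = p j c'" if "!!i. i < D ==> c i = c' i" for j c c'
 proof -
  interpret P: path_module Q A "deg M j" by (rule PM)
  show ?thesis unfolding p_def using P.klin_cong[of "zs j" c c'] that zs(3)[of j] by simp
 qed
 have p_surj: "\<exists>c. (\<forall>i. i \<ge> D --> c i = 0) \<and> p j c = h" if h: "h : cohomology M j" for j h
 proof -
  interpret P: path_module Q A "deg M j" by (rule PM)
  obtain z where z: "z : cocycles M j" "h = B.hcl M j z" using h by (auto simp: B.cohomology_eq)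
  obtain c where "z = P.klin (zs j) c" using zs(2)[OF z(1)] by (auto simp: P.kspan_def)
  then have "p j c = h" using z(2) by (simp add: p_def)
  then show ?thesis using p_cong[of "%i. if i < D then c i else 0" c j]
   by (intro exI[of _ "%i. if i < D then c i else 0"]) simp
 qed
 have unit_V: "unit i : V" if "i : BB" for i using that by (auto simp: V_def unit_apply)
 \<comment> \<open>A lift of \<open>f\<close> along \<open>p j\<close> is determined by preimages
   \<open>w i\<close> of the images of the basis vectors; it is linear over the field but need not
   respect the path algebra.\<close>
 have "\<exists>F. proj {..<D} * F = F \<and> (\<forall>\<phi>. p j (app F \<phi>) = f (app O.total \<phi>))" if f: "linmap A VM (B.hmod M j) f" for j f
 proof -
  have "\<forall>i\<in>BB. \<exists>c. (\<forall>l. l \<ge> D --> c l = 0) \<and> p j c = f (unit i)"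
   using p_surj linmapD(1)[OF f] unit_V by simp
  from bchoice[OF this] obtain w where w: "!!i l. i : BB ==> l \<ge> D ==> w i l = 0" "!!i. i : BB ==> p j (w i) = f (unit i)" by blast
  define F where "F = Endo (%\<phi>. \<Sum>i\<in>BB. fscale (\<phi> i) (w i))"
  have "fun_linear (%\<phi>. \<Sum>i\<in>BB. fscale (\<phi> i) (w i))"
   unfolding fun_linear_def by (auto simp: fun_eq_iff sum_fun_apply algebra_simps sum.distrib sum_distrib_left)
  then have F: "app F \<phi> = (\<Sum>i\<in>BB. fscale (\<phi> i) (w i))" for \<phi> unfolding F_def by (simp add: app_Endo)
  have "proj {..<D} * F = F" by (rule endo_eqI) (auto simp: F sum_fun_apply w(1) intro!: sum.neutral[symmetric])
  moreover have "p j (app F \<phi>) = f (app O.total \<phi>)" for \<phi>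
  proof -
   have "p j (\<Sum>i\<in>S. fscale (\<phi> i) (w i)) = f (\<Sum>i\<in>S. fscale (\<phi> i) (unit i)) \<and> (\<Sum>i\<in>S. fscale (\<phi> i) (unit i)) : V"
    if "finite S" "S \<subseteq> BB" for S
    using that
   proof (induction S)
    case empty
    show ?case unfolding sum.empty p_zero zero[OF f] by (intro conjI HOL.refl V_zero)
   next
    case (insert i S)
    have i: "i : BB" using insert.prems by simp
    note IH = insert.IH[OF subset_trans[OF subset_insertI insert.prems]]
    have e1: "p j (fscale (\<phi> i) (w i)) = f (fscale (\<phi> i) (unit i))"
     using p_scale w(2)[OF i] linmapD(3)[OF f sc_closed, of "unit i"] unit_V[OF i] rho_sc_V[OF unit_V[OF i]] by simp
    have e2: "f (fscale (\<phi> i) (unit i) + (\<Sum>i\<in>S. fscale (\<phi> i) (unit i))) =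
      f (fscale (\<phi> i) (unit i)) \<oplus>[B.hmod M j] f (\<Sum>i\<in>S. fscale (\<phi> i) (unit i))"
     using linmapD(2)[OF f, of "fscale (\<phi> i) (unit i)" "\<Sum>i\<in>S. fscale (\<phi> i) (unit i)"] V_fscale[OF unit_V[OF i]] IH
     unfolding VM_simps by blast
    show ?case unfolding sum.insert[OF insert.hyps] p_add e2 e1 conjunct1[OF IH]
     by (intro conjI HOL.refl V_add V_fscale unit_V i conjunct2[OF IH])
   qed
   note S = conjunct1[OF this[OF finite_BB subset_refl]]
   have "app O.total \<phi> = (\<Sum>i\<in>BB. fscale (app O.total \<phi> i) (unit i))" by (rule unit_expansion[OF finite_BB]) (simp add: total_eq)
   also have "\<dots> = (\<Sum>i\<in>BB. fscale (\<phi> i) (unit i))" by (rule sum.cong) (auto simp: total_eq)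
   finally show ?thesis using S F by simp
  qed
  ultimately show ?thesis by blast
 qed
 note liftF = this
 have liftG: "\<exists>G. G * proj {..<D} = G \<and> (\<forall>c. app G c = g (p j c))" if g: "linmap A (B.hmod M j) VM g" for j g
 proof -
  have gs: "g h : V" if "h : cohomology M j" for h using linmapD(1)[OF g] that by simp
  have "fun_linear (%c. g (p j c))" unfolding fun_linear_def
   using p_add p_scale linmapD(2,3)[OF g] pc rho_sc_V[OF gs[OF pc]] sc_closed by simp
  then have G: "app (Endo (%c. g (p j c))) c = g (p j c)" for c by (simp add: app_Endo)
  have "p j (app (proj {..<D}) c) = p j c" for c by (rule p_cong) simp
  then have "Endo (%c. g (p j c)) * proj {..<D} = Endo (%c. g (p j c))" by (intro endo_eqI) (simp add: G)
  then show ?thesis using G by blast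
 qed
 have "\<forall>t\<in>set I. \<exists>FG. proj {..<D} * fst FG = fst FG \<and> snd FG * proj {..<D} = snd FG \<and>
   (\<forall>\<phi>. p (fst t) (app (fst FG) \<phi>) = fst (snd t) (app O.total \<phi>)) \<and> (\<forall>c. app (snd FG) c = snd (snd t) (p (fst t) c))"
 proof
  fix t assume t: "t : set I"
  obtain j f g where tt: "t = (j, f, g)" by (cases t) auto
  obtain F G where "proj {..<D} * F = F" "\<forall>\<phi>. p j (app F \<phi>) = f (app O.total \<phi>)" "G * proj {..<D} = G" "\<forall>c. app G c = g (p j c)"
   using liftF[OF lin(1)] liftG[OF lin(2)] t tt by blast
  then show "\<exists>FG. proj {..<D} * fst FG = fst FG \<and> snd FG * proj {..<D} = snd FG \<and>
   (\<forall>\<phi>. p (fst t) (app (fst FG) \<phi>) = fst (snd t) (app O.total \<phi>)) \<and> (\<forall>c. app (snd FG) c = snd (snd t) (p (fst t) c))"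
   by (intro exI[of _ "(F, G)"]) (simp add: tt)
 qed
 from bchoice[OF this] obtain FG where FG: "!!t. t : set I ==> proj {..<D} * fst (FG t) = fst (FG t) \<and> snd (FG t) * proj {..<D} = snd (FG t) \<and>
   (\<forall>\<phi>. p (fst t) (app (fst (FG t)) \<phi>) = fst (snd t) (app O.total \<phi>)) \<and> (\<forall>c. app (snd (FG t)) c = snd (snd t) (p (fst t) c))" by blast
 \<comment> \<open>The choice of lifts drops out of the composite: first lifting \<open>f\<close>
   and then applying \<open>g\<close> after \<open>p j\<close> gives back \<open>g\<close> after
   \<open>f\<close>.\<close>
 have comp: "app (snd (FG t) * fst (FG t')) \<phi> = snd (snd t) (fst (snd t') (app O.total \<phi>))"
  if "t : set I" "t' : set I" "fst t = fst t'" for t t' \<phi>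
  using FG[OF that(1)] FG[OF that(2)] that(3) by simp
 have "(\<Sum>l<length I. snd (FG (I ! l)) * fst (FG (I ! l))) = O.total"
 proof (rule endo_eqI)
  fix \<phi> :: "nat => 'k" and i
  have "app (\<Sum>l<length I. snd (FG (I ! l)) * fst (FG (I ! l))) \<phi> = (\<Sum>l<length I. snd (snd (I ! l)) (fst (snd (I ! l)) (app O.total \<phi>)))"
   unfolding app_sum_endo by (rule sum.cong) (use comp in \<open>auto simp del: app_simps\<close>)
  also have "\<dots> = (\<Sum>t\<leftarrow>I. snd (snd t) (fst (snd t) (app O.total \<phi>)))"
   by (simp add: sum_list_sum_nth atLeast0LessThan)
  also have "\<dots> = app O.total \<phi>" using sum[OF total_in_V[of \<phi>]] by (simp add: split_def)
  finally show "app (\<Sum>l<length I. snd (FG (I ! l)) * fst (FG (I ! l))) \<phi> i = app O.total \<phi> i" by simp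
 qed
 \<comment> \<open>For equal degrees the composite is a module map from \<open>VM\<close> to itself,
   so it commutes with every \<open>rho r\<close>. Taking for \<open>r\<close> the vertex
   idempotents and the arrows gives the conditions of \<open>end_alg\<close>.\<close>
 moreover have "snd (FG t) * fst (FG t') : O.end_alg x" if t: "t : set I" and t': "t' : set I" and e: "fst t = fst t'" for t t'
 proof -
  let ?z = "snd (FG t) * fst (FG t')" and ?h = "%\<phi>. snd (snd t) (fst (snd t') \<phi>)"
  obtain j f g where tt: "t = (j, f, g)" by (cases t) auto
  obtain f' g' where tt': "t' = (j, f', g')" using e tt by (cases t') auto
  have "linmap A VM (B.hmod M (fst t)) (fst (snd t'))" "linmap A (B.hmod M (fst t)) VM (snd (snd t))"
   using lin(1)[of j f' g'] lin(2)[of j f g] t t' by (simp_all add: tt tt')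
  then have h: "linmap A VM VM ?h" by (rule linmap_comp)
  have z: "app ?z \<phi> = ?h (app O.total \<phi>)" for \<phi> by (rule comp[OF t t' e])
  have comm: "?z * rho r = rho r * ?z" if r: "r : carrier A" for r
  proof (rule endo_eqI)
   fix \<phi> i
   have "app (?z * rho r) \<phi> = ?h (app O.total (app (rho r) \<phi>))" unfolding app_simps(6)[of ?z] z ..
   also have "app O.total (app (rho r) \<phi>) = app (rho r) (app O.total \<phi>)"
    using arg_cong[OF rho_total(1)[of r], of "%y. app y \<phi>"] arg_cong[OF rho_total(2)[of r], of "%y. app y \<phi>"] by simp
   also have "?h (app (rho r) (app O.total \<phi>)) = app (rho r) (?h (app O.total \<phi>))"
    using linmapD(3)[OF h r, of "app O.total \<phi>"] total_in_V by simp
   finally show "app (?z * rho r) \<phi> i = app (rho r * ?z) \<phi> i" unfolding app_simps(6)[of "rho r"] z by simp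
  qed
  have "O.total * ?z * O.total = ?z"
  proof (rule endo_eqI)
   fix \<phi> i
   have "app (O.total * ?z * O.total) \<phi> = app O.total (?h (app O.total (app O.total \<phi>)))"
    unfolding app_simps(6)[of "O.total * ?z"] app_simps(6)[of "O.total"] z ..
   moreover have "app O.total (app O.total \<phi>) = app O.total \<phi>" using total_in_V V_iff by blast
   moreover have "app O.total (?h (app O.total \<phi>)) = ?h (app O.total \<phi>)"
    using linmapD(1)[OF h, of "app O.total \<phi>"] total_in_V V_iff by simp
   ultimately show "app (O.total * ?z * O.total) \<phi> i = app ?z \<phi> i" unfolding z by simp
  qed
  moreover have "?z * ev v = ev v * ?z" if "v : verts Q" for v
   using comm[OF idem_closed[OF that]] unfolding rho_idem[OF that] .
  moreover have "?z * x a = x a * ?z" if a: "a : arcs Q" for a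
  proof -
   have "(tail Q a, [a]) : paths Q" using a by (simp add: paths_iff awalk_Cons_iff awalk_Nil_iff)
   from comm[OF path_closed[OF this]] show ?thesis unfolding rho_arrow[OF a] .
  qed
  ultimately show ?thesis unfolding O.end_alg_def O.local_ops_def E.corner_def by blast
 qed
 moreover have "fst (I ! l) : {- n..n} \<and> proj {..<D} * fst (FG (I ! l)) = fst (FG (I ! l)) \<and> snd (FG (I ! l)) * proj {..<D} = snd (FG (I ! l))"
  if l: "l < length I" for l
 proof -
  obtain j f g where t: "I ! l = (j, f, g)" by (cases "I ! l") auto
  have "\<bar>j\<bar> \<le> n" using lin(3)[of j f g] nth_mem[OF l] t by simp
  then have "fst (I ! l) : {- n..n}" using t by (simp add: abs_le_iff)
  then show ?thesis using FG[OF nth_mem[OF l]] by blast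
 qed
 ultimately show ?thesis unfolding O.factors_through_def
  by (intro exI[of _ "{..<length I}"] exI[of _ "%l. fst (I ! l)"] exI[of _ "%l. fst (FG (I ! l))"] exI[of _ "%l. snd (FG (I ! l))"]
    conjI ballI impI) (simp_all del: app_simps)
qed

end

section \<open>The theorem\<close>

context quiver_algebra
begin

lemma cocycles_spanned:
 assumes M: "bounded_cpx A M"
 shows "\<exists>zs. set zs \<subseteq> cocycles M j \<and> cocycles M j \<subseteq> path_module.kspan A (deg M j) zs"
proof -
 interpret P: path_module Q A "deg M j" by (intro path_module.intro quiver_algebra_axioms B.cpxD(1)[OF M])
 have "P.M.submod (cocycles M j)"
  unfolding P.M.submod_def using B.cocycles_closed[OF M] B.cocyclesD(1) by (auto simp: subset_iff)
 then show ?thesis by (rule P.submod_kspan[OF B.cpxD(2)[OF M]])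
qed

lemma not_generated_one:
 assumes nd: "\<not> dynkin_quiver Q" and M: "bounded_cpx A M"
 shows "generated B.DB {M} 1 ~= {X. bounded_cpx A X}"
proof
 assume gen: "generated B.DB {M} 1 = {X. bounded_cpx A X}"
 obtain d :: "'v => nat" where d: "\<exists>v\<in>verts Q. d v ~= 0"
  "(\<Sum>v\<in>verts Q. (d v)\<^sup>2) \<le> (\<Sum>a\<in>arcs Q. d (tail Q a) * d (head Q a))"
  by (rule not_dynkin_form[OF fin_digraph_axioms nd])
 obtain zs where zs: "!!j. set (zs j) \<subseteq> cocycles M j \<and> cocycles M j \<subseteq> path_module.kspan A (deg M j) (zs j)"
  using cocycles_spanned[OF M] by metis
 obtain n where n: "!!i. \<bar>i\<bar> > n ==> elts M i = {\<zero>[deg M i]}" by (rule B.cpx_bound[OF M]) blast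
 \<comment> \<open>Outside the range of \<open>M\<close> the spanning list is replaced by the empty
   one, so that a single bound \<open>D\<close> on the lengths holds in all degrees.\<close>
 define zs' where "zs' j = (if \<bar>j\<bar> \<le> n then zs j else [])" for j
 have zs'1: "set (zs' j) \<subseteq> cocycles M j" for j using zs[of j] by (auto simp: zs'_def)
 have zs'2: "z : path_module.kspan A (deg M j) (zs' j)" if z: "z : cocycles M j" for j z
 proof (cases "\<bar>j\<bar> \<le> n")
  case True
  then show ?thesis using zs[of j] z by (auto simp: zs'_def)
 next
  case False
  interpret P: path_module Q A "deg M j" by (intro path_module.intro quiver_algebra_axioms B.cpxD(1)[OF M])
  have "z = \<zero>[deg M j]" using B.cocyclesD(1)[OF z] n[of j] False by simp
  then show ?thesis using False by (simp add: zs'_def P.kspan_def)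
 qed
 \<comment> \<open>The element 0 keeps the maximum defined when \<open>{- n..n}\<close> is empty, as
   \<open>n\<close> may be negative.\<close>
 define D where "D = Max ((%j. length (zs j)) ` {- n..n} \<union> {0})"
 have D: "length (zs' j) \<le> D" for j
 proof (cases "\<bar>j\<bar> \<le> n")
  case True
  then have "length (zs j) : (%j. length (zs j)) ` {- n..n} \<union> {0}" by (auto simp: abs_le_iff)
  then show ?thesis unfolding D_def zs'_def using True by (simp del: Un_insert_right)
 qed (simp add: zs'_def)
 obtain idx :: "'v => nat" where idx: "inj_on idx (verts Q)" using finite_imp_inj_to_nat_seg[OF finite_verts] by blast
 define T where "T = E.dim (E.corner (proj {..<D}) (proj {..<D}) :: 'k endo set)"
 \<comment> \<open>The bound of \<open>dim_corner_total_le\<close>. It depends on the quiver and on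
   \<open>M\<close> but not on the dimension vector, so the multiple \<open>m\<close> can be chosen
   beyond it.\<close>
 define c where "c = (card (arcs Q) * ((card {- n..n} * T)\<^sup>2 * T))\<^sup>2 * T"
 define m where "m = Suc c"
 \<comment> \<open>Blocks of \<open>m * d v\<close> coordinates, kept apart by the injective
   numbering \<open>idx\<close> of the vertices; the dimension vector is \<open>m\<close> times
   \<open>d\<close>, and both sides of the form inequality scale by the square of
   \<open>m\<close>.\<close>
 define Bs where "Bs v = (%i. prod_encode (idx v, i)) ` {..<m * d v}" for v
 have card_Bs: "card (Bs v) = m * d v" for v
  unfolding Bs_def by (subst card_image) (auto simp: inj_on_def)
 interpret G: graded_operators Q A Bs
 proof
  show "finite (Bs v)" for v by (simp add: Bs_def)
  show "Bs v \<inter> Bs w = {}" if "v : verts Q" "w : verts Q" "v ~= w" for v w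
   using inj_onD[OF idx _ that(1,2)] that(3) by (auto simp: Bs_def)
 qed
 have corner: "E.dim (E.corner (G.ev v) (G.ev w)) = m\<^sup>2 * (d v * d w)" if "v : verts Q" "w : verts Q" for v w
  unfolding G.ev_def corner_proj_dim(1)[OF G.finite_Bs[OF that(1)] G.finite_Bs[OF that(2)]] card_Bs
  by (simp add: power2_eq_square algebra_simps)
 have "E.dim (E.corner G.O.total G.O.total) \<le> (card (arcs Q) * ((card {- n..n} * T)\<^sup>2 * T))\<^sup>2 * T"
  unfolding T_def
 proof (rule G.O.dim_corner_total_le)
  have "(\<Sum>v\<in>verts Q. E.dim (E.corner (G.ev v) (G.ev v))) = m\<^sup>2 * (\<Sum>v\<in>verts Q. (d v)\<^sup>2)"
   by (simp add: corner sum_distrib_left power2_eq_square)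
  also have "\<dots> \<le> m\<^sup>2 * (\<Sum>a\<in>arcs Q. d (tail Q a) * d (head Q a))" using d(2) by simp
  also have "\<dots> = (\<Sum>a\<in>arcs Q. E.dim (E.corner (G.ev (tail Q a)) (G.ev (head Q a))))"
   by (simp add: corner sum_distrib_left)
  finally show "(\<Sum>v\<in>verts Q. E.dim (E.corner (G.ev v) (G.ev v))) \<le>
    (\<Sum>a\<in>arcs Q. E.dim (E.corner (G.ev (tail Q a)) (G.ev (head Q a))))" .
  show "G.O.factors_through (proj {..<D}) {- n..n} x" if "x : G.O.reps" for x
  proof -
   interpret R: graded_rep Q A Bs x by unfold_locales (rule that)
   show ?thesis by (rule R.factorisation[OF M _ zs'1 zs'2 D n]) (use gen R.bounded_stalk in auto)
  qed
  show "(proj {..<D} :: 'k endo) * proj {..<D} = proj {..<D}" by (simp add: proj_mult)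
  show "E.fin_dim (E.corner (proj {..<D}) (proj {..<D}) :: 'k endo set)" by (rule corner_proj_dim(2)) simp_all
 qed simp
 then have "E.dim (E.corner G.O.total G.O.total) \<le> c" by (simp add: c_def)
 moreover have "E.dim (E.corner G.O.total G.O.total) = card G.BB * card G.BB"
  unfolding G.total_eq by (rule corner_proj_dim(1)[OF G.finite_BB G.finite_BB])
 moreover have "m \<le> card G.BB"
 proof -
  obtain v where v: "v : verts Q" "d v ~= 0" using d(1) by blast
  have "m \<le> m * d v" using v(2) by simp
  also have "\<dots> = card (Bs v)" by (simp add: card_Bs)
  also have "\<dots> \<le> card G.BB" by (rule card_mono[OF G.finite_BB]) (use v in blast)
  finally show ?thesis .
 qed
 moreover have "m \<le> m * m" by (simp add: m_def)
 ultimately have "m \<le> c" using mult_le_mono[of m "card G.BB" m "card G.BB"] by linarith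
 then show False by (simp add: m_def)
qed

theorem tri_dim_eq_one:
 assumes "\<not> dynkin_quiver Q"
 shows "tri_dim B.DB = 1"
proof -
 let ?S = "{enat d | d. \<exists>M\<in>Ob B.DB. generated B.DB {M} (d + 1) = Ob B.DB}"
 have "enat 1 : ?S" using generated_two by (auto simp: numeral_2_eq_2 simp del: generated.simps)
 then have "Inf ?S \<le> 1" unfolding one_enat_def by (rule Inf_lower)
 moreover have "1 \<le> Inf ?S"
 proof (rule Inf_greatest)
  fix x assume "x : ?S"
  then obtain d M where x: "x = enat d" and M: "bounded_cpx A M" "generated B.DB {M} (d + 1) = {X. bounded_cpx A X}" by auto
  have "d ~= 0" using not_generated_one[OF assms M(1)] M(2) by (intro notI) simp
  then show "1 \<le> x" by (simp add: x one_enat_def)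
 qed
 ultimately show ?thesis unfolding tri_dim_def by (rule antisym)
qed

end

theorem corollary4p3:
  fixes Q :: "('v, 'a) pre_digraph"
  assumes "fin_digraph Q"
    and "acyclic_quiver Q"
    and "\<not> dynkin_quiver Q"
  shows "tri_dim (bounded_derived_category
           (path_algebra Q :: ('v \<times> 'a list \<Rightarrow> 'k::alg_closed_field) ring)) = 1"
proof -
  interpret quiver_algebra Q "path_algebra Q :: ('v \<times> 'a list \<Rightarrow> 'k) ring"
    by (intro quiver_algebra.intro quiver_algebra_axioms.intro assms(1,2) HOL.refl)
  show ?thesis by (rule tri_dim_eq_one[OF assms(3)])
qed

end
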